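(* Let $\mathbf{CG}$ be the category whose objects are games, whose morphisms from $A$ to $B$ are isomorphism classes of strategies $\sigma:S\to A^\perp\parallel B$, with composition $\odot$ and identities the copycat strategies $\gamma_A$. Then $\mathbf{CG}$ is a compact closed category, with: tensor $A\otimes B=A\parallel B$ on objects and $\sigma_1\otimes\sigma_2$ on morphisms as in the context; unit the empty game $1$; structural isomorphisms the liftings $\lceil\rho_A\rceil,\lceil\lambda_A\rceil,\lceil s_{A,B}\rceil,\lceil\alpha_{A,B,C}\rceil$; dual of $A$ given by $A^\perp$; and duality morphisms $\eta_A$ from $1$ to $A^\perp\otimes A$ and $\epsilon_A$ from $A\otimes A^\perp$ to $1$ given by the copycat event structure $\Gamma_A$ with its obvious maps $$\eta_A:\Gamma_A\to 1^\perp\parallel(A^\perp\parallel A),\qquad \epsilon_A:\Gamma_A\to(A\parallel A^\perp)^\perp\parallel 1 .$$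
   Context: **Event structures.** An event structure (es) is a triple $(E,\leq_E,\mathrm{Con}_E)$ where $E$ is a set of events, $\leq_E$ is a partial order on $E$ (causality) and $\mathrm{Con}_E$ is a non-empty set of finite subsets of $E$ (the consistent sets) such that: $[e]=\{e'\mid e'\leq_E e\}$ is finite for all $e\in E$; $\{e\}\in \mathrm{Con}_E$ for all $e$; $\mathrm{Con}_E$ is closed under subsets; and if $e'\leq_E e\in X\in \mathrm{Con}_E$ then $X\cup\{e'\}\in \mathrm{Con}_E$. $\mathcal{C}(E)$ is the set of (finite) configurations: finite consistent down-closed subsets of $E$, ordered by inclusion. A map of es $f:E\to F$ is a total function such that $fx\in\mathcal{C}(F)$ for all $x\in\mathcal{C}(E)$ and $f$ is injective on each configuration. **Polarities, games, pre-strategies.** An event structure with polarities (esp) is an es $A$ with a function $\mathrm{pol}_A:A\to\{-,+\}$; a game is an esp. $A^\perp$ is $A$ with polarities reversed. Maps of esps are maps of es preserving polarity. The parallel composition $E\parallel F$ has events $\{0\}\times E\cup\{1\}\times F$, causality and polarity componentwise (no causality across components), a set being consistent iff both its components are; $\parallel$ acts on maps componentwise; note $(A\parallel B)^\perp=A^\perp\parallel B^\perp$. $1$ is the empty game. A pre-strategy on $A$ is a map of esps $\sigma:S\to A$. Pre-strategies $\sigma:S\to A$, $\tau:T\to A$ are isomorphic, $\sigma\cong\tau$, if there is an isomorphism of esps $\phi:S\cong T$ with $\tau\circ\phi=\sigma$. **Interaction and composition.** A bijection $\varphi:q\simeq q'$ between finite partial orders is secured if the reflexive transitive closure of the relation $(a,b)\vartriangleleft(a',b')$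 iff $a<_q a'$ or $b<_{q'}b'$ on its graph is a partial order. For maps of es $\sigma:S\to A$, $\tau:T\to A$, the es $S\wedge T$ is: let $\mathcal{B}$ be the set of (graphs of) secured bijections $x\simeq\sigma x=\tau y\simeq y$ induced by $\sigma,\tau$ with $x\in\mathcal{C}(S)$, $y\in\mathcal{C}(T)$, $\sigma x=\tau y$; events are the elements of $\mathcal{B}$ having a greatest element (for the partial order on the graph given by the reflexive transitive closure of $\vartriangleleft$, with $x$ ordered by $\leq_S$ and $y$ by $\leq_T$); causality is inclusion; a finite set is consistent iff its union is in $\mathcal{B}$. $\sigma\wedge\tau:S\wedge T\to A$ sends an event with greatest element $(s,t)$ to $\sigma s=\tau t$. For pre-strategies $\sigma:S\to A^\perp\parallel B$ and $\tau:T\to B^\perp\parallel C$, ignoring polarities, $\tau\circledast\sigma:T\circledast S\to A\parallel B\parallel C$ is $(\sigma\parallel \mathrm{id}_C)\wedge(\mathrm{id}_A\parallel\tau)$. $T\odot S$ is the restriction of $T\circledast S$ (causality and consistency inherited) to the visible events, i.e. those mapped to $A$ or $C$; $\tau\odot\sigma:T\odot S\to A^\perp\parallel C$ is the restriction of $\tau\circledast\sigma$, with polarities on $T\odot S$ making it polarity preserving. **Copycat.** For a game $A$, $\Gamma_A$ has the events and polarities of $A^\perp\parallel A$, causality the transitive closure of $\leq_{A^\perp\parallel A}\cup\{((1-i,a),(i,a))\mid (i,a)\text{ positive in }A^\perp\parallel A\}$, and $X$ consistent iff its down-closure in $\Gamma_A$ is consistent in $A^\perp\parallel A$. $\gamma_A:\Gamma_A\to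 A^\perp\parallel A$ is the identity function. **Strategies.** A strategy on a game $A$ is a pre-strategy $\sigma:S\to A$ such that $\gamma_A\odot\sigma\cong\sigma$ (regarding $\sigma$ as a pre-strategy on $1^\perp\parallel A$). Equivalently, $\sigma$ is courteous (if $s$ is an immediate cause of $s'$ in $S$, i.e. $s<s'$ with nothing strictly in between, and $(\mathrm{pol}(s),\mathrm{pol}(s'))\neq(-,+)$, then $\sigma s$ is an immediate cause of $\sigma s'$ in $A$) and receptive (if $x\in\mathcal{C}(S)$, $a\in A\setminus\sigma x$ is negative and $\sigma x\cup\{a\}\in\mathcal{C}(A)$, there is a unique $s\in S \setminus x$ with $x\cup\{s\}\in\mathcal{C}(S)$ and $\sigma s=a$). Composition of strategies is associative and unital (with unit copycat) up to isomorphism, so $\mathbf{CG}$ is a category. **Tensor and lifting.** For strategies $\sigma_i:S_i\to A_i^\perp\parallel B_i$ ($i=1,2$), $\sigma_1\otimes\sigma_2:S_1\parallel S_2\to(A_1\parallel A_2)^\perp\parallel(B_1\parallel B_2)$ is $\sigma_1\parallel\sigma_2$ followed by the evident isomorphism $(A_1^\perp\parallel B_1)\parallel(A_2^\perp\parallel B_2)\cong(A_1\parallel A_2)^\perp\parallel(B_1\parallel B_2)$. For a receptive courteous map of esps $f:A\to B$, its lifting is the strategy $\lceil f\rceil=(\mathrm{id}_{A^\perp}\parallel f)\circ\gamma_A:\Gamma_A\to A^\perp\parallel B$. The evident isomorphisms of esps are $\rho_A:A\parallel1\to A$, $\lambda_A:1\parallel A\to A$, $s_{A,B}:A\parallel B\to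 B\parallel A$, $\alpha_{A,B,C}:(A\parallel B)\parallel C\to A\parallel(B\parallel C)$. **Compact closed** means: symmetric monoidal, and for each object $A$ the morphisms $\eta_A,\epsilon_A$ satisfy the two triangle (zig-zag) identities exhibiting $A^\perp$ as a dual of $A$, namely $\mathrm{id}_A=\lambda_A\circ(\epsilon_A\otimes \mathrm{id}_A)\circ\alpha^{-1}\circ(\mathrm{id}_A\otimes\eta_A)\circ\rho_A^{-1}$ and $\mathrm{id}_{A^\perp}=\rho_{A^\perp}\circ(\mathrm{id}_{A^\perp}\otimes\epsilon_A)\circ\alpha\circ(\eta_A\otimes \mathrm{id}_{A^\perp})\circ\lambda_{A^\perp}^{-1}$. *)

theory Defs
  imports Main "HOL-Library.FSet" "HOL-Library.FuncSet"
begin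

section \<open>Symmetric monoidal and compact closed categories\<close>

text \<open>
  A category is given by a set of objects, pairwise disjoint hom-sets, a composition (relevant
  only on composable arrows, written in application order) and identities. Equality of arrows
  is HOL equality, so quotients have to be taken in the arrows themselves.
\<close>

locale cat =
  fixes ob :: "'o set"
    and hom :: "'o \<Rightarrow> 'o \<Rightarrow> 'm set"
    and cmp :: "'m \<Rightarrow> 'm \<Rightarrow> 'm"  (infixl "\<cdot>" 70)
    and ide :: "'o \<Rightarrow> 'm"
  assumes hom_disjoint:
      "\<lbrakk>A \<in> ob; B \<in> ob; A' \<in> ob; B' \<in> ob; f \<in> hom A B; f \<in> hom A' B'\<rbrakk> \<Longrightarrow> A = A' \<and> B = B'"
    and ide_in_hom: "A \<in> ob \<Longrightarrow> ide A \<in> hom A A"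
    and cmp_in_hom:
      "\<lbrakk>A \<in> ob; B \<in> ob; C \<in> ob; f \<in> hom A B; g \<in> hom B C\<rbrakk> \<Longrightarrow> g \<cdot> f \<in> hom A C"
    and cmp_ide_right: "\<lbrakk>A \<in> ob; B \<in> ob; f \<in> hom A B\<rbrakk> \<Longrightarrow> f \<cdot> ide A = f"
    and cmp_ide_left: "\<lbrakk>A \<in> ob; B \<in> ob; f \<in> hom A B\<rbrakk> \<Longrightarrow> ide B \<cdot> f = f"
    and cmp_assoc:
      "\<lbrakk>A \<in> ob; B \<in> ob; C \<in> ob; D \<in> ob; f \<in> hom A B; g \<in> hom B C; h \<in> hom C D\<rbrakk>
        \<Longrightarrow> h \<cdot> (g \<cdot> f) = (h \<cdot> g) \<cdot> f"
begin

definition is_inverse :: "'o \<Rightarrow> 'o \<Rightarrow> 'm \<Rightarrow> 'm \<Rightarrow> bool" where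
  "is_inverse A B f g \<longleftrightarrow>
     f \<in> hom A B \<and> g \<in> hom B A \<and> g \<cdot> f = ide A \<and> f \<cdot> g = ide B"

definition iso_arr :: "'o \<Rightarrow> 'o \<Rightarrow> 'm \<Rightarrow> bool" where
  "iso_arr A B f \<longleftrightarrow> (\<exists>g. is_inverse A B f g)"

definition inv_arr :: "'o \<Rightarrow> 'o \<Rightarrow> 'm \<Rightarrow> 'm" where
  "inv_arr A B f = (THE g. is_inverse A B f g)"

end

locale symmetric_monoidal_cat = cat ob hom cmp ide
  for ob :: "'o set"
    and hom :: "'o \<Rightarrow> 'o \<Rightarrow> 'm set"
    and cmp :: "'m \<Rightarrow> 'm \<Rightarrow> 'm"  (infixl "\<cdot>" 70)
    and ide :: "'o \<Rightarrow> 'm" +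
  fixes tens :: "'o \<Rightarrow> 'o \<Rightarrow> 'o"  (infixr "\<otimes>" 75)
    and tens_arr :: "'m \<Rightarrow> 'm \<Rightarrow> 'm"  (infixr "\<otimes>\<^sub>a" 75)
    and unit_ob :: 'o  ("\<I>")
    and assoc :: "'o \<Rightarrow> 'o \<Rightarrow> 'o \<Rightarrow> 'm"  ("\<alpha>")
    and lunit :: "'o \<Rightarrow> 'm"  ("\<lambda>\<^sub>I")
    and runit :: "'o \<Rightarrow> 'm"  ("\<rho>")
    and symm :: "'o \<Rightarrow> 'o \<Rightarrow> 'm"  ("\<s>")
  assumes unit_ob: "\<I> \<in> ob"
    and tens_ob: "\<lbrakk>A \<in> ob; B \<in> ob\<rbrakk> \<Longrightarrow> A \<otimes> B \<in> ob"
    and tens_in_hom: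
      "\<lbrakk>A \<in> ob; B \<in> ob; A' \<in> ob; B' \<in> ob; f \<in> hom A A'; g \<in> hom B B'\<rbrakk>
        \<Longrightarrow> f \<otimes>\<^sub>a g \<in> hom (A \<otimes> B) (A' \<otimes> B')"
    and tens_ide: "\<lbrakk>A \<in> ob; B \<in> ob\<rbrakk> \<Longrightarrow> ide A \<otimes>\<^sub>a ide B = ide (A \<otimes> B)"
    and tens_cmp:
      "\<lbrakk>A \<in> ob; A' \<in> ob; A'' \<in> ob; B \<in> ob; B' \<in> ob; B'' \<in> ob;
        f \<in> hom A A'; f' \<in> hom A' A''; g \<in> hom B B'; g' \<in> hom B' B''\<rbrakk>
        \<Longrightarrow> (f' \<cdot> f) \<otimes>\<^sub>a (g' \<cdot> g) = (f' \<otimes>\<^sub>a g') \<cdot> (f \<otimes>\<^sub>a g)"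
    and assoc_iso:
      "\<lbrakk>A \<in> ob; B \<in> ob; C \<in> ob\<rbrakk> \<Longrightarrow> iso_arr ((A \<otimes> B) \<otimes> C) (A \<otimes> (B \<otimes> C)) (\<alpha> A B C)"
    and lunit_iso: "A \<in> ob \<Longrightarrow> iso_arr (\<I> \<otimes> A) A (\<lambda>\<^sub>I A)"
    and runit_iso: "A \<in> ob \<Longrightarrow> iso_arr (A \<otimes> \<I>) A (\<rho> A)"
    and symm_iso: "\<lbrakk>A \<in> ob; B \<in> ob\<rbrakk> \<Longrightarrow> iso_arr (A \<otimes> B) (B \<otimes> A) (\<s> A B)"
    and assoc_natural:
      "\<lbrakk>A \<in> ob; A' \<in> ob; B \<in> ob; B' \<in> ob; C \<in> ob; C' \<in> ob;
        f \<in> hom A A'; g \<in> hom B B'; h \<in> hom C C'\<rbrakk>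
        \<Longrightarrow> \<alpha> A' B' C' \<cdot> ((f \<otimes>\<^sub>a g) \<otimes>\<^sub>a h) = (f \<otimes>\<^sub>a (g \<otimes>\<^sub>a h)) \<cdot> \<alpha> A B C"
    and lunit_natural:
      "\<lbrakk>A \<in> ob; B \<in> ob; f \<in> hom A B\<rbrakk> \<Longrightarrow> \<lambda>\<^sub>I B \<cdot> (ide \<I> \<otimes>\<^sub>a f) = f \<cdot> \<lambda>\<^sub>I A"
    and runit_natural:
      "\<lbrakk>A \<in> ob; B \<in> ob; f \<in> hom A B\<rbrakk> \<Longrightarrow> \<rho> B \<cdot> (f \<otimes>\<^sub>a ide \<I>) = f \<cdot> \<rho> A"
    and symm_natural:
      "\<lbrakk>A \<in> ob; A' \<in> ob; B \<in> ob; B' \<in> ob; f \<in> hom A A'; g \<in> hom B B'\<rbrakk>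
        \<Longrightarrow> \<s> A' B' \<cdot> (f \<otimes>\<^sub>a g) = (g \<otimes>\<^sub>a f) \<cdot> \<s> A B"
    and pentagon:
      "\<lbrakk>A \<in> ob; B \<in> ob; C \<in> ob; D \<in> ob\<rbrakk>
        \<Longrightarrow> \<alpha> A B (C \<otimes> D) \<cdot> \<alpha> (A \<otimes> B) C D
           = (ide A \<otimes>\<^sub>a \<alpha> B C D) \<cdot> \<alpha> A (B \<otimes> C) D \<cdot> (\<alpha> A B C \<otimes>\<^sub>a ide D)"
    and unit_triangle:
      "\<lbrakk>A \<in> ob; B \<in> ob\<rbrakk> \<Longrightarrow> (ide A \<otimes>\<^sub>a \<lambda>\<^sub>I B) \<cdot> \<alpha> A \<I> B = \<rho> A \<otimes>\<^sub>a ide B"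
    and symm_symm: "\<lbrakk>A \<in> ob; B \<in> ob\<rbrakk> \<Longrightarrow> \<s> B A \<cdot> \<s> A B = ide (A \<otimes> B)"
    and symm_unit: "A \<in> ob \<Longrightarrow> \<lambda>\<^sub>I A \<cdot> \<s> A \<I> = \<rho> A"
    and hexagon:
      "\<lbrakk>A \<in> ob; B \<in> ob; C \<in> ob\<rbrakk>
        \<Longrightarrow> \<alpha> B C A \<cdot> \<s> A (B \<otimes> C) \<cdot> \<alpha> A B C
           = (ide B \<otimes>\<^sub>a \<s> A C) \<cdot> \<alpha> B A C \<cdot> (\<s> A B \<otimes>\<^sub>a ide C)"

locale compact_closed_cat = symmetric_monoidal_cat ob hom cmp ide tens tens_arr unit_ob
    assoc lunit runit symm
  for ob :: "'o set"
    and hom :: "'o \<Rightarrow> 'o \<Rightarrow> 'm set"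
    and cmp :: "'m \<Rightarrow> 'm \<Rightarrow> 'm"  (infixl "\<cdot>" 70)
    and ide :: "'o \<Rightarrow> 'm"
    and tens :: "'o \<Rightarrow> 'o \<Rightarrow> 'o"  (infixr "\<otimes>" 75)
    and tens_arr :: "'m \<Rightarrow> 'm \<Rightarrow> 'm"  (infixr "\<otimes>\<^sub>a" 75)
    and unit_ob :: 'o  ("\<I>")
    and assoc :: "'o \<Rightarrow> 'o \<Rightarrow> 'o \<Rightarrow> 'm"  ("\<alpha>")
    and lunit :: "'o \<Rightarrow> 'm"  ("\<lambda>\<^sub>I")
    and runit :: "'o \<Rightarrow> 'm"  ("\<rho>")
    and symm :: "'o \<Rightarrow> 'o \<Rightarrow> 'm"  ("\<s>") +
  fixes dual_ob :: "'o \<Rightarrow> 'o"  ("_\<^sup>\<star>" [1000] 999)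
    and coev :: "'o \<Rightarrow> 'm"  ("\<eta>")
    and ev :: "'o \<Rightarrow> 'm"  ("\<epsilon>")
  assumes dual_ob: "A \<in> ob \<Longrightarrow> A\<^sup>\<star> \<in> ob"
    and coev_in_hom: "A \<in> ob \<Longrightarrow> \<eta> A \<in> hom \<I> (A\<^sup>\<star> \<otimes> A)"
    and ev_in_hom: "A \<in> ob \<Longrightarrow> \<epsilon> A \<in> hom (A \<otimes> A\<^sup>\<star>) \<I>"
    and zigzag:
      "A \<in> ob \<Longrightarrow>
        ide A = \<lambda>\<^sub>I A \<cdot> (\<epsilon> A \<otimes>\<^sub>a ide A)
          \<cdot> inv_arr ((A \<otimes> A\<^sup>\<star>) \<otimes> A) (A \<otimes> (A\<^sup>\<star> \<otimes> A)) (\<alpha> A (A\<^sup>\<star>) A)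
          \<cdot> (ide A \<otimes>\<^sub>a \<eta> A) \<cdot> inv_arr (A \<otimes> \<I>) A (\<rho> A)"
    and zigzag_dual:
      "A \<in> ob \<Longrightarrow>
        ide (A\<^sup>\<star>) = \<rho> (A\<^sup>\<star>) \<cdot> (ide (A\<^sup>\<star>) \<otimes>\<^sub>a \<epsilon> A)
          \<cdot> \<alpha> (A\<^sup>\<star>) A (A\<^sup>\<star>)
          \<cdot> (\<eta> A \<otimes>\<^sub>a ide (A\<^sup>\<star>)) \<cdot> inv_arr (\<I> \<otimes> A\<^sup>\<star>) (A\<^sup>\<star>) (\<lambda>\<^sub>I (A\<^sup>\<star>))"


section \<open>Event structures and games\<close>

datatype polarity = Neg | Pos

fun opp :: "polarity \<Rightarrow> polarity" where
  "opp Neg = Pos"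
| "opp Pos = Neg"

record 'e es =
  Ev :: "'e set"
  Le :: "'e rel"   \<comment> \<open>\<open>(e', e) \<in> Le E\<close> means \<open>e' \<le> e\<close>\<close>
  Con :: "'e set set"

record 'e esp = "'e es" +
  pol :: "'e \<Rightarrow> polarity"

definition event_structure :: "('e, 'z) es_scheme \<Rightarrow> bool" where
  "event_structure E \<longleftrightarrow>
     partial_order_on (Ev E) (Le E) \<and>
     Con E \<noteq> {} \<and>
     (\<forall>X\<in>Con E. finite X \<and> X \<subseteq> Ev E) \<and>
     (\<forall>e\<in>Ev E. finite {e'. (e', e) \<in> Le E}) \<and>
     (\<forall>e\<in>Ev E. {e} \<in> Con E) \<and>
     (\<forall>X\<in>Con E. \<forall>Y. Y \<subseteq> X \<longrightarrow> Y \<in> Con E) \<and>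
     (\<forall>X\<in>Con E. \<forall>e\<in>X. \<forall>e'. (e', e) \<in> Le E \<longrightarrow> X \<union> {e'} \<in> Con E)"

text \<open>
  The polarity function is fixed to be \<open>undefined\<close> outside the events, so that equality of
  records is equality of event structures with polarities.
\<close>

definition game :: "'e esp \<Rightarrow> bool" where
  "game A \<longleftrightarrow> event_structure A \<and> pol A \<in> extensional (Ev A)"

definition configs :: "('e, 'z) es_scheme \<Rightarrow> 'e set set" where
  "configs E = {x. x \<in> Con E \<and> finite x \<and> (\<forall>e\<in>x. \<forall>e'. (e', e) \<in> Le E \<longrightarrow> e' \<in> x)}"

definition es_map :: "('e, 'y) es_scheme \<Rightarrow> ('f, 'z) es_scheme \<Rightarrow> ('e \<Rightarrow> 'f) \<Rightarrow> bool" where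
  "es_map E F f \<longleftrightarrow>
     f \<in> Ev E \<rightarrow> Ev F \<and> (\<forall>x\<in>configs E. f ` x \<in> configs F \<and> inj_on f x)"

definition esp_map :: "'e esp \<Rightarrow> 'f esp \<Rightarrow> ('e \<Rightarrow> 'f) \<Rightarrow> bool" where
  "esp_map E F f \<longleftrightarrow> es_map E F f \<and> (\<forall>e\<in>Ev E. pol F (f e) = pol E e)"

definition esp_iso :: "'e esp \<Rightarrow> 'f esp \<Rightarrow> ('e \<Rightarrow> 'f) \<Rightarrow> bool" where
  "esp_iso E F f \<longleftrightarrow> esp_map E F f \<and>
     (\<exists>g. esp_map F E g \<and> (\<forall>e\<in>Ev E. g (f e) = e) \<and> (\<forall>e\<in>Ev F. f (g e) = e))"

definition dual :: "'e esp \<Rightarrow> 'e esp"  ("_\<^sup>\<bottom>" [1000] 999) where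
  "A\<^sup>\<bottom> = A\<lparr>pol := restrict (opp \<circ> pol A) (Ev A)\<rparr>"

definition empty_game :: "'e esp"  ("\<one>") where
  "\<one> = \<lparr>Ev = {}, Le = {}, Con = {{}}, pol = (\<lambda>_. undefined)\<rparr>"

text \<open>
  A universe of events: the values generated from atoms in \<open>'a\<close> by the two tags of a parallel
  composition (\<open>False\<close> for 0, \<open>True\<close> for 1) and by the finite graphs that are the events of an
  interaction. All constructions on games and strategies stay within it, so that games over
  \<open>'a ev\<close> are the objects of a single category. Every game is, up to renaming of its events, a
  game over \<open>'a ev\<close> for \<open>'a\<close> its type of events (through \<open>Atom\<close>).
\<close>

datatype 'a ev =
    Atom 'a
  | Tag bool "'a ev"
  | Graph "('a ev \<times> 'a ev) fset"

definition par :: "'a ev esp \<Rightarrow> 'a ev esp \<Rightarrow> 'a ev esp"  (infixr "\<parallel>" 65) where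
  "A \<parallel> B =
    \<lparr>Ev = Tag False ` Ev A \<union> Tag True ` Ev B,
     Le = {(Tag False a', Tag False a) | a' a. (a', a) \<in> Le A}
        \<union> {(Tag True b', Tag True b) | b' b. (b', b) \<in> Le B},
     Con = {Tag False ` X \<union> Tag True ` Y | X Y. X \<in> Con A \<and> Y \<in> Con B},
     pol = restrict (\<lambda>e. case e of Tag i a \<Rightarrow> pol (if i then B else A) a)
             (Tag False ` Ev A \<union> Tag True ` Ev B)\<rparr>"

fun par_map :: "('a ev \<Rightarrow> 'a ev) \<Rightarrow> ('a ev \<Rightarrow> 'a ev) \<Rightarrow> 'a ev \<Rightarrow> 'a ev" where
  "par_map f g (Tag i a) = Tag i ((if i then g else f) a)"

text \<open>The evident isomorphisms; their values on other arguments are irrelevant.\<close>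

fun runit_map :: "'a ev \<Rightarrow> 'a ev" where
  "runit_map (Tag False a) = a"

fun lunit_map :: "'a ev \<Rightarrow> 'a ev" where
  "lunit_map (Tag True a) = a"

fun symm_map :: "'a ev \<Rightarrow> 'a ev" where
  "symm_map (Tag i a) = Tag (\<not> i) a"

fun assoc_map :: "'a ev \<Rightarrow> 'a ev" where
  "assoc_map (Tag False (Tag False a)) = Tag False a"
| "assoc_map (Tag False (Tag True b)) = Tag True (Tag False b)"
| "assoc_map (Tag True c) = Tag True (Tag True c)"

text \<open>\<open>(A\<^sub>1\<^sup>\<bottom> \<parallel> B\<^sub>1) \<parallel> (A\<^sub>2\<^sup>\<bottom> \<parallel> B\<^sub>2) \<cong> (A\<^sub>1 \<parallel> A\<^sub>2)\<^sup>\<bottom> \<parallel> (B\<^sub>1 \<parallel> B\<^sub>2)\<close>\<close>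

fun exchange_map :: "'a ev \<Rightarrow> 'a ev" where
  "exchange_map (Tag i (Tag j e)) = Tag j (Tag i e)"


section \<open>Secured bijections and interaction\<close>

text \<open>
  Bijections are represented by their graphs \<open>q\<close>. The order on \<open>q\<close> is the reflexive transitive
  closure, within \<open>q\<close>, of the union of the two strict orders on the components.
\<close>

definition graph_step :: "'s rel \<Rightarrow> 't rel \<Rightarrow> ('s \<times> 't) set \<Rightarrow> ('s \<times> 't) rel" where
  "graph_step r r' q =
     {((a, b), (a', b')). (a, b) \<in> q \<and> (a', b') \<in> q \<and>
        ((a, a') \<in> r \<and> a \<noteq> a' \<or> (b, b') \<in> r' \<and> b \<noteq> b')}"

definition graph_order :: "'s rel \<Rightarrow> 't rel \<Rightarrow> ('s \<times> 't) set \<Rightarrow> ('s \<times> 't) rel" where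
  "graph_order r r' q = (graph_step r r' q)\<^sup>* \<inter> q \<times> q"

definition secured :: "'s rel \<Rightarrow> 't rel \<Rightarrow> ('s \<times> 't) set \<Rightarrow> bool" where
  "secured r r' q \<longleftrightarrow> partial_order_on q (graph_order r r' q)"

definition is_greatest :: "'e rel \<Rightarrow> 'e set \<Rightarrow> 'e \<Rightarrow> bool" where
  "is_greatest r q p \<longleftrightarrow> p \<in> q \<and> (\<forall>p'\<in>q. (p', p) \<in> r)"

definition induced_graph :: "('s \<Rightarrow> 'c) \<Rightarrow> ('t \<Rightarrow> 'c) \<Rightarrow> 's set \<Rightarrow> 't set \<Rightarrow> ('s \<times> 't) set" where
  "induced_graph \<sigma> \<tau> x y = {(s, t). s \<in> x \<and> t \<in> y \<and> \<sigma> s = \<tau> t}"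

definition secured_bijections ::
  "('s, 'y) es_scheme \<Rightarrow> ('s \<Rightarrow> 'c) \<Rightarrow> ('t, 'z) es_scheme \<Rightarrow> ('t \<Rightarrow> 'c) \<Rightarrow> ('s \<times> 't) set set" where
  "secured_bijections S \<sigma> T \<tau> =
     {induced_graph \<sigma> \<tau> x y | x y. x \<in> configs S \<and> y \<in> configs T \<and> \<sigma> ` x = \<tau> ` y \<and>
        secured (Le S) (Le T) (induced_graph \<sigma> \<tau> x y)}"

fun graph_of :: "'a ev \<Rightarrow> ('a ev \<times> 'a ev) set" where
  "graph_of (Graph g) = fset g"

definition meet_events ::
  "('a ev, 'y) es_scheme \<Rightarrow> ('a ev \<Rightarrow> 'a ev) \<Rightarrow> ('a ev, 'z) es_scheme \<Rightarrow> ('a ev \<Rightarrow> 'a ev)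
     \<Rightarrow> 'a ev set" where
  "meet_events S \<sigma> T \<tau> =
     {Graph g | g. fset g \<in> secured_bijections S \<sigma> T \<tau> \<and>
        (\<exists>p. is_greatest (graph_order (Le S) (Le T) (fset g)) (fset g) p)}"

definition meet_es ::
  "('a ev, 'y) es_scheme \<Rightarrow> ('a ev \<Rightarrow> 'a ev) \<Rightarrow> ('a ev, 'z) es_scheme \<Rightarrow> ('a ev \<Rightarrow> 'a ev)
     \<Rightarrow> 'a ev es" where
  "meet_es S \<sigma> T \<tau> =
    \<lparr>Ev = meet_events S \<sigma> T \<tau>,
     Le = {(e', e). e' \<in> meet_events S \<sigma> T \<tau> \<and> e \<in> meet_events S \<sigma> T \<tau> \<and>
            graph_of e' \<subseteq> graph_of e},
     Con = {X. finite X \<and> X \<subseteq> meet_events S \<sigma> T \<tau> \<and>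
            (\<Union>e\<in>X. graph_of e) \<in> secured_bijections S \<sigma> T \<tau>}\<rparr>"

definition meet_map ::
  "('a ev, 'y) es_scheme \<Rightarrow> ('a ev \<Rightarrow> 'a ev) \<Rightarrow> ('a ev, 'z) es_scheme \<Rightarrow> 'a ev \<Rightarrow> 'a ev" where
  "meet_map S \<sigma> T e =
     \<sigma> (fst (THE p. is_greatest (graph_order (Le S) (Le T) (graph_of e)) (graph_of e) p))"


section \<open>Pre-strategies and strategies\<close>

text \<open>
  The underlying function of a pre-strategy matters only on the events of its domain;
  isomorphism of pre-strategies ignores its other values.
\<close>

type_synonym 'a prestrat = "'a ev esp \<times> ('a ev \<Rightarrow> 'a ev)"

definition prestrategy :: "'a ev esp \<Rightarrow> 'a prestrat \<Rightarrow> bool" where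
  "prestrategy A = (\<lambda>(S, \<sigma>). game S \<and> esp_map S A \<sigma>)"

definition prestrat_iso :: "'a prestrat \<Rightarrow> 'a prestrat \<Rightarrow> bool"  (infix "\<cong>" 50) where
  "prestrat_iso = (\<lambda>(S, \<sigma>) (T, \<tau>). \<exists>\<phi>. esp_iso S T \<phi> \<and> (\<forall>s\<in>Ev S. \<tau> (\<phi> s) = \<sigma> s))"

text \<open>
  For \<open>\<sigma> : S \<rightarrow> A\<^sup>\<bottom> \<parallel> B\<close> and \<open>\<tau> : T \<rightarrow> B\<^sup>\<bottom> \<parallel> C\<close>, the interaction lives over
  \<open>A \<parallel> B \<parallel> C\<close>, bracketed to the right; \<open>assoc_map\<close> brings the target of \<open>\<sigma> \<parallel> id\<^sub>C\<close> to this form.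
\<close>

definition interaction_es ::
  "'a ev esp \<Rightarrow> 'a ev esp \<Rightarrow> 'a prestrat \<Rightarrow> 'a prestrat \<Rightarrow> 'a ev es" where
  "interaction_es A C = (\<lambda>(T, \<tau>) (S, \<sigma>).
     meet_es (S \<parallel> C) (assoc_map \<circ> par_map \<sigma> id) (A \<parallel> T) (par_map id \<tau>))"

definition interaction_map ::
  "'a ev esp \<Rightarrow> 'a ev esp \<Rightarrow> 'a prestrat \<Rightarrow> 'a prestrat \<Rightarrow> 'a ev \<Rightarrow> 'a ev" where
  "interaction_map A C = (\<lambda>(T, \<tau>) (S, \<sigma>).
     meet_map (S \<parallel> C) (assoc_map \<circ> par_map \<sigma> id) (A \<parallel> T))"

text \<open>The events of \<open>A \<parallel> B \<parallel> C\<close> in \<open>A\<close> or \<open>C\<close>, and their copies in \<open>A \<parallel> C\<close>.\<close>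

definition outer_events :: "'a ev esp \<Rightarrow> 'a ev esp \<Rightarrow> 'a ev set" where
  "outer_events A C = Tag False ` Ev A \<union> (Tag True \<circ> Tag True) ` Ev C"

fun outer_map :: "'a ev \<Rightarrow> 'a ev" where
  "outer_map (Tag False a) = Tag False a"
| "outer_map (Tag True (Tag True c)) = Tag True c"

definition strat_comp ::
  "'a ev esp \<Rightarrow> 'a ev esp \<Rightarrow> 'a prestrat \<Rightarrow> 'a prestrat \<Rightarrow> 'a prestrat" where
  "strat_comp A C \<tau> \<sigma> =
    (let I = interaction_es A C \<tau> \<sigma>;
         V = {e \<in> Ev I. interaction_map A C \<tau> \<sigma> e \<in> outer_events A C};
         m = outer_map \<circ> interaction_map A C \<tau> \<sigma>
     in (\<lparr>Ev = V,
          Le = Le I \<inter> V \<times> V,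
          Con = {X \<in> Con I. X \<subseteq> V},
          pol = restrict (pol (A\<^sup>\<bottom> \<parallel> C) \<circ> m) V\<rparr>, m))"

definition copycat_le :: "'a ev esp \<Rightarrow> 'a ev rel" where
  "copycat_le A =
     (Le (A\<^sup>\<bottom> \<parallel> A) \<union>
      {(Tag (\<not> i) a, Tag i a) | i a. Tag i a \<in> Ev (A\<^sup>\<bottom> \<parallel> A) \<and> pol (A\<^sup>\<bottom> \<parallel> A) (Tag i a) = Pos})\<^sup>+"

definition copycat_esp :: "'a ev esp \<Rightarrow> 'a ev esp"  ("\<Gamma>") where
  "\<Gamma> A =
    \<lparr>Ev = Ev (A\<^sup>\<bottom> \<parallel> A),
     Le = copycat_le A,
     Con = {X. X \<subseteq> Ev (A\<^sup>\<bottom> \<parallel> A) \<and> {e'. \<exists>e\<in>X. (e', e) \<in> copycat_le A} \<in> Con (A\<^sup>\<bottom> \<parallel> A)},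
     pol = pol (A\<^sup>\<bottom> \<parallel> A)\<rparr>"

definition copycat :: "'a ev esp \<Rightarrow> 'a prestrat"  ("\<gamma>") where
  "\<gamma> A = (\<Gamma> A, id)"

text \<open>A pre-strategy on \<open>A\<close> regarded as a pre-strategy on \<open>\<one>\<^sup>\<bottom> \<parallel> A\<close>.\<close>

definition from_unit :: "'a prestrat \<Rightarrow> 'a prestrat" where
  "from_unit = (\<lambda>(S, \<sigma>). (S, Tag True \<circ> \<sigma>))"

definition strategy :: "'a ev esp \<Rightarrow> 'a prestrat \<Rightarrow> bool" where
  "strategy A \<sigma> \<longleftrightarrow>
     prestrategy A \<sigma> \<and> strat_comp \<one> A (\<gamma> A) (from_unit \<sigma>) \<cong> from_unit \<sigma>"

definition strat_tensor :: "'a prestrat \<Rightarrow> 'a prestrat \<Rightarrow> 'a prestrat" where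
  "strat_tensor = (\<lambda>(S\<^sub>1, \<sigma>\<^sub>1) (S\<^sub>2, \<sigma>\<^sub>2). (S\<^sub>1 \<parallel> S\<^sub>2, exchange_map \<circ> par_map \<sigma>\<^sub>1 \<sigma>\<^sub>2))"

definition lifting :: "'a ev esp \<Rightarrow> ('a ev \<Rightarrow> 'a ev) \<Rightarrow> 'a prestrat" where
  "lifting A f = (\<Gamma> A, par_map id f \<circ> snd (\<gamma> A))"


section \<open>The category of games and strategies\<close>

text \<open>
  An arrow is an isomorphism class of strategies together with its source and target.
  Composition and tensor of arrows are unions over all representatives: that they are single
  isomorphism classes, i.e. that the operations are well defined, is part of the claim that
  they lie in the hom-sets.
\<close>

record 'a arr =
  src :: "'a ev esp"
  trg :: "'a ev esp"
  cls :: "'a prestrat set"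

definition iso_class :: "'a ev esp \<Rightarrow> 'a prestrat \<Rightarrow> 'a prestrat set" where
  "iso_class A \<sigma> = {\<sigma>'. prestrategy A \<sigma>' \<and> \<sigma> \<cong> \<sigma>'}"

definition mk_arr :: "'a ev esp \<Rightarrow> 'a ev esp \<Rightarrow> 'a prestrat \<Rightarrow> 'a arr" where
  "mk_arr A B \<sigma> = \<lparr>src = A, trg = B, cls = iso_class (A\<^sup>\<bottom> \<parallel> B) \<sigma>\<rparr>"

definition CG_ob :: "'a ev esp set" where
  "CG_ob = {A. game A}"

definition CG_hom :: "'a ev esp \<Rightarrow> 'a ev esp \<Rightarrow> 'a arr set" where
  "CG_hom A B = {mk_arr A B \<sigma> | \<sigma>. strategy (A\<^sup>\<bottom> \<parallel> B) \<sigma>}"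

definition CG_comp :: "'a arr \<Rightarrow> 'a arr \<Rightarrow> 'a arr" where
  "CG_comp g f =
    \<lparr>src = src f, trg = trg g,
     cls = (\<Union>\<tau>\<in>cls g. \<Union>\<sigma>\<in>cls f.
              iso_class ((src f)\<^sup>\<bottom> \<parallel> trg g) (strat_comp (src f) (trg g) \<tau> \<sigma>))\<rparr>"

definition CG_id :: "'a ev esp \<Rightarrow> 'a arr" where
  "CG_id A = mk_arr A A (\<gamma> A)"

definition CG_tensor :: "'a arr \<Rightarrow> 'a arr \<Rightarrow> 'a arr" where
  "CG_tensor f g =
    \<lparr>src = src f \<parallel> src g, trg = trg f \<parallel> trg g,
     cls = (\<Union>\<sigma>\<in>cls f. \<Union>\<tau>\<in>cls g.
              iso_class ((src f \<parallel> src g)\<^sup>\<bottom> \<parallel> (trg f \<parallel> trg g)) (strat_tensor \<sigma> \<tau>))\<rparr>"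

definition CG_assoc :: "'a ev esp \<Rightarrow> 'a ev esp \<Rightarrow> 'a ev esp \<Rightarrow> 'a arr" where
  "CG_assoc A B C =
     mk_arr ((A \<parallel> B) \<parallel> C) (A \<parallel> (B \<parallel> C)) (lifting ((A \<parallel> B) \<parallel> C) assoc_map)"

definition CG_lunit :: "'a ev esp \<Rightarrow> 'a arr" where
  "CG_lunit A = mk_arr (\<one> \<parallel> A) A (lifting (\<one> \<parallel> A) lunit_map)"

definition CG_runit :: "'a ev esp \<Rightarrow> 'a arr" where
  "CG_runit A = mk_arr (A \<parallel> \<one>) A (lifting (A \<parallel> \<one>) runit_map)"

definition CG_symm :: "'a ev esp \<Rightarrow> 'a ev esp \<Rightarrow> 'a arr" where
  "CG_symm A B = mk_arr (A \<parallel> B) (B \<parallel> A) (lifting (A \<parallel> B) symm_map)"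

text \<open>
  In \<open>CG_ev\<close>, the game \<open>(A \<parallel> A\<^sup>\<bottom>)\<^sup>\<bottom>\<close> is \<open>A\<^sup>\<bottom> \<parallel> A\<close>.
\<close>

definition CG_coev :: "'a ev esp \<Rightarrow> 'a arr" where
  "CG_coev A = mk_arr \<one> (A\<^sup>\<bottom> \<parallel> A) (\<Gamma> A, Tag True)"

definition CG_ev :: "'a ev esp \<Rightarrow> 'a arr" where
  "CG_ev A = mk_arr (A \<parallel> A\<^sup>\<bottom>) \<one> (\<Gamma> A, Tag False)"

end

theory Submission
  imports Defs
begin

text \<open>
  A strategy is determined up to isomorphism by its configurations, each labelled with the moves it
  plays and equipped with the causal order on these labels. In these terms a composite consists of
  the pairs of configurations that agree on the shared labels and whose causal orders are jointly
  acyclic, with the shared labels hidden; every hidden label has to lie below a visible one.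
  Synchronisation is commutative and associative, successive hidings merge, and hiding commutes with
  synchronisation on other labels. Hence equations between composites reduce to rearrangements,
  together with one computation: copycat composed with itself is copycat.

  Copycat on \<open>A\<^sup>\<bottom> \<parallel> B\<close> is a pair of copycats side by side, so the equation defining strategies says
  that \<open>\<sigma>\<close> absorbs the composite with copycat on both sides at once; since copycat is idempotent,
  \<open>\<sigma>\<close> absorbs it on each side separately. These are the unit laws, and no appeal to courtesy or
  receptivity is needed. The structural isomorphisms, \<open>\<eta>\<close> and \<open>\<epsilon>\<close> are copycats with renamed labels,
  so that naturality, coherence and the triangle identities become renamings of chains of copycats.
\<close>

section \<open>Labelled state structures\<close>

text \<open>The obstacle is nesting. Events of an interaction are graphs over events of its factors,
  so the two bracketings of a triple composite have unrelated event sets, and a visible event still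
  carries the hidden moves in its graph. Moves of the games, by contrast, are common to both sides
  of an equation. A pre-strategy is injective on each configuration, so a configuration can be
  traded for its set of moves with the transported order, and nothing is lost: an event is recovered
  from the least configuration containing it, its polarity from the game. Inclusion of
  configurations has to be kept as well, since conflicting events may play the same move. Two facts
  carry the calculus. A cycle in a synchronisation that meets labels private to one factor either
  stays inside the order of that factor, which is impossible, or shrinks to a cycle of visible
  labels; so acyclicity may be tested after hiding. And the copies of the outer games that the
  interaction adjoins to its two factors act as identities for synchronisation.\<close>

text \<open>
  States stand for configurations: \<open>lab\<close> gives the labels occurring in a state and \<open>ord\<close> the
  causal order between them. The set \<open>Lbs\<close> bounds the labels that may occur at all, and so
  determines on which labels two structures synchronise.
\<close>

record ('s, 'l) ls =
  St :: "'s set"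
  Sle :: "'s \<Rightarrow> 's \<Rightarrow> bool"
  Lbs :: "'l set"
  lab :: "'s \<Rightarrow> 'l set"
  ord :: "'s \<Rightarrow> 'l rel"

definition valid :: "('s, 'l) ls \<Rightarrow> bool" where
  "valid X \<longleftrightarrow> (\<forall>s\<in>St X. lab X s \<subseteq> Lbs X \<and> ord X s \<subseteq> lab X s \<times> lab X s \<and>
     (\<forall>l\<in>lab X s. (l, l) \<in> ord X s) \<and> trans (ord X s) \<and> antisym (ord X s))"

text \<open>Inclusion is compared separately because labels do not determine it: configurations that
  differ by conflicting events with equal labels can look alike to \<open>lab\<close> and
  \<open>ord\<close>.\<close>

definition ls_iso :: "('s, 'l) ls \<Rightarrow> ('t, 'l) ls \<Rightarrow> bool"  (infix "\<approx>" 50) where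
  "X \<approx> Y \<longleftrightarrow> Lbs X = Lbs Y \<and> (\<exists>\<phi>. bij_betw \<phi> (St X) (St Y) \<and>
     (\<forall>s\<in>St X. lab Y (\<phi> s) = lab X s \<and> ord Y (\<phi> s) = ord X s) \<and>
     (\<forall>s\<in>St X. \<forall>s'\<in>St X. Sle Y (\<phi> s) (\<phi> s') \<longleftrightarrow> Sle X s s'))"

text \<open>Matching is against the whole bound \<open>Lbs\<close>, so a shared label must occur on
  both sides or on neither. Antisymmetry of the closure is the securedness condition for
  interactions. \<open>trancl\<close> is enough because the orders of \<open>valid\<close>
  structures are reflexive on their labels already.\<close>

definition join :: "('s, 'l) ls \<Rightarrow> ('t, 'l) ls \<Rightarrow> ('s \<times> 't, 'l) ls"  (infixr "\<bowtie>" 65) where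
  "X \<bowtie> Y =
    \<lparr>St = {(x, y). x \<in> St X \<and> y \<in> St Y \<and> lab X x \<inter> Lbs Y = lab Y y \<inter> Lbs X \<and>
            antisym ((ord X x \<union> ord Y y)\<^sup>+)},
     Sle = (\<lambda>(x, y) (x', y'). Sle X x x' \<and> Sle Y y y'),
     Lbs = Lbs X \<union> Lbs Y,
     lab = (\<lambda>(x, y). lab X x \<union> lab Y y),
     ord = (\<lambda>(x, y). (ord X x \<union> ord Y y)\<^sup>+)\<rparr>"

text \<open>
  Keeping only the states whose hidden labels lie below visible ones selects, among the states
  with the same visible part, those without superfluous hidden moves.
\<close>

definition hide :: "'l set \<Rightarrow> ('s, 'l) ls \<Rightarrow> ('s, 'l) ls" where
  "hide H X =
    \<lparr>St = {x \<in> St X. \<forall>h\<in>lab X x \<inter> H. \<exists>l\<in>lab X x - H. (h, l) \<in> ord X x},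
     Sle = Sle X,
     Lbs = Lbs X - H,
     lab = (\<lambda>x. lab X x - H),
     ord = (\<lambda>x. ord X x \<inter> (- H) \<times> (- H))\<rparr>"

section \<open>Isomorphism of labelled state structures\<close>

lemma ls_isoI:
  assumes "Lbs X = Lbs Y"
    and "\<And>s. s \<in> St X \<Longrightarrow> f s \<in> St Y" and "\<And>t. t \<in> St Y \<Longrightarrow> g t \<in> St X"
    and "\<And>s. s \<in> St X \<Longrightarrow> g (f s) = s" and "\<And>t. t \<in> St Y \<Longrightarrow> f (g t) = t"
    and "\<And>s. s \<in> St X \<Longrightarrow> lab Y (f s) = lab X s"
    and "\<And>s. s \<in> St X \<Longrightarrow> ord Y (f s) = ord X s"
    and "\<And>s s'. s \<in> St X \<Longrightarrow> s' \<in> St X \<Longrightarrow> Sle X s s' \<Longrightarrow> Sle Y (f s) (f s')"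
    and "\<And>t t'. t \<in> St Y \<Longrightarrow> t' \<in> St Y \<Longrightarrow> Sle Y t t' \<Longrightarrow> Sle X (g t) (g t')"
  shows "X \<approx> Y"
  unfolding ls_iso_def
proof (intro conjI exI[of _ f])
  show "bij_betw f (St X) (St Y)"
    by (rule bij_betwI[of _ _ _ g]) (use assms in auto)
  show "\<forall>s\<in>St X. \<forall>s'\<in>St X. Sle Y (f s) (f s') \<longleftrightarrow> Sle X s s'"
  proof (intro ballI iffI)
    fix s s' assume s: "s \<in> St X" "s' \<in> St X" and "Sle Y (f s) (f s')"
    then have "Sle X (g (f s)) (g (f s'))" using assms(2,9) by blast
    then show "Sle X s s'" using s assms(4) by simp
  qed (use assms in auto)
qed (use assms in auto)

lemma ls_isoE:
  assumes "X \<approx> Y"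
  obtains f g where "Lbs X = Lbs Y"
    and "\<And>s. s \<in> St X \<Longrightarrow> f s \<in> St Y" and "\<And>t. t \<in> St Y \<Longrightarrow> g t \<in> St X"
    and "\<And>s. s \<in> St X \<Longrightarrow> g (f s) = s" and "\<And>t. t \<in> St Y \<Longrightarrow> f (g t) = t"
    and "\<And>s. s \<in> St X \<Longrightarrow> lab Y (f s) = lab X s"
    and "\<And>s. s \<in> St X \<Longrightarrow> ord Y (f s) = ord X s"
    and "\<And>t. t \<in> St Y \<Longrightarrow> lab X (g t) = lab Y t"
    and "\<And>t. t \<in> St Y \<Longrightarrow> ord X (g t) = ord Y t"
    and "\<And>s s'. s \<in> St X \<Longrightarrow> s' \<in> St X \<Longrightarrow> Sle X s s' \<Longrightarrow> Sle Y (f s) (f s')"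
    and "\<And>t t'. t \<in> St Y \<Longrightarrow> t' \<in> St Y \<Longrightarrow> Sle Y t t' \<Longrightarrow> Sle X (g t) (g t')"
proof -
  from assms obtain f where f: "bij_betw f (St X) (St Y)"
     "\<And>s. s \<in> St X \<Longrightarrow> lab Y (f s) = lab X s \<and> ord Y (f s) = ord X s"
     "\<And>s s'. s \<in> St X \<Longrightarrow> s' \<in> St X \<Longrightarrow> Sle Y (f s) (f s') \<longleftrightarrow> Sle X s s'"
    and L: "Lbs X = Lbs Y"
    unfolding ls_iso_def by blast
  let ?g = "inv_into (St X) f"
  have g: "t \<in> St Y \<Longrightarrow> ?g t \<in> St X" "t \<in> St Y \<Longrightarrow> f (?g t) = t" for t
    using f(1) by (auto simp: bij_betw_def inv_into_into f_inv_into_f)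
  have "Sle X (?g t) (?g t')" if "t \<in> St Y" "t' \<in> St Y" "Sle Y t t'" for t t'
    using f(3)[of "?g t" "?g t'"] that g by simp
  moreover have "s \<in> St X \<Longrightarrow> f s \<in> St Y" "s \<in> St X \<Longrightarrow> ?g (f s) = s" for s
    using f(1) by (auto simp: bij_betw_def)
  moreover have "lab X (?g t) = lab Y t" "ord X (?g t) = ord Y t" if "t \<in> St Y" for t
    using f(2)[of "?g t"] g that by auto
  ultimately show ?thesis using that[of f ?g] f L g by blast
qed

lemma ls_iso_refl [simp]: "X \<approx> X"
  by (rule ls_isoI[where f = id and g = id]) auto

lemma ls_iso_sym: "X \<approx> Y \<Longrightarrow> Y \<approx> X"
  apply (elim ls_isoE)
  subgoal for f g by (rule ls_isoI[where f = g and g = f]) auto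
  done

lemma ls_iso_trans [trans]:
  assumes "X \<approx> Y" "Y \<approx> Z" shows "X \<approx> Z"
  using assms
  apply (elim ls_isoE)
  subgoal for f g f' g' by (rule ls_isoI[where f = "f' \<circ> f" and g = "g \<circ> g'"]) auto
  done

lemma ls_iso_valid: "X \<approx> Y \<Longrightarrow> valid X \<Longrightarrow> valid Y"
  by (elim ls_isoE) (simp add: valid_def, metis)

section \<open>Algebra of synchronisation and hiding\<close>

lemma join_simps [simp]:
  "Lbs (X \<bowtie> Y) = Lbs X \<union> Lbs Y"
  "lab (X \<bowtie> Y) (x, y) = lab X x \<union> lab Y y"
  "ord (X \<bowtie> Y) (x, y) = (ord X x \<union> ord Y y)\<^sup>+"
  "Sle (X \<bowtie> Y) (x, y) (x', y') \<longleftrightarrow> Sle X x x' \<and> Sle Y y y'"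
  "(x, y) \<in> St (X \<bowtie> Y) \<longleftrightarrow> x \<in> St X \<and> y \<in> St Y \<and> lab X x \<inter> Lbs Y = lab Y y \<inter> Lbs X \<and>
            antisym ((ord X x \<union> ord Y y)\<^sup>+)"
  by (auto simp: join_def)

lemma hide_simps [simp]:
  "Lbs (hide H X) = Lbs X - H" "lab (hide H X) x = lab X x - H"
  "ord (hide H X) x = ord X x \<inter> (- H) \<times> (- H)" "Sle (hide H X) = Sle X"
  "x \<in> St (hide H X) \<longleftrightarrow> x \<in> St X \<and> (\<forall>h\<in>lab X x \<inter> H. \<exists>l\<in>lab X x - H. (h, l) \<in> ord X x)"
  by (auto simp: hide_def)

lemma hide_cong:
  assumes "X \<approx> Y" shows "hide H X \<approx> hide H Y"
  using assms
  apply (elim ls_isoE)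
  subgoal for f g by (rule ls_isoI[where f = f and g = g]) auto
  done

lemma join_cong_left:
  assumes "X \<approx> X'" shows "X \<bowtie> Y \<approx> X' \<bowtie> Y"
  using assms
  apply (elim ls_isoE)
  subgoal for f g
    by (rule ls_isoI[where f = "map_prod f id" and g = "map_prod g id"]) auto
  done

lemma join_comm: "X \<bowtie> Y \<approx> Y \<bowtie> X"
  by (rule ls_isoI[where f = "\<lambda>(x, y). (y, x)" and g = "\<lambda>(x, y). (y, x)"])
    (auto simp: Un_commute)

lemma join_cong:
  assumes "X \<approx> X'" "Y \<approx> Y'" shows "X \<bowtie> Y \<approx> X' \<bowtie> Y'"
proof -
  have "X \<bowtie> Y \<approx> X' \<bowtie> Y" by (rule join_cong_left[OF assms(1)])
  also have "\<dots> \<approx> Y \<bowtie> X'" by (rule join_comm)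
  also have "\<dots> \<approx> Y' \<bowtie> X'" by (rule join_cong_left[OF assms(2)])
  also have "\<dots> \<approx> X' \<bowtie> Y'" by (rule join_comm)
  finally show ?thesis .
qed

lemma trancl_Un_trancl: "(R\<^sup>+ \<union> S)\<^sup>+ = (R \<union> S)\<^sup>+"
proof
  have "R\<^sup>+ \<subseteq> (R \<union> S)\<^sup>+" by (rule trancl_mono_subset) auto
  then have "R\<^sup>+ \<union> S \<subseteq> (R \<union> S)\<^sup>+" by auto
  then have "(R\<^sup>+ \<union> S)\<^sup>+ \<subseteq> ((R \<union> S)\<^sup>+)\<^sup>+" by (rule trancl_mono_subset)
  then show "(R\<^sup>+ \<union> S)\<^sup>+ \<subseteq> (R \<union> S)\<^sup>+" by simp
qed (rule trancl_mono_subset, auto)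

lemma trancl_Un_trancl': "(S \<union> R\<^sup>+)\<^sup>+ = (S \<union> R)\<^sup>+"
  using trancl_Un_trancl[of R S] by (simp add: Un_commute)

lemma validD:
  assumes "valid X" "s \<in> St X"
  shows "lab X s \<subseteq> Lbs X" "ord X s \<subseteq> lab X s \<times> lab X s" "l \<in> lab X s \<Longrightarrow> (l, l) \<in> ord X s"
    "trans (ord X s)" "antisym (ord X s)"
  using assms by (auto simp: valid_def)

lemma valid_join [simp, intro]:
  assumes "valid X" "valid Y" shows "valid (X \<bowtie> Y)"
  unfolding valid_def
proof
  fix s assume "s \<in> St (X \<bowtie> Y)"
  then obtain x y where s: "s = (x, y)" and x: "x \<in> St X" and y: "y \<in> St Y"
    and a: "antisym ((ord X x \<union> ord Y y)\<^sup>+)"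
    by (cases s) auto
  note v = validD[OF assms(1) x] validD[OF assms(2) y]
  have "ord X x \<union> ord Y y \<subseteq> (lab X x \<union> lab Y y) \<times> (lab X x \<union> lab Y y)" using v by blast
  then have "(ord X x \<union> ord Y y)\<^sup>+ \<subseteq> (lab X x \<union> lab Y y) \<times> (lab X x \<union> lab Y y)"
    by (rule trancl_subset_Sigma)
  then show "lab (X \<bowtie> Y) s \<subseteq> Lbs (X \<bowtie> Y) \<and>
    ord (X \<bowtie> Y) s \<subseteq> lab (X \<bowtie> Y) s \<times> lab (X \<bowtie> Y) s \<and>
    (\<forall>l\<in>lab (X \<bowtie> Y) s. (l, l) \<in> ord (X \<bowtie> Y) s) \<and> trans (ord (X \<bowtie> Y) s) \<and> antisym (ord (X \<bowtie> Y) s)"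
    using v a s by (auto intro!: r_into_trancl)
qed

lemma valid_hide [simp, intro]:
  assumes "valid X" shows "valid (hide H X)"
  unfolding valid_def
proof
  fix s assume "s \<in> St (hide H X)"
  then have s: "s \<in> St X" by simp
  have "trans (ord X s \<inter> (- H) \<times> (- H))"
    using validD(4)[OF assms s] unfolding trans_def by blast
  moreover have "antisym (ord X s \<inter> (- H) \<times> (- H))"
    using validD(5)[OF assms s] unfolding antisym_def by blast
  ultimately show "lab (hide H X) s \<subseteq> Lbs (hide H X) \<and>
    ord (hide H X) s \<subseteq> lab (hide H X) s \<times> lab (hide H X) s \<and>
    (\<forall>l\<in>lab (hide H X) s. (l, l) \<in> ord (hide H X) s) \<and> trans (ord (hide H X) s) \<and>
    antisym (ord (hide H X) s)"
    using validD[OF assms s] by auto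
qed

text \<open>Either bracketing closes the union of the three orders, so acyclicity of the whole
  implies that of the inner pair. The two matching conditions agree because the labels of a state
  stay within \<open>Lbs\<close>.\<close>

lemma join_assoc:
  assumes "valid X" "valid Y" "valid Z"
  shows "(X \<bowtie> Y) \<bowtie> Z \<approx> X \<bowtie> (Y \<bowtie> Z)"
proof (rule ls_isoI[where f = "\<lambda>((x, y), z). (x, (y, z))" and g = "\<lambda>(x, (y, z)). ((x, y), z)"])
  have *: "((x, y), z) \<in> St ((X \<bowtie> Y) \<bowtie> Z) \<longleftrightarrow> (x, y, z) \<in> St (X \<bowtie> (Y \<bowtie> Z))" for x y z
  proof (cases "x \<in> St X \<and> y \<in> St Y \<and> z \<in> St Z")
    case True
    then have x: "x \<in> St X" and y: "y \<in> St Y" and z: "z \<in> St Z" by auto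
    note sub = validD(1)[OF assms(1) x] validD(1)[OF assms(2) y] validD(1)[OF assms(3) z]
    let ?T = "(ord X x \<union> ord Y y \<union> ord Z z)\<^sup>+"
    have T1: "((ord X x \<union> ord Y y)\<^sup>+ \<union> ord Z z)\<^sup>+ = ?T" by (rule trancl_Un_trancl)
    have T2: "(ord X x \<union> (ord Y y \<union> ord Z z)\<^sup>+)\<^sup>+ = ?T"
      by (simp add: trancl_Un_trancl' Un_assoc)
    have A: "antisym ((ord X x \<union> ord Y y)\<^sup>+)" "antisym ((ord Y y \<union> ord Z z)\<^sup>+)" if "antisym ?T"
      by (rule antisym_subset[OF _ that], rule trancl_mono_subset, blast)+
    have B: "(lab X x \<inter> Lbs Y = lab Y y \<inter> Lbs X \<and> (lab X x \<union> lab Y y) \<inter> Lbs Z = lab Z z \<inter> (Lbs X \<union> Lbs Y))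
      \<longleftrightarrow> (lab Y y \<inter> Lbs Z = lab Z z \<inter> Lbs Y \<and> lab X x \<inter> (Lbs Y \<union> Lbs Z) = (lab Y y \<union> lab Z z) \<inter> Lbs X)"
      using sub by blast
    show ?thesis
      using A B x y z by (simp only: join_simps T1 T2) blast
  qed auto
  show "\<And>s. s \<in> St ((X \<bowtie> Y) \<bowtie> Z) \<Longrightarrow> (\<lambda>((x, y), z). (x, (y, z))) s \<in> St (X \<bowtie> Y \<bowtie> Z)"
    using * by (simp only: split_paired_all prod.case)
  show "\<And>t. t \<in> St (X \<bowtie> Y \<bowtie> Z) \<Longrightarrow> (\<lambda>(x, (y, z)). ((x, y), z)) t \<in> St ((X \<bowtie> Y) \<bowtie> Z)"
    using * by (simp only: split_paired_all prod.case)
qed (auto simp: trancl_Un_trancl trancl_Un_trancl' Un_assoc)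

lemma join_medial:
  assumes "valid X" "valid Y" "valid Z" "valid W"
  shows "(X \<bowtie> Y) \<bowtie> (Z \<bowtie> W) \<approx> (X \<bowtie> Z) \<bowtie> (Y \<bowtie> W)"
proof -
  note [intro] = assms
  have "(X \<bowtie> Y) \<bowtie> (Z \<bowtie> W) \<approx> X \<bowtie> (Y \<bowtie> (Z \<bowtie> W))" by (rule join_assoc) auto
  also have "\<dots> \<approx> X \<bowtie> ((Y \<bowtie> Z) \<bowtie> W)"
    by (intro join_cong ls_iso_refl ls_iso_sym[OF join_assoc]) auto
  also have "\<dots> \<approx> X \<bowtie> ((Z \<bowtie> Y) \<bowtie> W)" by (intro join_cong ls_iso_refl join_comm)
  also have "\<dots> \<approx> X \<bowtie> (Z \<bowtie> (Y \<bowtie> W))" by (intro join_cong ls_iso_refl join_assoc) auto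
  also have "\<dots> \<approx> (X \<bowtie> Z) \<bowtie> (Y \<bowtie> W)" by (rule ls_iso_sym[OF join_assoc]) auto
  finally show ?thesis .
qed

text \<open>As \<open>S\<close> avoids \<open>H\<close>, a path meets \<open>H\<close> only inside
  runs of \<open>R\<close>-steps, and transitivity merges each run into one step. Hence labels of
  \<open>H\<close> survive only as endpoints, and everything between \<open>l1\<close> and
  \<open>l2\<close> is visible.\<close>

lemma trancl_avoid:
  assumes R: "trans R" "\<And>a b. (a, b) \<in> R \<Longrightarrow> (a, a) \<in> R \<and> (b, b) \<in> R"
    and S: "\<And>a b. (a, b) \<in> S \<Longrightarrow> a \<notin> H \<and> b \<notin> H"
    and ab: "(a, b) \<in> (R \<union> S)\<^sup>+"
  shows "(a, b) \<in> R \<or> (\<exists>l1 l2. l1 \<notin> H \<and> l2 \<notin> H \<and> (a, l1) \<in> R\<^sup>= \<and>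
    (l1, l2) \<in> (R \<inter> (-H) \<times> (-H) \<union> S)\<^sup>* \<and> (l2, b) \<in> R\<^sup>=)"
  using ab
proof (induction rule: trancl_induct)
  case (base b)
  then show ?case using S by blast
next
  case (step b c)
  let ?Q = "R \<inter> (-H) \<times> (-H) \<union> S"
  from step.hyps(2) show ?case
  proof
    assume bc: "(b, c) \<in> R"
    then show ?case using step.IH R(1) by (blast dest: transD)
  next
    assume bc: "(b, c) \<in> S"
    then have n: "b \<notin> H" "c \<notin> H" using S by auto
    from step.IH show ?case
    proof (elim disjE exE conjE)
      assume "(a, b) \<in> R" then show ?case using n bc by blast
    next
      fix l1 l2 assume l: "l1 \<notin> H" "l2 \<notin> H" "(a, l1) \<in> R\<^sup>=" "(l1, l2) \<in> ?Q\<^sup>*" "(l2, b) \<in> R\<^sup>="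
      have "(l2, b) \<in> ?Q\<^sup>*" using l n by auto
      then have "(l1, c) \<in> ?Q\<^sup>*" using l(4) bc by (meson UnI2 r_into_rtrancl rtrancl_trans)
      then show ?case using l n by blast
    qed
  qed
qed

text \<open>\<open>H\<close> is private to \<open>X\<close>, so \<open>Y\<close> interacts only with
  what hiding leaves visible. The hiding conditions agree because a path from a hidden label to a
  visible one begins with a step of \<open>ord X x\<close> that already leaves \<open>H\<close>. The
  hard direction is acyclicity: comparing orders after hiding must also exclude cycles that run
  through \<open>H\<close>.\<close>

lemma hide_join:
  assumes X: "valid X" and Y: "valid Y" and H: "H \<inter> Lbs Y = {}"
  shows "hide H (X \<bowtie> Y) \<approx> hide H X \<bowtie> Y"
proof (rule ls_isoI[where f = id and g = id])
  have main: "((x, y) \<in> St (hide H (X \<bowtie> Y)) \<longleftrightarrow> (x, y) \<in> St (hide H X \<bowtie> Y)) \<and>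
      ord (hide H X \<bowtie> Y) (x, y) = ord (hide H (X \<bowtie> Y)) (x, y)"
    if x: "x \<in> St X" and y: "y \<in> St Y" for x y
  proof -
    note vx = validD[OF X x] and vy = validD[OF Y y]
    let ?R = "ord X x" and ?S = "ord Y y"
    let ?R' = "?R \<inter> (-H) \<times> (-H)"
    have Rr: "\<And>a b. (a, b) \<in> ?R \<Longrightarrow> (a, a) \<in> ?R \<and> (b, b) \<in> ?R" using vx by blast
    have Ss: "\<And>a b. (a, b) \<in> ?S \<Longrightarrow> a \<notin> H \<and> b \<notin> H" using vy H by blast
    have av: "(a, b) \<in> ?R \<or> (\<exists>l1 l2. l1 \<notin> H \<and> l2 \<notin> H \<and> (a, l1) \<in> ?R\<^sup>= \<and>
        (l1, l2) \<in> (?R' \<union> ?S)\<^sup>* \<and> (l2, b) \<in> ?R\<^sup>=)" if "(a, b) \<in> (?R \<union> ?S)\<^sup>+" for a b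
      by (rule trancl_avoid[OF vx(4) Rr Ss that])
    have sub: "(?R' \<union> ?S)\<^sup>+ \<subseteq> (?R \<union> ?S)\<^sup>+" by (rule trancl_mono_subset) auto
    have subH: "(?R' \<union> ?S)\<^sup>+ \<subseteq> (-H) \<times> (-H)"
      by (rule trancl_subset_Sigma) (use Ss in auto)
    have o: "(?R' \<union> ?S)\<^sup>+ = (?R \<union> ?S)\<^sup>+ \<inter> (-H) \<times> (-H)" (is "?A = ?B")
    proof
      show "?B \<subseteq> ?A"
      proof clarify
        fix a b assume ab: "(a, b) \<in> (?R \<union> ?S)\<^sup>+" "a \<notin> H" "b \<notin> H"
        have F: "(c, d) \<in> ?R\<^sup>= \<Longrightarrow> c \<notin> H \<Longrightarrow> d \<notin> H \<Longrightarrow> (c, d) \<in> (?R' \<union> ?S)\<^sup>*" for c d by auto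
        have "(a, a) \<in> ?R' \<union> ?S"
        proof -
          from ab(1) have "\<exists>c. (a, c) \<in> ?R \<union> ?S" by (meson tranclD)
          then show ?thesis using vx vy ab(2) by blast
        qed
        moreover have "(a, b) \<in> (?R' \<union> ?S)\<^sup>*"
          using av[OF ab(1)]
        proof (elim disjE exE conjE)
          assume "(a, b) \<in> ?R" then show ?thesis using F ab by blast
        next
          fix l1 l2 assume "l1 \<notin> H" "l2 \<notin> H" "(a, l1) \<in> ?R\<^sup>=" "(l1, l2) \<in> (?R' \<union> ?S)\<^sup>*" "(l2, b) \<in> ?R\<^sup>="
          then show ?thesis using F[of a l1] F[of l2 b] ab by (meson rtrancl_trans)
        qed
        ultimately show "(a, b) \<in> ?A" by (meson rtrancl_into_trancl2)
      qed
    qed (use sub subH in auto)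
    let ?U = "(?R \<union> ?S)\<^sup>+"
    \<comment> \<open>\<open>?S\<close> avoids \<open>H\<close>, so a path leaves or enters \<open>H\<close> by a single step of \<open>?R\<close>.\<close>
    have out: "(a, b) \<in> ?R \<or> (\<exists>l. l \<notin> H \<and> (a, l) \<in> ?R \<and> (l, b) \<in> ?U)" if ab: "(a, b) \<in> ?U" "a \<in> H" for a b
      using av[OF ab(1)]
    proof (elim disjE exE conjE)
      fix l1 l2 assume l: "l1 \<notin> H" "l2 \<notin> H" "(a, l1) \<in> ?R\<^sup>=" "(l1, l2) \<in> (?R' \<union> ?S)\<^sup>*" "(l2, b) \<in> ?R\<^sup>="
      have al: "(a, l1) \<in> ?R" using l ab(2) by auto
      have "(l1, l1) \<in> ?U" using Rr[OF al] by blast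
      moreover have "(l1, l2) \<in> ?U\<^sup>=" using l(4) sub by (auto simp: rtrancl_eq_or_trancl)
      moreover have "(l2, b) \<in> ?U\<^sup>=" using l(5) by auto
      ultimately have "(l1, b) \<in> ?U" by (auto intro: trancl_trans)
      then show ?thesis using l(1) al by blast
    qed blast
    have into: "(a, b) \<in> ?R \<or> (\<exists>l. l \<notin> H \<and> (l, b) \<in> ?R \<and> (a, l) \<in> ?U)" if ab: "(a, b) \<in> ?U" "b \<in> H" for a b
      using av[OF ab(1)]
    proof (elim disjE exE conjE)
      fix l1 l2 assume l: "l1 \<notin> H" "l2 \<notin> H" "(a, l1) \<in> ?R\<^sup>=" "(l1, l2) \<in> (?R' \<union> ?S)\<^sup>*" "(l2, b) \<in> ?R\<^sup>="
      have lb: "(l2, b) \<in> ?R" using l ab(2) by auto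
      have "(l2, l2) \<in> ?U" using Rr[OF lb] by blast
      moreover have "(l1, l2) \<in> ?U\<^sup>=" using l(4) sub by (auto simp: rtrancl_eq_or_trancl)
      moreover have "(a, l1) \<in> ?U\<^sup>=" using l(3) by auto
      ultimately have "(a, l2) \<in> ?U" by (auto intro: trancl_trans)
      then show ?thesis using l(2) lb by blast
    qed blast
    \<comment> \<open>A cycle meeting both \<open>H\<close> and its complement is shortened to a
      visible one (\<open>h1\<close>). A cycle through \<open>H\<close> then stays inside the single
      order \<open>?R\<close> (\<open>h2\<close>), which is antisymmetric.\<close>
    have anti: "antisym ?U" if a: "antisym ((?R' \<union> ?S)\<^sup>+)"
    proof -
      have h1: False if hk: "h \<in> H" "l \<notin> H" "(h, l) \<in> ?U" "(l, h) \<in> ?U" for h l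
      proof -
        have ll: "(l, l) \<in> ?U" using hk(3,4) by (meson trancl_trans)
        \<comment> \<open>\<open>m1\<close> is a visible label right after \<open>h\<close> on the
          cycle and \<open>m2\<close> one right before it. Both are linked to \<open>h\<close> by
          \<open>?R\<close>, so transitivity of \<open>?R\<close> closes a visible cycle through
          them; this forces \<open>m1 = m2\<close>, hence \<open>h = m1\<close>, although
          \<open>h\<close> is hidden.\<close>
        obtain m1 where m1: "m1 \<notin> H" "(h, m1) \<in> ?R" "(m1, l) \<in> ?U" using out[OF hk(3,1)] hk(2) ll by blast
        obtain m2 where m2: "m2 \<notin> H" "(m2, h) \<in> ?R" "(l, m2) \<in> ?U" using into[OF hk(4,1)] hk(2) ll by blast
        have "(m1, m2) \<in> ?U" using m1 m2 by (meson trancl_trans)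
        then have "(m1, m2) \<in> (?R' \<union> ?S)\<^sup>+" using o m1 m2 by auto
        moreover have "(m2, m1) \<in> ?R" using m1 m2 vx(4) by (meson transD)
        then have "(m2, m1) \<in> (?R' \<union> ?S)\<^sup>+" using m1 m2 by auto
        ultimately have "m1 = m2" by (rule antisymD[OF a])
        then have "h = m1" using m1 m2 antisymD[OF vx(5), of h m1] by simp
        then show False using hk m1 by simp
      qed
      have h2: "(h, k) \<in> ?R" if hk: "(h, k) \<in> ?U" "(k, h) \<in> ?U" "h \<in> H" for h k
      proof -
        have False if l: "l \<notin> H" "(h, l) \<in> ?R" "(l, k) \<in> ?U" for l
        proof -
          have "(l, h) \<in> ?U" using l(3) hk(2) by (rule trancl_trans)
          moreover have "(h, l) \<in> ?U" using l(2) by blast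
          ultimately show False using h1[OF hk(3) l(1)] by simp
        qed
        then show ?thesis using out[OF hk(1,3)] by blast
      qed
      show ?thesis
      proof (rule antisymI)
        fix h k assume hk: "(h, k) \<in> ?U" "(k, h) \<in> ?U"
        consider "h \<notin> H" "k \<notin> H" | "h \<in> H" "k \<in> H" | "h \<in> H" "k \<notin> H" | "h \<notin> H" "k \<in> H" by blast
        then show "h = k"
        proof cases
          case 1
          then have "(h, k) \<in> (?R' \<union> ?S)\<^sup>+" "(k, h) \<in> (?R' \<union> ?S)\<^sup>+" using hk unfolding o by simp_all
          then show ?thesis by (rule antisymD[OF a])
        next
          case 2
          show ?thesis by (rule antisymD[OF vx(5) h2[OF hk 2(1)] h2[OF hk(2,1) 2(2)]])
        next
          case 3 then show ?thesis using h1[of h k] hk by simp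
        next
          case 4 then show ?thesis using h1[of k h] hk by simp
        qed
      qed
    qed
    have hid: "(\<exists>l\<in>(lab X x \<union> lab Y y) - H. (h, l) \<in> (?R \<union> ?S)\<^sup>+) \<longleftrightarrow> (\<exists>l\<in>lab X x - H. (h, l) \<in> ?R)"
      if h: "h \<in> lab X x \<inter> H" for h
    proof
      assume "\<exists>l\<in>(lab X x \<union> lab Y y) - H. (h, l) \<in> (?R \<union> ?S)\<^sup>+"
      then obtain l where l: "l \<notin> H" "(h, l) \<in> (?R \<union> ?S)\<^sup>+" by blast
      from av[OF l(2)] show "\<exists>l\<in>lab X x - H. (h, l) \<in> ?R"
        using l(1) h vx(2) by blast
    qed (use vx in blast)
    have labs: "lab Y y \<inter> H = {}" using vy H by blast
    have m: "(lab X x - H) \<inter> Lbs Y = lab Y y \<inter> (Lbs X - H) \<longleftrightarrow> lab X x \<inter> Lbs Y = lab Y y \<inter> Lbs X"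
      using vy vx H by blast
    have hid2: "(\<forall>h\<in>(lab X x \<union> lab Y y) \<inter> H. \<exists>l\<in>(lab X x \<union> lab Y y) - H. (h, l) \<in> (?R \<union> ?S)\<^sup>+)
       \<longleftrightarrow> (\<forall>h\<in>lab X x \<inter> H. \<exists>l\<in>lab X x - H. (h, l) \<in> ?R)"
      using labs hid by blast
    have anti2: "antisym ((?R \<union> ?S)\<^sup>+) \<longleftrightarrow> antisym ((?R' \<union> ?S)\<^sup>+)"
      using anti antisym_subset[OF sub] by blast
    show ?thesis
      using x y by (simp only: join_simps hide_simps hid2 anti2 m o simp_thms) blast
  qed
  have st: "s \<in> St (hide H (X \<bowtie> Y)) \<longleftrightarrow> s \<in> St (hide H X \<bowtie> Y)" for s
  proof (cases s)
    case (Pair x y)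
    show ?thesis
    proof (cases "x \<in> St X \<and> y \<in> St Y")
      case True
      then show ?thesis unfolding Pair using main by blast
    qed (auto simp: Pair)
  qed
  then show "s \<in> St (hide H (X \<bowtie> Y)) \<Longrightarrow> id s \<in> St (hide H X \<bowtie> Y)"
      "s \<in> St (hide H X \<bowtie> Y) \<Longrightarrow> id s \<in> St (hide H (X \<bowtie> Y))" for s by auto
  show "ord (hide H X \<bowtie> Y) (id s) = ord (hide H (X \<bowtie> Y)) s" if "s \<in> St (hide H (X \<bowtie> Y))" for s
  proof (cases s)
    case (Pair x y)
    then have "x \<in> St X" "y \<in> St Y" using that by auto
    then show ?thesis unfolding Pair id_apply using main by blast
  qed
  show "lab (hide H X \<bowtie> Y) (id s) = lab (hide H (X \<bowtie> Y)) s" if "s \<in> St (hide H (X \<bowtie> Y))" for s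
    using that H validD(1)[OF Y] by (cases s) auto
qed (use H in auto)

lemma hide_join_right:
  assumes X: "valid X" and Y: "valid Y" and H: "H \<inter> Lbs X = {}"
  shows "hide H (X \<bowtie> Y) \<approx> X \<bowtie> hide H Y"
proof -
  have "hide H (X \<bowtie> Y) \<approx> hide H (Y \<bowtie> X)" by (rule hide_cong[OF join_comm])
  also have "\<dots> \<approx> hide H Y \<bowtie> X" by (rule hide_join[OF Y X H])
  also have "\<dots> \<approx> X \<bowtie> hide H Y" by (rule join_comm)
  finally show ?thesis .
qed

text \<open>A label of \<open>K\<close> lies below some label outside \<open>K\<close>; should that
  one be in \<open>H\<close>, one further step leaves both sets.\<close>

lemma hide_hide:
  assumes X: "valid X"
  shows "hide H (hide K X) \<approx> hide (H \<union> K) X"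
proof (rule ls_isoI[where f = id and g = id])
  have "x \<in> St (hide H (hide K X)) \<longleftrightarrow> x \<in> St (hide (H \<union> K) X)" for x
  proof (cases "x \<in> St X")
    case True
    note v = validD[OF X True]
    show ?thesis
    proof
      assume "x \<in> St (hide H (hide K X))"
      then have K: "\<And>h. h \<in> lab X x \<Longrightarrow> h \<in> K \<Longrightarrow> \<exists>l\<in>lab X x - K. (h, l) \<in> ord X x"
        and H: "\<And>h. h \<in> lab X x \<Longrightarrow> h \<notin> K \<Longrightarrow> h \<in> H \<Longrightarrow> \<exists>l\<in>lab X x - K - H. (h, l) \<in> ord X x"
        by fastforce+
      have "\<exists>l\<in>lab X x - (H \<union> K). (h, l) \<in> ord X x" if hx: "h \<in> lab X x" "h \<in> H \<union> K" for h
      proof (cases "h \<in> K")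
        case True
        then obtain l where l: "l \<in> lab X x" "l \<notin> K" "(h, l) \<in> ord X x" using K hx(1) by blast
        show ?thesis
        proof (cases "l \<in> H")
          case True
          then obtain l' where "l' \<in> lab X x - K - H" "(l, l') \<in> ord X x" using H l by blast
          then show ?thesis using l(3) v(4) by (blast dest: transD)
        qed (use l in blast)
      qed (use H hx in blast)
      then show "x \<in> St (hide (H \<union> K) X)" using True by auto
    qed (use True in fastforce)
  qed auto
  then show "s \<in> St (hide H (hide K X)) \<Longrightarrow> id s \<in> St (hide (H \<union> K) X)"
    "s \<in> St (hide (H \<union> K) X) \<Longrightarrow> id s \<in> St (hide H (hide K X))" for s by auto
qed auto

text \<open>Relations on disjoint label sets cannot compose, so their union is already transitive
  and antisymmetric, and there is nothing to match.\<close>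

lemma join_disjoint:
  assumes X: "valid X" and Y: "valid Y" and dis: "Lbs X \<inter> Lbs Y = {}" and x: "x \<in> St X" and y: "y \<in> St Y"
  shows "(x, y) \<in> St (X \<bowtie> Y)" "ord (X \<bowtie> Y) (x, y) = ord X x \<union> ord Y y"
proof -
  note l = validD(1)[OF X x] validD(1)[OF Y y]
  have vx: "ord X x \<subseteq> Lbs X \<times> Lbs X" "trans (ord X x)" "antisym (ord X x)"
    and vy: "ord Y y \<subseteq> Lbs Y \<times> Lbs Y" "trans (ord Y y)" "antisym (ord Y y)"
    using validD(2,4,5)[OF X x] validD(2,4,5)[OF Y y] l by blast+
  have "trans (ord X x \<union> ord Y y)" using vx(1,2) vy(1,2) dis unfolding trans_def by blast
  then have t: "(ord X x \<union> ord Y y)\<^sup>+ = ord X x \<union> ord Y y" by simp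
  have "antisym (ord X x \<union> ord Y y)" using vx(1,3) vy(1,3) dis unfolding antisym_def by blast
  moreover have "lab X x \<inter> Lbs Y = lab Y y \<inter> Lbs X" using l dis by blast
  ultimately show "(x, y) \<in> St (X \<bowtie> Y)" "ord (X \<bowtie> Y) (x, y) = ord X x \<union> ord Y y"
    unfolding join_simps t using x y by simp_all
qed

text \<open>\<open>k y\<close> is the part of \<open>y\<close> that \<open>X\<close> can see. It is
  the only partner of \<open>y\<close>, and its order is already contained in that of
  \<open>y\<close>, so joining with \<open>X\<close> adds nothing. The case of interest is a game
  joined with a pre-strategy that plays on it.\<close>

lemma join_absorb:
  assumes X: "valid X" and Y: "valid Y" and L: "Lbs X \<subseteq> Lbs Y"
    and k: "\<And>y. y \<in> St Y \<Longrightarrow> k y \<in> St X \<and> lab X (k y) = lab Y y \<inter> Lbs X \<and> ord X (k y) \<subseteq> ord Y y"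
    and uniq: "\<And>x y. x \<in> St X \<Longrightarrow> y \<in> St Y \<Longrightarrow> lab X x = lab Y y \<inter> Lbs X \<Longrightarrow> x = k y"
    and mono: "\<And>y y'. y \<in> St Y \<Longrightarrow> y' \<in> St Y \<Longrightarrow> Sle Y y y' \<Longrightarrow> Sle X (k y) (k y')"
  shows "X \<bowtie> Y \<approx> Y"
proof -
  have o: "(ord X (k y) \<union> ord Y y)\<^sup>+ = ord Y y" if "y \<in> St Y" for y
  proof -
    have "ord X (k y) \<union> ord Y y = ord Y y" using k[OF that] by blast
    then show ?thesis using validD(4)[OF Y that] by simp
  qed
  have kx: "x = k y" if "(x, y) \<in> St (X \<bowtie> Y)" for x y
    using that validD(1)[OF X, of x] L by (intro uniq) auto
  show ?thesis
  proof (rule ls_isoI[where f = snd and g = "\<lambda>y. (k y, y)"])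
    show "t \<in> St Y \<Longrightarrow> (k t, t) \<in> St (X \<bowtie> Y)" for t
      using k[of t] o[of t] validD(5)[OF Y, of t] L validD(1)[OF X, of "k t"] by auto
    show "lab Y (snd s) = lab (X \<bowtie> Y) s" if "s \<in> St (X \<bowtie> Y)" for s
      using that kx[of "fst s" "snd s"] k[of "snd s"] by (cases s) auto
    show "ord Y (snd s) = ord (X \<bowtie> Y) s" if "s \<in> St (X \<bowtie> Y)" for s
      using that kx[of "fst s" "snd s"] o[of "snd s"] by (cases s) auto
    show "(k (snd s), snd s) = s" if "s \<in> St (X \<bowtie> Y)" for s
      using that kx[of "fst s" "snd s"] by (cases s) auto
  qed (use L mono in auto)
qed

text \<open>\<open>L\<close> is a parameter and not the image of the events under \<open>f\<close>:
  synchronisation must also forbid a partner from playing shared moves that this structure never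
  plays.\<close>

definition LS :: "'l set \<Rightarrow> ('e, 'z) es_scheme \<Rightarrow> ('e \<Rightarrow> 'l) \<Rightarrow> ('e set, 'l) ls" where
  "LS L S f = \<lparr>St = configs S, Sle = (\<subseteq>), Lbs = L, lab = (\<lambda>x. f ` x),
     ord = (\<lambda>x. {(f s, f s') | s s'. s \<in> x \<and> s' \<in> x \<and> (s, s') \<in> Le S})\<rparr>"

lemma LS_simps [simp]:
  "St (LS L S f) = configs S" "Sle (LS L S f) x y \<longleftrightarrow> x \<subseteq> y" "Lbs (LS L S f) = L"
  "lab (LS L S f) x = f ` x"
  "ord (LS L S f) x = {(f s, f s') | s s'. s \<in> x \<and> s' \<in> x \<and> (s, s') \<in> Le S}"
  by (auto simp: LS_def)

lemma event_structureI:
  assumes "partial_order_on (Ev E) (Le E)" "{} \<in> Con E"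
    and "\<And>X. X \<in> Con E \<Longrightarrow> finite X \<and> X \<subseteq> Ev E"
    and "\<And>e. e \<in> Ev E \<Longrightarrow> finite {e'. (e', e) \<in> Le E}"
    and "\<And>e. e \<in> Ev E \<Longrightarrow> {e} \<in> Con E"
    and "\<And>X Y. X \<in> Con E \<Longrightarrow> Y \<subseteq> X \<Longrightarrow> Y \<in> Con E"
    and "\<And>X e e'. X \<in> Con E \<Longrightarrow> e \<in> X \<Longrightarrow> (e', e) \<in> Le E \<Longrightarrow> X \<union> {e'} \<in> Con E"
  shows "event_structure E"
  unfolding event_structure_def
  apply (intro conjI ballI allI impI)
  subgoal by (rule assms(1))
  subgoal using assms(2) by blast
  subgoal for X using assms(3)[of X] by simp
  subgoal for X using assms(3)[of X] by simp
  subgoal by (rule assms(4))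
  subgoal by (rule assms(5))
  subgoal by (rule assms(6))
  subgoal by (rule assms(7))
  done

section \<open>Event structures\<close>

locale es =
  fixes E :: "('e, 'z) es_scheme"
  assumes event_structure: "event_structure E"
begin

lemma Le_refl: "e \<in> Ev E \<Longrightarrow> (e, e) \<in> Le E"
  and Le_trans: "(a, b) \<in> Le E \<Longrightarrow> (b, c) \<in> Le E \<Longrightarrow> (a, c) \<in> Le E"
  and Le_antisym: "(a, b) \<in> Le E \<Longrightarrow> (b, a) \<in> Le E \<Longrightarrow> a = b"
  and Le_Ev: "(a, b) \<in> Le E \<Longrightarrow> a \<in> Ev E \<and> b \<in> Ev E"
  using event_structure unfolding event_structure_def order_on_defs
  by (auto dest: refl_onD transD antisymD)

lemma Con_empty: "{} \<in> Con E"
  and Con_Ev: "X \<in> Con E \<Longrightarrow> X \<subseteq> Ev E"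
  and Con_finite: "X \<in> Con E \<Longrightarrow> finite X"
  and Con_singleton: "e \<in> Ev E \<Longrightarrow> {e} \<in> Con E"
  and Con_subset: "X \<in> Con E \<Longrightarrow> Y \<subseteq> X \<Longrightarrow> Y \<in> Con E"
  and Con_insert: "X \<in> Con E \<Longrightarrow> e \<in> X \<Longrightarrow> (e', e) \<in> Le E \<Longrightarrow> insert e' X \<in> Con E"
  and finite_below: "e \<in> Ev E \<Longrightarrow> finite {e'. (e', e) \<in> Le E}"
  using event_structure unfolding event_structure_def by auto

lemma configsD: "x \<in> configs E \<Longrightarrow> x \<subseteq> Ev E"
  "x \<in> configs E \<Longrightarrow> x \<in> Con E"
  "x \<in> configs E \<Longrightarrow> finite x"
  "x \<in> configs E \<Longrightarrow> e \<in> x \<Longrightarrow> (e', e) \<in> Le E \<Longrightarrow> e' \<in> x"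
  using Con_Ev by (auto simp: configs_def)

lemma configsI: "x \<in> Con E \<Longrightarrow> (\<And>e e'. e \<in> x \<Longrightarrow> (e', e) \<in> Le E \<Longrightarrow> e' \<in> x) \<Longrightarrow> x \<in> configs E"
  using Con_finite by (auto simp: configs_def)

lemma configs_subset:
  assumes "x \<in> configs E" "y \<subseteq> x" "\<And>e e'. e \<in> y \<Longrightarrow> (e', e) \<in> Le E \<Longrightarrow> e' \<in> y"
  shows "y \<in> configs E"
  by (rule configsI) (use assms Con_subset configsD in blast)+

lemma empty_config: "{} \<in> configs E"
  by (auto intro: configsI Con_empty)

definition below :: "'e \<Rightarrow> 'e set" where
  "below e = {e'. (e', e) \<in> Le E}"

lemma below_config:
  assumes "e \<in> Ev E" shows "below e \<in> configs E"
proof (rule configsI)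
  \<comment> \<open>\<open>e\<close> stays in the set throughout, so the axiom that adds a cause of
    a member applies once for each element of the finite set \<open>below e\<close>.\<close>
  have "insert e F \<in> Con E" if "finite F" "F \<subseteq> below e" for F
    using that
  proof (induction F)
    case (insert a F)
    then have "insert e F \<in> Con E" "(a, e) \<in> Le E" by (auto simp: below_def)
    then have "insert a (insert e F) \<in> Con E" by (rule Con_insert[OF _ insertI1])
    then show ?case by (simp add: insert_commute)
  qed (use assms Con_singleton in simp)
  from this[of "below e"] show "below e \<in> Con E"
    using finite_below assms Le_refl by (auto simp: below_def insert_absorb)
qed (auto simp: below_def intro: Le_trans)

lemma below_self: "e \<in> Ev E \<Longrightarrow> e \<in> below e"
  by (simp add: below_def Le_refl)

lemma below_subset: "x \<in> configs E \<Longrightarrow> e \<in> x \<Longrightarrow> below e \<subseteq> x"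
  by (auto simp: below_def configsD)

lemma below_subset_iff: "a \<in> Ev E \<Longrightarrow> b \<in> Ev E \<Longrightarrow> below a \<subseteq> below b \<longleftrightarrow> (a, b) \<in> Le E"
  by (auto simp: below_def intro: Le_trans Le_refl)

lemma valid_LS:
  assumes "f ` Ev E \<subseteq> L" and inj: "\<And>x. x \<in> configs E \<Longrightarrow> inj_on f x"
  shows "valid (LS L E f)"
  unfolding valid_def
proof
  fix x assume "x \<in> St (LS L E f)"
  then have x: "x \<in> configs E" by simp
  then have xE: "x \<subseteq> Ev E" by (rule configsD)
  have i: "f a = f b \<Longrightarrow> a \<in> x \<Longrightarrow> b \<in> x \<Longrightarrow> a = b" for a b using inj[OF x] by (auto dest: inj_onD)
  have "trans (ord (LS L E f) x)"
    by (rule transI) (auto, metis i Le_trans)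
  moreover have "antisym (ord (LS L E f) x)"
    by (rule antisymI) (auto, metis i Le_antisym)
  ultimately show "lab (LS L E f) x \<subseteq> Lbs (LS L E f) \<and>
         ord (LS L E f) x \<subseteq> lab (LS L E f) x \<times> lab (LS L E f) x \<and>
         (\<forall>l\<in>lab (LS L E f) x. (l, l) \<in> ord (LS L E f) x) \<and>
         trans (ord (LS L E f) x) \<and> antisym (ord (LS L E f) x)"
    using xE assms(1) Le_refl by auto blast
qed

end

lemma LS_cong:
  assumes "es S" "\<And>e. e \<in> Ev S \<Longrightarrow> f e = g e"
  shows "LS L S f \<approx> LS L S g"
proof (rule ls_isoI[where f = id and g = id])
  fix x assume "x \<in> St (LS L S f)"
  then have "x \<subseteq> Ev S" using es.configsD(1)[OF assms(1)] by auto
  then have e: "e \<in> x \<Longrightarrow> f e = g e" for e using assms(2) by blast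
  show "lab (LS L S g) (id x) = lab (LS L S f) x" using e by (auto intro!: image_eqI)
  show "ord (LS L S g) (id x) = ord (LS L S f) x" using e by (auto) metis+
qed auto

text \<open>Events are recovered as the prime configurations, those of the form \<open>below e\<close>.\<close>

lemma LS_iso_transfer:
  assumes S: "es S" and T: "es T"
    and injS: "\<And>x. x \<in> configs S \<Longrightarrow> inj_on f x" and injT: "\<And>x. x \<in> configs T \<Longrightarrow> inj_on g x"
    and lab: "\<And>x. x \<in> configs S \<Longrightarrow> \<Phi> x \<in> configs T \<and> g ` \<Phi> x = f ` x \<and>
       ord (LS L T g) (\<Phi> x) = ord (LS L S f) x"
    and s: "s \<in> Ev S"
  obtains t where "t \<in> Ev T" "g t = f s" "\<Phi> (es.below S s) = es.below T t"
proof -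
  interpret S: es S by fact
  interpret T: es T by fact
  let ?y = "\<Phi> (S.below s)"
  have y: "?y \<in> configs T" "g ` ?y = f ` S.below s" 
    and o: "ord (LS L T g) ?y = ord (LS L S f) (S.below s)"
    using lab S.below_config[OF s] by auto
  obtain t where t: "t \<in> ?y" "g t = f s" using y(2) S.below_self[OF s] by (metis image_iff)
  have tE: "t \<in> Ev T" using t(1) y(1) T.configsD by blast
  have i: "g a = g b \<Longrightarrow> a \<in> ?y \<Longrightarrow> b \<in> ?y \<Longrightarrow> a = b" for a b
    using injT[OF y(1)] by (auto dest: inj_onD)
  \<comment> \<open>The transported order makes the label of \<open>s\<close> the greatest one of
    the image, and injectivity on \<open>?y\<close> turns this into causality below
    \<open>t\<close>.\<close>
  have "(u, t) \<in> Le T" if u: "u \<in> ?y" for u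
  proof -
    have "g u \<in> f ` S.below s" using y u by blast
    then obtain r where r: "r \<in> S.below s" "g u = f r" by blast
    have "(f r, f s) \<in> ord (LS L S f) (S.below s)"
      using r S.below_self[OF s] by (auto simp: S.below_def)
    then have "(g u, g t) \<in> ord (LS L T g) ?y" using o r t by simp
    then obtain a b where ab: "a \<in> ?y" "b \<in> ?y" "(a, b) \<in> Le T" "g u = g a" "g t = g b" by auto
    then have "u = a" "t = b" using i u t(1) by blast+
    then show ?thesis using ab by simp
  qed
  then have "?y = T.below t" using T.below_subset[OF y(1) t(1)] by (auto simp: T.below_def)
  then show ?thesis using that tE t by blast
qed

text \<open>Primes go to primes, which yields maps on events. That \<open>\<phi>\<close> acts on a
  configuration as \<open>\<Phi>\<close> does needs monotonicity in both directions, through the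
  fact that an event lies in a configuration iff its prime is included in it.\<close>

lemma LS_iso_imp:
  assumes S: "es S" and T: "es T"
    and injS: "\<And>x. x \<in> configs S \<Longrightarrow> inj_on f x" and injT: "\<And>x. x \<in> configs T \<Longrightarrow> inj_on g x"
    and iso: "LS L S f \<approx> LS L T g"
  obtains \<phi> \<psi> where "\<And>s. s \<in> Ev S \<Longrightarrow> \<phi> s \<in> Ev T \<and> g (\<phi> s) = f s \<and> \<psi> (\<phi> s) = s"
    and "\<And>t. t \<in> Ev T \<Longrightarrow> \<psi> t \<in> Ev S \<and> f (\<psi> t) = g t \<and> \<phi> (\<psi> t) = t"
    and "\<And>x. x \<in> configs S \<Longrightarrow> \<phi> ` x \<in> configs T" and "\<And>y. y \<in> configs T \<Longrightarrow> \<psi> ` y \<in> configs S"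
proof -
  interpret S: es S by fact
  interpret T: es T by fact
  from iso obtain \<Phi> \<Psi> where 
    F: "\<And>x. x \<in> configs S \<Longrightarrow> \<Phi> x \<in> configs T \<and> g ` \<Phi> x = f ` x \<and>
       ord (LS L T g) (\<Phi> x) = ord (LS L S f) x"
    and G: "\<And>x. x \<in> configs T \<Longrightarrow> \<Psi> x \<in> configs S \<and> f ` \<Psi> x = g ` x \<and>
       ord (LS L S f) (\<Psi> x) = ord (LS L T g) x"
    and GF: "\<And>x. x \<in> configs S \<Longrightarrow> \<Psi> (\<Phi> x) = x" and FG: "\<And>x. x \<in> configs T \<Longrightarrow> \<Phi> (\<Psi> x) = x"
    and Fm: "\<And>x x'. x \<in> configs S \<Longrightarrow> x' \<in> configs S \<Longrightarrow> x \<subseteq> x' \<Longrightarrow> \<Phi> x \<subseteq> \<Phi> x'"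
    and Gm: "\<And>x x'. x \<in> configs T \<Longrightarrow> x' \<in> configs T \<Longrightarrow> x \<subseteq> x' \<Longrightarrow> \<Psi> x \<subseteq> \<Psi> x'"
    apply (elim ls_isoE)
    subgoal premises p for F G
      by (rule p(1)[of F G]) (use p(2-) in \<open>simp_all del: LS_simps(5)\<close>)
    done
  have "\<exists>\<phi>. \<forall>s\<in>Ev S. \<phi> s \<in> Ev T \<and> g (\<phi> s) = f s \<and> \<Phi> (S.below s) = T.below (\<phi> s)"
  proof (intro bchoice ballI)
    fix s assume s: "s \<in> Ev S"
    show "\<exists>t. t \<in> Ev T \<and> g t = f s \<and> \<Phi> (S.below s) = T.below t"
      by (rule LS_iso_transfer[of S T f g \<Phi> L s, OF S T injS injT F s]) blast+
  qed
  then obtain \<phi> where phi: "\<And>s. s \<in> Ev S \<Longrightarrow> \<phi> s \<in> Ev T \<and> g (\<phi> s) = f s \<and> \<Phi> (S.below s) = T.below (\<phi> s)"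
    by blast
  have "\<exists>\<psi>. \<forall>t\<in>Ev T. \<psi> t \<in> Ev S \<and> f (\<psi> t) = g t \<and> \<Psi> (T.below t) = S.below (\<psi> t)"
  proof (intro bchoice ballI)
    fix s assume s: "s \<in> Ev T"
    show "\<exists>t. t \<in> Ev S \<and> f t = g s \<and> \<Psi> (T.below s) = S.below t"
      by (rule LS_iso_transfer[of T S g f \<Psi> L s, OF T S injT injS G s]) blast+
  qed
  then obtain \<psi> where psi: "\<And>t. t \<in> Ev T \<Longrightarrow> \<psi> t \<in> Ev S \<and> f (\<psi> t) = g t \<and> \<Psi> (T.below t) = S.below (\<psi> t)"
    by blast
  have bS: "a = b" if "a \<in> Ev S" "b \<in> Ev S" "S.below a = S.below b" for a b
    using that S.below_subset_iff S.Le_antisym by (metis subset_refl)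
  have bT: "a = b" if "a \<in> Ev T" "b \<in> Ev T" "T.below a = T.below b" for a b
    using that T.below_subset_iff T.Le_antisym by (metis subset_refl)
  have 1: "\<psi> (\<phi> s) = s" if "s \<in> Ev S" for s
    by (rule bS) (use that phi psi GF S.below_config in metis)+
  have 2: "\<phi> (\<psi> s) = s" if "s \<in> Ev T" for s
    by (rule bT) (use that phi psi FG T.below_config in metis)+
  have 3: "\<phi> ` x = \<Phi> x" if x: "x \<in> configs S" for x
  proof (intro equalityI subsetI)
    fix t assume "t \<in> \<phi> ` x"
    then obtain s where s: "s \<in> x" "t = \<phi> s" by blast
    then have sE: "s \<in> Ev S" using x S.configsD by blast
    have "T.below t \<subseteq> \<Phi> x"
      using Fm[OF S.below_config[OF sE] x S.below_subset[OF x s(1)]] phi[OF sE] s by simp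
    then show "t \<in> \<Phi> x" using T.below_self phi[OF sE] s by blast
  next
    fix t assume t: "t \<in> \<Phi> x"
    have Fx: "\<Phi> x \<in> configs T" using F[OF x] by simp
    then have tE: "t \<in> Ev T" using t T.configsD by blast
    have "S.below (\<psi> t) \<subseteq> x"
      using Gm[OF T.below_config[OF tE] Fx T.below_subset[OF Fx t]] psi[OF tE] GF[OF x] by simp
    then have "\<psi> t \<in> x" using S.below_self psi[OF tE] by blast
    then show "t \<in> \<phi> ` x" using 2[OF tE] by (metis imageI)
  qed
  have 4: "\<psi> ` y = \<Psi> y" if y: "y \<in> configs T" for y
  proof -
    have "y = \<phi> ` \<Psi> y" using 3 G[OF y] FG[OF y] by simp
    then have "\<psi> ` y = (\<lambda>s. \<psi> (\<phi> s)) ` \<Psi> y" by (metis image_image)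
    also have "\<dots> = id ` \<Psi> y"
      by (rule image_cong) (use 1 G[OF y] S.configsD(1)[of "\<Psi> y"] in auto)
    finally show ?thesis by simp
  qed
  show ?thesis
    by (rule that[of \<phi> \<psi>]) (use phi psi 1 2 3 4 F G in auto)
qed

text \<open>Preservation of configurations suffices to preserve causality, since
  \<open>below s\<close> is the least configuration containing \<open>s\<close>.\<close>

lemma LS_iso_of_bij:
  assumes S: "es S" and T: "es T"
    and \<phi>: "\<And>s. s \<in> Ev S \<Longrightarrow> \<phi> s \<in> Ev T \<and> \<psi> (\<phi> s) = s \<and> g (\<phi> s) = f s"
    and \<psi>: "\<And>t. t \<in> Ev T \<Longrightarrow> \<psi> t \<in> Ev S \<and> \<phi> (\<psi> t) = t"
    and c\<phi>: "\<And>x. x \<in> configs S \<Longrightarrow> \<phi> ` x \<in> configs T" and c\<psi>: "\<And>y. y \<in> configs T \<Longrightarrow> \<psi> ` y \<in> configs S"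
  shows "LS L S f \<approx> LS L T g"
proof -
  interpret S: es S by fact
  interpret T: es T by fact
  have img1: "\<psi> ` \<phi> ` x = x" if "x \<subseteq> Ev S" for x using that \<phi> by (force simp: image_iff)
  have img2: "\<phi> ` \<psi> ` x = x" if "x \<subseteq> Ev T" for x using that \<psi> by (force simp: image_iff)
  have bel: "T.below (\<phi> s) \<subseteq> \<phi> ` S.below s" if s: "s \<in> Ev S" for s
    by (rule T.below_subset) (use c\<phi> S.below_config S.below_self s in auto)
  have bel': "S.below (\<psi> t) \<subseteq> \<psi> ` T.below t" if t: "t \<in> Ev T" for t
    by (rule S.below_subset) (use c\<psi> T.below_config T.below_self t in auto)
  have le: "(\<phi> a, \<phi> b) \<in> Le T \<longleftrightarrow> (a, b) \<in> Le S" if "a \<in> Ev S" "b \<in> Ev S" for a b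
  proof
    assume "(\<phi> a, \<phi> b) \<in> Le T"
    then have "\<phi> a \<in> \<phi> ` S.below b" using bel[OF that(2)] by (auto simp: T.below_def)
    then obtain c where "c \<in> S.below b" "\<phi> a = \<phi> c" by blast
    moreover then have "c \<in> Ev S" using S.Le_Ev by (auto simp: S.below_def)
    ultimately show "(a, b) \<in> Le S" using \<phi> that by (metis S.below_def mem_Collect_eq)
  next
    assume ab: "(a, b) \<in> Le S"
    have "a \<in> S.below (\<psi> (\<phi> b))" using ab \<phi> that by (simp add: S.below_def)
    then have "a \<in> \<psi> ` T.below (\<phi> b)" using bel'[of "\<phi> b"] \<phi> that by blast
    then obtain c where c: "c \<in> T.below (\<phi> b)" "a = \<psi> c" by blast
    moreover then have "c \<in> Ev T" using T.Le_Ev by (auto simp: T.below_def)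
    ultimately show "(\<phi> a, \<phi> b) \<in> Le T" using \<psi> by (simp add: T.below_def)
  qed
  show ?thesis
  proof (rule ls_isoI[where f = "image \<phi>" and g = "image \<psi>"])
    fix x assume "x \<in> St (LS L S f)"
    then have x: "x \<in> configs S" by simp
    then have xE: "x \<subseteq> Ev S" by (rule S.configsD)
    show "\<phi> ` x \<in> St (LS L T g)" using c\<phi> x by simp
    show "\<psi> ` \<phi> ` x = x" using img1 xE .
    show "lab (LS L T g) (\<phi> ` x) = lab (LS L S f) x"
      using xE \<phi> by (simp add: image_image) (meson image_cong subsetD)
    show "ord (LS L T g) (\<phi> ` x) = ord (LS L S f) x"
    proof (intro equalityI subrelI)
      fix u v assume "(u, v) \<in> ord (LS L T g) (\<phi> ` x)"
      then obtain s s' where s: "s \<in> x" "s' \<in> x" "(\<phi> s, \<phi> s') \<in> Le T" "u = g (\<phi> s)" "v = g (\<phi> s')" by auto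
      then have "(s, s') \<in> Le S" "u = f s" "v = f s'" using le \<phi> xE by blast+
      then show "(u, v) \<in> ord (LS L S f) x" using s by auto
    next
      fix u v assume "(u, v) \<in> ord (LS L S f) x"
      then obtain s s' where s: "s \<in> x" "s' \<in> x" "(s, s') \<in> Le S" "u = f s" "v = f s'" by auto
      then have "(\<phi> s, \<phi> s') \<in> Le T" "u = g (\<phi> s)" "v = g (\<phi> s')" using le \<phi> xE by auto
      then show "(u, v) \<in> ord (LS L T g) (\<phi> ` x)" using s by auto
    qed
  qed (use c\<psi> img2 T.configsD in auto)
qed

section \<open>Parallel composition\<close>

definition inl :: "'a ev set \<Rightarrow> 'a ev set" where "inl x = {a. Tag False a \<in> x}"
definition inr :: "'a ev set \<Rightarrow> 'a ev set" where "inr x = {a. Tag True a \<in> x}"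

abbreviation duo :: "'a ev set \<Rightarrow> 'a ev set \<Rightarrow> 'a ev set" where
  "duo x y \<equiv> Tag False ` x \<union> Tag True ` y"

lemma inl_duo [simp]: "inl (duo x y) = x" and inr_duo [simp]: "inr (duo x y) = y"
  by (auto simp: inl_def inr_def)

lemma par_simps [simp]:
  "Ev (A \<parallel> B) = duo (Ev A) (Ev B)"
  "(Tag False a, Tag False b) \<in> Le (A \<parallel> B) \<longleftrightarrow> (a, b) \<in> Le A"
  "(Tag True a, Tag True b) \<in> Le (A \<parallel> B) \<longleftrightarrow> (a, b) \<in> Le B"
  "(Tag True a, Tag False b) \<notin> Le (A \<parallel> B)"
  "(Tag False a, Tag True b) \<notin> Le (A \<parallel> B)"
  "Z \<in> Con (A \<parallel> B) \<longleftrightarrow> (\<exists>X Y. Z = duo X Y \<and> X \<in> Con A \<and> Y \<in> Con B)"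
  "a \<in> Ev A \<Longrightarrow> pol (A \<parallel> B) (Tag False a) = pol A a"
  "b \<in> Ev B \<Longrightarrow> pol (A \<parallel> B) (Tag True b) = pol B b"
  by (auto simp: par_def)

lemma Le_par: "(u, v) \<in> Le (A \<parallel> B) \<longleftrightarrow>
   (\<exists>a b. u = Tag False a \<and> v = Tag False b \<and> (a, b) \<in> Le A) \<or>
   (\<exists>a b. u = Tag True a \<and> v = Tag True b \<and> (a, b) \<in> Le B)"
  by (auto simp: par_def)

lemma duo_eq_iff [simp]: "duo x y = duo x' y' \<longleftrightarrow> x = x' \<and> y = y'"
  by (metis inl_duo inr_duo)

lemma duo_subset_iff [simp]: "duo x y \<subseteq> duo x' y' \<longleftrightarrow> x \<subseteq> x' \<and> y \<subseteq> y'"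
  by auto

lemma duo_split: "x \<subseteq> duo X Y \<Longrightarrow> x = duo (inl x) (inr x)"
  by (auto simp: inl_def inr_def)

lemma Con_parI: "X \<in> Con A \<Longrightarrow> Y \<in> Con B \<Longrightarrow> duo X Y \<in> Con (A \<parallel> B)"
  by simp

lemma es_par:
  assumes "es A" "es B" shows "es (A \<parallel> B)"
proof (rule es.intro, rule event_structureI)
  interpret A: es A by fact
  interpret B: es B by fact
  show "partial_order_on (Ev (A \<parallel> B)) (Le (A \<parallel> B))"
    unfolding order_on_defs
  proof (intro conjI)
    show "Le (A \<parallel> B) \<subseteq> Ev (A \<parallel> B) \<times> Ev (A \<parallel> B)"
      using A.Le_Ev B.Le_Ev by (auto simp: Le_par)
    show "antisym (Le (A \<parallel> B))"
      by (rule antisymI) (auto simp: Le_par intro: A.Le_antisym B.Le_antisym)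
    show "trans (Le (A \<parallel> B))"
      by (rule transI) (auto simp: Le_par intro: A.Le_trans B.Le_trans)
    show "refl_on (Ev (A \<parallel> B)) (Le (A \<parallel> B))"
      by (rule refl_onI) (auto simp: Le_par intro: A.Le_refl B.Le_refl)
  qed
  show "finite {e'. (e', e) \<in> Le (A \<parallel> B)}" if e: "e \<in> Ev (A \<parallel> B)" for e
  proof (cases "e \<in> Tag False ` Ev A")
    case True
    then obtain a where "a \<in> Ev A" "e = Tag False a" by blast
    then show ?thesis using A.finite_below[of a] by (auto simp: Le_par intro: finite_subset[of _ "Tag False ` {e'. (e', a) \<in> Le A}"])
  next
    case False
    then obtain a where "a \<in> Ev B" "e = Tag True a" using e by auto
    then show ?thesis using B.finite_below[of a] by (auto simp: Le_par intro: finite_subset[of _ "Tag True ` {e'. (e', a) \<in> Le B}"])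
  qed
  show "Y \<in> Con (A \<parallel> B)" if "X \<in> Con (A \<parallel> B)" "Y \<subseteq> X" for X Y
  proof -
    from that(1) obtain P Q where P: "X = duo P Q" "P \<in> Con A" "Q \<in> Con B" by auto
    have "inl Y \<subseteq> P" "inr Y \<subseteq> Q" using that(2) P by (auto simp: inl_def inr_def)
    then have "inl Y \<in> Con A" "inr Y \<in> Con B" using P A.Con_subset B.Con_subset by auto
    then have "duo (inl Y) (inr Y) \<in> Con (A \<parallel> B)" by (rule Con_parI)
    moreover have "Y = duo (inl Y) (inr Y)" by (rule duo_split) (use that P in blast)
    ultimately show ?thesis by (simp only:)
  qed
  show "X \<union> {e'} \<in> Con (A \<parallel> B)" if X: "X \<in> Con (A \<parallel> B)" "e \<in> X" "(e', e) \<in> Le (A \<parallel> B)" for X e e'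
  proof -
    from that(1) obtain P Q where P: "X = duo P Q" "P \<in> Con A" "Q \<in> Con B" by auto
    from X(3) show ?thesis unfolding Le_par
    proof (elim disjE exE conjE)
      fix a b assume ab: "e' = Tag False a" "e = Tag False b" "(a, b) \<in> Le A"
      then have "insert a P \<in> Con A" using P X A.Con_insert by auto
      moreover have "X \<union> {e'} = duo (insert a P) Q" using P ab by auto
      ultimately show ?thesis using Con_parI[OF _ P(3)] by (simp only:)
    next
      fix a b assume ab: "e' = Tag True a" "e = Tag True b" "(a, b) \<in> Le B"
      then have "insert a Q \<in> Con B" using P X B.Con_insert by auto
      moreover have "X \<union> {e'} = duo P (insert a Q)" using P ab by auto
      ultimately show ?thesis using Con_parI[OF P(2)] by (simp only:)
    qed
  qed
  show "{e} \<in> Con (A \<parallel> B)" if "e \<in> Ev (A \<parallel> B)" for e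
  proof -
    from that consider a where "e = Tag False a" "a \<in> Ev A" | b where "e = Tag True b" "b \<in> Ev B" by auto
    then show ?thesis
    proof cases
      case 1
      then have "{e} = duo {a} {}" by simp
      then show ?thesis using Con_parI[OF A.Con_singleton[OF 1(2)] B.Con_empty] by (simp only:)
    next
      case 2
      then have "{e} = duo {} {b}" by simp
      then show ?thesis using Con_parI[OF A.Con_empty B.Con_singleton[OF 2(2)]] by (simp only:)
    qed
  qed
  show "{} \<in> Con (A \<parallel> B)" using Con_parI[OF A.Con_empty B.Con_empty] by simp
  show "finite X \<and> X \<subseteq> Ev (A \<parallel> B)" if "X \<in> Con (A \<parallel> B)" for X
  proof -
    from that obtain P Q where P: "X = duo P Q" "P \<in> Con A" "Q \<in> Con B" by auto
    have "finite X" using P A.Con_finite[OF P(2)] B.Con_finite[OF P(3)] by simp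
    moreover have "X \<subseteq> Ev (A \<parallel> B)"
      unfolding P(1) par_simps by (intro Un_mono image_mono A.Con_Ev B.Con_Ev P)
    ultimately show ?thesis by blast
  qed
qed

lemma configs_par:
  assumes "es A" "es B"
  shows "configs (A \<parallel> B) = {duo x y | x y. x \<in> configs A \<and> y \<in> configs B}"
proof -
  interpret A: es A by fact
  interpret B: es B by fact
  interpret AB: es "A \<parallel> B" by (rule es_par) fact+
  have 1: "duo x y \<in> configs (A \<parallel> B) \<longleftrightarrow> x \<in> configs A \<and> y \<in> configs B" for x y
  proof
    assume c: "duo x y \<in> configs (A \<parallel> B)"
    show "x \<in> configs A \<and> y \<in> configs B"
    proof
      show "x \<in> configs A"
        by (rule A.configsI) (use AB.configsD(2)[OF c] AB.configsD(4)[OF c, of "Tag False _" "Tag False _"] in auto)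
      show "y \<in> configs B"
        by (rule B.configsI) (use AB.configsD(2)[OF c] AB.configsD(4)[OF c, of "Tag True _" "Tag True _"] in auto)
    qed
  next
    assume c: "x \<in> configs A \<and> y \<in> configs B"
    show "duo x y \<in> configs (A \<parallel> B)"
      by (rule AB.configsI) (use c A.configsD B.configsD in \<open>auto simp: Le_par\<close>)
  qed
  have 2: "x = duo (inl x) (inr x)" if "x \<in> configs (A \<parallel> B)" for x
    by (rule duo_split) (use AB.configsD(1)[OF that] in simp)
  show ?thesis
  proof (intro equalityI subsetI)
    fix x assume x: "x \<in> configs (A \<parallel> B)"
    then have "inl x \<in> configs A \<and> inr x \<in> configs B" using 1[of "inl x" "inr x"] 2[OF x] by (simp only:)
    then show "x \<in> {duo x y | x y. x \<in> configs A \<and> y \<in> configs B}" using 2[OF x] by blast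
  next
    fix z assume "z \<in> {duo x y | x y. x \<in> configs A \<and> y \<in> configs B}"
    then obtain x y where "z = duo x y" "x \<in> configs A \<and> y \<in> configs B" by blast
    then show "z \<in> configs (A \<parallel> B)" using 1[of x y] by (simp only:)
  qed
qed

text \<open>With disjoint label bounds nothing is shared, so the join merely puts the two orders
  side by side.\<close>

lemma LS_par:
  assumes A: "es A" and B: "es B" and N: "N = L \<union> M" and LM: "L \<inter> M = {}"
    and f: "(\<lambda>a. f (Tag False a)) ` Ev A \<subseteq> L" "(\<lambda>a. f (Tag True a)) ` Ev B \<subseteq> M"
    and inj: "\<And>x. x \<in> configs (A \<parallel> B) \<Longrightarrow> inj_on f x"
  shows "LS N (A \<parallel> B) f \<approx> LS L A (\<lambda>a. f (Tag False a)) \<bowtie> LS M B (\<lambda>a. f (Tag True a))"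
    (is "_ \<approx> ?X \<bowtie> ?Y")
proof (rule ls_isoI[where f = "\<lambda>x. (inl x, inr x)" and g = "\<lambda>(x, y). duo x y"])
  interpret A: es A by fact
  interpret B: es B by fact
  have injA: "inj_on (\<lambda>a. f (Tag False a)) x" if "x \<in> configs A" for x
    using inj[of "duo x {}"] that B.empty_config configs_par[OF A B] by (auto simp: inj_on_def)
  have injB: "inj_on (\<lambda>a. f (Tag True a)) x" if "x \<in> configs B" for x
    using inj[of "duo {} x"] that A.empty_config configs_par[OF A B] by (auto simp: inj_on_def)
  have vX: "valid ?X" by (rule A.valid_LS) (use f injA in auto)
  have vY: "valid ?Y" by (rule B.valid_LS) (use f injB in auto)
  have *: "(x, y) \<in> St (?X \<bowtie> ?Y) \<and> ord (?X \<bowtie> ?Y) (x, y) = ord (LS N (A \<parallel> B) f) (duo x y)"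
    if x: "x \<in> configs A" and y: "y \<in> configs B" for x y
  proof -
    have "x \<in> St ?X" "y \<in> St ?Y" "Lbs ?X \<inter> Lbs ?Y = {}" using x y LM by simp_all
    note J = join_disjoint[OF vX vY this(3,1,2)]
    have "ord (LS N (A \<parallel> B) f) (duo x y) = ord ?X x \<union> ord ?Y y"
      by (auto simp: Le_par) blast+
    then show ?thesis unfolding J(2) using J(1) by simp
  qed
  show "s \<in> St (LS N (A \<parallel> B) f) \<Longrightarrow> (inl s, inr s) \<in> St (?X \<bowtie> ?Y)"
    and "s \<in> St (LS N (A \<parallel> B) f) \<Longrightarrow> ord (?X \<bowtie> ?Y) (inl s, inr s) = ord (LS N (A \<parallel> B) f) s" for s
    using * by (auto simp: configs_par[OF A B] simp del: join_simps LS_simps(5))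
  show "t \<in> St (?X \<bowtie> ?Y) \<Longrightarrow> (case t of (x, y) \<Rightarrow> duo x y) \<in> St (LS N (A \<parallel> B) f)" for t
    by (cases t) (auto simp: configs_par[OF A B])
  show "Sle (?X \<bowtie> ?Y) (inl s, inr s) (inl s', inr s')" if "Sle (LS N (A \<parallel> B) f) s s'" for s s'
    using that by (auto simp: inl_def inr_def)
  show "Sle (LS N (A \<parallel> B) f) (case t of (x, y) \<Rightarrow> duo x y) (case t' of (x, y) \<Rightarrow> duo x y)"
    if "Sle (?X \<bowtie> ?Y) t t'" for t t'
    using that by (cases t; cases t') auto
qed (use N in \<open>auto simp: configs_par[OF A B] image_Un image_image\<close>)

section \<open>Configurations of an interaction\<close>

text \<open>\<open>L\<^sub>0\<close> is the common set of moves and \<open>g\<close> an injective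
  naming of it. The naming is left free so that the same results serve both with the identity and
  with names chosen for synchronising and hiding.\<close>

locale meet = S: es S + T: es T
  for S :: "('a ev, 'y) es_scheme" and T :: "('a ev, 'z) es_scheme" +
  fixes \<sigma> \<tau> :: "'a ev \<Rightarrow> 'a ev" and g :: "'a ev \<Rightarrow> 'l" and L\<^sub>0 :: "'a ev set"
  assumes inj_\<sigma>: "x \<in> configs S \<Longrightarrow> inj_on \<sigma> x" and inj_\<tau>: "y \<in> configs T \<Longrightarrow> inj_on \<tau> y"
    and \<sigma>_L: "\<sigma> ` Ev S \<subseteq> L\<^sub>0" and \<tau>_L: "\<tau> ` Ev T \<subseteq> L\<^sub>0" and inj_g: "inj_on g L\<^sub>0"
begin

abbreviation "B \<equiv> secured_bijections S \<sigma> T \<tau>"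
abbreviation "go \<equiv> graph_order (Le S) (Le T)"
abbreviation "gs \<equiv> graph_step (Le S) (Le T)"
abbreviation "LX \<equiv> LS (g ` L\<^sub>0) S (\<lambda>s. g (\<sigma> s))"
abbreviation "LY \<equiv> LS (g ` L\<^sub>0) T (\<lambda>t. g (\<tau> t))"

lemma gs_iff: "((a, b), (a', b')) \<in> gs q \<longleftrightarrow> (a, b) \<in> q \<and> (a', b') \<in> q \<and>
        ((a, a') \<in> Le S \<and> a \<noteq> a' \<or> (b, b') \<in> Le T \<and> b \<noteq> b')"
  by (simp add: graph_step_def)

lemma gs_sub: "gs q \<subseteq> q \<times> q"
  by (auto simp: graph_step_def)

lemma go_refl: "p \<in> q \<Longrightarrow> (p, p) \<in> go q"
  by (simp add: graph_order_def)

lemma go_sub: "(p, p') \<in> go q \<Longrightarrow> p \<in> q \<and> p' \<in> q"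
  by (simp add: graph_order_def)

lemma go_trans: "(p, p') \<in> go q \<Longrightarrow> (p', p'') \<in> go q \<Longrightarrow> (p, p'') \<in> go q"
  by (auto simp: graph_order_def)

lemma gs_go: "(p, p') \<in> gs q \<Longrightarrow> (p, p') \<in> go q"
  using gs_sub by (auto simp: graph_order_def)

lemma secured_iff: "secured (Le S) (Le T) q \<longleftrightarrow> antisym (go q)"
proof -
  have "refl_on q (go q)" "trans (go q)" "go q \<subseteq> q \<times> q"
    by (auto intro!: refl_onI transI simp: go_refl intro: go_trans dest: go_sub)
  then show ?thesis by (simp add: secured_def order_on_defs)
qed

lemma induced_graph_D:
  assumes "\<sigma> ` x = \<tau> ` y"
  shows "fst ` induced_graph \<sigma> \<tau> x y = x" "snd ` induced_graph \<sigma> \<tau> x y = y"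
proof -
  have "\<exists>t\<in>y. \<sigma> s = \<tau> t" if "s \<in> x" for s using assms that by (metis image_iff)
  then show "fst ` induced_graph \<sigma> \<tau> x y = x" by (force simp: induced_graph_def)
  have "\<exists>s\<in>x. \<sigma> s = \<tau> t" if "t \<in> y" for t using assms that by (metis image_iff)
  then show "snd ` induced_graph \<sigma> \<tau> x y = y" by (force simp: induced_graph_def)
qed

lemma induced_graph_self:
  assumes y: "snd ` q \<in> configs T" and eq: "\<And>s t. (s, t) \<in> q \<Longrightarrow> \<sigma> s = \<tau> t"
  shows "induced_graph \<sigma> \<tau> (fst ` q) (snd ` q) = q"
proof (intro equalityI subsetI)
  fix p assume "p \<in> induced_graph \<sigma> \<tau> (fst ` q) (snd ` q)"
  then obtain s t s' t' where p: "p = (s, t)" "(s, t') \<in> q" "(s', t) \<in> q" "\<sigma> s = \<tau> t"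
    by (auto simp: induced_graph_def)
  then have "\<tau> t' = \<tau> t" "t \<in> snd ` q" "t' \<in> snd ` q" using eq by force+
  then have "t' = t" using inj_onD[OF inj_\<tau>[OF y]] by simp
  then show "p \<in> q" using p by simp
qed (use eq in \<open>force simp: induced_graph_def\<close>)

text \<open>A secured bijection is determined by its graph, whose projections are the two
  configurations. In this form membership can be checked for subsets and unions of graphs without
  first producing the configurations.\<close>

lemma B_iff: "q \<in> B \<longleftrightarrow> fst ` q \<in> configs S \<and> snd ` q \<in> configs T \<and> (\<forall>s t. (s, t) \<in> q \<longrightarrow> \<sigma> s = \<tau> t) \<and>
    antisym (go q)"
proof
  assume "q \<in> B"
  then obtain x y where q: "q = induced_graph \<sigma> \<tau> x y" and x: "x \<in> configs S" and y: "y \<in> configs T"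
    and xy: "\<sigma> ` x = \<tau> ` y" and a: "antisym (go q)"
    unfolding secured_bijections_def secured_iff by blast
  have "fst ` q = x" "snd ` q = y" unfolding q by (rule induced_graph_D[OF xy])+
  then show "fst ` q \<in> configs S \<and> snd ` q \<in> configs T \<and> (\<forall>s t. (s, t) \<in> q \<longrightarrow> \<sigma> s = \<tau> t) \<and> antisym (go q)"
    using x y a by (auto simp: q induced_graph_def)
next
  assume *: "fst ` q \<in> configs S \<and> snd ` q \<in> configs T \<and> (\<forall>s t. (s, t) \<in> q \<longrightarrow> \<sigma> s = \<tau> t) \<and> antisym (go q)"
  have "induced_graph \<sigma> \<tau> (fst ` q) (snd ` q) = q" by (rule induced_graph_self) (use * in blast)+
  moreover have "\<sigma> ` fst ` q = \<tau> ` snd ` q" using * by force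
  ultimately show "q \<in> B" unfolding secured_bijections_def secured_iff using * by (metis (mono_tags, lifting) mem_Collect_eq)
qed

lemma B_D:
  assumes "q \<in> B"
  shows "fst ` q \<in> configs S" "snd ` q \<in> configs T" "(s, t) \<in> q \<Longrightarrow> \<sigma> s = \<tau> t" "antisym (go q)"
  using assms unfolding B_iff by blast+

lemma B_fun:
  assumes q: "q \<in> B" "(s, t) \<in> q" "(s, t') \<in> q" shows "t = t'"
proof (rule inj_onD[OF inj_\<tau>[OF B_D(2)[OF q(1)]]])
  show "\<tau> t = \<tau> t'" using B_D(3)[OF q(1) q(2)] B_D(3)[OF q(1) q(3)] by simp
qed (use q in force)+

lemma B_inj:
  assumes q: "q \<in> B" "(s, t) \<in> q" "(s', t) \<in> q" shows "s = s'"
proof (rule inj_onD[OF inj_\<sigma>[OF B_D(1)[OF q(1)]]])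
  show "\<sigma> s = \<sigma> s'" using B_D(3)[OF q(1) q(2)] B_D(3)[OF q(1) q(3)] by simp
qed (use q in force)+

lemma B_finite: "q \<in> B \<Longrightarrow> finite q"
  by (rule finite_subset[OF subset_fst_snd], rule finite_SigmaI)
    (use S.configsD(3) T.configsD(3) B_D in blast)+

text \<open>A subset closed under predecessors contains every path that ends in it, so its own order
  is the induced one and stays acyclic. Its projections are down-closed because a strict causal step
  in either factor is a step of the graph.\<close>

lemma B_down:
  assumes q: "q \<in> B" and d: "d \<subseteq> q" and dc: "\<And>p p'. p \<in> d \<Longrightarrow> (p', p) \<in> gs q \<Longrightarrow> p' \<in> d"
  shows "d \<in> B" "go d = go q \<inter> d \<times> d"
proof -
  have st: "(p', p) \<in> gs d" if "(p', p) \<in> gs q" "p \<in> d" for p p'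
    using that dc[OF that(2,1)] by (cases p; cases p') (auto simp: gs_iff)
  have "(p', p) \<in> (gs d)\<^sup>* \<and> p' \<in> d" if "(p', p) \<in> (gs q)\<^sup>*" "p \<in> d" for p p'
    using that
  proof (induction rule: converse_rtrancl_induct)
    case (step a b)
    then have "(a, b) \<in> gs d" using st by simp
    then show ?case using step gs_sub by (meson converse_rtrancl_into_rtrancl mem_Sigma_iff subsetD)
  qed simp
  moreover have "(gs d)\<^sup>* \<subseteq> (gs q)\<^sup>*" by (rule rtrancl_mono) (use d in \<open>auto simp: graph_step_def\<close>)
  ultimately show go: "go d = go q \<inter> d \<times> d" unfolding graph_order_def using d by blast
  have q': "fst ` q \<in> configs S" "snd ` q \<in> configs T" "\<And>s t. (s, t) \<in> q \<Longrightarrow> \<sigma> s = \<tau> t" "antisym (go q)"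
    using q B_iff by auto
  have "fst ` d \<in> configs S"
  proof (rule S.configs_subset[OF q'(1)])
    fix s s' assume "s \<in> fst ` d" and s: "(s', s) \<in> Le S"
    then obtain t where t: "(s, t) \<in> d" by force
    then have "s' \<in> fst ` q" using S.configsD(4)[OF q'(1) _ s] d by force
    then obtain t' where t': "(s', t') \<in> q" by force
    show "s' \<in> fst ` d"
    proof (cases "s' = s")
      case False
      then have "((s', t'), (s, t)) \<in> gs q" using t t' d s by (auto simp: gs_iff)
      then show ?thesis using dc t by force
    qed (use t in force)
  qed (use d in blast)
  moreover have "snd ` d \<in> configs T"
  proof (rule T.configs_subset[OF q'(2)])
    fix s s' assume "s \<in> snd ` d" and s: "(s', s) \<in> Le T"
    then obtain t where t: "(t, s) \<in> d" by force
    then have "s' \<in> snd ` q" using T.configsD(4)[OF q'(2) _ s] d by force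
    then obtain t' where t': "(t', s') \<in> q" by force
    show "s' \<in> snd ` d"
    proof (cases "s' = s")
      case False
      then have "((t', s'), (t, s)) \<in> gs q" using t t' d s by (auto simp: gs_iff)
      then show ?thesis using dc t by force
    qed (use t in force)
  qed (use d in blast)
  moreover have "antisym (go d)" unfolding go by (rule antisym_subset[OF _ q'(4)]) auto
  ultimately show "d \<in> B" unfolding B_iff using q' d by blast
qed

text \<open>Inclusion of secured bijections is automatically inclusion as a down-set: one component
  of a predecessor of \<open>p\<close> lies in a projection of \<open>q\<close>, and the partner it
  has there is forced by \<open>q'\<close>.\<close>

lemma B_sub_down:
  assumes q: "q \<in> B" and q': "q' \<in> B" and sub: "q \<subseteq> q'" and p: "p \<in> q" "(p', p) \<in> gs q'"
  shows "p' \<in> q"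
proof -
  obtain s t s' t' where [simp]: "p = (s, t)" "p' = (s', t')" by (cases p; cases p')
  have pq: "(s, t) \<in> q" "(s', t') \<in> q'" using p gs_sub by auto
  have c: "fst ` q \<in> configs S" "snd ` q \<in> configs T" using q B_iff by auto
  have "(s', s) \<in> Le S \<or> (t', t) \<in> Le T" using p by (auto simp: gs_iff)
  then show ?thesis
  proof
    assume "(s', s) \<in> Le S"
    then have "s' \<in> fst ` q" using S.configsD(4)[OF c(1)] pq by force
    then obtain t'' where "(s', t'') \<in> q" by force
    then show ?thesis using B_fun[OF q' pq(2)] sub by auto
  next
    assume "(t', t) \<in> Le T"
    then have "t' \<in> snd ` q" using T.configsD(4)[OF c(2)] pq by force
    then obtain s'' where "(s'', t') \<in> q" by force
    then show ?thesis using B_inj[OF q' pq(2)] sub by auto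
  qed
qed

lemma B_sub_go:
  assumes "q \<in> B" "q' \<in> B" "q \<subseteq> q'"
  shows "go q = go q' \<inter> q \<times> q"
  using B_down(2)[OF assms(2,3)] B_sub_down[OF assms] by blast

lemma B_sub_go_down:
  assumes "q \<in> B" "q' \<in> B" "q \<subseteq> q'" "p \<in> q" "(p', p) \<in> go q'"
  shows "p' \<in> q" "(p', p) \<in> go q"
proof -
  have "(p', p) \<in> (gs q')\<^sup>*" using assms by (simp add: graph_order_def)
  then show "p' \<in> q"
    by (induction rule: converse_rtrancl_induct) (use assms B_sub_down in blast)+
  then show "(p', p) \<in> go q" using assms B_sub_go by blast
qed

text \<open>The principal down-set of \<open>p\<close>. It is again a secured bijection and has
  \<open>p\<close> as its greatest element, hence is the graph of an event of the
  interaction.\<close>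

definition dn :: "('a ev \<times> 'a ev) set \<Rightarrow> 'a ev \<times> 'a ev \<Rightarrow> ('a ev \<times> 'a ev) set" where
  "dn q p = {p'. (p', p) \<in> go q}"

lemma dn:
  assumes q: "q \<in> B" and p: "p \<in> q"
  shows "dn q p \<in> B" "dn q p \<subseteq> q" "p \<in> dn q p" "is_greatest (go (dn q p)) (dn q p) p"
proof -
  show 1: "dn q p \<subseteq> q" using go_sub unfolding dn_def by blast
  have 2: "p'' \<in> dn q p" if "p' \<in> dn q p" "(p'', p') \<in> gs q" for p' p''
    using that gs_go go_trans unfolding dn_def by blast
  show "dn q p \<in> B" using B_down(1)[OF q 1 2] .
  show 3: "p \<in> dn q p" using go_refl p by (simp add: dn_def)
  have "go (dn q p) = go q \<inter> dn q p \<times> dn q p" using B_down(2)[OF q 1 2] .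
  then show "is_greatest (go (dn q p)) (dn q p) p"
    using 3 unfolding is_greatest_def by (auto simp: dn_def)
qed

text \<open>The first component alone fixes the label, because \<open>\<sigma> s = \<tau> t\<close>
  for every pair of a secured bijection.\<close>

abbreviation "c \<equiv> \<lambda>p. g (\<sigma> (fst p))"

lemma c_inj: assumes "q \<in> B" shows "inj_on c q"
proof (rule inj_onI)
  fix p p' assume p: "p \<in> q" "p' \<in> q" and eq: "c p = c p'"
  have f: "fst ` q \<in> configs S" using assms B_iff by auto
  then have "fst p \<in> Ev S" "fst p' \<in> Ev S" using p S.configsD(1) by blast+
  then have "\<sigma> (fst p) = \<sigma> (fst p')" using inj_onD[OF inj_g eq] \<sigma>_L by blast
  then have "fst p = fst p'" using inj_onD[OF inj_\<sigma>[OF f]] p by blast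
  then show "p = p'" using p B_fun[OF assms] by (metis prod.collapse)
qed

text \<open>Whole secured bijections as states: the halfway point between pairs of synchronised
  configurations and configurations of the interaction.\<close>

definition LB :: "(('a ev \<times> 'a ev) set, 'l) ls" where
  "LB = \<lparr>St = B, Sle = (\<subseteq>), Lbs = g ` L\<^sub>0, lab = (\<lambda>q. c ` q), ord = (\<lambda>q. {(c p, c p') | p p'. (p, p') \<in> go q})\<rparr>"

lemma LB_simps [simp]: "St LB = B" "Sle LB q q' \<longleftrightarrow> q \<subseteq> q'" "Lbs LB = g ` L\<^sub>0" "lab LB q = c ` q"
  "ord LB q = {(c p, c p') | p p'. (p, p') \<in> go q}"
  by (auto simp: LB_def)

text \<open>A step of the graph is a causal step in one of the factors and conversely, read off on
  labels. The hypotheses are those available before acyclicity of \<open>q\<close> is known, since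
  \<open>join_LB\<close> derives securedness of an induced graph from this identity.\<close>

lemma ord_graph:
  assumes inj: "inj_on c q" and eq: "\<And>s t. (s, t) \<in> q \<Longrightarrow> \<sigma> s = \<tau> t"
    and f: "\<And>s t t'. (s, t) \<in> q \<Longrightarrow> (s, t') \<in> q \<Longrightarrow> t = t'"
    and i: "\<And>s s' t. (s, t) \<in> q \<Longrightarrow> (s', t) \<in> q \<Longrightarrow> s = s'"
    and E: "fst ` q \<subseteq> Ev S" "snd ` q \<subseteq> Ev T"
  shows "(ord LX (fst ` q) \<union> ord LY (snd ` q))\<^sup>+ = ord LB q"
proof -
  let ?R = "ord LX (fst ` q) \<union> ord LY (snd ` q)"
  have 1: "\<exists>p p'. u = c p \<and> v = c p' \<and> p \<in> q \<and> p' \<in> q \<and> ((p, p') \<in> gs q \<or> p = p')" if "(u, v) \<in> ?R" for u v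
  proof -
    from that have "(\<exists>s t s' t'. u = g (\<sigma> s) \<and> v = g (\<sigma> s') \<and> (s, t) \<in> q \<and> (s', t') \<in> q \<and> (s, s') \<in> Le S) \<or>
       (\<exists>s t s' t'. u = g (\<tau> t) \<and> v = g (\<tau> t') \<and> (s, t) \<in> q \<and> (s', t') \<in> q \<and> (t, t') \<in> Le T)"
      by auto blast+
    then show ?thesis
    proof (elim disjE exE conjE)
      fix s t s' t' assume a: "u = g (\<sigma> s)" "v = g (\<sigma> s')" "(s, t) \<in> q" "(s', t') \<in> q" "(s, s') \<in> Le S"
      then show ?thesis using f[of s t t'] by (intro exI[of _ "(s, t)"] exI[of _ "(s', t')"]) (auto simp: gs_iff)
    next
      fix s t s' t' assume a: "u = g (\<tau> t)" "v = g (\<tau> t')" "(s, t) \<in> q" "(s', t') \<in> q" "(t, t') \<in> Le T"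
      then show ?thesis using i[of s t s'] eq[OF a(3)] eq[OF a(4)]
        by (intro exI[of _ "(s, t)"] exI[of _ "(s', t')"]) (auto simp: gs_iff)
    qed
  qed
  have 2: "(c p, c p') \<in> ?R" if "(p, p') \<in> gs q \<or> p = p' \<and> p \<in> q" for p p'
  proof -
    obtain s t s' t' where [simp]: "p = (s, t)" "p' = (s', t')" by (cases p; cases p')
    have q: "(s, t) \<in> q" "(s', t') \<in> q" using that gs_sub by auto
    then have m: "s \<in> fst ` q" "s' \<in> fst ` q" "t \<in> snd ` q" "t' \<in> snd ` q" by force+
    have "(s, s') \<in> Le S \<or> (t, t') \<in> Le T" using that m E S.Le_refl by (auto simp: gs_iff)
    then show ?thesis
    proof
      assume "(s, s') \<in> Le S" then show ?thesis using m by auto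
    next
      assume "(t, t') \<in> Le T"
      then have "(g (\<tau> t), g (\<tau> t')) \<in> ord LY (snd ` q)" using m unfolding LS_simps by blast
      then show ?thesis using eq q by simp
    qed
  qed
  show ?thesis
  proof (intro equalityI subrelI)
    fix u v assume "(u, v) \<in> ?R\<^sup>+"
    then have "\<exists>p p'. u = c p \<and> v = c p' \<and> (p, p') \<in> go q"
    proof (induction rule: trancl_induct)
      case (base y)
      then show ?case using 1[of u y] gs_go go_refl by blast
    next
      case (step y z)
      then obtain p p' where p: "u = c p" "y = c p'" "(p, p') \<in> go q" by blast
      from 1[OF step(2)] obtain r r' where r: "y = c r" "z = c r'" "r \<in> q" "(r, r') \<in> go q"
        using gs_go go_refl by blast
      have "p' = r" using inj p r go_sub by (metis inj_onD)
      then show ?case using p r go_trans by blast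
    qed
    then show "(u, v) \<in> ord LB q" by auto
  next
    fix u v assume "(u, v) \<in> ord LB q"
    then obtain p p' where p: "u = c p" "v = c p'" "(p, p') \<in> (gs q)\<^sup>*" "p \<in> q" by (auto simp: graph_order_def)
    from p(3) have "(c p, c p') \<in> ?R\<^sup>+"
    proof (induction rule: rtrancl_induct)
      case base
      show ?case using 2[of p p] p(4) by blast
    next
      case (step y z)
      have "(c y, c z) \<in> ?R" using 2[of y z] step(2) by blast
      then show ?case using step(3) by (rule trancl_into_trancl[rotated])
    qed
    then show "(u, v) \<in> ?R\<^sup>+" using p by simp
  qed
qed

lemma antisym_go_iff:
  assumes "inj_on c q" shows "antisym (ord LB q) \<longleftrightarrow> antisym (go q)"
proof
  assume a: "antisym (ord LB q)"
  show "antisym (go q)"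
  proof (rule antisymI)
    fix p p' assume p: "(p, p') \<in> go q" "(p', p) \<in> go q"
    then have "(c p, c p') \<in> ord LB q" "(c p', c p) \<in> ord LB q" unfolding LB_simps by blast+
    then have "c p = c p'" by (rule antisymD[OF a])
    then show "p = p'" using inj_onD[OF assms] go_sub[OF p(1)] by blast
  qed
next
  assume a: "antisym (go q)"
  show "antisym (ord LB q)"
  proof (rule antisymI)
    fix u v assume "(u, v) \<in> ord LB q" "(v, u) \<in> ord LB q"
    then obtain p p' r r' where p: "u = c p" "v = c p'" "(p, p') \<in> go q" "v = c r" "u = c r'" "(r, r') \<in> go q"
      unfolding LB_simps by blast
    have "p' = r" by (rule inj_onD[OF assms]) (use p go_sub[OF p(3)] go_sub[OF p(6)] in simp_all)
    moreover have "p = r'" by (rule inj_onD[OF assms]) (use p go_sub[OF p(3)] go_sub[OF p(6)] in simp_all)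
    ultimately have "p = p'" using antisymD[OF a] p by blast
    then show "u = v" using p by simp
  qed
qed

text \<open>Both sides have the same label bound and \<open>g\<close> is injective, so matching
  labels means that the two configurations have the same image in \<open>L\<^sub>0\<close>. They
  then induce a bijection, and acyclicity of the joined label orders is its securedness.\<close>

lemma join_LB: "LX \<bowtie> LY \<approx> LB"
proof -
  let ?f = "\<lambda>(x, y). induced_graph \<sigma> \<tau> x y"
  show ?thesis
  proof (rule ls_isoI[where f = ?f and g = "\<lambda>q. (fst ` q, snd ` q)"])
    have gin: "g u = g v \<Longrightarrow> u \<in> L\<^sub>0 \<Longrightarrow> v \<in> L\<^sub>0 \<Longrightarrow> u = v" for u v using inj_g by (auto dest: inj_onD)
    have oB: "(ord LX (fst ` q) \<union> ord LY (snd ` q))\<^sup>+ = ord LB q" if "q \<in> B" for q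
      by (rule ord_graph[OF c_inj[OF that] _ _ _ S.configsD(1)[OF B_D(1)[OF that]] T.configsD(1)[OF B_D(2)[OF that]]])
        (erule B_D(3)[OF that], erule (1) B_fun[OF that], erule (1) B_inj[OF that])
    have B_St: "(fst ` q, snd ` q) \<in> St (LX \<bowtie> LY) \<and> induced_graph \<sigma> \<tau> (fst ` q) (snd ` q) = q" if q: "q \<in> B" for q
    proof
      have b: "fst ` q \<in> configs S" "snd ` q \<in> configs T" "\<And>s t. (s, t) \<in> q \<Longrightarrow> \<sigma> s = \<tau> t" "antisym (go q)"
        using q B_iff by auto
      have "(\<lambda>s. g (\<sigma> s)) ` fst ` q = (\<lambda>t. g (\<tau> t)) ` snd ` q" using b(3) by force
      moreover have "(\<lambda>s. g (\<sigma> s)) ` fst ` q \<subseteq> g ` L\<^sub>0" using S.configsD(1)[OF b(1)] \<sigma>_L by blast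
      ultimately show "(fst ` q, snd ` q) \<in> St (LX \<bowtie> LY)"
        unfolding join_simps oB[OF q] using b antisym_go_iff[OF c_inj[OF q]] by simp
      show "induced_graph \<sigma> \<tau> (fst ` q) (snd ` q) = q" by (rule induced_graph_self[OF b(2,3)])
    qed
    have St_B: "induced_graph \<sigma> \<tau> x y \<in> B \<and> fst ` induced_graph \<sigma> \<tau> x y = x \<and> snd ` induced_graph \<sigma> \<tau> x y = y"
      if xy: "(x, y) \<in> St (LX \<bowtie> LY)" for x y
    proof -
      let ?q = "induced_graph \<sigma> \<tau> x y"
      have x: "x \<in> configs S" and y: "y \<in> configs T" and
        a: "antisym ((ord LX x \<union> ord LY y)\<^sup>+)"
        using xy by (simp_all del: LS_simps(5))
      have xE: "x \<subseteq> Ev S" "y \<subseteq> Ev T" by (rule S.configsD(1)[OF x], rule T.configsD(1)[OF y])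
      have L: "\<sigma> ` x \<subseteq> L\<^sub>0" "\<tau> ` y \<subseteq> L\<^sub>0" using xE \<sigma>_L \<tau>_L by blast+
      have "(\<lambda>s. g (\<sigma> s)) ` x \<inter> g ` L\<^sub>0 = (\<lambda>t. g (\<tau> t)) ` y \<inter> g ` L\<^sub>0" using xy by simp
      moreover have "(\<lambda>s. g (\<sigma> s)) ` x \<subseteq> g ` L\<^sub>0" "(\<lambda>t. g (\<tau> t)) ` y \<subseteq> g ` L\<^sub>0" using L by blast+
      ultimately have "g ` \<sigma> ` x = g ` \<tau> ` y" by (simp add: image_image Int_absorb2)
      then have im: "\<sigma> ` x = \<tau> ` y" using inj_on_image_eq_iff[OF inj_g L] by simp
      note fs = induced_graph_D(1)[OF im] and sn = induced_graph_D(2)[OF im]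
      have i: "inj_on c ?q" and f1: "\<And>s t t'. (s, t) \<in> ?q \<Longrightarrow> (s, t') \<in> ?q \<Longrightarrow> t = t'"
        and f2: "\<And>s s' t. (s, t) \<in> ?q \<Longrightarrow> (s', t) \<in> ?q \<Longrightarrow> s = s'"
      proof -
        show f1: "t = t'" if "(s, t) \<in> ?q" "(s, t') \<in> ?q" for s t t'
          using that inj_onD[OF inj_\<tau>[OF y]] by (auto simp: induced_graph_def)
        show f2: "s = s'" if "(s, t) \<in> ?q" "(s', t) \<in> ?q" for s s' t
          using that inj_onD[OF inj_\<sigma>[OF x]] by (auto simp: induced_graph_def)
        show "inj_on c ?q"
        proof (rule inj_onI)
          fix p p' assume p: "p \<in> ?q" "p' \<in> ?q" and eq: "c p = c p'"
          have fp: "fst p \<in> x" "fst p' \<in> x" using p fs by blast+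
          have "\<sigma> (fst p) = \<sigma> (fst p')" by (rule gin[OF eq]) (use fp L in blast)+
          then have "fst p = fst p'" using inj_onD[OF inj_\<sigma>[OF x] _ fp] by simp
          then show "p = p'" using p f1[of "fst p" "snd p" "snd p'"] by (cases p; cases p') simp
        qed
      qed
      have "(ord LX (fst ` ?q) \<union> ord LY (snd ` ?q))\<^sup>+ = ord LB ?q"
        by (rule ord_graph[OF i _ f1 f2]) (use fs sn xE in \<open>auto simp: induced_graph_def\<close>)
      then have "antisym (go ?q)" using a fs sn antisym_go_iff[OF i] by simp
      then have "?q \<in> B" unfolding secured_bijections_def secured_iff using x y im by blast
      then show ?thesis using fs sn by simp
    qed
    show "s \<in> St (LX \<bowtie> LY) \<Longrightarrow> ?f s \<in> St LB" for s
      using St_B by (cases s) auto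
    show "s \<in> St (LX \<bowtie> LY) \<Longrightarrow> (fst ` ?f s, snd ` ?f s) = s" for s
      using St_B by (cases s) auto
    show "t \<in> St LB \<Longrightarrow> (fst ` t, snd ` t) \<in> St (LX \<bowtie> LY)" for t using B_St[of t] unfolding LB_simps by blast
    show "t \<in> St LB \<Longrightarrow> ?f (fst ` t, snd ` t) = t" for t using B_St[of t] by simp
    show "ord LB (?f s) = ord (LX \<bowtie> LY) s" if "s \<in> St (LX \<bowtie> LY)" for s
    proof (cases s)
      case (Pair x y)
      then show ?thesis using that St_B[of x y] oB[of "induced_graph \<sigma> \<tau> x y"]
        by (simp del: LS_simps(5) LB_simps(5) join_simps(5))
    qed
    show "lab LB (?f s) = lab (LX \<bowtie> LY) s" if "s \<in> St (LX \<bowtie> LY)" for s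
    proof (cases s)
      case (Pair x y)
      let ?q = "induced_graph \<sigma> \<tau> x y"
      have q: "?q \<in> B" "fst ` ?q = x" "snd ` ?q = y" using that St_B[of x y] Pair by auto
      have "(\<lambda>s. g (\<sigma> s)) ` fst ` ?q = (\<lambda>t. g (\<tau> t)) ` snd ` ?q" by (force simp: induced_graph_def)
      moreover have "c ` ?q = (\<lambda>s. g (\<sigma> s)) ` fst ` ?q" by (simp add: image_image)
      ultimately show ?thesis using q Pair by simp
    qed
    show "Sle LB (?f s) (?f s')"
      if "Sle (LX \<bowtie> LY) s s'" for s s'
      using that by (cases s; cases s') (auto simp: induced_graph_def)
    show "Sle (LX \<bowtie> LY) (fst ` t, snd ` t) (fst ` t', snd ` t')" if "Sle LB t t'" for t t'
      using that by auto
  qed auto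
qed

end

section \<open>Events of an interaction as points of secured bijections\<close>

context meet
begin

abbreviation "ME \<equiv> meet_events S \<sigma> T \<tau>"

definition top_of :: "'a ev \<Rightarrow> 'a ev \<times> 'a ev" where
  "top_of e = (THE p. is_greatest (go (graph_of e)) (graph_of e) p)"

lemma meet_map_top: "meet_map S \<sigma> T e = \<sigma> (fst (top_of e))"
  by (simp add: meet_map_def top_of_def)

lemma greatest_unique:
  assumes "q \<in> B" "is_greatest (go q) q p" "is_greatest (go q) q p'" shows "p = p'"
  using assms(2,3) antisymD[OF B_D(4)[OF assms(1)], of p p'] by (simp add: is_greatest_def)

lemma top_of_eq:
  assumes "graph_of e \<in> B" "is_greatest (go (graph_of e)) (graph_of e) p" shows "top_of e = p"
  unfolding top_of_def by (rule the_equality) (use assms greatest_unique in auto)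

lemma ME_D:
  assumes "e \<in> ME"
  shows "graph_of e \<in> B" "top_of e \<in> graph_of e" "p \<in> graph_of e \<Longrightarrow> (p, top_of e) \<in> go (graph_of e)"
    "finite (graph_of e)"
proof -
  from assms obtain G p where G: "e = Graph G" "fset G \<in> B" "is_greatest (go (fset G)) (fset G) p"
    unfolding meet_events_def by blast
  show 1: "graph_of e \<in> B" using G by simp
  then have "is_greatest (go (graph_of e)) (graph_of e) (top_of e)" using G top_of_eq[of e p] by simp
  then show "top_of e \<in> graph_of e" "p \<in> graph_of e \<Longrightarrow> (p, top_of e) \<in> go (graph_of e)" for p
    by (simp_all add: is_greatest_def)
  show "finite (graph_of e)" using G by simp
qed

lemma ME_inj: "e \<in> ME \<Longrightarrow> e' \<in> ME \<Longrightarrow> graph_of e = graph_of e' \<Longrightarrow> e = e'"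
  by (auto simp: meet_events_def fset_inject)

text \<open>Events carry their graphs as an \<open>fset\<close>, so the down-set of \<open>p\<close>
  has to pass through \<open>Abs_fset\<close>; \<open>B_finite\<close> makes this faithful.\<close>

definition ev_at :: "('a ev \<times> 'a ev) set \<Rightarrow> 'a ev \<times> 'a ev \<Rightarrow> 'a ev" where
  "ev_at q p = Graph (Abs_fset (dn q p))"

lemma ev_at:
  assumes q: "q \<in> B" and p: "p \<in> q"
  shows "graph_of (ev_at q p) = dn q p" "ev_at q p \<in> ME" "top_of (ev_at q p) = p"
proof -
  have "finite (dn q p)" using B_finite[OF dn(1)[OF q p]] .
  then have f: "fset (Abs_fset (dn q p)) = dn q p" by (simp add: Abs_fset_inverse)
  then show g: "graph_of (ev_at q p) = dn q p" by (simp add: ev_at_def)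
  show "ev_at q p \<in> ME"
    unfolding meet_events_def ev_at_def
    by (rule CollectI, rule exI[of _ "Abs_fset (dn q p)"], unfold f) (use dn[OF q p] in blast)
  show "top_of (ev_at q p) = p" by (rule top_of_eq) (use dn[OF q p] g in simp_all)
qed

text \<open>An event included in \<open>q\<close> is a down-set of \<open>q\<close>, and a down-set
  with a greatest element is principal. The events inside \<open>q\<close> are thus in bijection
  with the points of \<open>q\<close>.\<close>

lemma ME_dn:
  assumes e: "e \<in> ME" and q: "q \<in> B" and sub: "graph_of e \<subseteq> q"
  shows "graph_of e = dn q (top_of e)" "e = ev_at q (top_of e)"
proof -
  have go: "go (graph_of e) = go q \<inter> graph_of e \<times> graph_of e" by (rule B_sub_go[OF ME_D(1)[OF e] q sub])
  show 1: "graph_of e = dn q (top_of e)"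
  proof (intro equalityI subsetI)
    fix p assume "p \<in> graph_of e"
    then show "p \<in> dn q (top_of e)" using ME_D(3)[OF e, of p] go by (simp add: dn_def)
  next
    fix p assume "p \<in> dn q (top_of e)"
    then have "(p, top_of e) \<in> go q" by (simp add: dn_def)
    then show "p \<in> graph_of e" by (rule B_sub_go_down(1)[OF ME_D(1)[OF e] q sub ME_D(2)[OF e]])
  qed
  have "top_of e \<in> q" using ME_D(2)[OF e] sub by blast
  then show "e = ev_at q (top_of e)" using ME_inj[OF e] ev_at[OF q] 1 by simp
qed

lemma dn_mono_iff: 
  assumes "q \<in> B" "p \<in> q" "p' \<in> q" shows "dn q p \<subseteq> dn q p' \<longleftrightarrow> (p, p') \<in> go q"
  using go_refl[OF assms(2)] go_trans unfolding dn_def by blast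

end

text \<open>\<open>R\<close> is characterised by its components and not defined, so that it can be
  the event structure with polarities built by \<open>strat_comp\<close>. \<open>VO\<close> contains
  the visible moves.\<close>

locale meet_restrict = meet S T \<sigma> \<tau> g L\<^sub>0
  for S :: "('a ev, 'y) es_scheme" and T :: "('a ev, 'z) es_scheme" and \<sigma> \<tau> :: "'a ev \<Rightarrow> 'a ev"
    and g :: "'a ev \<Rightarrow> 'l" and L\<^sub>0 :: "'a ev set" +
  fixes R :: "('a ev, 'w) es_scheme" and VO :: "'a ev set"
  assumes R_Ev: "Ev R = {e \<in> Ev (meet_es S \<sigma> T \<tau>). meet_map S \<sigma> T e \<in> VO}"
    and R_Le: "Le R = Le (meet_es S \<sigma> T \<tau>) \<inter> Ev R \<times> Ev R"
    and R_Con: "Con R = {X \<in> Con (meet_es S \<sigma> T \<tau>). X \<subseteq> Ev R}"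
begin

lemma Ev_iff: "e \<in> Ev R \<longleftrightarrow> e \<in> ME \<and> \<sigma> (fst (top_of e)) \<in> VO"
  by (simp add: R_Ev meet_es_def meet_map_top)

lemma Le_iff: "(e', e) \<in> Le R \<longleftrightarrow> e' \<in> Ev R \<and> e \<in> Ev R \<and> graph_of e' \<subseteq> graph_of e"
  by (auto simp: R_Le meet_es_def R_Ev)

lemma Con_iff: "X \<in> Con R \<longleftrightarrow> finite X \<and> X \<subseteq> Ev R \<and> (\<Union>e\<in>X. graph_of e) \<in> B"
  by (auto simp: R_Con meet_es_def R_Ev)

lemma B_empty: "{} \<in> B"
  unfolding B_iff by (simp add: S.empty_config T.empty_config graph_order_def antisym_def)

text \<open>Each event is a down-set of the whole union by \<open>B_sub_down\<close>, hence so is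
  the union of a subfamily.\<close>

lemma Union_down:
  assumes X: "(\<Union>e\<in>X. graph_of e) \<in> B" and E: "X \<subseteq> ME" and Y: "Y \<subseteq> X"
  shows "(\<Union>e\<in>Y. graph_of e) \<in> B"
proof (rule B_down(1)[OF X])
  show "(\<Union>e\<in>Y. graph_of e) \<subseteq> (\<Union>e\<in>X. graph_of e)" using Y by blast
  fix p p' assume "p \<in> (\<Union>e\<in>Y. graph_of e)" and p': "(p', p) \<in> gs (\<Union>e\<in>X. graph_of e)"
  then obtain e where e: "e \<in> Y" "p \<in> graph_of e" by blast
  have "e \<in> ME" "graph_of e \<subseteq> (\<Union>e\<in>X. graph_of e)" using e Y E by blast+
  then have "p' \<in> graph_of e" using B_sub_down[OF ME_D(1) X _ e(2) p'] by blast
  then show "p' \<in> (\<Union>e\<in>Y. graph_of e)" using e by blast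
qed

lemma es_R: "es R"
proof (rule es.intro, rule event_structureI)
  show "partial_order_on (Ev R) (Le R)"
    unfolding order_on_defs
  proof (intro conjI)
    show "refl_on (Ev R) (Le R)" by (rule refl_onI) (simp_all add: Le_iff)
    show "trans (Le R)" by (rule transI) (auto simp: Le_iff)
    show "antisym (Le R)" by (rule antisymI, rule ME_inj) (auto simp: Le_iff Ev_iff)
    show "Le R \<subseteq> Ev R \<times> Ev R" by (auto simp: Le_iff)
  qed
  show "{} \<in> Con R" by (simp add: Con_iff B_empty)
  show "finite X \<and> X \<subseteq> Ev R" if "X \<in> Con R" for X using that by (simp add: Con_iff)
  show "finite {e'. (e', e) \<in> Le R}" if "e \<in> Ev R" for e
  proof -
    have "finite (Pow (graph_of e))" using ME_D(4)[of e] that by (simp add: Ev_iff)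
    moreover have "graph_of ` {e'. (e', e) \<in> Le R} \<subseteq> Pow (graph_of e)" by (auto simp: Le_iff)
    moreover have "inj_on graph_of {e'. (e', e) \<in> Le R}"
      by (rule inj_onI, rule ME_inj) (auto simp: Le_iff Ev_iff)
    ultimately show ?thesis using inj_on_finite by blast
  qed
  show "{e} \<in> Con R" if "e \<in> Ev R" for e using that ME_D(1) by (simp add: Con_iff Ev_iff)
  show "Y \<in> Con R" if "X \<in> Con R" "Y \<subseteq> X" for X Y
    using that Union_down[of X Y] unfolding Con_iff Ev_iff subset_iff by (meson finite_subset subsetI)
  show "X \<union> {e'} \<in> Con R" if "X \<in> Con R" "e \<in> X" "(e', e) \<in> Le R" for X e e'
  proof -
    have "(\<Union>e\<in>X \<union> {e'}. graph_of e) = (\<Union>e\<in>X. graph_of e)" using that by (auto simp: Le_iff)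
    then show ?thesis using that unfolding Con_iff Le_iff by simp
  qed
qed

abbreviation "U z \<equiv> \<Union>e\<in>z. graph_of e"

lemma config_ME: "z \<in> configs R \<Longrightarrow> U z \<in> B" "z \<in> configs R \<Longrightarrow> z \<subseteq> Ev R"
    "z \<in> configs R \<Longrightarrow> e \<in> z \<Longrightarrow> e \<in> ME"
  using es.configsD(1,2)[OF es_R, of z] by (auto simp: Con_iff Ev_iff)

text \<open>A visible pair occurring in the graph of an event of \<open>z\<close> is itself the top
  of a smaller visible event, which belongs to \<open>z\<close> by down-closure.\<close>

lemma top_image:
  assumes z: "z \<in> configs R"
  shows "top_of ` z = {p \<in> U z. \<sigma> (fst p) \<in> VO}"
proof (intro equalityI subsetI)
  fix p assume "p \<in> top_of ` z"
  then obtain e where e: "e \<in> z" "p = top_of e" by blast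
  then show "p \<in> {p \<in> U z. \<sigma> (fst p) \<in> VO}"
    using ME_D(2)[OF config_ME(3)[OF z e(1)]] config_ME(2)[OF z] Ev_iff by blast
next
  fix p assume "p \<in> {p \<in> U z. \<sigma> (fst p) \<in> VO}"
  then obtain e where e: "e \<in> z" "p \<in> graph_of e" and VO: "\<sigma> (fst p) \<in> VO" by blast
  note eM = config_ME(3)[OF z e(1)]
  have g: "graph_of e \<in> B" using ME_D(1)[OF eM] .
  have "ev_at (graph_of e) p \<in> Ev R" using ev_at[OF g e(2)] VO by (simp add: Ev_iff)
  moreover have "graph_of (ev_at (graph_of e) p) \<subseteq> graph_of e" using ev_at(1)[OF g e(2)] dn(2)[OF g e(2)] by simp
  moreover have "e \<in> Ev R" using config_ME(2)[OF z] e by blast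
  ultimately have "ev_at (graph_of e) p \<in> z" using es.configsD(4)[OF es_R z e(1)] by (simp add: Le_iff)
  then show "p \<in> top_of ` z" using ev_at(3)[OF g e(2)] by (metis imageI)
qed

lemma config_of:
  assumes z: "z \<in> configs R" shows "z = ev_at (U z) ` {p \<in> U z. \<sigma> (fst p) \<in> VO}"
proof -
  have "e = ev_at (U z) (top_of e)" if "e \<in> z" for e
    by (rule ME_dn(2)[OF config_ME(3)[OF z that] config_ME(1)[OF z]]) (use that in blast)
  then have "z = ev_at (U z) ` top_of ` z" by (force simp: image_iff)
  then show ?thesis using top_image[OF z] by simp
qed

lemma top_inj: "z \<in> configs R \<Longrightarrow> inj_on top_of z"
proof (rule inj_onI)
  fix e e' assume z: "z \<in> configs R" and e: "e \<in> z" "e' \<in> z" and eq: "top_of e = top_of e'"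
  have "e = ev_at (U z) (top_of e)" "e' = ev_at (U z) (top_of e')"
    by (rule ME_dn(2)[OF config_ME(3)[OF z e(1)] config_ME(1)[OF z]], use e in blast,
        rule ME_dn(2)[OF config_ME(3)[OF z e(2)] config_ME(1)[OF z]], use e in blast)
  then show "e = e'" using eq by simp
qed

definition H where "H = g ` (L\<^sub>0 - VO)"

lemma c_H: 
  assumes "q \<in> B" "p \<in> q" shows "c p \<in> H \<longleftrightarrow> \<sigma> (fst p) \<notin> VO"
proof -
  have "fst p \<in> Ev S" using S.configsD(1)[OF B_D(1)[OF assms(1)]] assms(2) by blast
  then have "\<sigma> (fst p) \<in> L\<^sub>0" using \<sigma>_L by blast
  then show ?thesis using inj_g unfolding H_def by (auto dest: inj_onD)
qed

lemma hide_LB_St: "q \<in> St (hide H LB) \<longleftrightarrow> q \<in> B \<and> (\<forall>p\<in>q. \<exists>p'\<in>q. \<sigma> (fst p') \<in> VO \<and> (p, p') \<in> go q)"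
proof (cases "q \<in> B")
  case True
  note cH = c_H[OF True] and ci = c_inj[OF True]
  show ?thesis
  proof
    assume h: "q \<in> St (hide H LB)"
    have "\<exists>p'\<in>q. \<sigma> (fst p') \<in> VO \<and> (p, p') \<in> go q" if p: "p \<in> q" for p
    proof (cases "\<sigma> (fst p) \<in> VO")
      case False
      then have "c p \<in> c ` q \<inter> H" using cH[OF p] p by simp
      then obtain l where l: "l \<in> c ` q - H" "(c p, l) \<in> ord LB q"
        using h unfolding hide_simps LB_simps(4) by blast
      then obtain r r' where r: "c p = c r" "l = c r'" "(r, r') \<in> go q" by auto
      then have rq: "r \<in> q" "r' \<in> q" using go_sub by blast+
      have "p = r" by (rule inj_onD[OF ci r(1) p rq(1)])
      then show ?thesis using r rq l cH[OF rq(2)] by blast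
    qed (use p go_refl in blast)
    then show "q \<in> B \<and> (\<forall>p\<in>q. \<exists>p'\<in>q. \<sigma> (fst p') \<in> VO \<and> (p, p') \<in> go q)" using True by blast
  next
    assume h: "q \<in> B \<and> (\<forall>p\<in>q. \<exists>p'\<in>q. \<sigma> (fst p') \<in> VO \<and> (p, p') \<in> go q)"
    have "\<exists>l\<in>c ` q - H. (h, l) \<in> ord LB q" if "h \<in> c ` q \<inter> H" for h
    proof -
      from that obtain p where p: "p \<in> q" "h = c p" by blast
      then obtain p' where p': "p' \<in> q" "\<sigma> (fst p') \<in> VO" "(p, p') \<in> go q" using h by blast
      then have "c p' \<in> c ` q - H" using cH[OF p'(1)] by simp
      moreover have "(h, c p') \<in> ord LB q" unfolding LB_simps using p' p by blast
      ultimately show ?thesis by blast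
    qed
    then show "q \<in> St (hide H LB)" using True by simp
  qed
qed simp

text \<open>The hiding condition says that \<open>q\<close> is the union of the down-sets of its
  visible points. This is what makes the visible events remember all of \<open>q\<close>, hidden
  part included.\<close>

lemma config_at:
  assumes q: "q \<in> St (hide H LB)"
  defines "z \<equiv> ev_at q ` {p \<in> q. \<sigma> (fst p) \<in> VO}"
  shows "z \<in> configs R" "U z = q"
proof -
  have qB: "q \<in> B" and vis: "\<And>p. p \<in> q \<Longrightarrow> \<exists>p'\<in>q. \<sigma> (fst p') \<in> VO \<and> (p, p') \<in> go q"
    using q hide_LB_St by blast+
  have Uz: "U z = (\<Union>p\<in>{p \<in> q. \<sigma> (fst p) \<in> VO}. dn q p)"
    unfolding z_def using ev_at(1)[OF qB] by auto
  show U: "U z = q"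
  proof (intro equalityI subsetI)
    fix p assume "p \<in> U z" then show "p \<in> q" unfolding Uz using dn(2)[OF qB] by blast
  next
    fix p assume "p \<in> q"
    from vis[OF this] show "p \<in> U z" unfolding Uz dn_def by blast
  qed
  have zE: "z \<subseteq> Ev R" unfolding z_def using ev_at(2,3)[OF qB] by (auto simp: Ev_iff)
  show "z \<in> configs R"
  proof (rule es.configsI[OF es_R])
    show "z \<in> Con R" unfolding Con_iff U using zE qB B_finite[OF qB] by (simp add: z_def)
    fix e e' assume e: "e \<in> z" and le: "(e', e) \<in> Le R"
    have e': "e' \<in> ME" "\<sigma> (fst (top_of e')) \<in> VO" "graph_of e' \<subseteq> graph_of e" using le by (simp_all add: Le_iff Ev_iff)
    have "graph_of e' \<subseteq> q" using e' e U by blast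
    then have "e' = ev_at q (top_of e')" "top_of e' \<in> q" using ME_dn(2)[OF e'(1) qB] ME_D(2)[OF e'(1)] by blast+
    then show "e' \<in> z" unfolding z_def using e' by blast
  qed
qed

lemma LB_config:
  assumes z: "z \<in> configs R" shows "U z \<in> St (hide H LB)"
  unfolding hide_LB_St
proof (intro conjI ballI)
  show "U z \<in> B" by (rule config_ME(1)[OF z])
  fix p assume "p \<in> U z"
  then obtain e where e: "e \<in> z" "p \<in> graph_of e" by blast
  note eM = config_ME(3)[OF z e(1)]
  have "(p, top_of e) \<in> go (graph_of e)" by (rule ME_D(3)[OF eM e(2)])
  then have "(p, top_of e) \<in> go (U z)"
    using B_sub_go[OF ME_D(1)[OF eM] config_ME(1)[OF z]] e by blast
  moreover have "\<sigma> (fst (top_of e)) \<in> VO" using config_ME(2)[OF z] e Ev_iff by blast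
  ultimately show "\<exists>p'\<in>U z. \<sigma> (fst p') \<in> VO \<and> (p, p') \<in> go (U z)" using go_sub by blast
qed

text \<open>A configuration of visible events corresponds to the union of their graphs, and the
  inverse takes the events at the visible points. A hidden pair occurs in such a union only below a
  visible one, which is the condition that \<open>hide\<close> imposes.\<close>

theorem LS_restrict: "LS (g ` (L\<^sub>0 \<inter> VO)) R (\<lambda>e. g (meet_map S \<sigma> T e)) \<approx> hide H (LX \<bowtie> LY)" (is "?Z \<approx> _")
proof -
  have "?Z \<approx> hide H LB"
  proof (rule ls_isoI[where f = U and g = "\<lambda>q. ev_at q ` {p \<in> q. \<sigma> (fst p) \<in> VO}"])
    show "Lbs ?Z = Lbs (hide H LB)"
      using inj_g unfolding H_def by (auto dest: inj_onD)
    fix z assume "z \<in> St ?Z"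
    then have z: "z \<in> configs R" by simp
    note Uz = config_ME(1)[OF z]
    show "U z \<in> St (hide H LB)" by (rule LB_config[OF z])
    show "ev_at (U z) ` {p \<in> U z. \<sigma> (fst p) \<in> VO} = z" using config_of[OF z] by simp
    have vis: "c ` U z - H = c ` {p \<in> U z. \<sigma> (fst p) \<in> VO}" using c_H[OF Uz] by auto
    show "lab (hide H LB) (U z) = lab ?Z z"
      unfolding hide_simps LB_simps vis top_image[OF z, symmetric] by (simp add: image_image meet_map_top)
    \<comment> \<open>Events of \<open>z\<close> are principal down-sets of \<open>U z\<close>, so
      causality between them is the graph order between their tops.\<close>
    have le: "(e, e') \<in> Le R \<longleftrightarrow> (top_of e, top_of e') \<in> go (U z)" if "e \<in> z" "e' \<in> z" for e e'
    proof -
      have s: "graph_of e \<subseteq> U z" "graph_of e' \<subseteq> U z" using that by blast+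
      have "e \<in> ME" "e' \<in> ME" "e \<in> Ev R" "e' \<in> Ev R" using that config_ME(2,3)[OF z] by blast+
      moreover then have "top_of e \<in> U z" "top_of e' \<in> U z" using ME_D(2) s by blast+
      ultimately show ?thesis
        using ME_dn(1)[OF _ Uz s(1)] ME_dn(1)[OF _ Uz s(2)] dn_mono_iff[OF Uz, of "top_of e" "top_of e'"]
        by (simp add: Le_iff)
    qed
    show "ord (hide H LB) (U z) = ord ?Z z"
    proof (intro equalityI subrelI)
      fix u v assume "(u, v) \<in> ord (hide H LB) (U z)"
      then obtain p p' where p: "u = c p" "v = c p'" "(p, p') \<in> go (U z)" "c p \<notin> H" "c p' \<notin> H" by auto
      then have m: "p \<in> U z" "p' \<in> U z" using go_sub by blast+
      then have "p \<in> top_of ` z" "p' \<in> top_of ` z" using p c_H[OF Uz] top_image[OF z] by auto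
      then obtain e e' where e: "e \<in> z" "e' \<in> z" "p = top_of e" "p' = top_of e'" by blast
      then have "(e, e') \<in> Le R" using le p by simp
      then show "(u, v) \<in> ord ?Z z"
        unfolding LS_simps meet_map_top using e p by blast
    next
      fix u v assume "(u, v) \<in> ord ?Z z"
      then obtain e e' where e: "e \<in> z" "e' \<in> z" "(e, e') \<in> Le R" "u = c (top_of e)" "v = c (top_of e')"
        unfolding LS_simps meet_map_top by blast
      then have "(top_of e, top_of e') \<in> go (U z)" using le by simp
      moreover have "c (top_of e) \<notin> H" "c (top_of e') \<notin> H"
        using e top_image[OF z] c_H[OF Uz] by blast+
      ultimately show "(u, v) \<in> ord (hide H LB) (U z)" unfolding hide_simps LB_simps using e by blast
    qed
  next
    fix q assume q: "q \<in> St (hide H LB)"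
    show "ev_at q ` {p \<in> q. \<sigma> (fst p) \<in> VO} \<in> St ?Z"
      using config_at(1)[OF q] by simp
    show "U (ev_at q ` {p \<in> q. \<sigma> (fst p) \<in> VO}) = q" by (rule config_at(2)[OF q])
    fix q' assume q': "q' \<in> St (hide H LB)" and le: "Sle (hide H LB) q q'"
    have B: "q \<in> B" "q' \<in> B" and s: "q \<subseteq> q'" using q q' le hide_LB_St by auto
    have "ev_at q p = ev_at q' p" if "p \<in> q" for p
      using ME_dn(2)[OF ev_at(2)[OF B(1) that] B(2)] ev_at(1,3)[OF B(1) that] dn(2)[OF B(1) that] s by simp
    then show "Sle ?Z
       (ev_at q ` {p \<in> q. \<sigma> (fst p) \<in> VO}) (ev_at q' ` {p \<in> q'. \<sigma> (fst p) \<in> VO})"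
      using s by auto
  qed auto
  also have "hide H LB \<approx> hide H (LX \<bowtie> LY)" by (intro hide_cong ls_iso_sym[OF join_LB])
  finally show ?thesis .
qed

lemma meet_map_config:
  assumes z: "z \<in> configs R"
  obtains x where "x \<in> configs S" "meet_map S \<sigma> T ` z = \<sigma> ` x \<inter> VO" 
proof
  show "fst ` U z \<in> configs S" by (rule B_D(1)[OF config_ME(1)[OF z]])
  have "meet_map S \<sigma> T ` z = (\<lambda>p. \<sigma> (fst p)) ` top_of ` z" by (simp add: image_image meet_map_top)
  also have "\<dots> = \<sigma> ` fst ` U z \<inter> VO" unfolding top_image[OF z] by auto
  finally show "meet_map S \<sigma> T ` z = \<sigma> ` fst ` U z \<inter> VO" .
qed

lemma meet_map_inj:
  assumes z: "z \<in> configs R" shows "inj_on (meet_map S \<sigma> T) z"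
proof (rule inj_onI)
  fix e e' assume e: "e \<in> z" "e' \<in> z" "meet_map S \<sigma> T e = meet_map S \<sigma> T e'"
  have "top_of e \<in> U z" "top_of e' \<in> U z" using e top_image[OF z] by blast+
  then have "top_of e = top_of e'" using inj_onD[OF c_inj[OF config_ME(1)[OF z]]] e by (simp add: meet_map_top)
  then show "e = e'" using inj_onD[OF top_inj[OF z]] e by blast
qed

end

section \<open>Games\<close>

lemma game_es: "game A \<Longrightarrow> es A"
  by (simp add: game_def es_def)

lemma dual_simps [simp]:
  "Ev (A\<^sup>\<bottom>) = Ev A" "Le (A\<^sup>\<bottom>) = Le A" "Con (A\<^sup>\<bottom>) = Con A" "configs (A\<^sup>\<bottom>) = configs A"
  "a \<in> Ev A \<Longrightarrow> pol (A\<^sup>\<bottom>) a = opp (pol A a)"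
  by (auto simp: dual_def configs_def)

lemma opp_opp [simp]: "opp (opp x) = x"
  by (cases x) auto

lemma game_dual [simp]: "game A \<Longrightarrow> game (A\<^sup>\<bottom>)"
  by (auto simp: game_def dual_def event_structure_def)

lemma esp_eqI:
  fixes A B :: "'e esp"
  assumes "Ev A = Ev B" "Le A = Le B" "Con A = Con B" "pol A \<in> extensional (Ev A)" "pol B \<in> extensional (Ev B)"
    and "\<And>a. a \<in> Ev A \<Longrightarrow> pol A a = pol B a"
  shows "A = B"
proof -
  have "pol A = pol B"
    by (rule extensionalityI[of _ "Ev A"]) (use assms in auto)
  then show ?thesis using assms by (cases A; cases B) simp
qed

lemma dual_extensional [simp]: "pol (A\<^sup>\<bottom>) \<in> extensional (Ev A)"
  by (simp add: dual_def)

lemma par_extensional [simp]: "pol (A \<parallel> B) \<in> extensional (duo (Ev A) (Ev B))"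
  by (simp add: par_def)

lemma dual_dual [simp]: "game A \<Longrightarrow> (A\<^sup>\<bottom>)\<^sup>\<bottom> = A"
  by (rule esp_eqI) (auto simp: game_def intro: dual_extensional[of "A\<^sup>\<bottom>", simplified])

lemma game_par [simp]: "game A \<Longrightarrow> game B \<Longrightarrow> game (A \<parallel> B)"
  using es_par[of A B] by (simp add: game_def es_def)

lemma par_Le_dual: "Le (A\<^sup>\<bottom> \<parallel> B\<^sup>\<bottom>) = Le (A \<parallel> B)" "Con (A\<^sup>\<bottom> \<parallel> B\<^sup>\<bottom>) = Con (A \<parallel> B)"
  by (simp_all add: par_def)

lemma dual_par: "(A \<parallel> B)\<^sup>\<bottom> = A\<^sup>\<bottom> \<parallel> B\<^sup>\<bottom>"
proof (rule esp_eqI)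
  show "pol ((A \<parallel> B)\<^sup>\<bottom>) \<in> extensional (Ev ((A \<parallel> B)\<^sup>\<bottom>))" using dual_extensional[of "A \<parallel> B"] by simp
  show "pol (A\<^sup>\<bottom> \<parallel> B\<^sup>\<bottom>) \<in> extensional (Ev (A\<^sup>\<bottom> \<parallel> B\<^sup>\<bottom>))" using par_extensional[of "A\<^sup>\<bottom>" "B\<^sup>\<bottom>"] by simp
qed (auto simp: par_Le_dual)

lemma game_empty [simp]: "game \<one>"
  by (auto simp: game_def empty_game_def event_structure_def order_on_defs refl_on_def trans_def antisym_def extensional_def)

lemma empty_simps [simp]: "Ev \<one> = {}" "Le \<one> = {}" "Con \<one> = {{}}" "configs \<one> = {{}}"
  by (auto simp: empty_game_def configs_def)

lemma dual_empty [simp]: "\<one>\<^sup>\<bottom> = \<one>"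
  by (rule esp_eqI) (auto simp: extensional_def empty_game_def dual_def)

lemma configs_par_game: 
  "game A \<Longrightarrow> game B \<Longrightarrow> configs (A \<parallel> B) = {duo x y | x y. x \<in> configs A \<and> y \<in> configs B}"
  by (intro configs_par game_es)

lemma config_par_iff: 
  assumes "game A" "game B" shows "duo x y \<in> configs (A \<parallel> B) \<longleftrightarrow> x \<in> configs A \<and> y \<in> configs B"
  unfolding configs_par_game[OF assms] by auto

section \<open>Pre-strategies as labelled state structures\<close>

definition tag :: "('a ev \<Rightarrow> 'l) \<Rightarrow> ('a ev \<Rightarrow> 'l) \<Rightarrow> 'a ev \<Rightarrow> 'l" where
  "tag p q e = (case e of Tag i a \<Rightarrow> if i then q a else p a)"

lemma tag_simps [simp]: "tag p q (Tag False a) = p a" "tag p q (Tag True a) = q a"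
  by (simp_all add: tag_def)

text \<open>This is what makes \<open>tag p q\<close> injective on a parallel composition: two games
  under separated names are never synchronised by accident, even if they are the same game.\<close>

definition sep :: "('a ev \<Rightarrow> 'l) \<Rightarrow> 'a ev esp \<Rightarrow> ('a ev \<Rightarrow> 'l) \<Rightarrow> 'a ev esp \<Rightarrow> bool" where
  "sep p A q B \<longleftrightarrow> inj_on p (Ev A) \<and> inj_on q (Ev B) \<and> p ` Ev A \<inter> q ` Ev B = {}"

lemma sep_sym: "sep p A q B \<Longrightarrow> sep q B p A"
  by (auto simp: sep_def)

lemma tag_image [simp]: "tag p q ` duo X Y = p ` X \<union> q ` Y"
  by (simp add: image_Un image_image)

lemma inj_tag: "sep p A q B \<Longrightarrow> inj_on (tag p q) (duo (Ev A) (Ev B))"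
proof (rule inj_onI)
  fix e e' assume s: "sep p A q B" and e: "e \<in> duo (Ev A) (Ev B)" "e' \<in> duo (Ev A) (Ev B)" "tag p q e = tag p q e'"
  have pq: "p a \<noteq> q b" if "a \<in> Ev A" "b \<in> Ev B" for a b using s that unfolding sep_def by blast
  have i: "inj_on p (Ev A)" "inj_on q (Ev B)" using s by (simp_all add: sep_def)
  from e pq show "e = e'" by (auto dest: inj_onD[OF i(1)] inj_onD[OF i(2)]) (metis pq)+
qed

text \<open>
  The functions \<open>p\<close> and \<open>q\<close> name the moves of the two games. Naming a game in the same way in two
  structures connects them along that game.
\<close>

definition LSp :: "('a ev \<Rightarrow> 'l) \<Rightarrow> ('a ev \<Rightarrow> 'l) \<Rightarrow> 'a ev esp \<Rightarrow> 'a ev esp \<Rightarrow> 'a prestrat \<Rightarrow> ('a ev set, 'l) ls" where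
  "LSp p q A B \<sigma> = LS (p ` Ev A \<union> q ` Ev B) (fst \<sigma>) (\<lambda>s. tag p q (snd \<sigma> s))"

lemma LSp_Lbs [simp]: "Lbs (LSp p q A B \<sigma>) = p ` Ev A \<union> q ` Ev B"
  by (simp add: LSp_def)

lemma prestrategyD:
  assumes "prestrategy A \<sigma>"
  shows "game (fst \<sigma>)" "es (fst \<sigma>)" "s \<in> Ev (fst \<sigma>) \<Longrightarrow> snd \<sigma> s \<in> Ev A"
    "x \<in> configs (fst \<sigma>) \<Longrightarrow> snd \<sigma> ` x \<in> configs A" "x \<in> configs (fst \<sigma>) \<Longrightarrow> inj_on (snd \<sigma>) x"
    "s \<in> Ev (fst \<sigma>) \<Longrightarrow> pol A (snd \<sigma> s) = pol (fst \<sigma>) s"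
  using assms by (auto simp: prestrategy_def esp_map_def es_map_def split_def game_es)

lemma prestrategyI:
  assumes "game (fst \<sigma>)" "\<And>s. s \<in> Ev (fst \<sigma>) \<Longrightarrow> snd \<sigma> s \<in> Ev A"
    "\<And>x. x \<in> configs (fst \<sigma>) \<Longrightarrow> snd \<sigma> ` x \<in> configs A \<and> inj_on (snd \<sigma>) x"
    "\<And>s. s \<in> Ev (fst \<sigma>) \<Longrightarrow> pol A (snd \<sigma> s) = pol (fst \<sigma>) s"
  shows "prestrategy A \<sigma>"
  using assms by (auto simp: prestrategy_def esp_map_def es_map_def split_def)

lemma prestrategy_inj_comp:
  assumes \<sigma>: "prestrategy A \<sigma>" and g: "inj_on g (Ev A)" and x: "x \<in> configs (fst \<sigma>)"
  shows "inj_on (\<lambda>s. g (snd \<sigma> s)) x"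
proof -
  have "snd \<sigma> ` x \<subseteq> Ev A" 
    using es.configsD(1)[OF prestrategyD(2)[OF \<sigma>] x] prestrategyD(3)[OF \<sigma>] by blast
  then have "inj_on g (snd \<sigma> ` x)" using g inj_on_subset by blast
  from comp_inj_on[OF prestrategyD(5)[OF \<sigma> x] this] show ?thesis by (simp add: comp_def)
qed

lemma valid_LSp [simp, intro]:
  assumes \<sigma>: "prestrategy (A\<^sup>\<bottom> \<parallel> B) \<sigma>" and s: "sep p A q B"
  shows "valid (LSp p q A B \<sigma>)"
  unfolding LSp_def
proof (rule es.valid_LS[OF prestrategyD(2)[OF \<sigma>]])
  have "snd \<sigma> ` Ev (fst \<sigma>) \<subseteq> duo (Ev A) (Ev B)" using prestrategyD(3)[OF \<sigma>] by auto
  then have "tag p q ` snd \<sigma> ` Ev (fst \<sigma>) \<subseteq> tag p q ` duo (Ev A) (Ev B)" by (rule image_mono)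
  then show "(\<lambda>s. tag p q (snd \<sigma> s)) ` Ev (fst \<sigma>) \<subseteq> p ` Ev A \<union> q ` Ev B" by (simp add: image_image)
  show "inj_on (\<lambda>s. tag p q (snd \<sigma> s)) x" if "x \<in> configs (fst \<sigma>)" for x
    by (rule prestrategy_inj_comp[OF \<sigma> _ that]) (use inj_tag[OF s] in simp)
qed

lemma LS_prestrat_iso:
  assumes \<sigma>: "prestrategy A \<sigma>" and \<tau>: "prestrategy A \<tau>" and iso: "\<sigma> \<cong> \<tau>"
  shows "LS L (fst \<sigma>) (\<lambda>s. g (snd \<sigma> s)) \<approx> LS L (fst \<tau>) (\<lambda>s. g (snd \<tau> s))"
proof -
  from iso obtain \<phi> where \<phi>: "esp_iso (fst \<sigma>) (fst \<tau>) \<phi>" "\<And>s. s \<in> Ev (fst \<sigma>) \<Longrightarrow> snd \<tau> (\<phi> s) = snd \<sigma> s"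
    by (auto simp: prestrat_iso_def split_def)
  from \<phi>(1) obtain \<psi> where m: "esp_map (fst \<sigma>) (fst \<tau>) \<phi>" "esp_map (fst \<tau>) (fst \<sigma>) \<psi>"
    "\<And>s. s \<in> Ev (fst \<sigma>) \<Longrightarrow> \<psi> (\<phi> s) = s" "\<And>t. t \<in> Ev (fst \<tau>) \<Longrightarrow> \<phi> (\<psi> t) = t"
    unfolding esp_iso_def by blast
  show ?thesis
    by (rule LS_iso_of_bij[where \<phi> = \<phi> and \<psi> = \<psi>])
      (use prestrategyD[OF \<sigma>] prestrategyD[OF \<tau>] \<phi>(2) m in \<open>auto simp: esp_map_def es_map_def\<close>)
qed

text \<open>Labels leave out polarities, yet both domains inherit them from \<open>A\<close> through
  their maps, so a bijection commuting with the maps preserves them. Injectivity of \<open>g\<close>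
  recovers moves from labels.\<close>

lemma prestrat_iso_of_LS:
  assumes \<sigma>: "prestrategy A \<sigma>" and \<tau>: "prestrategy A \<tau>" and g: "inj_on g (Ev A)"
    and iso: "LS L (fst \<sigma>) (\<lambda>s. g (snd \<sigma> s)) \<approx> LS L (fst \<tau>) (\<lambda>s. g (snd \<tau> s))"
  shows "\<sigma> \<cong> \<tau>"
proof -
  note S = prestrategyD[OF \<sigma>] and T = prestrategyD[OF \<tau>]
  obtain \<phi> \<psi> where 1: "\<And>s. s \<in> Ev (fst \<sigma>) \<Longrightarrow> \<phi> s \<in> Ev (fst \<tau>) \<and> g (snd \<tau> (\<phi> s)) = g (snd \<sigma> s) \<and> \<psi> (\<phi> s) = s"
    and 2: "\<And>t. t \<in> Ev (fst \<tau>) \<Longrightarrow> \<psi> t \<in> Ev (fst \<sigma>) \<and> g (snd \<sigma> (\<psi> t)) = g (snd \<tau> t) \<and> \<phi> (\<psi> t) = t"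
    and 3: "\<And>x. x \<in> configs (fst \<sigma>) \<Longrightarrow> \<phi> ` x \<in> configs (fst \<tau>)"
    and 4: "\<And>y. y \<in> configs (fst \<tau>) \<Longrightarrow> \<psi> ` y \<in> configs (fst \<sigma>)"
    apply (rule LS_iso_imp[OF S(2) T(2) _ _ iso])
      apply (erule prestrategy_inj_comp[OF \<sigma> g])
     apply (erule prestrategy_inj_comp[OF \<tau> g])
    subgoal premises p by (rule p(1)) (fact p(2-5))+
    done
  have 5: "snd \<tau> (\<phi> s) = snd \<sigma> s" if "s \<in> Ev (fst \<sigma>)" for s
    by (rule inj_onD[OF g]) (use 1[OF that] S(3)[OF that] T(3) in auto)
  have 6: "snd \<sigma> (\<psi> s) = snd \<tau> s" if "s \<in> Ev (fst \<tau>)" for s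
    by (rule inj_onD[OF g]) (use 2[OF that] T(3)[OF that] S(3) in auto)
  have i1: "inj_on \<phi> x" if "x \<in> configs (fst \<sigma>)" for x
    by (rule inj_on_inverseI[of _ \<psi>]) (use 1 es.configsD(1)[OF S(2) that] in auto)
  have i2: "inj_on \<psi> x" if "x \<in> configs (fst \<tau>)" for x
    by (rule inj_on_inverseI[of _ \<phi>]) (use 2 es.configsD(1)[OF T(2) that] in auto)
  have m1: "esp_map (fst \<sigma>) (fst \<tau>) \<phi>"
    unfolding esp_map_def es_map_def
  proof (intro conjI ballI)
    show "pol (fst \<tau>) (\<phi> s) = pol (fst \<sigma>) s" if "s \<in> Ev (fst \<sigma>)" for s
      using S(6)[OF that] T(6)[of "\<phi> s"] 1[OF that] 5[OF that] by simp
  qed (use 1 3 i1 in auto)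
  have m2: "esp_map (fst \<tau>) (fst \<sigma>) \<psi>"
    unfolding esp_map_def es_map_def
  proof (intro conjI ballI)
    show "pol (fst \<sigma>) (\<psi> s) = pol (fst \<tau>) s" if "s \<in> Ev (fst \<tau>)" for s
      using T(6)[OF that] S(6)[of "\<psi> s"] 2[OF that] 6[OF that] by simp
  qed (use 2 4 i2 in auto)
  have "esp_iso (fst \<sigma>) (fst \<tau>) \<phi>"
    unfolding esp_iso_def using m1 m2 1 2 by blast
  then show ?thesis using 5 unfolding prestrat_iso_def by (auto simp: split_def)
qed

text \<open>The bridge between strategies and labelled structures: an isomorphism proved for one
  convenient choice of separated names holds for every such choice.\<close>

lemma LSp_iso_iff:
  assumes \<sigma>: "prestrategy (A\<^sup>\<bottom> \<parallel> B) \<sigma>" and \<tau>: "prestrategy (A\<^sup>\<bottom> \<parallel> B) \<tau>" and s: "sep p A q B"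
  shows "LSp p q A B \<sigma> \<approx> LSp p q A B \<tau> \<longleftrightarrow> \<sigma> \<cong> \<tau>"
  unfolding LSp_def
  using LS_prestrat_iso[OF \<sigma> \<tau>] prestrat_iso_of_LS[OF \<sigma> \<tau>, of "tag p q"] inj_tag[OF s] by auto

text \<open>The last hypothesis says that configurations of \<open>T\<close> project to
  configurations of \<open>C\<close>. Applied to the prime of an event it shows that a cause in
  \<open>C\<close> of the move played there is played below that event; so \<open>C\<close>
  contributes no order that \<open>T\<close> lacks.\<close>

lemma join_absorb_game:
  assumes C: "es C" and T: "es T" and r: "inj_on r (Ev C)" and L: "r ` Ev C \<subseteq> L"
    and valid: "valid (LS L T f)" and f: "\<And>y. y \<in> configs T \<Longrightarrow> inj_on f y"
    and k: "\<And>y. y \<in> configs T \<Longrightarrow> {c \<in> Ev C. r c \<in> f ` y} \<in> configs C"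
  shows "LS (r ` Ev C) C r \<bowtie> LS L T f \<approx> LS L T f"
proof (rule join_absorb[where k = "\<lambda>y. {c \<in> Ev C. r c \<in> f ` y}"])
  interpret C: es C by fact
  interpret T: es T by fact
  show "valid (LS (r ` Ev C) C r)" by (rule C.valid_LS) (use C.configsD(1) r inj_on_subset in blast)+
  show "valid (LS L T f)" by fact
  show "Lbs (LS (r ` Ev C) C r) \<subseteq> Lbs (LS L T f)" using L by simp
  fix y assume "y \<in> St (LS L T f)"
  then have y: "y \<in> configs T" by simp
  show "{c \<in> Ev C. r c \<in> f ` y} \<in> St (LS (r ` Ev C) C r) \<and>
     lab (LS (r ` Ev C) C r) {c \<in> Ev C. r c \<in> f ` y} = lab (LS L T f) y \<inter> Lbs (LS (r ` Ev C) C r) \<and>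
     ord (LS (r ` Ev C) C r) {c \<in> Ev C. r c \<in> f ` y} \<subseteq> ord (LS L T f) y"
  proof (intro conjI)
    show "ord (LS (r ` Ev C) C r) {c \<in> Ev C. r c \<in> f ` y} \<subseteq> ord (LS L T f) y"
    proof (intro subrelI)
      fix u v assume "(u, v) \<in> ord (LS (r ` Ev C) C r) {c \<in> Ev C. r c \<in> f ` y}"
      then obtain c c' t t' where c: "(c, c') \<in> Le C" "c' \<in> Ev C" "u = r c" "v = r c'" and t: "t \<in> y" "t' \<in> y"
         "r c = f t" "r c' = f t'" by auto
      have t': "t' \<in> Ev T" using T.configsD(1)[OF y] t by blast
      have "c' \<in> {c \<in> Ev C. r c \<in> f ` T.below t'}" using c t T.below_self[OF t'] by auto
      then have "c \<in> {c \<in> Ev C. r c \<in> f ` T.below t'}"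
        using C.configsD(4)[OF k[OF T.below_config[OF t']] _ c(1)] by blast
      then obtain w where w: "w \<in> T.below t'" "r c = f w" by blast
      then have "w \<in> y" using T.below_subset[OF y t(2)] by blast
      then have "w = t" using inj_onD[OF f[OF y]] w t by simp
      then show "(u, v) \<in> ord (LS L T f) y" using w c t by (auto simp: T.below_def)
    qed
    show "lab (LS (r ` Ev C) C r) {c \<in> Ev C. r c \<in> f ` y} = lab (LS L T f) y \<inter> Lbs (LS (r ` Ev C) C r)"
    proof -
      have "r ` {c \<in> Ev C. r c \<in> Y} = Y \<inter> r ` Ev C" for Y by auto
      then show ?thesis by simp
    qed
  qed (use k[OF y] in simp)
next
  fix x y assume "x \<in> St (LS (r ` Ev C) C r)" "y \<in> St (LS L T f)"
    "lab (LS (r ` Ev C) C r) x = lab (LS L T f) y \<inter> Lbs (LS (r ` Ev C) C r)"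
  then have x: "x \<subseteq> Ev C" "r ` x = f ` y \<inter> r ` Ev C" using es.configsD(1)[OF C] by auto
  show "x = {c \<in> Ev C. r c \<in> f ` y}"
    using x r by (auto dest: inj_onD)
qed auto

section \<open>Composition\<close>

lemma outer_events_eq: "outer_events A C = Tag False ` Ev A \<union> Tag True ` Tag True ` Ev C"
  by (simp add: outer_events_def image_comp)

lemma inj_par_map:
  assumes f: "inj_on f x" and g: "inj_on g y" shows "inj_on (par_map f g) (duo x y)"
  by (rule inj_onI) (auto dest: inj_onD[OF f] inj_onD[OF g])

lemma port_part:
  assumes "b \<subseteq> Y" "c \<subseteq> X" "inj_on r X" "q ` Y \<inter> r ` X = {}"
  shows "{e \<in> X. r e \<in> q ` b \<union> r ` c} = c"
proof (intro equalityI subsetI)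
  fix e assume e: "e \<in> {e \<in> X. r e \<in> q ` b \<union> r ` c}"
  then have "r e \<notin> q ` b" using assms(1,4) by blast
  then obtain e' where "e' \<in> c" "r e = r e'" using e by blast
  then show "e \<in> c" using e inj_onD[OF assms(3), of e e'] assms(2) by blast
qed (use assms(2) in blast)

lemma inj_assoc: "inj_on assoc_map (duo (duo X Y) Z)"
  by (rule inj_on_inverseI[where g = "\<lambda>e. case e of Tag False a \<Rightarrow> Tag False (Tag False a) |
      Tag True (Tag False b) \<Rightarrow> Tag False (Tag True b) | Tag True (Tag True c) \<Rightarrow> Tag True c"]) auto

lemma assoc_image: "assoc_map ` duo (duo X Y) Z = duo X (duo Y Z)"
  by (simp add: image_Un image_image Un_assoc)

locale composable =
  fixes A B C :: "'a ev esp" and \<sigma> \<tau> :: "'a prestrat"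
  assumes A: "game A" and B: "game B" and C: "game C"
    and \<sigma>: "prestrategy (A\<^sup>\<bottom> \<parallel> B) \<sigma>" and \<tau>: "prestrategy (B\<^sup>\<bottom> \<parallel> C) \<tau>"
begin

abbreviation "\<sigma>' \<equiv> assoc_map \<circ> par_map (snd \<sigma>) id"
abbreviation "\<tau>' \<equiv> par_map id (snd \<tau>)"
abbreviation "W \<equiv> duo (Ev A) (duo (Ev B) (Ev C))"

lemma \<sigma>_image: "par_map (snd \<sigma>) id ` duo x c = duo (snd \<sigma> ` x) c"
  by (simp add: image_Un image_image)

lemma \<tau>_image: "par_map id (snd \<tau>) ` duo a y = duo a (snd \<tau> ` y)"
  by (simp add: image_Un image_image)

lemma \<sigma>_config:
  assumes "x \<in> configs (fst \<sigma>)"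
  obtains a b where "snd \<sigma> ` x = duo a b" "a \<in> configs A" "b \<in> configs B"
  using prestrategyD(4)[OF \<sigma> assms] configs_par_game[of "A\<^sup>\<bottom>" B] A B by auto

lemma \<tau>_config:
  assumes "y \<in> configs (fst \<tau>)"
  obtains b c where "snd \<tau> ` y = duo b c" "b \<in> configs B" "c \<in> configs C"
  using prestrategyD(4)[OF \<tau> assms] configs_par_game[of "B\<^sup>\<bottom>" C] B C by auto

lemma \<sigma>_Ev: "snd \<sigma> ` Ev (fst \<sigma>) \<subseteq> duo (Ev A) (Ev B)"
  using prestrategyD(3)[OF \<sigma>] by auto

lemma \<tau>_Ev: "snd \<tau> ` Ev (fst \<tau>) \<subseteq> duo (Ev B) (Ev C)"
  using prestrategyD(3)[OF \<tau>] by auto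

lemma es_SC: "es (fst \<sigma> \<parallel> C)" and es_AT: "es (A \<parallel> fst \<tau>)"
  using prestrategyD(2)[OF \<sigma>] prestrategyD(2)[OF \<tau>] game_es[OF A] game_es[OF C] es_par by blast+

lemma \<sigma>'_image: "\<sigma>' ` duo x c = assoc_map ` duo (snd \<sigma> ` x) c"
  unfolding image_comp[symmetric] \<sigma>_image ..

lemma \<sigma>'_Ev: "\<sigma>' ` Ev (fst \<sigma> \<parallel> C) \<subseteq> W"
proof -
  have "duo (snd \<sigma> ` Ev (fst \<sigma>)) (Ev C) \<subseteq> duo (duo (Ev A) (Ev B)) (Ev C)"
    using \<sigma>_Ev by (intro Un_mono image_mono) simp_all
  from image_mono[OF this, of assoc_map] show ?thesis
    unfolding par_simps(1) \<sigma>'_image assoc_image .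
qed

lemma \<tau>'_Ev: "\<tau>' ` Ev (A \<parallel> fst \<tau>) \<subseteq> W"
  unfolding par_simps(1) \<tau>_image using \<tau>_Ev by (intro Un_mono image_mono) simp_all

lemma \<sigma>'_inj:
  assumes "x \<in> configs (fst \<sigma> \<parallel> C)" shows "inj_on \<sigma>' x"
proof -
  from assms obtain y c where x: "x = duo y c" "y \<in> configs (fst \<sigma>)" "c \<in> configs C"
    unfolding configs_par[OF prestrategyD(2)[OF \<sigma>] game_es[OF C]] by blast
  obtain a b where ab: "snd \<sigma> ` y = duo a b" using \<sigma>_config[OF x(2)] .
  have "inj_on (par_map (snd \<sigma>) id) x"
    unfolding x(1) by (rule inj_par_map[OF prestrategyD(5)[OF \<sigma> x(2)] inj_on_id])
  moreover have "inj_on assoc_map (par_map (snd \<sigma>) id ` x)"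
    unfolding x(1) \<sigma>_image ab by (rule inj_assoc)
  ultimately show ?thesis by (rule comp_inj_on)
qed

lemma \<tau>'_inj:
  assumes "x \<in> configs (A \<parallel> fst \<tau>)" shows "inj_on \<tau>' x"
proof -
  from assms obtain a y where x: "x = duo a y" "a \<in> configs A" "y \<in> configs (fst \<tau>)"
    unfolding configs_par[OF game_es[OF A] prestrategyD(2)[OF \<tau>]] by blast
  show ?thesis
    unfolding x(1) by (rule inj_par_map[OF inj_on_id prestrategyD(5)[OF \<tau> x(3)]])
qed

abbreviation "R \<equiv> fst (strat_comp A C \<tau> \<sigma>)"
abbreviation "mm \<equiv> meet_map (fst \<sigma> \<parallel> C) \<sigma>' (A \<parallel> fst \<tau>)"

lemma snd_comp: "snd (strat_comp A C \<tau> \<sigma>) = outer_map \<circ> mm"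
  by (simp add: strat_comp_def interaction_map_def split_def Let_def)

lemma R_simps:
  "Ev R = {e \<in> Ev (meet_es (fst \<sigma> \<parallel> C) \<sigma>' (A \<parallel> fst \<tau>) \<tau>'). mm e \<in> outer_events A C}"
  "Le R = Le (meet_es (fst \<sigma> \<parallel> C) \<sigma>' (A \<parallel> fst \<tau>) \<tau>') \<inter> Ev R \<times> Ev R"
  "Con R = {X \<in> Con (meet_es (fst \<sigma> \<parallel> C) \<sigma>' (A \<parallel> fst \<tau>) \<tau>'). X \<subseteq> Ev R}"
  "pol R = restrict (pol (A\<^sup>\<bottom> \<parallel> C) \<circ> (outer_map \<circ> mm)) (Ev R)"
  by (simp_all add: strat_comp_def interaction_map_def interaction_es_def split_def Let_def)

lemma meet_restrict:
  assumes "inj_on g W"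
  shows "meet_restrict (fst \<sigma> \<parallel> C) (A \<parallel> fst \<tau>) \<sigma>' \<tau>' g W R (outer_events A C)"
  proof (unfold_locales)
  show "event_structure (fst \<sigma> \<parallel> C)" "event_structure (A \<parallel> fst \<tau>)" using es_SC es_AT by (simp_all add: es_def)
qed (fact \<sigma>'_inj \<tau>'_inj \<sigma>'_Ev \<tau>'_Ev assms R_simps)+

lemma outer_map_outer: "w \<in> outer_events A C \<Longrightarrow> outer_map w \<in> duo (Ev A) (Ev C)"
  by (auto simp: outer_events_eq)

lemma inj_outer: "inj_on outer_map (outer_events A C)"
  by (auto simp: outer_events_eq inj_on_def)

theorem prestrategy_comp: "prestrategy (A\<^sup>\<bottom> \<parallel> C) (strat_comp A C \<tau> \<sigma>)"
proof -
  \<comment> \<open>No synchronisation under new names takes place here, so the moves may name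
    themselves.\<close>
  interpret meet_restrict "fst \<sigma> \<parallel> C" "A \<parallel> fst \<tau>" \<sigma>' \<tau>' id W R "outer_events A C"
    by (rule meet_restrict) simp
  show ?thesis
  proof (rule prestrategyI)
    show "game R" using es_R by (simp add: game_def es_def R_simps(4))
    show "snd (strat_comp A C \<tau> \<sigma>) s \<in> Ev (A\<^sup>\<bottom> \<parallel> C)" if "s \<in> Ev R" for s
      using that outer_map_outer unfolding R_simps(1) snd_comp by auto
    show "pol (A\<^sup>\<bottom> \<parallel> C) (snd (strat_comp A C \<tau> \<sigma>) s) = pol R s" if "s \<in> Ev R" for s
      using that unfolding R_simps(4) snd_comp by simp
    fix z assume z: "z \<in> configs R"
    have o: "mm ` z \<subseteq> outer_events A C" using config_ME(2)[OF z] R_simps(1) by blast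
    obtain x where x: "x \<in> configs (fst \<sigma> \<parallel> C)" "mm ` z = \<sigma>' ` x \<inter> outer_events A C"
      using meet_map_config[OF z] by blast
    from x(1) obtain y c where y: "x = duo y c" "y \<in> configs (fst \<sigma>)" "c \<in> configs C"
      unfolding configs_par[OF prestrategyD(2)[OF \<sigma>] game_es[OF C]] by blast
    obtain a b where ab: "snd \<sigma> ` y = duo a b" "a \<in> configs A" "b \<in> configs B" using \<sigma>_config[OF y(2)] .
    have sub: "a \<subseteq> Ev A" "c \<subseteq> Ev C"
      using es.configsD(1)[OF game_es[OF A] ab(2)] es.configsD(1)[OF game_es[OF C] y(3)] by auto
    have "mm ` z = duo a (duo b c) \<inter> outer_events A C"
      unfolding x(2) y(1) \<sigma>'_image ab(1) assoc_image ..
    also have "\<dots> = Tag False ` a \<union> Tag True ` Tag True ` c"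
      using sub by (auto simp: outer_events_eq)
    finally have "snd (strat_comp A C \<tau> \<sigma>) ` z = duo a c"
      unfolding snd_comp image_comp[symmetric] by (simp add: image_Un image_image)
    moreover have "duo a c \<in> configs (A\<^sup>\<bottom> \<parallel> C)"
      using config_par_iff[of "A\<^sup>\<bottom>" C] A C ab(2) y(3) by simp
    moreover have "inj_on (snd (strat_comp A C \<tau> \<sigma>)) z"
      unfolding snd_comp
      by (rule comp_inj_on[OF meet_map_inj[OF z] inj_on_subset[OF inj_outer o]])
    ultimately show "snd (strat_comp A C \<tau> \<sigma>) ` z \<in> configs (A\<^sup>\<bottom> \<parallel> C) \<and> inj_on (snd (strat_comp A C \<tau> \<sigma>)) z"
      by simp
  qed
qed

text \<open>Each leg of the interaction is a strategy side by side with a copy of an outer game.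
  Rearranging the four factors lets each copy meet the strategy that already plays on its game. The
  names are pairwise separated so that the outer games do not synchronise with each other, even when
  they coincide.\<close>

theorem LSp_comp:
  assumes pq: "sep p A q B" and pr: "sep p A r C" and qr: "sep q B r C"
  shows "LSp p r A C (strat_comp A C \<tau> \<sigma>) \<approx> hide (q ` Ev B) (LSp p q A B \<sigma> \<bowtie> LSp q r B C \<tau>)"
proof -
  let ?g = "tag p (tag q r)"
  let ?P = "p ` Ev A" and ?Q = "q ` Ev B" and ?R = "r ` Ev C"
  have dis: "?P \<inter> ?Q = {}" "?P \<inter> ?R = {}" "?Q \<inter> ?R = {}"
    and inj: "inj_on p (Ev A)" "inj_on q (Ev B)" "inj_on r (Ev C)"
    using pq pr qr by (auto simp: sep_def)
  have "inj_on (tag p (tag q r)) (duo (Ev A) (Ev (B \<parallel> C)))"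
    by (rule inj_tag) (use inj dis inj_tag[OF qr] in \<open>auto simp: sep_def image_Un image_image\<close>)
  then have g: "inj_on ?g W" by simp
  interpret meet_restrict "fst \<sigma> \<parallel> C" "A \<parallel> fst \<tau>" \<sigma>' \<tau>' ?g W R "outer_events A C"
    by (rule meet_restrict[OF g])
  have gW: "?g ` W = ?P \<union> (?Q \<union> ?R)" by (simp add: image_Un image_image)
  have H: "H = ?Q"
  proof -
    have "W - outer_events A C = Tag True ` Tag False ` Ev B" by (auto simp: outer_events_eq)
    then show ?thesis unfolding H_def by (simp add: image_image)
  qed
  have V: "?g ` (W \<inter> outer_events A C) = ?P \<union> ?R"
  proof -
    have "W \<inter> outer_events A C = Tag False ` Ev A \<union> Tag True ` Tag True ` Ev C" by (auto simp: outer_events_eq)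
    then show ?thesis by (simp add: image_Un image_image)
  qed
  note es\<sigma> = prestrategyD(2)[OF \<sigma>] and es\<tau> = prestrategyD(2)[OF \<tau>] and esA = game_es[OF A] and esC = game_es[OF C]
  have "LSp p r A C (strat_comp A C \<tau> \<sigma>) \<approx> LS (?P \<union> ?R) R (\<lambda>e. ?g (mm e))"
    unfolding LSp_def
  proof (rule LS_cong[OF es_R])
    fix e assume "e \<in> Ev R"
    then have "mm e \<in> outer_events A C" using R_simps(1) by simp
    then show "tag p r (snd (strat_comp A C \<tau> \<sigma>) e) = ?g (mm e)"
      unfolding snd_comp by (auto simp: outer_events_eq)
  qed
  also have "\<dots> \<approx> hide ?Q (LS (?g ` W) (fst \<sigma> \<parallel> C) (\<lambda>s. ?g (\<sigma>' s)) \<bowtie> LS (?g ` W) (A \<parallel> fst \<tau>) (\<lambda>t. ?g (\<tau>' t)))"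
    using LS_restrict unfolding V H .
  also have "\<dots> \<approx> hide ?Q (LSp p q A B \<sigma> \<bowtie> LSp q r B C \<tau>)"
  proof (rule hide_cong)
    let ?X = "LSp p q A B \<sigma>" and ?Y = "LSp q r B C \<tau>" and ?A = "LS ?P A p" and ?C = "LS ?R C r"
    have vX: "valid ?X" and vY: "valid ?Y" using \<sigma> \<tau> pq qr by auto
    have vA: "valid ?A" by (rule es.valid_LS[OF esA subset_refl inj_on_subset[OF inj(1) es.configsD(1)[OF esA]]])
    have vC: "valid ?C" by (rule es.valid_LS[OF esC subset_refl inj_on_subset[OF inj(3) es.configsD(1)[OF esC]]])
    have ev\<sigma>: "snd \<sigma> s \<in> duo (Ev A) (Ev B)" if "s \<in> Ev (fst \<sigma>)" for s using \<sigma>_Ev that by blast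
    have ev\<tau>: "snd \<tau> s \<in> duo (Ev B) (Ev C)" if "s \<in> Ev (fst \<tau>)" for s using \<tau>_Ev that by blast
    have l1: "?g (\<sigma>' (Tag False s)) = tag p q (snd \<sigma> s)" if "s \<in> Ev (fst \<sigma>)" for s
      using ev\<sigma>[OF that] by auto
    have l2: "?g (\<tau>' (Tag True s)) = tag q r (snd \<tau> s)" for s by simp
    have in1: "tag p q (snd \<sigma> s) \<in> ?P \<union> ?Q" if "s \<in> Ev (fst \<sigma>)" for s using ev\<sigma>[OF that] by auto
    have in2: "tag q r (snd \<tau> s) \<in> ?Q \<union> ?R" if "s \<in> Ev (fst \<tau>)" for s using ev\<tau>[OF that] by auto
    have i1: "inj_on (\<lambda>s. ?g (\<sigma>' s)) x" if "x \<in> configs (fst \<sigma> \<parallel> C)" for x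
    proof -
      have "\<sigma>' ` x \<subseteq> W" using es.configsD(1)[OF es_SC that] \<sigma>'_Ev by blast
      from comp_inj_on[OF \<sigma>'_inj[OF that] inj_on_subset[OF g this]] show ?thesis by (simp add: comp_def)
    qed
    have i2: "inj_on (\<lambda>s. ?g (\<tau>' s)) x" if "x \<in> configs (A \<parallel> fst \<tau>)" for x
    proof -
      have "\<tau>' ` x \<subseteq> W" using es.configsD(1)[OF es_AT that] \<tau>'_Ev by blast
      from comp_inj_on[OF \<tau>'_inj[OF that] inj_on_subset[OF g this]] show ?thesis by (simp add: comp_def)
    qed
    have "LS (?g ` W) (fst \<sigma> \<parallel> C) (\<lambda>s. ?g (\<sigma>' s)) \<approx>
       LS (?P \<union> ?Q) (fst \<sigma>) (\<lambda>s. ?g (\<sigma>' (Tag False s))) \<bowtie> LS ?R C (\<lambda>s. ?g (\<sigma>' (Tag True s)))"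
    proof (rule LS_par[OF es\<sigma> esC _ _ _ _ i1])
      show "(\<lambda>s. ?g (\<sigma>' (Tag False s))) ` Ev (fst \<sigma>) \<subseteq> ?P \<union> ?Q"
        by (rule image_subsetI) (simp only: l1 in1)
    qed (use gW dis in auto)
    also have "\<dots> \<approx> ?X \<bowtie> ?C"
      unfolding LSp_def by (intro join_cong LS_cong[OF es\<sigma>] LS_cong[OF esC] l1) simp_all
    finally have 1: "LS (?g ` W) (fst \<sigma> \<parallel> C) (\<lambda>s. ?g (\<sigma>' s)) \<approx> ?X \<bowtie> ?C" .
    have "LS (?g ` W) (A \<parallel> fst \<tau>) (\<lambda>s. ?g (\<tau>' s)) \<approx>
       LS ?P A (\<lambda>s. ?g (\<tau>' (Tag False s))) \<bowtie> LS (?Q \<union> ?R) (fst \<tau>) (\<lambda>s. ?g (\<tau>' (Tag True s)))"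
    proof (rule LS_par[OF esA es\<tau> _ _ _ _ i2])
      show "(\<lambda>s. ?g (\<tau>' (Tag True s))) ` Ev (fst \<tau>) \<subseteq> ?Q \<union> ?R"
        by (rule image_subsetI) (simp only: l2 in2)
    qed (use gW dis in auto)
    also have "\<dots> \<approx> ?A \<bowtie> ?Y"
      unfolding LSp_def by (intro join_cong LS_cong[OF es\<tau>] LS_cong[OF esA] l2) simp_all
    finally have 2: "LS (?g ` W) (A \<parallel> fst \<tau>) (\<lambda>s. ?g (\<tau>' s)) \<approx> ?A \<bowtie> ?Y" .
    \<comment> \<open>The copies of \<open>C\<close> and \<open>A\<close> adjoined by the interaction are absorbed, since \<open>\<tau>\<close> and \<open>\<sigma>\<close> already
      visit configurations of these games.\<close>
    have CY: "?C \<bowtie> ?Y \<approx> ?Y"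
      unfolding LSp_def
    proof (rule join_absorb_game[OF esC es\<tau> inj(3)])
      fix y assume y: "y \<in> configs (fst \<tau>)"
      obtain b c where bc: "snd \<tau> ` y = duo b c" "b \<in> configs B" "c \<in> configs C" using \<tau>_config[OF y] .
      have "(\<lambda>s. tag q r (snd \<tau> s)) ` y = tag q r ` duo b c" unfolding bc(1)[symmetric] by (simp add: image_image)
      also have "\<dots> = q ` b \<union> r ` c" by simp
      finally have "{e \<in> Ev C. r e \<in> (\<lambda>s. tag q r (snd \<tau> s)) ` y} = c"
        using port_part[OF es.configsD(1)[OF game_es[OF B] bc(2)] es.configsD(1)[OF esC bc(3)] inj(3) dis(3)]
        by simp
      then show "{e \<in> Ev C. r e \<in> (\<lambda>s. tag q r (snd \<tau> s)) ` y} \<in> configs C" using bc by simp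
    qed (use vY inj_tag[OF qr] prestrategy_inj_comp[OF \<tau>] in \<open>auto simp: LSp_def\<close>)
    have AX: "?A \<bowtie> ?X \<approx> ?X"
      unfolding LSp_def
    proof (rule join_absorb_game[OF esA es\<sigma> inj(1)])
      fix y assume y: "y \<in> configs (fst \<sigma>)"
      obtain b c where bc: "snd \<sigma> ` y = duo b c" "b \<in> configs A" "c \<in> configs B" using \<sigma>_config[OF y] .
      have "(\<lambda>s. tag p q (snd \<sigma> s)) ` y = tag p q ` duo b c" unfolding bc(1)[symmetric] by (simp add: image_image)
      also have "\<dots> = p ` b \<union> q ` c" by simp
      finally have "{e \<in> Ev A. p e \<in> (\<lambda>s. tag p q (snd \<sigma> s)) ` y} = b"
        using port_part[OF es.configsD(1)[OF game_es[OF B] bc(3)] es.configsD(1)[OF esA bc(2)] inj(1), of q] dis(1)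
        by (simp add: Un_commute Int_commute)
      then show "{e \<in> Ev A. p e \<in> (\<lambda>s. tag p q (snd \<sigma> s)) ` y} \<in> configs A" using bc by simp
    qed (use vX inj_tag[OF pq] prestrategy_inj_comp[OF \<sigma>] in \<open>auto simp: LSp_def\<close>)
    have "LS (?g ` W) (fst \<sigma> \<parallel> C) (\<lambda>s. ?g (\<sigma>' s)) \<bowtie> LS (?g ` W) (A \<parallel> fst \<tau>) (\<lambda>t. ?g (\<tau>' t))
       \<approx> (?X \<bowtie> ?C) \<bowtie> (?A \<bowtie> ?Y)" by (rule join_cong[OF 1 2])
    also have "\<dots> \<approx> (?X \<bowtie> ?A) \<bowtie> (?C \<bowtie> ?Y)" by (rule join_medial[OF vX vC vA vY])
    also have "\<dots> \<approx> (?A \<bowtie> ?X) \<bowtie> (?C \<bowtie> ?Y)" by (rule join_cong[OF join_comm ls_iso_refl])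
    also have "\<dots> \<approx> ?X \<bowtie> ?Y" by (rule join_cong[OF AX CY])
    finally show "LS (?g ` W) (fst \<sigma> \<parallel> C) (\<lambda>s. ?g (\<sigma>' s)) \<bowtie> LS (?g ` W) (A \<parallel> fst \<tau>) (\<lambda>t. ?g (\<tau>' t)) \<approx> ?X \<bowtie> ?Y" .
  qed
  finally show ?thesis .
qed

end

section \<open>Copycat\<close>

text \<open>Crossing from one copy of a game to another happens at a move of suitable polarity; the
  two ends may lie causally away from this move.\<close>

definition via :: "polarity \<Rightarrow> 'e esp \<Rightarrow> 'e \<Rightarrow> 'e \<Rightarrow> bool" where
  "via s A a b \<longleftrightarrow> (\<exists>c. (a, c) \<in> Le A \<and> (c, b) \<in> Le A \<and> pol A c = s)"

text \<open>
  Causality between copies of a game, indexed by levels: copycat forwards positive moves to higher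
  levels and negative ones to lower levels. Two levels describe copycat, three its composite with
  itself.
\<close>

definition xle :: "'e esp \<Rightarrow> 'i::linorder \<Rightarrow> 'e \<Rightarrow> 'i \<Rightarrow> 'e \<Rightarrow> bool" where
  "xle A i a j b \<longleftrightarrow> (a, b) \<in> Le A \<and> (i = j \<or> i < j \<and> via Pos A a b \<or> j < i \<and> via Neg A a b)"

text \<open>\<open>P i\<close> names the moves of level \<open>i\<close> and \<open>X i\<close> is
  the configuration there. One formula for all sets of levels allows copycat and its composite with
  itself to be compared directly.\<close>

definition gord :: "'e esp \<Rightarrow> ('i::linorder \<Rightarrow> 'e \<Rightarrow> 'l) \<Rightarrow> ('i \<Rightarrow> 'e set) \<Rightarrow> 'i set \<Rightarrow> 'l rel" where
  "gord A P X I = (\<Union>i\<in>I. \<Union>j\<in>I. {(P i a, P j b) | a b. a \<in> X i \<and> b \<in> X j \<and> xle A i a j b})"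

lemma gord_iff: "(u, v) \<in> gord A P X I \<longleftrightarrow>
   (\<exists>i a j b. u = P i a \<and> v = P j b \<and> i \<in> I \<and> j \<in> I \<and> a \<in> X i \<and> b \<in> X j \<and> xle A i a j b)"
  unfolding gord_def by blast

text \<open>The levels of copycat are indexed by the tags, with \<open>False\<close>, the dual copy,
  below \<open>True\<close>.\<close>

definition lev :: "'b \<Rightarrow> 'b \<Rightarrow> bool \<Rightarrow> 'b" where
  "lev u v i = (if i then v else u)"

lemma lev_simps [simp]: "lev u v False = u" "lev u v True = v"
  by (simp_all add: lev_def)

lemma via_trans: 
  assumes "es A" shows "via s A a b \<Longrightarrow> (b, c) \<in> Le A \<Longrightarrow> via s A a c" "(c, a) \<in> Le A \<Longrightarrow> via s A a b \<Longrightarrow> via s A c b"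
  unfolding via_def using es.Le_trans[OF assms] by blast+

text \<open>The intermediate level may lie outside the interval between \<open>i\<close> and
  \<open>k\<close>. But if \<open>i < k\<close> then one of the two steps goes up, and its crossing
  move lies causally between \<open>a\<close> and \<open>c\<close>; dually if
  \<open>k < i\<close>.\<close>

lemma xle_trans:
  assumes "es A" "xle A i a j b" "xle A j b k c" shows "xle A i a k c"
proof -
  have ab: "(a, b) \<in> Le A" and bc: "(b, c) \<in> Le A" using assms by (simp_all add: xle_def)
  have ac: "(a, c) \<in> Le A" by (rule es.Le_trans[OF assms(1) ab bc])
  have "via s A a b \<Longrightarrow> via s A a c" "via s A b c \<Longrightarrow> via s A a c" for s
    using via_trans(1)[OF assms(1) _ bc] via_trans(2)[OF assms(1) ab] by blast+
  then have v: "i = j \<or> i < j \<and> via Pos A a c \<or> j < i \<and> via Neg A a c"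
    "j = k \<or> j < k \<and> via Pos A a c \<or> k < j \<and> via Neg A a c"
    using assms(2,3) unfolding xle_def by blast+
  show ?thesis unfolding xle_def
    by (cases i k rule: linorder_cases) (use ac v in auto)
qed

lemma via_same: "es A \<Longrightarrow> via s A a a \<Longrightarrow> pol A a = s"
  unfolding via_def using es.Le_antisym[of A] by blast

text \<open>Once \<open>a = b\<close>, a crossing move between different levels can only be
  \<open>a\<close> itself; crossing in both directions would make \<open>a\<close> both positive and
  negative.\<close>

lemma xle_antisym:
  assumes "es A" "xle A i a j b" "xle A j b i a" shows "i = j \<and> a = b"
proof -
  have ab: "a = b" by (rule es.Le_antisym[OF assms(1)]) (use assms(2,3) in \<open>simp_all add: xle_def\<close>)
  have "via Pos A a a \<Longrightarrow> via Neg A a a \<Longrightarrow> False" using via_same[OF assms(1), of Pos a] via_same[OF assms(1), of Neg a] by simp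
  then show ?thesis using assms(2,3) unfolding xle_def ab by auto
qed

lemma xle_refl: "es A \<Longrightarrow> a \<in> Ev A \<Longrightarrow> xle A i a i a"
  by (simp add: xle_def es.Le_refl)

text \<open>Expanding the four blocks removes the index type, so the copycat order indexed by
  \<open>bool\<close> can be identified with a two-level slice of an order indexed by
  \<open>nat\<close>.\<close>

lemma gord_pair:
  assumes "i < j"
  shows "gord A P X {i, j} =
    {(P i a, P i b) | a b. a \<in> X i \<and> b \<in> X i \<and> (a, b) \<in> Le A} \<union>
    {(P j a, P j b) | a b. a \<in> X j \<and> b \<in> X j \<and> (a, b) \<in> Le A} \<union>
    {(P i a, P j b) | a b. a \<in> X i \<and> b \<in> X j \<and> (a, b) \<in> Le A \<and> via Pos A a b} \<union>
    {(P j a, P i b) | a b. a \<in> X j \<and> b \<in> X i \<and> (a, b) \<in> Le A \<and> via Neg A a b}"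
proof -
  have [simp]: "xle A i a i b = ((a, b) \<in> Le A)" "xle A j a j b = ((a, b) \<in> Le A)"
    "xle A i a j b = ((a, b) \<in> Le A \<and> via Pos A a b)" "xle A j a i b = ((a, b) \<in> Le A \<and> via Neg A a b)" for a b
    using assms by (auto simp: xle_def)
  show ?thesis unfolding gord_def by (simp, blast)
qed

lemma gord_lev: "i < j \<Longrightarrow> gord A (lev (P i) (P j)) (lev (X i) (X j)) UNIV = gord A P X {i, j}"
  using gord_pair[of False True A "lev (P i) (P j)" "lev (X i) (X j)"] gord_pair[of i j A P X]
  by (simp add: UNIV_bool)

text \<open>The Scott order on configurations of a game: \<open>y\<close> arises from
  \<open>x\<close> by removing positive moves and adding negative ones.\<close>

definition scott :: "'e esp \<Rightarrow> 'e set \<Rightarrow> 'e set \<Rightarrow> bool" where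
  "scott A x y \<longleftrightarrow> x \<in> configs A \<and> y \<in> configs A \<and> (\<forall>a\<in>y. pol A a = Pos \<longrightarrow> a \<in> x) \<and> (\<forall>a\<in>x. pol A a = Neg \<longrightarrow> a \<in> y)"

text \<open>Copycat with its configurations in Scott form; \<open>p\<close> names the dual copy and
  \<open>q\<close> the other one.\<close>

definition cc :: "('e \<Rightarrow> 'l) \<Rightarrow> ('e \<Rightarrow> 'l) \<Rightarrow> 'e esp \<Rightarrow> ('e set \<times> 'e set, 'l) ls" where
  "cc p q A = \<lparr>St = {(x, y). scott A x y}, Sle = (\<lambda>(x, y) (x', y'). x \<subseteq> x' \<and> y \<subseteq> y'),
     Lbs = p ` Ev A \<union> q ` Ev A, lab = (\<lambda>(x, y). p ` x \<union> q ` y),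
     ord = (\<lambda>(x, y). gord A (lev p q) (lev x y) UNIV)\<rparr>"

lemma cc_simps [simp]:
  "(x, y) \<in> St (cc p q A) \<longleftrightarrow> scott A x y" "Sle (cc p q A) (x, y) (x', y') \<longleftrightarrow> x \<subseteq> x' \<and> y \<subseteq> y'"
  "Lbs (cc p q A) = p ` Ev A \<union> q ` Ev A" "lab (cc p q A) (x, y) = p ` x \<union> q ` y"
  "ord (cc p q A) (x, y) = gord A (lev p q) (lev x y) UNIV"
  by (simp_all add: cc_def)

subsection \<open>The event structure\<close>

lemma pol_cc: "a \<in> Ev A \<Longrightarrow> pol (A\<^sup>\<bottom> \<parallel> A) (Tag i a) = (if i then pol A a else opp (pol A a))"
  by (cases i) auto

lemma opp_eq_iff [simp]: "opp x = Pos \<longleftrightarrow> x = Neg" "opp x = Neg \<longleftrightarrow> x = Pos"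
  by (cases x; simp)+

text \<open>\<open>xle\<close> contains the generating pairs and is transitive, hence contains their
  closure. Conversely a crossing factors as a causal step to the crossing move, the copycat link at
  that move, and a causal step in the other copy.\<close>

lemma copycat_le_iff:
  assumes A: "es A"
  shows "(u, v) \<in> copycat_le A \<longleftrightarrow> (\<exists>i a j b. u = Tag i a \<and> v = Tag j b \<and> xle A i a j b)"
proof
  interpret A: es A by fact
  let ?B = "Le (A\<^sup>\<bottom> \<parallel> A) \<union>
      {(Tag (\<not> i) a, Tag i a) | i a. Tag i a \<in> Ev (A\<^sup>\<bottom> \<parallel> A) \<and> pol (A\<^sup>\<bottom> \<parallel> A) (Tag i a) = Pos}"
  {
    have *: "\<exists>i a j b. u = Tag i a \<and> v = Tag j b \<and> xle A i a j b" if "(u, v) \<in> ?B" for u v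
      using that
    proof
      assume "(u, v) \<in> Le (A\<^sup>\<bottom> \<parallel> A)"
      then show ?thesis unfolding Le_par by (auto simp: xle_def)
    next
      assume "(u, v) \<in> {(Tag (\<not> i) a, Tag i a) | i a. Tag i a \<in> Ev (A\<^sup>\<bottom> \<parallel> A) \<and> pol (A\<^sup>\<bottom> \<parallel> A) (Tag i a) = Pos}"
      then obtain i a where ia: "u = Tag (\<not> i) a" "v = Tag i a" "a \<in> Ev A" "pol (A\<^sup>\<bottom> \<parallel> A) (Tag i a) = Pos" by auto
      \<comment> \<open>Positive in \<open>A\<^sup>\<bottom> \<parallel> A\<close> means positive in
        \<open>A\<close> for the right copy but negative in \<open>A\<close> for the left
        one.\<close>
      then have p: "pol A a = (if i then Pos else Neg)" by (auto simp: pol_cc split: if_splits)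
      then have "via (if i then Pos else Neg) A a a" unfolding via_def using A.Le_refl[OF ia(3)] by blast
      then have "xle A (\<not> i) a i a" using A.Le_refl[OF ia(3)] by (cases i) (auto simp: xle_def)
      then show ?thesis using ia by blast
    qed
    assume "(u, v) \<in> copycat_le A"
    then have "(u, v) \<in> ?B\<^sup>+" by (simp add: copycat_le_def)
    then show "\<exists>i a j b. u = Tag i a \<and> v = Tag j b \<and> xle A i a j b"
    proof (induction rule: trancl_induct)
      case (base y)
      then show ?case by (rule *)
    next
      case (step y z)
      obtain i a j b where 1: "y = Tag i a" "z = Tag j b" "xle A i a j b" using *[OF step(2)] by blast
      obtain k c l d where 2: "u = Tag k c" "y = Tag l d" "xle A k c l d" using step(3) by blast
      have "xle A k c j b" by (rule xle_trans[OF A 2(3)]) (use 1 2 in simp)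
      then show ?case using 1 2 by blast
    qed
  next
    assume "\<exists>i a j b. u = Tag i a \<and> v = Tag j b \<and> xle A i a j b"
    then obtain i a j b where uv: "u = Tag i a" "v = Tag j b" and x: "xle A i a j b" by blast
    have le: "(Tag k c, Tag k d) \<in> ?B\<^sup>+" if "(c, d) \<in> Le A" for k c d
      using that by (cases k) auto
    have cr: "(Tag (\<not> k) c, Tag k c) \<in> ?B\<^sup>+" if "c \<in> Ev A" "pol A c = (if k then Pos else Neg)" for k c
    proof -
      have "pol (A\<^sup>\<bottom> \<parallel> A) (Tag k c) = Pos" "Tag k c \<in> Ev (A\<^sup>\<bottom> \<parallel> A)" using that by (cases k; auto simp: pol_cc)+
      then show ?thesis by (intro r_into_trancl UnI2) blast
    qed
    show "(u, v) \<in> copycat_le A"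
    proof (cases "i = j")
      case True
      then show ?thesis using x le uv by (simp add: copycat_le_def xle_def)
    next
      case False
      then have ij: "i = (\<not> j)" by simp
      have "via (if j then Pos else Neg) A a b" using x False by (cases i; cases j) (auto simp: xle_def)
      then obtain c where c: "(a, c) \<in> Le A" "(c, b) \<in> Le A" "pol A c = (if j then Pos else Neg)"
        unfolding via_def by blast
      then have "c \<in> Ev A" using A.Le_Ev by blast
      from le[OF c(1), of i] cr[OF this c(3)] le[OF c(2), of j] show ?thesis
        unfolding copycat_le_def uv ij by (meson trancl_trans)
    qed
  }
qed

lemma copycat_simps: "Ev (\<Gamma> A) = duo (Ev A) (Ev A)" "Le (\<Gamma> A) = copycat_le A" "pol (\<Gamma> A) = pol (A\<^sup>\<bottom> \<parallel> A)"
  "X \<in> Con (\<Gamma> A) \<longleftrightarrow> X \<subseteq> duo (Ev A) (Ev A) \<and> {e'. \<exists>e\<in>X. (e', e) \<in> copycat_le A} \<in> Con (A\<^sup>\<bottom> \<parallel> A)"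
  by (simp_all add: copycat_esp_def)

lemma game_copycat [simp]:
  assumes A: "game A" shows "game (\<Gamma> A)"
proof -
  interpret A: es A using game_es[OF A] .
  interpret P: es "A\<^sup>\<bottom> \<parallel> A" by (rule game_es) (simp add: A)
  note iff = copycat_le_iff[OF game_es[OF A]]
  let ?cl = "\<lambda>X. {e'. \<exists>e\<in>X. (e', e) \<in> copycat_le A}"
  have refl: "(e, e) \<in> copycat_le A" if "e \<in> duo (Ev A) (Ev A)" for e
  proof -
    from that obtain i a where "e = Tag i a" "a \<in> Ev A" by blast
    then show ?thesis unfolding iff using xle_refl[OF A.es_axioms, of a i] by blast
  qed
  have Ev: "e \<in> duo (Ev A) (Ev A) \<and> e' \<in> duo (Ev A) (Ev A)" if "(e, e') \<in> copycat_le A" for e e'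
  proof -
    from that obtain i a j b where *: "e = Tag i a" "e' = Tag j b" "xle A i a j b" unfolding iff by blast
    then have "a \<in> Ev A" "b \<in> Ev A" using A.Le_Ev by (auto simp: xle_def)
    then show ?thesis using * by (cases i; cases j) auto
  qed
  have tr: "(a, c) \<in> copycat_le A" if "(a, b) \<in> copycat_le A" "(b, c) \<in> copycat_le A" for a b c
    using that unfolding copycat_le_def by (rule trancl_trans)
  have "event_structure (\<Gamma> A)"
  proof (rule event_structureI)
    show "partial_order_on (Ev (\<Gamma> A)) (Le (\<Gamma> A))"
      unfolding order_on_defs copycat_simps
    proof (intro conjI)
      show "refl_on (duo (Ev A) (Ev A)) (copycat_le A)" using refl by (intro refl_onI)
      show "trans (copycat_le A)" using tr by (intro transI)
      show "antisym (copycat_le A)"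
      proof (rule antisymI)
        fix u v assume "(u, v) \<in> copycat_le A" "(v, u) \<in> copycat_le A"
        then obtain i a j b where "u = Tag i a" "v = Tag j b" "xle A i a j b" "xle A j b i a" unfolding iff by blast
        then show "u = v" using xle_antisym[OF A.es_axioms, of i a j b] by simp
      qed
      show "copycat_le A \<subseteq> duo (Ev A) (Ev A) \<times> duo (Ev A) (Ev A)" using Ev by (intro subrelI) blast
    qed
    show "{} \<in> Con (\<Gamma> A)" using P.Con_empty unfolding copycat_simps by simp
    show "finite X \<and> X \<subseteq> Ev (\<Gamma> A)" if "X \<in> Con (\<Gamma> A)" for X
    proof -
      have X: "X \<subseteq> duo (Ev A) (Ev A)" "?cl X \<in> Con (A\<^sup>\<bottom> \<parallel> A)" using that unfolding copycat_simps by simp_all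
      have "X \<subseteq> ?cl X" using refl X(1) by blast
      then show ?thesis using X(1) P.Con_finite[OF X(2)] finite_subset unfolding copycat_simps by blast
    qed
    \<comment> \<open>Consistency of a prime is inherited from the game: all causes of
      \<open>Tag j b\<close> lie in the two copies of the causes of \<open>b\<close>.\<close>
    have sing: "{e'. (e', e) \<in> copycat_le A} \<in> Con (A\<^sup>\<bottom> \<parallel> A)" if "e \<in> duo (Ev A) (Ev A)" for e
    proof -
      from that obtain j b where e: "e = Tag j b" "b \<in> Ev A" by auto
      have "duo (A.below b) (A.below b) \<in> Con (A\<^sup>\<bottom> \<parallel> A)"
        by (rule Con_parI) (use A.below_config[OF e(2)] A.configsD(2) in auto)
      moreover have "{e'. (e', e) \<in> copycat_le A} \<subseteq> duo (A.below b) (A.below b)"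
      proof
        fix e' assume "e' \<in> {e'. (e', e) \<in> copycat_le A}"
        then obtain i a where *: "e' = Tag i a" "xle A i a j b" using e unfolding iff by blast
        then have "a \<in> A.below b" by (simp add: xle_def A.below_def)
        then show "e' \<in> duo (A.below b) (A.below b)" using * by (cases i) auto
      qed
      ultimately show ?thesis by (rule P.Con_subset)
    qed
    show "finite {e'. (e', e) \<in> Le (\<Gamma> A)}" if "e \<in> Ev (\<Gamma> A)" for e
      using P.Con_finite[OF sing] that unfolding copycat_simps by simp
    show "{e} \<in> Con (\<Gamma> A)" if "e \<in> Ev (\<Gamma> A)" for e
      using sing[of e] that unfolding copycat_simps by simp
    show "Y \<in> Con (\<Gamma> A)" if "X \<in> Con (\<Gamma> A)" "Y \<subseteq> X" for X Y
    proof -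
      have "?cl Y \<subseteq> ?cl X" using that(2) by blast
      then show ?thesis using that P.Con_subset unfolding copycat_simps by blast
    qed
    show "X \<union> {e'} \<in> Con (\<Gamma> A)" if "X \<in> Con (\<Gamma> A)" "e \<in> X" "(e', e) \<in> Le (\<Gamma> A)" for X e e'
    proof -
      have "(e', e) \<in> copycat_le A" using that(3) unfolding copycat_simps .
      then have "?cl (X \<union> {e'}) = ?cl X" using that(2) tr by blast
      moreover have "e' \<in> duo (Ev A) (Ev A)" using Ev \<open>(e', e) \<in> copycat_le A\<close> by blast
      ultimately show ?thesis using that(1) unfolding copycat_simps by simp
    qed
  qed
  then show ?thesis using par_extensional[of "A\<^sup>\<bottom>" A] by (simp add: game_def copycat_simps)
qed

text \<open>Down-closure asks that a positive move on the right be preceded by its copy on the left,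
  and a negative move on the left by its copy on the right. Together with being a configuration on
  each side, these two conditions form the Scott order.\<close>

lemma configs_copycat:
  assumes A: "game A"
  shows "configs (\<Gamma> A) = {duo x y | x y. scott A x y}"
proof (intro equalityI subsetI)
  interpret A: es A using game_es[OF A] .
  interpret G: es "\<Gamma> A" by (rule game_es) (simp add: A)
  interpret P: es "A\<^sup>\<bottom> \<parallel> A" by (rule game_es) (simp add: A)
  note iff = copycat_le_iff[OF game_es[OF A]]
  {
    fix z assume z: "z \<in> configs (\<Gamma> A)"
    define x y where "x = inl z" and "y = inr z"
    have zE: "z \<subseteq> duo (Ev A) (Ev A)" using G.configsD(1)[OF z] by (simp add: copycat_simps)
    then have zxy: "z = duo x y" unfolding x_def y_def by (rule duo_split)
    have down: "e' \<in> z" if "e \<in> z" "(e', e) \<in> copycat_le A" for e e'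
      using G.configsD(4)[OF z that(1)] that(2) by (simp add: copycat_simps)
    have "{e'. \<exists>e\<in>z. (e', e) \<in> copycat_le A} = z"
    proof (intro equalityI subsetI)
      fix e assume e: "e \<in> z"
      then have "(e, e) \<in> copycat_le A" using G.Le_refl[of e] zE by (auto simp: copycat_simps)
      then show "e \<in> {e'. \<exists>e\<in>z. (e', e) \<in> copycat_le A}" using e by blast
    qed (use down in blast)
    then have "z \<in> Con (A\<^sup>\<bottom> \<parallel> A)" using G.configsD(2)[OF z] by (simp add: copycat_simps)
    moreover have "e' \<in> z" if "e \<in> z" "(e', e) \<in> Le (A\<^sup>\<bottom> \<parallel> A)" for e e'
      by (rule down[OF that(1)]) (use that(2) in \<open>auto simp: copycat_le_def\<close>)
    ultimately have "z \<in> configs (A\<^sup>\<bottom> \<parallel> A)" by (rule P.configsI)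
    then have xy: "x \<in> configs A" "y \<in> configs A" using config_par_iff[of "A\<^sup>\<bottom>" A x y] A zxy by simp_all
    have "a \<in> x" if a: "a \<in> y" "pol A a = Pos" for a
    proof -
      have "a \<in> Ev A" using A.configsD(1)[OF xy(2)] a by blast
      then have "xle A False a True a" using a A.Le_refl by (auto simp: xle_def via_def)
      then have "Tag False a \<in> z" using down[of "Tag True a" "Tag False a"] a zxy unfolding iff by blast
      then show ?thesis by (simp add: x_def inl_def)
    qed
    moreover have "a \<in> y" if a: "a \<in> x" "pol A a = Neg" for a
    proof -
      have "a \<in> Ev A" using A.configsD(1)[OF xy(1)] a by blast
      then have "xle A True a False a" using a A.Le_refl by (auto simp: xle_def via_def)
      then have "Tag True a \<in> z" using down[of "Tag False a" "Tag True a"] a zxy unfolding iff by blast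
      then show ?thesis by (simp add: y_def inr_def)
    qed
    ultimately have "scott A x y" using xy by (simp add: scott_def)
    then show "z \<in> {duo x y | x y. scott A x y}" using zxy by blast
  next
    fix z assume "z \<in> {duo x y | x y. scott A x y}"
    then obtain x y where z: "z = duo x y" and s: "scott A x y" by blast
    have xy: "x \<in> configs A" "y \<in> configs A" using s by (simp_all add: scott_def)
    have down: "e' \<in> z" if e: "e \<in> z" and le: "(e', e) \<in> copycat_le A" for e e'
    proof -
      from le obtain i a j b where ab: "e' = Tag i a" "e = Tag j b" "xle A i a j b" unfolding iff by blast
      have D: "d \<in> x \<Longrightarrow> (c, d) \<in> Le A \<Longrightarrow> c \<in> x" "d \<in> y \<Longrightarrow> (c, d) \<in> Le A \<Longrightarrow> c \<in> y" for c d
        using A.configsD(4)[OF xy(1)] A.configsD(4)[OF xy(2)] by blast+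
      have X: "b \<in> y \<Longrightarrow> via Pos A a b \<Longrightarrow> a \<in> x" "b \<in> x \<Longrightarrow> via Neg A a b \<Longrightarrow> a \<in> y"
        using D s unfolding via_def scott_def by blast+
      show ?thesis
        using e ab D X unfolding z by (cases i; cases j) (auto simp: xle_def)
    qed
    have zE: "z \<subseteq> duo (Ev A) (Ev A)" unfolding z by (intro Un_mono image_mono A.configsD(1) xy)
    have "{e'. \<exists>e\<in>z. (e', e) \<in> copycat_le A} = z"
    proof (intro equalityI subsetI)
      fix e assume e: "e \<in> z"
      then have "(e, e) \<in> copycat_le A" using G.Le_refl[of e] zE by (auto simp: copycat_simps)
      then show "e \<in> {e'. \<exists>e\<in>z. (e', e) \<in> copycat_le A}" using e by blast
    qed (use down in blast)
    moreover have "z \<in> Con (A\<^sup>\<bottom> \<parallel> A)" unfolding z by (rule Con_parI) (use xy A.configsD(2) in auto)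
    ultimately have "z \<in> Con (\<Gamma> A)" using zE by (simp add: copycat_simps)
    then show "z \<in> configs (\<Gamma> A)" by (rule G.configsI) (use down in \<open>simp add: copycat_simps\<close>)
  }
qed

lemma LS_copycat:
  assumes A: "game A"
  shows "LS (p ` Ev A \<union> q ` Ev A) (\<Gamma> A) (tag p q) \<approx> cc p q A" (is "?Z \<approx> _")
proof -
  let ?g = "\<lambda>(x, y). duo x y"
  show ?thesis
  proof (rule ls_isoI[where f = "\<lambda>z. (inl z, inr z)" and g = ?g])
    note iff = copycat_le_iff[OF game_es[OF A]]
    have *: "gord A (lev p q) (lev x y) UNIV = {(tag p q s, tag p q s') | s s'. s \<in> duo x y \<and> s' \<in> duo x y \<and> (s, s') \<in> copycat_le A}"
      for x y
    proof -
      have m: "Tag i a \<in> duo x y \<longleftrightarrow> a \<in> lev x y i" "tag p q (Tag i a) = lev p q i a" for i a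
        by (cases i; auto)+
      show ?thesis
      proof (intro equalityI subrelI)
        fix u v assume "(u, v) \<in> gord A (lev p q) (lev x y) UNIV"
        then obtain i a j b where "u = tag p q (Tag i a)" "v = tag p q (Tag j b)" "Tag i a \<in> duo x y" "Tag j b \<in> duo x y" "xle A i a j b"
          unfolding gord_iff m by blast
        then show "(u, v) \<in> {(tag p q s, tag p q s') | s s'. s \<in> duo x y \<and> s' \<in> duo x y \<and> (s, s') \<in> copycat_le A}"
          unfolding iff by blast
      next
        fix u v assume "(u, v) \<in> {(tag p q s, tag p q s') | s s'. s \<in> duo x y \<and> s' \<in> duo x y \<and> (s, s') \<in> copycat_le A}"
        then obtain i a j b where "u = tag p q (Tag i a)" "v = tag p q (Tag j b)" "Tag i a \<in> duo x y" "Tag j b \<in> duo x y" "xle A i a j b"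
          unfolding iff by blast
        then show "(u, v) \<in> gord A (lev p q) (lev x y) UNIV"
          unfolding gord_iff m by blast
      qed
    qed
    show "ord (cc p q A) (inl s, inr s) = ord ?Z s"
      if "s \<in> St ?Z" for s
    proof -
      have "s = duo (inl s) (inr s)" using that configs_copycat[OF A] by auto
      then show ?thesis using *[of "inl s" "inr s"] by (simp add: copycat_simps)
    qed
    show "Sle (cc p q A) (inl s, inr s) (inl s', inr s')" if "Sle ?Z s s'" for s s'
      using that by (auto simp: inl_def inr_def)
    show "Sle ?Z (?g t) (?g t')"
      if "Sle (cc p q A) t t'" for t t' using that by (cases t; cases t') auto
    show "lab (cc p q A) (inl s, inr s) = lab ?Z s"
      if "s \<in> St ?Z" for s
    proof -
      have "s = duo (inl s) (inr s)" using that configs_copycat[OF A] by auto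
      then have "tag p q ` s = p ` inl s \<union> q ` inr s" using tag_image by metis
      then show ?thesis by simp
    qed
    show "(inl s, inr s) \<in> St (cc p q A)" "(?g (inl s, inr s)) = s"
      if s: "s \<in> St ?Z" for s
    proof -
      obtain x y where "s = duo x y" "scott A x y" using s unfolding LS_simps configs_copycat[OF A] by blast
      then show "(inl s, inr s) \<in> St (cc p q A)" "(?g (inl s, inr s)) = s" by simp_all
    qed
    show "(?g t) \<in> St ?Z" if t: "t \<in> St (cc p q A)" for t
      unfolding LS_simps configs_copycat[OF A] using t by (cases t) auto
  qed (simp_all add: split_def)
qed

subsection \<open>Laws of copycat\<close>

lemma prestrategy_copycat:
  assumes A: "game A" shows "prestrategy (A\<^sup>\<bottom> \<parallel> A) (\<gamma> A)"
proof (rule prestrategyI)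
  fix x assume "x \<in> configs (fst (\<gamma> A))"
  then obtain a b where "x = duo a b" "scott A a b" by (auto simp: copycat_def configs_copycat[OF A])
  then show "snd (\<gamma> A) ` x \<in> configs (A\<^sup>\<bottom> \<parallel> A) \<and> inj_on (snd (\<gamma> A)) x"
    using config_par_iff[of "A\<^sup>\<bottom>" A a b] A by (simp add: copycat_def scott_def)
qed (simp_all add: A copycat_def copycat_simps)

lemma LSp_copycat: "game A \<Longrightarrow> LSp p q A A (\<gamma> A) \<approx> cc p q A"
  using LS_copycat by (simp add: LSp_def copycat_def)

lemma valid_cc [simp, intro]:
  assumes "game A" "sep p A q A" shows "valid (cc p q A)"
  by (rule ls_iso_valid[OF LSp_copycat[OF assms(1)]]) (use prestrategy_copycat assms in blast)

lemma cc_cong: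
  fixes A :: "'a ev esp"
  assumes A: "game A" and p: "\<And>a. a \<in> Ev A \<Longrightarrow> p a = p' a" and q: "\<And>a. a \<in> Ev A \<Longrightarrow> q a = q' a"
  shows "cc p q A \<approx> cc p' q' A"
proof -
  have "LS (p ` Ev A \<union> q ` Ev A) (\<Gamma> A) (tag p q) \<approx> LS (p ` Ev A \<union> q ` Ev A) (\<Gamma> A) (tag p' q')"
    by (rule LS_cong) (use p q A game_es[OF game_copycat[OF A]] in \<open>auto simp: copycat_simps\<close>)
  moreover have "p ` Ev A \<union> q ` Ev A = p' ` Ev A \<union> q' ` Ev A"
    using p q by (simp cong: image_cong)
  ultimately show ?thesis
    using LS_copycat[OF A, of p q] LS_copycat[OF A, of p' q'] by (metis ls_iso_sym ls_iso_trans)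
qed

text \<open>The two copycats occupy levels 0, 1 and 1, 2 of a three-level order. Its restriction to
  levels 0 and 2 is copycat again, because a crossing from 0 to 2 is described exactly like one
  between adjacent levels. What remains is that states correspond: the outer pair has to determine
  the middle configuration.\<close>

lemma cc_idem:
  fixes A :: "'a ev esp"
  assumes A: "game A" and pq: "sep p A q A" and qr: "sep q A r A" and pr: "sep p A r A"
  shows "hide (q ` Ev A) (cc p q A \<bowtie> cc q r A) \<approx> cc p r A" (is "?Z \<approx> _")
proof -
  interpret A: es A by (rule game_es[OF A])
  define P where "P = (\<lambda>n::nat. if n = 0 then p else if n = 1 then q else r)"
  have P [simp]: "P 0 = p" "P (Suc 0) = q" "P 2 = r" by (simp_all add: P_def)
  have ip: "inj_on p (Ev A)" and iq: "inj_on q (Ev A)" and ir: "inj_on r (Ev A)"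
    and dis: "p ` Ev A \<inter> q ` Ev A = {}" "q ` Ev A \<inter> r ` Ev A = {}" "p ` Ev A \<inter> r ` Ev A = {}"
    using pq qr pr by (simp_all add: sep_def)
  have Pinj: "i = j \<and> a = b" if "P i a = P j b" "i \<in> {0, 1, 2}" "j \<in> {0, 1, 2}" "a \<in> Ev A" "b \<in> Ev A" for i j a b
  proof -
    have n: "p c \<noteq> q d" "q c \<noteq> r d" "p c \<noteq> r d" if "c \<in> Ev A" "d \<in> Ev A" for c d
      using dis that by blast+
    show ?thesis using that n[OF that(4,5)] n[OF that(5,4)] inj_onD[OF ip, of a b] inj_onD[OF iq, of a b] inj_onD[OF ir, of a b]
      by (auto simp: P_def split: if_splits)
  qed
  define X where "X = (\<lambda>x y z. (\<lambda>n::nat. if n = 0 then x else if n = 1 then y else (z :: 'a ev set)))"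
  have X [simp]: "X x y z 0 = x" "X x y z (Suc 0) = y" "X x y z 2 = z" for x y z by (simp_all add: X_def)
  let ?I = "{0, 1, 2} :: nat set"
  have G01: "gord A (lev p q) (lev x y) UNIV = gord A P (X x y z) {0, 1}" for x y z
    using gord_lev[of 0 1 A P "X x y z"] by simp
  have G12: "gord A (lev q r) (lev y z) UNIV = gord A P (X x y z) {1, 2}" for x y z
    using gord_lev[of 1 2 A P "X x y z"] by simp
  have G02: "gord A (lev p r) (lev x z) UNIV = gord A P (X x y z) {0, 2}" for x y z
    using gord_lev[of 0 2 A P "X x y z"] by simp
  have mono: "gord A P W J \<subseteq> gord A P W ?I" if "J \<subseteq> ?I" for W J
    unfolding gord_def by (intro UN_mono that subset_refl)
  have XE: "X x y z n \<subseteq> Ev A" if "x \<subseteq> Ev A" "y \<subseteq> Ev A" "z \<subseteq> Ev A" for x y z n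
    using that by (simp add: X_def)
  \<comment> \<open>\<open>Pinj\<close> reads a shared label back as one level and one move, so
    transitivity of \<open>xle\<close> passes to the order on labels.\<close>
  have tr: "trans (gord A P W ?I)" if W: "\<And>n. W n \<subseteq> Ev A" for W
  proof (rule transI)
    fix u v w assume "(u, v) \<in> gord A P W ?I" "(v, w) \<in> gord A P W ?I"
    then obtain i a j b j' b' k c where 1: "u = P i a" "v = P j b" "i \<in> ?I" "j \<in> ?I" "a \<in> W i" "b \<in> W j" "xle A i a j b"
      and 2: "v = P j' b'" "w = P k c" "j' \<in> ?I" "k \<in> ?I" "b' \<in> W j'" "c \<in> W k" "xle A j' b' k c"
      unfolding gord_iff by blast
    have "j = j' \<and> b = b'" by (rule Pinj) (use 1 2 W in auto)
    then have "xle A i a k c" using xle_trans[OF A.es_axioms 1(7)] 2(7) by simp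
    then show "(u, w) \<in> gord A P W ?I" unfolding gord_iff using 1 2 by blast
  qed
  have an: "antisym (gord A P W ?I)" if W: "\<And>n. W n \<subseteq> Ev A" for W
  proof (rule antisymI)
    fix u v assume "(u, v) \<in> gord A P W ?I" "(v, u) \<in> gord A P W ?I"
    then obtain i a j b j' b' k c where 1: "u = P i a" "v = P j b" "i \<in> ?I" "j \<in> ?I" "a \<in> W i" "b \<in> W j" "xle A i a j b"
      and 2: "v = P j' b'" "u = P k c" "j' \<in> ?I" "k \<in> ?I" "b' \<in> W j'" "c \<in> W k" "xle A j' b' k c"
      unfolding gord_iff by blast
    have j: "j = j' \<and> b = b'" by (rule Pinj) (use 1 2 W in auto)
    have k: "i = k \<and> a = c" by (rule Pinj) (use 1 2 W in auto)
    have "i = j \<and> a = b" by (rule xle_antisym[OF A.es_axioms 1(7)]) (use 2(7) j k in simp)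
    then show "u = v" using 1 by simp
  qed
  have down: "c \<in> x" if "x \<in> configs A" "b \<in> x" "(c, b) \<in> Le A" for x b c
    using A.configsD(4) that by blast
  have full: "(gord A P (X x y z) {0, 1} \<union> gord A P (X x y z) {1, 2})\<^sup>+ = gord A P (X x y z) ?I" (is "?L\<^sup>+ = _")
    if s1: "scott A x y" and s2: "scott A y z" for x y z
  proof
    let ?W = "X x y z"
    have c: "x \<in> configs A" "y \<in> configs A" "z \<in> configs A" using s1 s2 by (simp_all add: scott_def)
    have "?L \<subseteq> gord A P ?W ?I" using mono[of "{0,1}" ?W] mono[of "{1,2}" ?W] by simp
    then have "?L\<^sup>+ \<subseteq> (gord A P ?W ?I)\<^sup>+" by (rule trancl_mono_subset)
    then show "?L\<^sup>+ \<subseteq> gord A P ?W ?I" using tr[of ?W] XE c A.configsD(1) by simp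
    show "gord A P ?W ?I \<subseteq> ?L\<^sup>+"
    proof (rule subrelI)
      fix u v assume "(u, v) \<in> gord A P ?W ?I"
      then obtain i a j b where uv: "u = P i a" "v = P j b" "i \<in> ?I" "j \<in> ?I" "a \<in> ?W i" "b \<in> ?W j" "xle A i a j b"
        unfolding gord_iff by blast
      have L: "(P i a, P j b) \<in> ?L\<^sup>+" if "i \<in> J" "j \<in> J" "J = {0, 1} \<or> J = {1, 2}" "a \<in> ?W i" "b \<in> ?W j" "xle A i a j b" for i j a b J
      proof -
        have "(P i a, P j b) \<in> gord A P ?W J" unfolding gord_iff using that by blast
        then show ?thesis using that(3) by blast
      qed
      consider "i \<in> {0, 1}" "j \<in> {0, 1}" | "i \<in> {1, 2}" "j \<in> {1, 2}" | "i = 0" "j = 2" | "i = 2" "j = 0"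
        using uv(3,4) by auto
      then show "(u, v) \<in> ?L\<^sup>+"
      proof cases
        case 1 then show ?thesis using L[of i "{0,1}" j a b] uv by simp
      next
        case 2 then show ?thesis using L[of i "{1,2}" j a b] uv by simp
      next
        case 3
        then have ab: "a \<in> x" "b \<in> z" "via Pos A a b" using uv by (simp_all add: xle_def)
        then obtain d where d: "(a, d) \<in> Le A" "(d, b) \<in> Le A" "pol A d = Pos" unfolding via_def by blast
        \<comment> \<open>The crossing move \<open>d\<close> is positive and lies in
          \<open>z\<close>, so the Scott condition puts it into \<open>y\<close>; the link from
          level 0 to level 2 can therefore pause at \<open>d\<close> on level 1.\<close>
        have "d \<in> z" by (rule down[OF c(3) ab(2) d(2)])
        then have dy: "d \<in> y" using s2 d by (simp add: scott_def)
        have dd: "(d, d) \<in> Le A" using A.Le_refl A.Le_Ev d(1) by blast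
        have "xle A 0 a (1::nat) d" "xle A (1::nat) d 2 b" using d dd by (auto simp: xle_def via_def)
        then have "(P 0 a, P 1 d) \<in> ?L\<^sup>+" "(P 1 d, P 2 b) \<in> ?L\<^sup>+"
          using L[of 0 "{0,1}" 1 a d] L[of 1 "{1,2}" 2 d b] ab dy by simp_all
        then show ?thesis using 3 uv by (meson trancl_trans)
      next
        case 4
        then have ab: "a \<in> z" "b \<in> x" "via Neg A a b" using uv by (simp_all add: xle_def)
        then obtain d where d: "(a, d) \<in> Le A" "(d, b) \<in> Le A" "pol A d = Neg" unfolding via_def by blast
        have "d \<in> x" by (rule down[OF c(1) ab(2) d(2)])
        then have dy: "d \<in> y" using s1 d by (simp add: scott_def)
        have dd: "(d, d) \<in> Le A" using A.Le_refl A.Le_Ev d(1) by blast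
        have "xle A 2 a (1::nat) d" "xle A (1::nat) d 0 b" using d dd by (auto simp: xle_def via_def)
        then have "(P 2 a, P 1 d) \<in> ?L\<^sup>+" "(P 1 d, P 0 b) \<in> ?L\<^sup>+"
          using L[of 2 "{1,2}" 1 a d] L[of 1 "{0,1}" 0 d b] ab dy by simp_all
        then show ?thesis using 4 uv by (meson trancl_trans)
      qed
    qed
  qed
  \<comment> \<open>The hidden middle configuration is forced: it consists of the moves below one that copycat
    forwards to a visible side.\<close>
  define m where "m x z = {a \<in> Ev A. \<exists>c. (a, c) \<in> Le A \<and> (c \<in> z \<and> pol A c = Pos \<or> c \<in> x \<and> pol A c = Neg)}" for x z
  have St: "((x, y), (y', z)) \<in> St ?Z \<longleftrightarrow>
     scott A x y \<and> scott A y z \<and> y = y' \<and> y = m x z" for x y y' z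
  proof (cases "scott A x y \<and> scott A y' z")
    case True
    then have s1: "scott A x y" and s2: "scott A y' z" by auto
    have c: "x \<in> configs A" "y \<in> configs A" "y' \<in> configs A" "z \<in> configs A" using s1 s2 by (simp_all add: scott_def)
    note E = A.configsD(1)[OF c(1)] A.configsD(1)[OF c(2)] A.configsD(1)[OF c(3)] A.configsD(1)[OF c(4)]
    have mt: "(p ` x \<union> q ` y) \<inter> (q ` Ev A \<union> r ` Ev A) = (q ` y' \<union> r ` z) \<inter> (p ` Ev A \<union> q ` Ev A) \<longleftrightarrow> y = y'"
    proof -
      have "(p ` x \<union> q ` y) \<inter> (q ` Ev A \<union> r ` Ev A) = q ` y" using E dis by blast
      moreover have "(q ` y' \<union> r ` z) \<inter> (p ` Ev A \<union> q ` Ev A) = q ` y'" using E dis by blast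
      ultimately show ?thesis using inj_on_image_eq_iff[OF iq E(2,3)] by simp
    qed
    show ?thesis
    proof (cases "y = y'")
      case True
      let ?W = "X x y z"
      have s2': "scott A y z" using s2 True by simp
      have W: "?W n \<subseteq> Ev A" for n by (rule XE) (use E in auto)
      have lab: "p ` x \<union> q ` y \<union> (q ` y \<union> r ` z) - q ` Ev A = p ` x \<union> r ` z"
        "(p ` x \<union> q ` y \<union> (q ` y \<union> r ` z)) \<inter> q ` Ev A = q ` y"
        using E dis by blast+
      \<comment> \<open>A middle move reaches level 2 only through a positive move and level 0 only
        through a negative one. This is the membership condition of \<open>m\<close>.\<close>
      have h: "(\<exists>l\<in>p ` x \<union> r ` z. (q a, l) \<in> gord A P ?W ?I) \<longleftrightarrow>
          (\<exists>c. (a, c) \<in> Le A \<and> (c \<in> z \<and> pol A c = Pos \<or> c \<in> x \<and> pol A c = Neg))" if a: "a \<in> y" for a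
      proof
        assume "\<exists>l\<in>p ` x \<union> r ` z. (q a, l) \<in> gord A P ?W ?I"
        then obtain l where l: "l \<in> p ` x \<union> r ` z" "(q a, l) \<in> gord A P ?W ?I" by blast
        then obtain i a' j b where g: "q a = P i a'" "l = P j b" "i \<in> ?I" "j \<in> ?I" "a' \<in> ?W i" "b \<in> ?W j" "xle A i a' j b"
          unfolding gord_iff by blast
        have ia: "i = 1 \<and> a' = a" by (rule Pinj) (use g a E W in auto)
        have "l \<notin> q ` Ev A" using l(1) E dis by blast
        then have "j \<noteq> 1" using g(2,6) E(2) by auto
        then have "j = 0 \<and> b \<in> x \<and> via Neg A a b \<or> j = 2 \<and> b \<in> z \<and> via Pos A a b"
          using g ia by (auto simp: xle_def)
        then show "\<exists>c. (a, c) \<in> Le A \<and> (c \<in> z \<and> pol A c = Pos \<or> c \<in> x \<and> pol A c = Neg)"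
          unfolding via_def using down[OF c(1)] down[OF c(4)] by blast
      next
        assume "\<exists>c. (a, c) \<in> Le A \<and> (c \<in> z \<and> pol A c = Pos \<or> c \<in> x \<and> pol A c = Neg)"
        then obtain d where d: "(a, d) \<in> Le A" "d \<in> z \<and> pol A d = Pos \<or> d \<in> x \<and> pol A d = Neg" by blast
        have dd: "(d, d) \<in> Le A" using A.Le_refl A.Le_Ev d(1) by blast
        from d(2) show "\<exists>l\<in>p ` x \<union> r ` z. (q a, l) \<in> gord A P ?W ?I"
        proof
          assume z: "d \<in> z \<and> pol A d = Pos"
          have "xle A 1 a (2::nat) d" using d dd z by (auto simp: xle_def via_def)
          then have "(P 1 a, P 2 d) \<in> gord A P ?W ?I" unfolding gord_iff using a z X by fastforce
          then show ?thesis using z by auto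
        next
          assume z: "d \<in> x \<and> pol A d = Neg"
          have "xle A 1 a (0::nat) d" using d dd z by (auto simp: xle_def via_def)
          then have "(P 1 a, P 0 d) \<in> gord A P ?W ?I" unfolding gord_iff using a z X by fastforce
          then show ?thesis using z by auto
        qed
      qed
      have my: "m x z \<subseteq> y"
      proof
        fix a assume "a \<in> m x z"
        then obtain d where d: "(a, d) \<in> Le A" "d \<in> z \<and> pol A d = Pos \<or> d \<in> x \<and> pol A d = Neg" unfolding m_def by blast
        have "d \<in> y" using d(2) s1 s2' unfolding scott_def by blast
        then show "a \<in> y" by (rule down[OF c(2) _ d(1)])
      qed
      have "(\<forall>h\<in>q ` y. \<exists>l\<in>p ` x \<union> r ` z. (h, l) \<in> gord A P ?W ?I) \<longleftrightarrow> (\<forall>a\<in>y. a \<in> m x z)"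
        using h E(2) unfolding m_def by blast
      then have hid: "(\<forall>h\<in>q ` y. \<exists>l\<in>p ` x \<union> r ` z. (h, l) \<in> gord A P ?W ?I) \<longleftrightarrow> y = m x z" using my by blast
      show ?thesis
        unfolding hide_simps join_simps cc_simps True[symmetric] G01[of _ _ z] G12[of _ _ x] full[OF s1 s2'] lab hid
        using s1 s2' an[OF W] mt True by simp
    next
      case False
      then show ?thesis using mt by simp
    qed
  qed auto
  \<comment> \<open>By the Scott condition the moves generating \<open>m x z\<close> lie in both
    \<open>x\<close> and \<open>z\<close>, so \<open>m x z\<close> is contained in each of
    them.\<close>
  have m_scott: "scott A x (m x z) \<and> scott A (m x z) z" if s: "scott A x z" for x z
  proof -
    have c: "x \<in> configs A" "z \<in> configs A" using s by (simp_all add: scott_def)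
    have sub: "m x z \<subseteq> x" "m x z \<subseteq> z"
      using s down[OF c(1)] down[OF c(2)] unfolding m_def scott_def by blast+
    have "m x z \<in> configs A"
      by (rule A.configs_subset[OF c(1) sub(1)]) (auto simp: m_def dest: A.Le_Ev intro: A.Le_trans)
    moreover have "a \<in> m x z" if "a \<in> z \<and> pol A a = Pos \<or> a \<in> x \<and> pol A a = Neg" for a
    proof -
      have "a \<in> Ev A" using that A.configsD(1) c by blast
      then show ?thesis using that A.Le_refl unfolding m_def by blast
    qed
    ultimately show ?thesis using c sub unfolding scott_def by blast
  qed
  \<comment> \<open>The visible labels are those of levels 0 and 2, and \<open>xle\<close> between
    these levels does not refer to level 1.\<close>
  have ord_eq: "ord (cc p r A) (x, z) = ord ?Z ((x, y), (y, z))"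
    if s1: "scott A x y" and s2: "scott A y z" for x y z
  proof -
    let ?W = "X x y z"
    have c: "x \<subseteq> Ev A" "y \<subseteq> Ev A" "z \<subseteq> Ev A" using s1 s2 A.configsD(1) by (simp_all add: scott_def)
    have W: "?W n \<subseteq> Ev A" for n by (rule XE) (use c in auto)
    have nq: "P i a \<notin> q ` Ev A \<longleftrightarrow> i \<in> {0, 2}" if "i \<in> ?I" "a \<in> ?W i" for i a
    proof -
      have "a \<in> Ev A" using that(2) W by blast
      then have "p a \<notin> q ` Ev A" "r a \<notin> q ` Ev A" "q a \<in> q ` Ev A" using dis by blast+
      then show ?thesis using that(1) by (auto simp: P_def)
    qed
    have "gord A P ?W {0, 2} = gord A P ?W ?I \<inter> (- q ` Ev A) \<times> (- q ` Ev A)"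
    proof (intro equalityI subrelI)
      fix u v assume "(u, v) \<in> gord A P ?W {0, 2}"
      then obtain i a j b where uv: "u = P i a" "v = P j b" "i \<in> {0,2}" "j \<in> {0,2}" "a \<in> ?W i" "b \<in> ?W j" "xle A i a j b"
        unfolding gord_iff by blast
      have I: "i \<in> ?I" "j \<in> ?I" using uv(3,4) by auto
      then have "(u, v) \<in> gord A P ?W ?I" unfolding gord_iff using uv by blast
      moreover have "u \<notin> q ` Ev A" "v \<notin> q ` Ev A"
        using nq[OF I(1) uv(5)] nq[OF I(2) uv(6)] uv by simp_all
      ultimately show "(u, v) \<in> gord A P ?W ?I \<inter> (- q ` Ev A) \<times> (- q ` Ev A)" by simp
    next
      fix u v assume "(u, v) \<in> gord A P ?W ?I \<inter> (- q ` Ev A) \<times> (- q ` Ev A)"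
      then obtain i a j b where uv: "u = P i a" "v = P j b" "i \<in> ?I" "j \<in> ?I" "a \<in> ?W i" "b \<in> ?W j" "xle A i a j b"
         "u \<notin> q ` Ev A" "v \<notin> q ` Ev A"
        unfolding gord_iff Int_iff mem_Sigma_iff Compl_iff by blast
      then have "i \<in> {0, 2}" "j \<in> {0, 2}" using nq[OF uv(3,5)] nq[OF uv(4,6)] by simp_all
      then show "(u, v) \<in> gord A P ?W {0, 2}" unfolding gord_iff using uv by blast
    qed
    then show ?thesis
      unfolding hide_simps join_simps cc_simps G01[of _ _ z] G12[of _ _ x] G02[of _ _ y] full[OF s1 s2] .
  qed
  let ?f = "\<lambda>((x, y), (y', z)). (x, z)" and ?g = "\<lambda>(x, z). ((x, m x z), (m x z, z))"
  show ?thesis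
  proof (rule ls_isoI[where f = ?f and g = ?g])
    show "Lbs ?Z = Lbs (cc p r A)" using dis by auto
    fix s assume s: "s \<in> St ?Z"
    obtain x y y' z where sx: "s = ((x, y), (y', z))" by (metis surj_pair)
    with s St have *: "scott A x y" "scott A y z" "y' = y" "y = m x z" by blast+
    have E: "x \<subseteq> Ev A" "y \<subseteq> Ev A" "z \<subseteq> Ev A" using *(1,2) A.configsD(1) by (simp_all add: scott_def)
    have "scott A x z" using *(1,2) unfolding scott_def by blast
    then show "?f s \<in> St (cc p r A)" using sx by simp
    show "?g (?f s) = s" using sx * by simp
    show "ord (cc p r A) (?f s) = ord ?Z s"
      unfolding sx *(3) prod.case by (rule ord_eq[OF *(1,2)])
    show "lab (cc p r A) (?f s) = lab ?Z s"
      unfolding sx *(3) prod.case hide_simps join_simps cc_simps using E dis by blast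
    fix s' assume "Sle ?Z s s'"
    then show "Sle (cc p r A) (?f s) (?f s')"
      unfolding hide_simps by (auto simp: split_paired_all join_def cc_def split: prod.splits)
  next
    fix t assume t: "t \<in> St (cc p r A)"
    show "?g t \<in> St ?Z"
    proof (cases t)
      case (Pair x z)
      then have "scott A x z" using t by simp
      then have "((x, m x z), (m x z, z)) \<in> St ?Z"
        using St m_scott by blast
      then show ?thesis unfolding Pair prod.case .
    qed
    show "?f (?g t) = t" by (cases t) simp
    fix t' assume "Sle (cc p r A) t t'"
    then obtain x z x' z' where xz: "t = (x, z)" "t' = (x', z')" "x \<subseteq> x'" "z \<subseteq> z'" by (cases t; cases t') auto
    then have "m x z \<subseteq> m x' z'" by (auto simp: m_def)
    then show "Sle ?Z (?g t) (?g t')"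
      using xz by simp
  qed
qed

text \<open>The inverse is explicit because liftings in both directions are formed from it. Order
  and consistency are reflected as well as preserved, which makes the notion symmetric in
  \<open>f\<close> and \<open>g\<close>.\<close>

definition giso :: "'e esp \<Rightarrow> 'f esp \<Rightarrow> ('e \<Rightarrow> 'f) \<Rightarrow> ('f \<Rightarrow> 'e) \<Rightarrow> bool" where
  "giso A B f g \<longleftrightarrow> game A \<and> game B \<and>
     (\<forall>a\<in>Ev A. f a \<in> Ev B \<and> g (f a) = a \<and> pol B (f a) = pol A a) \<and>
     (\<forall>b\<in>Ev B. g b \<in> Ev A \<and> f (g b) = b) \<and>
     (\<forall>a\<in>Ev A. \<forall>a'\<in>Ev A. (f a, f a') \<in> Le B \<longleftrightarrow> (a, a') \<in> Le A) \<and>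
     (\<forall>X. X \<subseteq> Ev A \<longrightarrow> (f ` X \<in> Con B \<longleftrightarrow> X \<in> Con A))"

lemma gisoD:
  assumes "giso A B f g"
  shows "game A" "game B" "a \<in> Ev A \<Longrightarrow> f a \<in> Ev B" "a \<in> Ev A \<Longrightarrow> g (f a) = a" "a \<in> Ev A \<Longrightarrow> pol B (f a) = pol A a"
    "b \<in> Ev B \<Longrightarrow> g b \<in> Ev A" "b \<in> Ev B \<Longrightarrow> f (g b) = b"
    "a \<in> Ev A \<Longrightarrow> a' \<in> Ev A \<Longrightarrow> (f a, f a') \<in> Le B \<longleftrightarrow> (a, a') \<in> Le A"
    "X \<subseteq> Ev A \<Longrightarrow> f ` X \<in> Con B \<longleftrightarrow> X \<in> Con A"
  using assms unfolding giso_def by blast+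

lemma giso_image_inv:
  assumes "giso A B f g" "X \<subseteq> Ev A" shows "g ` f ` X = X"
proof -
  have "g (f a) = a" if "a \<in> X" for a using gisoD(4)[OF assms(1)] assms(2) that by blast
  then show ?thesis by (simp add: image_image)
qed

lemma giso_sym:
  assumes i: "giso A B f g" shows "giso B A g f"
proof -
  note D = gisoD[OF i]
  have inv: "f ` g ` X = X" if "X \<subseteq> Ev B" for X
  proof -
    have "f (g a) = a" if "a \<in> X" for a using D(7) that \<open>X \<subseteq> Ev B\<close> by blast
    then show ?thesis by (simp add: image_image)
  qed
  show ?thesis
    unfolding giso_def
  proof (intro conjI ballI allI impI)
    show "game B" "game A" by (rule D)+
    fix b assume b: "b \<in> Ev B"
    show "g b \<in> Ev A" "f (g b) = b" using D(6,7) b by simp_all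
    show "pol A (g b) = pol B b" using D(5)[OF D(6)[OF b]] D(7)[OF b] by simp
    show "((g b, g b') \<in> Le A) = ((b, b') \<in> Le B)" if b': "b' \<in> Ev B" for b'
      using D(8)[OF D(6)[OF b] D(6)[OF b']] D(7) b b' by simp
  next
    fix a assume "a \<in> Ev A" then show "f a \<in> Ev B" "g (f a) = a" using D by simp_all
  next
    fix X assume X: "X \<subseteq> Ev B"
    then have "g ` X \<subseteq> Ev A" using D(6) by blast
    from D(9)[OF this] show "(g ` X \<in> Con A) = (X \<in> Con B)" using inv[OF X] by simp
  qed
qed

lemma giso_id: "game A \<Longrightarrow> giso A A id id"
  by (simp add: giso_def)

lemma giso_comp:
  assumes "giso A B f g" "giso B C h k" shows "giso A C (h \<circ> f) (g \<circ> k)"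
proof -
  note D = gisoD[OF assms(1)] and E = gisoD[OF assms(2)]
  have "(h \<circ> f) ` X \<in> Con C \<longleftrightarrow> X \<in> Con A" if X: "X \<subseteq> Ev A" for X
  proof -
    have fX: "f ` X \<subseteq> Ev B" using D(3) X by blast
    show ?thesis using D(9)[OF X] E(9)[OF fX] by (simp only: image_comp)
  qed
  then show ?thesis unfolding giso_def using D(1-8) E(1-8) by simp
qed

lemma giso_configs:
  assumes i: "giso A B f g" and x: "x \<in> configs A" shows "f ` x \<in> configs B"
proof -
  note D = gisoD[OF i]
  interpret A: es A by (rule game_es[OF D(1)])
  interpret B: es B by (rule game_es[OF D(2)])
  have xE: "x \<subseteq> Ev A" by (rule A.configsD(1)[OF x])
  show ?thesis
  proof (rule B.configsI)
    show "f ` x \<in> Con B" using D(9)[OF xE] A.configsD(2)[OF x] by simp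
    fix e e' assume "e \<in> f ` x" and le: "(e', e) \<in> Le B"
    then obtain a where a: "a \<in> x" "e = f a" by blast
    have aE: "a \<in> Ev A" using a xE by blast
    have e': "e' \<in> Ev B" using B.Le_Ev[OF le] by simp
    have "(f (g e'), f a) \<in> Le B" using le a D(7)[OF e'] by simp
    then have "(g e', a) \<in> Le A" using D(8)[OF D(6)[OF e'] aE] by simp
    then have "g e' \<in> x" by (rule A.configsD(4)[OF x a(1)])
    then show "e' \<in> f ` x" using D(7)[OF e'] by (metis imageI)
  qed
qed

lemma giso_inj: "giso A B f g \<Longrightarrow> inj_on f (Ev A)"
  by (rule inj_on_inverseI[of _ g]) (rule gisoD(4))

lemma giso_image: "giso A B f g \<Longrightarrow> f ` Ev A = Ev B"
  using gisoD(3,6,7)[of A B f g] by (auto simp: image_iff) metis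

lemma giso_par:
  assumes i: "giso A B f g" and i': "giso A' B' f' g'"
  shows "giso (A \<parallel> A') (B \<parallel> B') (par_map f f') (par_map g g')"
proof -
  note D = gisoD[OF i] and E = gisoD[OF i']
  have C: "par_map f f' ` X \<in> Con (B \<parallel> B') \<longleftrightarrow> X \<in> Con (A \<parallel> A')" if X: "X \<subseteq> Ev (A \<parallel> A')" for X
  proof -
    have s: "X = duo (inl X) (inr X)" by (rule duo_split) (use X in simp)
    have sub: "inl X \<subseteq> Ev A" "inr X \<subseteq> Ev A'" using X by (auto simp: inl_def inr_def)
    have "par_map f f' ` duo Y Z = duo (f ` Y) (f' ` Z)" for Y Z by (simp add: image_Un image_image)
    then have "par_map f f' ` X = duo (f ` inl X) (f' ` inr X)" using s by metis
    moreover have "duo Y Z \<in> Con (P \<parallel> Q) \<longleftrightarrow> Y \<in> Con P \<and> Z \<in> Con Q" for Y Z and P Q :: "'c ev esp"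
      by auto
    ultimately show ?thesis using D(9)[OF sub(1)] E(9)[OF sub(2)] s by (metis (no_types, lifting))
  qed
  show ?thesis
    unfolding giso_def
  proof (intro conjI ballI)
    show "\<forall>X. X \<subseteq> Ev (A \<parallel> A') \<longrightarrow> (par_map f f' ` X \<in> Con (B \<parallel> B')) = (X \<in> Con (A \<parallel> A'))" using C by blast
    fix a a' assume "a \<in> Ev (A \<parallel> A')" "a' \<in> Ev (A \<parallel> A')"
    then show "((par_map f f' a, par_map f f' a') \<in> Le (B \<parallel> B')) = ((a, a') \<in> Le (A \<parallel> A'))"
      using D(8) E(8) by auto
  qed (use D(1-7) E(1-7) in auto)
qed

lemma via_giso:
  assumes i: "giso A B f g" and a: "a \<in> Ev A" and b: "b \<in> Ev A"
  shows "via s B (f a) (f b) \<longleftrightarrow> via s A a b"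
proof
  note D = gisoD[OF i]
  assume "via s B (f a) (f b)"
  then obtain c where c: "(f a, c) \<in> Le B" "(c, f b) \<in> Le B" "pol B c = s" unfolding via_def by blast
  have cE: "c \<in> Ev B" using es.Le_Ev[OF game_es[OF D(2)] c(1)] by simp
  have "(a, g c) \<in> Le A" "(g c, b) \<in> Le A"
    using D(8)[OF a D(6)[OF cE]] D(8)[OF D(6)[OF cE] b] D(7)[OF cE] c by simp_all
  moreover have "pol A (g c) = s" using D(5)[OF D(6)[OF cE]] D(7)[OF cE] c(3) by simp
  ultimately show "via s A a b" unfolding via_def by blast
next
  note D = gisoD[OF i]
  assume "via s A a b"
  then obtain c where c: "(a, c) \<in> Le A" "(c, b) \<in> Le A" "pol A c = s" unfolding via_def by blast
  have cE: "c \<in> Ev A" using es.Le_Ev[OF game_es[OF D(1)] c(1)] by simp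
  then show "via s B (f a) (f b)" unfolding via_def using c D(8)[OF a cE] D(8)[OF cE b] D(5)[OF cE] by blast
qed

lemma xle_giso:
  assumes i: "giso A B f g" and a: "a \<in> Ev A" and b: "b \<in> Ev A"
  shows "xle B i (f a) j (f b) \<longleftrightarrow> xle A i a j b"
  unfolding xle_def via_giso[OF assms] gisoD(8)[OF assms] ..

lemma scott_giso:
  assumes i: "giso A B f g" and s: "scott A x y" shows "scott B (f ` x) (f ` y)"
proof -
  have E: "x \<subseteq> Ev A" "y \<subseteq> Ev A" using s es.configsD(1)[OF game_es[OF gisoD(1)[OF i]]] by (simp_all add: scott_def)
  have "pol B (f a) = pol A a" if "a \<in> x \<union> y" for a using gisoD(5)[OF i] E that by blast
  then show ?thesis using s giso_configs[OF i] unfolding scott_def by auto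
qed

text \<open>Renaming a game along an isomorphism is absorbed into the labels; this is how copycats
  on isomorphic games are brought to a common one.\<close>

lemma cc_iso:
  assumes i: "giso A B f g"
  shows "cc (\<lambda>a. p (f a)) (\<lambda>a. q (f a)) A \<approx> cc p q B" (is "?X \<approx> ?Y")
proof -
  let ?f = "map_prod (image f) (image f)" and ?g = "map_prod (image g) (image g)"
  show ?thesis
  proof (rule ls_isoI[where f = ?f and g = ?g])
    note D = gisoD[OF i] and i' = giso_sym[OF i]
    interpret A: es A by (rule game_es[OF D(1)])
    interpret B: es B by (rule game_es[OF D(2)])
    have E: "x \<subseteq> Ev A" "y \<subseteq> Ev A" if "scott A x y" for x y using that A.configsD(1) by (simp_all add: scott_def)
    have E': "x \<subseteq> Ev B" "y \<subseteq> Ev B" if "scott B x y" for x y using that B.configsD(1) by (simp_all add: scott_def)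
    show "Lbs ?X = Lbs ?Y" using giso_image[OF i] by (simp add: image_image[symmetric])
    show "?f s \<in> St ?Y" if "s \<in> St ?X" for s
      using that scott_giso[OF i] by (cases s) simp
    show "?g s \<in> St ?X" if "s \<in> St ?Y" for s
      using that scott_giso[OF i'] by (cases s) simp
    show "?g (?f s) = s" if "s \<in> St ?X" for s
      using that E giso_image_inv[OF i] by (cases s) simp
    show "?f (?g s) = s" if "s \<in> St ?Y" for s
      using that E' giso_image_inv[OF i'] by (cases s) simp
    show "lab ?Y (?f s) = lab ?X s" for s by (cases s) (simp add: image_image)
    show "ord ?Y (?f s) = ord ?X s" if "s \<in> St ?X" for s
    proof (cases s)
      case (Pair x y)
      then have xy: "x \<subseteq> Ev A" "y \<subseteq> Ev A" using that E by auto
      have l: "lev (f ` x) (f ` y) i = f ` lev x y i" "lev (\<lambda>a. p (f a)) (\<lambda>a. q (f a)) i a = lev p q i (f a)"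
        "lev x y i \<subseteq> Ev A" for i a
        using xy by (cases i; simp)+
      have "gord B (lev p q) (lev (f ` x) (f ` y)) UNIV = gord A (lev (\<lambda>a. p (f a)) (\<lambda>a. q (f a))) (lev x y) UNIV"
      proof (intro equalityI subrelI)
        fix u v assume "(u, v) \<in> gord B (lev p q) (lev (f ` x) (f ` y)) UNIV"
        then obtain i a j b where uv: "u = lev p q i (f a)" "v = lev p q j (f b)" "a \<in> lev x y i" "b \<in> lev x y j"
          "xle B i (f a) j (f b)" unfolding gord_iff l(1) by blast
        then have "xle A i a j b" using xle_giso[OF i, of a b] l(3) by blast
        then show "(u, v) \<in> gord A (lev (\<lambda>a. p (f a)) (\<lambda>a. q (f a))) (lev x y) UNIV"
          unfolding gord_iff l(2) using uv by blast
      next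
        fix u v assume "(u, v) \<in> gord A (lev (\<lambda>a. p (f a)) (\<lambda>a. q (f a))) (lev x y) UNIV"
        then obtain i a j b where uv: "u = lev p q i (f a)" "v = lev p q j (f b)" "a \<in> lev x y i" "b \<in> lev x y j"
          "xle A i a j b" unfolding gord_iff l(2) by blast
        then have "xle B i (f a) j (f b)" using xle_giso[OF i, of a b] l(3) by blast
        then show "(u, v) \<in> gord B (lev p q) (lev (f ` x) (f ` y)) UNIV"
          unfolding gord_iff l(1) using uv by blast
      qed
      then show ?thesis using Pair by simp
    qed
    show "Sle ?Y (?f s) (?f s')" if "Sle ?X s s'" for s s'
      using that by (cases s; cases s') auto
    show "Sle ?X (?g s) (?g s')" if "Sle ?Y s s'" for s s'
      using that by (cases s; cases s') auto
  qed
qed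

section \<open>Copycat on dual, parallel and empty games\<close>

lemma lev_not [simp]: "lev u v (\<not> i) = lev v u i"
  by (cases i) simp_all

lemma Tag_in_image [simp]: "Tag i a \<in> Tag j ` x \<longleftrightarrow> i = j \<and> a \<in> x"
  by auto

lemma via_dual: 
  assumes "game A" shows "via s (A\<^sup>\<bottom>) a b \<longleftrightarrow> via (opp s) A a b"
proof -
  have "pol (A\<^sup>\<bottom>) c = s \<longleftrightarrow> pol A c = opp s" if "(a, c) \<in> Le A" for c
    using es.Le_Ev[OF game_es[OF assms] that] by auto
  then show ?thesis unfolding via_def by auto
qed

lemma xle_dual: "game A \<Longrightarrow> xle (A\<^sup>\<bottom>) (i::bool) a j b \<longleftrightarrow> xle A (\<not> i) a (\<not> j) b"
  by (cases i; cases j) (simp_all add: xle_def via_dual)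

lemma scott_dual:
  assumes "game A" shows "scott (A\<^sup>\<bottom>) x y \<longleftrightarrow> scott A y x"
proof -
  have "x \<subseteq> Ev A" if "x \<in> configs A" for x by (rule es.configsD(1)[OF game_es[OF assms] that])
  then show ?thesis unfolding scott_def by (auto; force)
qed

text \<open>Reversing polarities reverses the direction in which moves are forwarded, so copycat on
  the dual is copycat read from its other end. Negating the level accounts for both the order and
  the Scott condition.\<close>

lemma cc_dual:
  assumes A: "game A" shows "cc p q (A\<^sup>\<bottom>) \<approx> cc q p A"
proof (rule ls_isoI[where f = prod.swap and g = prod.swap])
  show "ord (cc q p A) (prod.swap s) = ord (cc p q (A\<^sup>\<bottom>)) s" for s
  proof (cases s)
    case (Pair x y)
    have "gord A (lev q p) (lev y x) UNIV = gord (A\<^sup>\<bottom>) (lev p q) (lev x y) UNIV"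
    proof (intro equalityI subrelI)
      fix u v assume "(u, v) \<in> gord A (lev q p) (lev y x) UNIV"
      then obtain i a j b where uv: "u = lev q p i a" "v = lev q p j b" "a \<in> lev y x i" "b \<in> lev y x j" "xle A i a j b"
        unfolding gord_iff by blast
      show "(u, v) \<in> gord (A\<^sup>\<bottom>) (lev p q) (lev x y) UNIV"
        unfolding gord_iff
        by (rule exI[of _ "\<not> i"], rule exI[of _ a], rule exI[of _ "\<not> j"], rule exI[of _ b]) (use uv in \<open>simp add: xle_dual[OF A]\<close>)
    next
      fix u v assume "(u, v) \<in> gord (A\<^sup>\<bottom>) (lev p q) (lev x y) UNIV"
      then obtain i a j b where uv: "u = lev p q i a" "v = lev p q j b" "a \<in> lev x y i" "b \<in> lev x y j" "xle (A\<^sup>\<bottom>) i a j b"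
        unfolding gord_iff by blast
      show "(u, v) \<in> gord A (lev q p) (lev y x) UNIV"
        unfolding gord_iff
        by (rule exI[of _ "\<not> i"], rule exI[of _ a], rule exI[of _ "\<not> j"], rule exI[of _ b]) (use uv in \<open>simp add: xle_dual[OF A]\<close>)
    qed
    then show ?thesis using Pair by simp
  qed
  show "prod.swap s \<in> St (cc q p A)" if "s \<in> St (cc p q (A\<^sup>\<bottom>))" for s using that scott_dual[OF A] by (cases s) simp
  show "prod.swap s \<in> St (cc p q (A\<^sup>\<bottom>))" if "s \<in> St (cc q p A)" for s using that scott_dual[OF A] by (cases s) simp
  show "lab (cc q p A) (prod.swap s) = lab (cc p q (A\<^sup>\<bottom>)) s" for s by (cases s) auto
  show "Sle (cc q p A) (prod.swap s) (prod.swap s')" if "Sle (cc p q (A\<^sup>\<bottom>)) s s'" for s s' using that by (cases s; cases s') auto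
  show "Sle (cc p q (A\<^sup>\<bottom>)) (prod.swap s) (prod.swap s')" if "Sle (cc q p A) s s'" for s s' using that by (cases s; cases s') auto
qed auto

lemma via_par:
  assumes "game A" "game B"
  shows "via s (A \<parallel> B) (Tag k a) (Tag k' b) \<longleftrightarrow> k = k' \<and> via s (if k then B else A) a b"
proof -
  have "pol (A \<parallel> B) (Tag k c) = pol (if k then B else A) c" if "(a, c) \<in> Le (if k then B else A)" for k c
    using that es.Le_Ev[OF game_es[OF assms(1)]] es.Le_Ev[OF game_es[OF assms(2)]] by (cases k) auto
  then show ?thesis unfolding via_def Le_par by (cases k; cases k') (auto; force)+
qed

lemma xle_par:
  assumes "game A" "game B"
  shows "xle (A \<parallel> B) i (Tag k a) j (Tag k' b) \<longleftrightarrow> k = k' \<and> xle (if k then B else A) i a j b"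
  unfolding xle_def via_par[OF assms] Le_par by (cases k; cases k') auto

lemma scott_par:
  assumes A: "game A" and B: "game B"
  shows "scott (A \<parallel> B) (duo x x') (duo y y') \<longleftrightarrow> scott A x y \<and> scott B x' y'"
proof -
  have "x \<subseteq> Ev A" if "x \<in> configs A" for x by (rule es.configsD(1)[OF game_es[OF A] that])
  then have 1: "pol (A \<parallel> B) (Tag False a) = pol A a" if "x \<in> configs A" "a \<in> x" for a x using that by force
  have "x \<subseteq> Ev B" if "x \<in> configs B" for x by (rule es.configsD(1)[OF game_es[OF B] that])
  then have 2: "pol (A \<parallel> B) (Tag True a) = pol B a" if "x \<in> configs B" "a \<in> x" for a x using that by force
  show ?thesis
  proof (cases "x \<in> configs A \<and> y \<in> configs A \<and> x' \<in> configs B \<and> y' \<in> configs B")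
    case True
    then have p: "\<And>a. a \<in> x \<Longrightarrow> pol (A \<parallel> B) (Tag False a) = pol A a" "\<And>a. a \<in> y \<Longrightarrow> pol (A \<parallel> B) (Tag False a) = pol A a"
      "\<And>a. a \<in> x' \<Longrightarrow> pol (A \<parallel> B) (Tag True a) = pol B a" "\<And>a. a \<in> y' \<Longrightarrow> pol (A \<parallel> B) (Tag True a) = pol B a"
      using 1 2 by blast+
    then show ?thesis
      unfolding scott_def config_par_iff[OF A B] using True p by (simp add: ball_Un cong: ball_cong) blast
  qed (use config_par_iff[OF A B] in \<open>auto simp: scott_def\<close>)
qed

lemma scott_duo:
  assumes A: "game A" and B: "game B" and s: "scott (A \<parallel> B) x y"
  shows "x = duo (inl x) (inr x)" "y = duo (inl y) (inr y)" "scott A (inl x) (inl y)" "scott B (inr x) (inr y)"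
proof -
  have E: "x \<subseteq> duo (Ev A) (Ev B)" "y \<subseteq> duo (Ev A) (Ev B)"
    using s es.configsD(1)[OF game_es[OF game_par[OF A B]]] by (simp_all add: scott_def)
  show 1: "x = duo (inl x) (inr x)" by (rule duo_split[OF E(1)])
  show 2: "y = duo (inl y) (inr y)" by (rule duo_split[OF E(2)])
  have "scott (A \<parallel> B) (duo (inl x) (inr x)) (duo (inl y) (inr y))" using s 1 2 by (simp only:)
  then show "scott A (inl x) (inl y)" "scott B (inr x) (inr y)" unfolding scott_par[OF A B] by simp_all
qed

text \<open>No causal link, hence no crossing, connects the two components, so both the order and
  the Scott condition split.\<close>

lemma cc_par:
  assumes A: "game A" and B: "game B" and v: "valid (cc p q A)" "valid (cc p' q' B)"
    and dis: "(p ` Ev A \<union> q ` Ev A) \<inter> (p' ` Ev B \<union> q' ` Ev B) = {}"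
  shows "cc (tag p p') (tag q q') (A \<parallel> B) \<approx> cc p q A \<bowtie> cc p' q' B" (is "?Z \<approx> ?X \<bowtie> ?Y")
proof -
  let ?f = "\<lambda>(x, y). ((inl x, inl y), (inr x, inr y))" and ?g = "\<lambda>((x, y), (x', y')). (duo x x', duo y y')"
  show ?thesis
  proof (rule ls_isoI[where f = ?f and g = ?g])
    have dis': "Lbs ?X \<inter> Lbs ?Y = {}" using dis by simp
    note J = join_disjoint[OF v dis']
    have J1: "((x, y), (x', y')) \<in> St (?X \<bowtie> ?Y) \<longleftrightarrow> scott A x y \<and> scott B x' y'" for x y x' y'
    proof
      assume "((x, y), (x', y')) \<in> St (?X \<bowtie> ?Y)"
      then show "scott A x y \<and> scott B x' y'" unfolding join_simps cc_simps by blast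
    next
      assume "scott A x y \<and> scott B x' y'"
      then show "((x, y), (x', y')) \<in> St (?X \<bowtie> ?Y)" using J(1)[of "(x, y)" "(x', y')"] by simp
    qed
    show "Lbs ?Z = Lbs (?X \<bowtie> ?Y)" by auto
    {
      fix s assume "s \<in> St ?Z"
      then obtain x y where s: "s = (x, y)" "scott (A \<parallel> B) x y" by (cases s) simp
      note d = scott_duo[OF A B s(2)]
      show "?f s \<in> St (?X \<bowtie> ?Y)"
        unfolding s(1) prod.case J1 using d(3,4) by blast
      show "?g (?f s) = s"
        unfolding s(1) prod.case d(1,2)[symmetric] ..
      have "tag p p' ` x = p ` inl x \<union> p' ` inr x" "tag q q' ` y = q ` inl y \<union> q' ` inr y"
        using d(1,2) tag_image by metis+
      then show "lab (?X \<bowtie> ?Y) (?f s) = lab ?Z s"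
        unfolding s(1) by auto
      have "gord (A \<parallel> B) (lev (tag p p') (tag q q')) (lev x y) UNIV =
         gord A (lev p q) (lev (inl x) (inl y)) UNIV \<union> gord B (lev p' q') (lev (inr x) (inr y)) UNIV" (is "?G = ?G1 \<union> ?G2")
      proof -
        have m: "Tag False a \<in> lev x y i \<longleftrightarrow> a \<in> lev (inl x) (inl y) i" "Tag True a \<in> lev x y i \<longleftrightarrow> a \<in> lev (inr x) (inr y) i"
          "lev (tag p p') (tag q q') i (Tag False a) = lev p q i a" "lev (tag p p') (tag q q') i (Tag True a) = lev p' q' i a" for a i
          by (cases i; simp add: inl_def inr_def)+
        have sub: "lev x y i \<subseteq> Tag False ` Ev A \<union> Tag True ` Ev B" for i
          using s(2) es.configsD(1)[OF game_es[OF game_par[OF A B]]] by (cases i) (auto simp: scott_def)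
        show ?thesis
        proof (intro equalityI subrelI)
          fix u v assume "(u, v) \<in> ?G"
          then obtain i a j b where uv: "u = lev (tag p p') (tag q q') i a" "v = lev (tag p p') (tag q q') j b"
             "a \<in> lev x y i" "b \<in> lev x y j" "xle (A \<parallel> B) i a j b" unfolding gord_iff by blast
          obtain k c where c: "a = Tag k c" using subsetD[OF sub uv(3)] by auto
          obtain k' d where d: "b = Tag k' d" using subsetD[OF sub uv(4)] by auto
          note cd = c d
          have x: "k = k'" "xle (if k then B else A) i c j d" using uv(5) unfolding c d xle_par[OF A B] by blast+
          show "(u, v) \<in> ?G1 \<union> ?G2"
          proof (cases k)
            case True
            have "u = lev p' q' i c" "v = lev p' q' j d" "c \<in> lev (inr x) (inr y) i" "d \<in> lev (inr x) (inr y) j" "xle B i c j d"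
              using uv x True unfolding c d by (simp_all add: m)
            then have "(u, v) \<in> ?G2" unfolding gord_iff by blast
            then show ?thesis by blast
          next
            case False
            have "u = lev p q i c" "v = lev p q j d" "c \<in> lev (inl x) (inl y) i" "d \<in> lev (inl x) (inl y) j" "xle A i c j d"
              using uv x False unfolding c d by (simp_all add: m)
            then have "(u, v) \<in> ?G1" unfolding gord_iff by blast
            then show ?thesis by blast
          qed
        next
          fix u v assume "(u, v) \<in> ?G1 \<union> ?G2"
          then show "(u, v) \<in> ?G"
          proof
            assume "(u, v) \<in> ?G1"
            then obtain i a j b where uv: "u = lev p q i a" "v = lev p q j b"
               "a \<in> lev (inl x) (inl y) i" "b \<in> lev (inl x) (inl y) j" "xle A i a j b" unfolding gord_iff by blast
            then show ?thesis unfolding gord_iff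
              by - (rule exI[of _ i], rule exI[of _ "Tag False a"], rule exI[of _ j], rule exI[of _ "Tag False b"],
                  simp add: m xle_par[OF A B])
          next
            assume "(u, v) \<in> ?G2"
            then obtain i a j b where uv: "u = lev p' q' i a" "v = lev p' q' j b"
               "a \<in> lev (inr x) (inr y) i" "b \<in> lev (inr x) (inr y) j" "xle B i a j b" unfolding gord_iff by blast
            then show ?thesis unfolding gord_iff
              by - (rule exI[of _ i], rule exI[of _ "Tag True a"], rule exI[of _ j], rule exI[of _ "Tag True b"],
                  simp add: m xle_par[OF A B])
          qed
        qed
      qed
      then show "ord (?X \<bowtie> ?Y) (?f s) = ord ?Z s"
        unfolding s(1) prod.case cc_simps using J(2)[of "(inl x, inl y)" "(inr x, inr y)"] d(3,4) by simp
    next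
      fix t assume "t \<in> St (?X \<bowtie> ?Y)"
      then obtain x y x' y' where t: "t = ((x, y), (x', y'))" "scott A x y" "scott B x' y'"
        using J1 by (metis surj_pair)
      show "?g t \<in> St ?Z"
        unfolding t(1) prod.case cc_simps scott_par[OF A B] using t by simp
      show "?f (?g t) = t"
        unfolding t(1) by simp
    }
    show "Sle (?X \<bowtie> ?Y) (?f s) (?f s')"
      if "Sle ?Z s s'" for s s'
      using that by (cases s; cases s') (auto simp: inl_def inr_def)
    show "Sle ?Z (?g t) (?g t')"
      if "Sle (?X \<bowtie> ?Y) t t'" for t t'
      using that unfolding join_def cc_def by (auto simp: split_def)
  qed
qed

text \<open>Copycat on the empty game has a single state, and this state has no labels.\<close>

lemma cc_empty:
  assumes "valid X" shows "X \<bowtie> cc p q \<one> \<approx> X"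
proof (rule ls_isoI[where f = fst and g = "\<lambda>x. (x, ({}, {}))"])
  have s: "scott \<one> x y \<longleftrightarrow> x = {} \<and> y = {}" for x y by (auto simp: scott_def)
  have g: "gord \<one> P W UNIV = {}" for P W by (auto simp: gord_iff xle_def)
  have t: "(ord X x)\<^sup>+ = ord X x" "antisym (ord X x)" if "x \<in> St X" for x
    using validD(4,5)[OF assms that] by simp_all
  show "(x, ({}, {})) \<in> St (X \<bowtie> cc p q \<one>)" if "x \<in> St X" for x
    using that t by (simp add: s g)
  show "(fst z, ({}, {})) = z" if "z \<in> St (X \<bowtie> cc p q \<one>)" for z
    using that by (cases z; cases "snd z") (auto simp: s)
  show "ord X (fst z) = ord (X \<bowtie> cc p q \<one>) z" if "z \<in> St (X \<bowtie> cc p q \<one>)" for z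
    using that t by (cases z; cases "snd z") (auto simp: s g)
  show "lab X (fst z) = lab (X \<bowtie> cc p q \<one>) z" if "z \<in> St (X \<bowtie> cc p q \<one>)" for z
    using that by (cases z; cases "snd z") (auto simp: s)
  show "Sle X (fst z) (fst z')" if "Sle (X \<bowtie> cc p q \<one>) z z'" for z z'
    using that by (cases z; cases z') simp
  show "fst z \<in> St X" if "z \<in> St (X \<bowtie> cc p q \<one>)" for z using that by (cases z) simp
qed auto

section \<open>Strategies\<close>

text \<open>A label is a move paired with a number. Different numbers give disjoint names, so
  separation is settled by \<open>simp\<close>, and a number acts as the name of a wire.\<close>

abbreviation P :: "nat \<Rightarrow> 'a ev \<Rightarrow> nat \<times> 'a ev" where "P n \<equiv> Pair n"

lemma sep_simps [simp]:
  "sep p A q B \<longleftrightarrow> inj_on p (Ev A) \<and> inj_on q (Ev B) \<and> p ` Ev A \<inter> q ` Ev B = {}"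
  by (simp add: sep_def)

lemma inj_tag_iff [simp]:
  "inj_on (tag p q) (duo X Y) \<longleftrightarrow> inj_on p X \<and> inj_on q Y \<and> p ` X \<inter> q ` Y = {}"
proof
  assume *: "inj_on (tag p q) (duo X Y)"
  have "inj_on p X" "inj_on q Y"
    using inj_onD[OF *, of "Tag False _" "Tag False _"] inj_onD[OF *, of "Tag True _" "Tag True _"]
    by (auto intro!: inj_onI)
  moreover have "p a \<noteq> q b" if "a \<in> X" "b \<in> Y" for a b
    using inj_onD[OF *, of "Tag False a" "Tag True b"] that by auto
  ultimately show "inj_on p X \<and> inj_on q Y \<and> p ` X \<inter> q ` Y = {}" by blast
next
  assume *: "inj_on p X \<and> inj_on q Y \<and> p ` X \<inter> q ` Y = {}"
  then have n: "p a \<noteq> q b" "q b \<noteq> p a" if "a \<in> X" "b \<in> Y" for a b using that by (metis IntI empty_iff imageI)+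
  have i: "inj_on p X" "inj_on q Y" using * by simp_all
  show "inj_on (tag p q) (duo X Y)"
    by (rule inj_onI) (auto dest: inj_onD[OF i(1)] inj_onD[OF i(2)] simp: n)
qed

lemma P_disjoint [simp]: "m \<noteq> n \<Longrightarrow> P m ` X \<inter> P n ` Y = {}"
  by auto

lemma inj_P [simp]: "inj_on (P n) X"
  by (simp add: inj_on_def)

text \<open>The bound \<open>{}\<close> is a placeholder: \<open>\<approx>\<close> only compares the
  two bounds for equality. The equivalence laws of \<open>\<cong>\<close> are inherited from those
  of \<open>\<approx>\<close> through this form.\<close>

lemma prestrat_iso_iff:
  assumes "prestrategy A \<sigma>" "prestrategy A \<tau>"
  shows "\<sigma> \<cong> \<tau> \<longleftrightarrow> LS {} (fst \<sigma>) (snd \<sigma>) \<approx> LS {} (fst \<tau>) (snd \<tau>)"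
  using LS_prestrat_iso[OF assms, of "{}" id] prestrat_iso_of_LS[OF assms, of id "{}"] by auto

lemma iso_refl: "prestrategy A \<sigma> \<Longrightarrow> \<sigma> \<cong> \<sigma>"
  by (simp add: prestrat_iso_iff)

lemma iso_sym: "prestrategy A \<sigma> \<Longrightarrow> prestrategy A \<tau> \<Longrightarrow> \<sigma> \<cong> \<tau> \<Longrightarrow> \<tau> \<cong> \<sigma>"
  by (simp add: prestrat_iso_iff ls_iso_sym)

lemma iso_trans:
  "prestrategy A \<sigma> \<Longrightarrow> prestrategy A \<tau> \<Longrightarrow> prestrategy A \<upsilon> \<Longrightarrow> \<sigma> \<cong> \<tau> \<Longrightarrow> \<tau> \<cong> \<upsilon> \<Longrightarrow> \<sigma> \<cong> \<upsilon>"
  by (simp add: prestrat_iso_iff) (rule ls_iso_trans)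

abbreviation pre :: "'a ev esp \<Rightarrow> 'a ev esp \<Rightarrow> 'a prestrat \<Rightarrow> bool" where
  "pre A B \<sigma> \<equiv> game A \<and> game B \<and> prestrategy (A\<^sup>\<bottom> \<parallel> B) \<sigma>"

lemma isoI_LSp:
  assumes "pre A B \<sigma>" "pre A B \<tau>" "LSp p q A B \<sigma> \<approx> LSp p q A B \<tau>" "sep p A q B" shows "\<sigma> \<cong> \<tau>"
  using LSp_iso_iff assms by blast

lemma LSp_iso:
  assumes "pre A B \<sigma>" "pre A B \<tau>" "\<sigma> \<cong> \<tau>" shows "LSp p q A B \<sigma> \<approx> LSp p q A B \<tau>"
  unfolding LSp_def by (rule LS_prestrat_iso[of "A\<^sup>\<bottom> \<parallel> B"]) (use assms in auto)

lemma composableI: "pre A B \<sigma> \<Longrightarrow> pre B C \<tau> \<Longrightarrow> composable A B C \<sigma> \<tau>"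
  by (simp add: composable_def)

lemma pre_comp: "pre A B \<sigma> \<Longrightarrow> pre B C \<tau> \<Longrightarrow> pre A C (strat_comp A C \<tau> \<sigma>)"
  using composable.prestrategy_comp[OF composableI] by blast

lemma LSp_comp:
  assumes "pre A B \<sigma>" "pre B C \<tau>" "sep p A q B" "sep p A r C" "sep q B r C"
  shows "LSp p r A C (strat_comp A C \<tau> \<sigma>) \<approx> hide (q ` Ev B) (LSp p q A B \<sigma> \<bowtie> LSp q r B C \<tau>)"
  by (rule composable.LSp_comp[OF composableI]) (use assms in auto)

lemma valid_LSp': "pre A B \<sigma> \<Longrightarrow> sep p A q B \<Longrightarrow> valid (LSp p q A B \<sigma>)"
  using valid_LSp by blast

section \<open>Composition up to isomorphism\<close>

lemma comp_cong:
  assumes "pre A B \<sigma>" "pre A B \<sigma>'" "pre B C \<tau>" "pre B C \<tau>'" "\<sigma> \<cong> \<sigma>'" "\<tau> \<cong> \<tau>'"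
  shows "strat_comp A C \<tau> \<sigma> \<cong> strat_comp A C \<tau>' \<sigma>'"
proof (rule isoI_LSp[where p = "P 0" and q = "P 2"])
  have "LSp (P 0) (P 2) A C (strat_comp A C \<tau> \<sigma>) \<approx>
     hide (P 5 ` Ev B) (LSp (P 0) (P 5) A B \<sigma> \<bowtie> LSp (P 5) (P 2) B C \<tau>)"
    by (rule LSp_comp) (use assms in simp_all)
  also have "\<dots> \<approx> hide (P 5 ` Ev B) (LSp (P 0) (P 5) A B \<sigma>' \<bowtie> LSp (P 5) (P 2) B C \<tau>')"
    by (intro hide_cong join_cong LSp_iso assms)
  also have "\<dots> \<approx> LSp (P 0) (P 2) A C (strat_comp A C \<tau>' \<sigma>')"
    by (rule ls_iso_sym[OF LSp_comp]) (use assms in simp_all)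
  finally show "LSp (P 0) (P 2) A C (strat_comp A C \<tau> \<sigma>) \<approx> LSp (P 0) (P 2) A C (strat_comp A C \<tau>' \<sigma>')" .
qed (simp_all add: pre_comp[OF assms(1,3)] pre_comp[OF assms(2,4)])

text \<open>\<open>H\<close> is the wire between \<open>X\<close> and \<open>Y\<close>, and
  \<open>K\<close> the one between \<open>Y\<close> and \<open>Z\<close>. Neither is seen by the
  remaining factor, so both hidings move outwards and bracketing becomes a matter of the join
  alone.\<close>

lemma hide_chain:
  assumes X: "valid X" and Y: "valid Y" and Z: "valid Z" and "H \<inter> Lbs Z = {}" "K \<inter> Lbs X = {}"
  shows "hide K (hide H (X \<bowtie> Y) \<bowtie> Z) \<approx> hide H (X \<bowtie> hide K (Y \<bowtie> Z))"
proof -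
  note [intro] = X Y Z
  have "hide K (hide H (X \<bowtie> Y) \<bowtie> Z) \<approx> hide K (hide H ((X \<bowtie> Y) \<bowtie> Z))"
    by (intro hide_cong ls_iso_sym[OF hide_join]) (use assms in auto)
  also have "\<dots> \<approx> hide (K \<union> H) ((X \<bowtie> Y) \<bowtie> Z)" by (rule hide_hide) auto
  also have "\<dots> \<approx> hide (K \<union> H) (X \<bowtie> (Y \<bowtie> Z))" by (intro hide_cong join_assoc) auto
  also have "\<dots> = hide (H \<union> K) (X \<bowtie> (Y \<bowtie> Z))" by (simp add: Un_commute)
  also have "\<dots> \<approx> hide H (hide K (X \<bowtie> (Y \<bowtie> Z)))" by (rule ls_iso_sym[OF hide_hide]) auto
  also have "\<dots> \<approx> hide H (X \<bowtie> hide K (Y \<bowtie> Z))"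
    by (intro hide_cong hide_join_right) (use assms in auto)
  finally show ?thesis .
qed

lemma strat_assoc:
  assumes \<sigma>: "pre A B \<sigma>" and \<tau>: "pre B C \<tau>" and \<upsilon>: "pre C D \<upsilon>"
  shows "strat_comp A D \<upsilon> (strat_comp A C \<tau> \<sigma>) \<cong> strat_comp A D (strat_comp B D \<upsilon> \<tau>) \<sigma>"
proof (rule isoI_LSp[where p = "P 0" and q = "P 3"])
  note st = pre_comp[OF \<sigma> \<tau>] and tu = pre_comp[OF \<tau> \<upsilon>]
  note c = st tu pre_comp[OF st \<upsilon>] pre_comp[OF \<sigma> tu]
  let ?X = "LSp (P 0) (P 5) A B \<sigma>" and ?Y = "LSp (P 5) (P 2) B C \<tau>" and ?Z = "LSp (P 2) (P 3) C D \<upsilon>"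
  have v: "valid ?X" "valid ?Y" "valid ?Z" using assms by (auto intro!: valid_LSp)
  have "LSp (P 0) (P 3) A D (strat_comp A D \<upsilon> (strat_comp A C \<tau> \<sigma>)) \<approx>
     hide (P 2 ` Ev C) (LSp (P 0) (P 2) A C (strat_comp A C \<tau> \<sigma>) \<bowtie> ?Z)"
    by (rule LSp_comp) (use assms c in simp_all)
  also have "\<dots> \<approx> hide (P 2 ` Ev C) (hide (P 5 ` Ev B) (?X \<bowtie> ?Y) \<bowtie> ?Z)"
    by (intro hide_cong join_cong ls_iso_refl LSp_comp) (use assms in simp_all)
  also have "\<dots> \<approx> hide (P 5 ` Ev B) (?X \<bowtie> hide (P 2 ` Ev C) (?Y \<bowtie> ?Z))"
    by (rule hide_chain[OF v]) auto
  also have "\<dots> \<approx> hide (P 5 ` Ev B) (?X \<bowtie> LSp (P 5) (P 3) B D (strat_comp B D \<upsilon> \<tau>))"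
    by (intro hide_cong join_cong ls_iso_refl ls_iso_sym[OF LSp_comp]) (use assms in simp_all)
  also have "\<dots> \<approx> LSp (P 0) (P 3) A D (strat_comp A D (strat_comp B D \<upsilon> \<tau>) \<sigma>)"
    by (rule ls_iso_sym[OF LSp_comp]) (use assms c in simp_all)
  finally show "LSp (P 0) (P 3) A D (strat_comp A D \<upsilon> (strat_comp A C \<tau> \<sigma>)) \<approx>
    LSp (P 0) (P 3) A D (strat_comp A D (strat_comp B D \<upsilon> \<tau>) \<sigma>)" .
  show "pre A D (strat_comp A D \<upsilon> (strat_comp A C \<tau> \<sigma>))" "pre A D (strat_comp A D (strat_comp B D \<upsilon> \<tau>) \<sigma>)"
    by (rule c)+
qed simp

lemma pre_copycat: "game A \<Longrightarrow> pre A A (\<gamma> A)"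
  using prestrategy_copycat by blast

lemma copycat_idem:
  assumes A: "game A" shows "strat_comp A A (\<gamma> A) (\<gamma> A) \<cong> \<gamma> A"
proof (rule isoI_LSp[where p = "P 0" and q = "P 2"])
  have "LSp (P 0) (P 2) A A (strat_comp A A (\<gamma> A) (\<gamma> A)) \<approx>
     hide (P 5 ` Ev A) (LSp (P 0) (P 5) A A (\<gamma> A) \<bowtie> LSp (P 5) (P 2) A A (\<gamma> A))"
    by (rule LSp_comp) (use pre_copycat[OF A] in simp_all)
  also have "\<dots> \<approx> hide (P 5 ` Ev A) (cc (P 0) (P 5) A \<bowtie> cc (P 5) (P 2) A)"
    by (intro hide_cong join_cong LSp_copycat A)
  also have "\<dots> \<approx> cc (P 0) (P 2) A" by (rule cc_idem) (use A in simp_all)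
  also have "\<dots> \<approx> LSp (P 0) (P 2) A A (\<gamma> A)" by (rule ls_iso_sym[OF LSp_copycat[OF A]])
  finally show "LSp (P 0) (P 2) A A (strat_comp A A (\<gamma> A) (\<gamma> A)) \<approx> LSp (P 0) (P 2) A A (\<gamma> A)" .
qed (use pre_copycat[OF A] pre_comp[OF pre_copycat[OF A] pre_copycat[OF A]] in simp_all)

lemma pre_from_unit:
  assumes A: "game A" and \<sigma>: "prestrategy A \<sigma>" shows "pre \<one> A (from_unit \<sigma>)"
proof -
  note D = prestrategyD[OF \<sigma>]
  have "prestrategy (\<one>\<^sup>\<bottom> \<parallel> A) (from_unit \<sigma>)"
  proof (rule prestrategyI)
    show "game (fst (from_unit \<sigma>))" using D by (simp add: from_unit_def split_def)
    show "snd (from_unit \<sigma>) s \<in> Ev (\<one>\<^sup>\<bottom> \<parallel> A)" if "s \<in> Ev (fst (from_unit \<sigma>))" for s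
      using that D by (simp add: from_unit_def split_def)
    show "pol (\<one>\<^sup>\<bottom> \<parallel> A) (snd (from_unit \<sigma>) s) = pol (fst (from_unit \<sigma>)) s" if "s \<in> Ev (fst (from_unit \<sigma>))" for s
      using that D by (simp add: from_unit_def split_def)
    fix x assume "x \<in> configs (fst (from_unit \<sigma>))"
    then have x: "x \<in> configs (fst \<sigma>)" by (simp add: from_unit_def split_def)
    have "snd (from_unit \<sigma>) ` x = duo {} (snd \<sigma> ` x)" by (simp add: from_unit_def split_def image_comp)
    moreover have "duo {} (snd \<sigma> ` x) \<in> configs (\<one>\<^sup>\<bottom> \<parallel> A)"
      using config_par_iff[OF game_empty A, of "{}" "snd \<sigma> ` x"] D(4)[OF x] by simp
    moreover have "inj_on (snd (from_unit \<sigma>)) x"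
      using D(5)[OF x] by (auto simp: from_unit_def split_def inj_on_def)
    ultimately show "snd (from_unit \<sigma>) ` x \<in> configs (\<one>\<^sup>\<bottom> \<parallel> A) \<and> inj_on (snd (from_unit \<sigma>)) x" by simp
  qed
  then show ?thesis using A by simp
qed

text \<open>An equality and not only an isomorphism: the empty game has no moves to name, so naming
  two games separately is the same as naming the single game
  \<open>A\<^sup>\<bottom> \<parallel> B\<close> by a \<open>tag\<close>.\<close>

lemma LSp_from_unit: "LSp u (tag p q) \<one> (A\<^sup>\<bottom> \<parallel> B) (from_unit \<sigma>) = LSp p q A B \<sigma>"
  by (simp add: LSp_def from_unit_def split_def)

text \<open>The defining equation of strategies composes with the copycat of the whole game; since the
  latter is the parallel composition of two copycats, it amounts to absorbing copycats on both sides.\<close>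

lemma strategy_iff:
  assumes \<sigma>: "pre A B \<sigma>"
  shows "strategy (A\<^sup>\<bottom> \<parallel> B) \<sigma> \<longleftrightarrow> strat_comp A B (\<gamma> B) (strat_comp A B \<sigma> (\<gamma> A)) \<cong> \<sigma>"
proof -
  let ?G = "A\<^sup>\<bottom> \<parallel> B" and ?S = "strat_comp A B (\<gamma> B) (strat_comp A B \<sigma> (\<gamma> A))"
  let ?t = "tag (P 0) (P 5)" and ?t' = "tag (P 2) (P 3)"
  have A: "game A" and B: "game B" and G: "game ?G" using \<sigma> by simp_all
  have u: "pre \<one> ?G (from_unit \<sigma>)" using pre_from_unit[OF G] \<sigma> by blast
  have g: "pre A A (\<gamma> A)" "pre B B (\<gamma> B)" "pre ?G ?G (\<gamma> ?G)" using pre_copycat A B G by blast+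
  have c: "pre \<one> ?G (strat_comp \<one> ?G (\<gamma> ?G) (from_unit \<sigma>))" using pre_comp[OF u g(3)] .
  have S: "pre A B (strat_comp A B \<sigma> (\<gamma> A))" "pre A B ?S" using pre_comp[OF g(1) \<sigma>] pre_comp[OF _ g(2)] by blast+
  let ?X = "LSp (P 0) (P 5) A B \<sigma>" and ?L = "cc (P 2) (P 0) A" and ?R = "cc (P 5) (P 3) B"
  have v: "valid ?X" "valid ?L" "valid ?R" using A B \<sigma> by (auto intro!: valid_LSp valid_cc)
  note [intro] = v
  \<comment> \<open>\<open>P 9\<close> stands for the empty game and names nothing; 0 and 5 are the
    wires to be hidden, 2 and 3 the outer ones.\<close>
  have "LSp (P 9) ?t' \<one> ?G (strat_comp \<one> ?G (\<gamma> ?G) (from_unit \<sigma>)) \<approx>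
     hide (?t ` Ev ?G) (LSp (P 9) ?t \<one> ?G (from_unit \<sigma>) \<bowtie> LSp ?t ?t' ?G ?G (\<gamma> ?G))"
    by (rule LSp_comp[OF u g(3)]) (simp_all add: Int_Un_distrib Int_Un_distrib2)
  also have "\<dots> \<approx> hide (P 0 ` Ev A \<union> P 5 ` Ev B) (?X \<bowtie> (?L \<bowtie> ?R))"
  proof -
    \<comment> \<open>The left half is a copycat on \<open>A\<^sup>\<bottom>\<close>, leading from
      the inner wire 0 to the outer wire 2. Turned around it is a copycat on \<open>A\<close> that
      feeds the source of \<open>\<sigma>\<close>.\<close>
    have "LSp ?t ?t' ?G ?G (\<gamma> ?G) \<approx> cc ?t ?t' ?G" by (rule LSp_copycat[OF G])
    also have "\<dots> \<approx> cc (P 0) (P 2) (A\<^sup>\<bottom>) \<bowtie> ?R"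
      by (rule cc_par) (use A B in \<open>auto intro!: valid_cc\<close>)
    also have "\<dots> \<approx> ?L \<bowtie> ?R" by (intro join_cong cc_dual ls_iso_refl A)
    finally show ?thesis unfolding LSp_from_unit by (simp add: hide_cong join_cong)
  qed
  also have "\<dots> \<approx> hide (P 0 ` Ev A \<union> P 5 ` Ev B) ((?L \<bowtie> ?X) \<bowtie> ?R)"
  proof (rule hide_cong)
    have "?X \<bowtie> (?L \<bowtie> ?R) \<approx> (?X \<bowtie> ?L) \<bowtie> ?R" by (rule ls_iso_sym[OF join_assoc]) auto
    also have "\<dots> \<approx> (?L \<bowtie> ?X) \<bowtie> ?R" by (intro join_cong join_comm ls_iso_refl)
    finally show "?X \<bowtie> (?L \<bowtie> ?R) \<approx> (?L \<bowtie> ?X) \<bowtie> ?R" .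
  qed
  also have "\<dots> = hide (P 5 ` Ev B \<union> P 0 ` Ev A) ((?L \<bowtie> ?X) \<bowtie> ?R)" by (simp add: Un_commute)
  also have "\<dots> \<approx> hide (P 5 ` Ev B) (hide (P 0 ` Ev A) ((?L \<bowtie> ?X) \<bowtie> ?R))" by (rule ls_iso_sym[OF hide_hide]) auto
  also have "\<dots> \<approx> hide (P 5 ` Ev B) (hide (P 0 ` Ev A) (?L \<bowtie> ?X) \<bowtie> ?R)" by (intro hide_cong hide_join) auto
  also have "\<dots> \<approx> hide (P 5 ` Ev B) (LSp (P 2) (P 5) A B (strat_comp A B \<sigma> (\<gamma> A)) \<bowtie> LSp (P 5) (P 3) B B (\<gamma> B))"
  proof (intro hide_cong join_cong)
    have "LSp (P 2) (P 5) A B (strat_comp A B \<sigma> (\<gamma> A)) \<approx> hide (P 0 ` Ev A) (LSp (P 2) (P 0) A A (\<gamma> A) \<bowtie> ?X)"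
      by (rule LSp_comp[OF g(1) \<sigma>]) simp_all
    also have "\<dots> \<approx> hide (P 0 ` Ev A) (?L \<bowtie> ?X)" by (intro hide_cong join_cong LSp_copycat ls_iso_refl A)
    finally show "hide (P 0 ` Ev A) (?L \<bowtie> ?X) \<approx> LSp (P 2) (P 5) A B (strat_comp A B \<sigma> (\<gamma> A))" by (rule ls_iso_sym)
    show "?R \<approx> LSp (P 5) (P 3) B B (\<gamma> B)" by (rule ls_iso_sym[OF LSp_copycat[OF B]])
  qed
  also have "\<dots> \<approx> LSp (P 2) (P 3) A B ?S" by (rule ls_iso_sym[OF LSp_comp[OF S(1) g(2)]]) simp_all
  finally have *: "LSp (P 9) ?t' \<one> ?G (strat_comp \<one> ?G (\<gamma> ?G) (from_unit \<sigma>)) \<approx> LSp (P 2) (P 3) A B ?S" .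
  have "strategy ?G \<sigma> \<longleftrightarrow> strat_comp \<one> ?G (\<gamma> ?G) (from_unit \<sigma>) \<cong> from_unit \<sigma>"
    using \<sigma> by (simp add: strategy_def)
  also have "\<dots> \<longleftrightarrow> LSp (P 9) ?t' \<one> ?G (strat_comp \<one> ?G (\<gamma> ?G) (from_unit \<sigma>)) \<approx> LSp (P 9) ?t' \<one> ?G (from_unit \<sigma>)"
    by (rule LSp_iso_iff[symmetric]) (use c u in simp_all)
  also have "\<dots> \<longleftrightarrow> LSp (P 9) ?t' \<one> ?G (strat_comp \<one> ?G (\<gamma> ?G) (from_unit \<sigma>)) \<approx> LSp (P 2) (P 3) A B \<sigma>"
    unfolding LSp_from_unit ..
  also have "\<dots> \<longleftrightarrow> LSp (P 2) (P 3) A B ?S \<approx> LSp (P 2) (P 3) A B \<sigma>"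
    using * ls_iso_trans ls_iso_sym by blast
  also have "\<dots> \<longleftrightarrow> ?S \<cong> \<sigma>"
    by (rule LSp_iso_iff) (use S \<sigma> in simp_all)
  finally show ?thesis .
qed

abbreviation strat :: "'a ev esp \<Rightarrow> 'a ev esp \<Rightarrow> 'a prestrat \<Rightarrow> bool" where
  "strat A B \<sigma> \<equiv> game A \<and> game B \<and> strategy (A\<^sup>\<bottom> \<parallel> B) \<sigma>"

lemma strat_pre: "strat A B \<sigma> \<Longrightarrow> pre A B \<sigma>"
  by (simp add: strategy_def)

lemma strat_left:
  assumes s: "strat A B \<sigma>" shows "strat_comp A B (\<gamma> B) \<sigma> \<cong> \<sigma>"
proof -
  have \<sigma>: "pre A B \<sigma>" using strat_pre[OF s] .
  have g: "pre A A (\<gamma> A)" "pre B B (\<gamma> B)" using pre_copycat \<sigma> by blast+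
  let ?r = "strat_comp A B \<sigma> (\<gamma> A)"
  have r: "pre A B ?r" using pre_comp[OF g(1) \<sigma>] .
  have gr: "pre A B (strat_comp A B (\<gamma> B) ?r)" using pre_comp[OF r g(2)] .
  have gg: "pre B B (strat_comp B B (\<gamma> B) (\<gamma> B))" using pre_comp[OF g(2) g(2)] .
  have 1: "strat_comp A B (\<gamma> B) ?r \<cong> \<sigma>" using s strategy_iff[OF \<sigma>] by blast
  have e1: "\<sigma> \<cong> strat_comp A B (\<gamma> B) ?r" using iso_sym[of "A\<^sup>\<bottom> \<parallel> B"] 1 gr \<sigma> by blast
  have 2: "strat_comp A B (\<gamma> B) \<sigma> \<cong> strat_comp A B (\<gamma> B) (strat_comp A B (\<gamma> B) ?r)"
    by (rule comp_cong[OF \<sigma> gr g(2) g(2) e1 iso_refl[of "B\<^sup>\<bottom> \<parallel> B"]]) (use g in blast)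
  have 3: "strat_comp A B (\<gamma> B) (strat_comp A B (\<gamma> B) ?r) \<cong> strat_comp A B (strat_comp B B (\<gamma> B) (\<gamma> B)) ?r"
    by (rule strat_assoc[OF r g(2) g(2)])
  have 4: "strat_comp A B (strat_comp B B (\<gamma> B) (\<gamma> B)) ?r \<cong> strat_comp A B (\<gamma> B) ?r"
    by (rule comp_cong[OF r r gg g(2) iso_refl[of "A\<^sup>\<bottom> \<parallel> B"] copycat_idem]) (use r \<sigma> in blast)+
  note T = iso_trans[of "A\<^sup>\<bottom> \<parallel> B"]
  have p: "prestrategy (A\<^sup>\<bottom> \<parallel> B) (strat_comp A B (\<gamma> B) \<sigma>)" "prestrategy (A\<^sup>\<bottom> \<parallel> B) (strat_comp A B (\<gamma> B) (strat_comp A B (\<gamma> B) ?r))"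
    "prestrategy (A\<^sup>\<bottom> \<parallel> B) (strat_comp A B (strat_comp B B (\<gamma> B) (\<gamma> B)) ?r)" "prestrategy (A\<^sup>\<bottom> \<parallel> B) (strat_comp A B (\<gamma> B) ?r)"
    "prestrategy (A\<^sup>\<bottom> \<parallel> B) \<sigma>"
    using pre_comp[OF \<sigma> g(2)] pre_comp[OF gr g(2)] pre_comp[OF r gg] gr \<sigma> by simp_all
  show ?thesis
    using T[OF p(1) p(2) p(5) 2 T[OF p(2) p(3) p(5) 3 T[OF p(3) p(4) p(5) 4 1]]] .
qed

text \<open>Relies on the left law: by associativity the copycat on \<open>B\<close> in the
  two-sided equation is moved next to \<open>\<sigma>\<close> and absorbed there, which leaves only
  the copycat on \<open>A\<close>.\<close>

lemma strat_right:
  assumes s: "strat A B \<sigma>" shows "strat_comp A B \<sigma> (\<gamma> A) \<cong> \<sigma>"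
proof -
  have \<sigma>: "pre A B \<sigma>" using strat_pre[OF s] .
  have g: "pre A A (\<gamma> A)" "pre B B (\<gamma> B)" using pre_copycat \<sigma> by blast+
  let ?r = "strat_comp A B \<sigma> (\<gamma> A)"
  have r: "pre A B ?r" using pre_comp[OF g(1) \<sigma>] .
  have gr: "pre A B (strat_comp A B (\<gamma> B) ?r)" using pre_comp[OF r g(2)] .
  have l: "pre A B (strat_comp A B (\<gamma> B) \<sigma>)" using pre_comp[OF \<sigma> g(2)] .
  have 1: "strat_comp A B (\<gamma> B) ?r \<cong> \<sigma>" using s strategy_iff[OF \<sigma>] by blast
  have 2: "strat_comp A B (\<gamma> B) ?r \<cong> strat_comp A B (strat_comp A B (\<gamma> B) \<sigma>) (\<gamma> A)"
    by (rule strat_assoc[OF g(1) \<sigma> g(2)])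
  have 3: "strat_comp A B (strat_comp A B (\<gamma> B) \<sigma>) (\<gamma> A) \<cong> ?r"
    by (rule comp_cong[OF g(1) g(1) l \<sigma> iso_refl[of "A\<^sup>\<bottom> \<parallel> A"] strat_left[OF s]]) (use g in blast)
  have p: "prestrategy (A\<^sup>\<bottom> \<parallel> B) ?r" "prestrategy (A\<^sup>\<bottom> \<parallel> B) (strat_comp A B (\<gamma> B) ?r)"
     "prestrategy (A\<^sup>\<bottom> \<parallel> B) (strat_comp A B (strat_comp A B (\<gamma> B) \<sigma>) (\<gamma> A))" "prestrategy (A\<^sup>\<bottom> \<parallel> B) \<sigma>"
    using r gr pre_comp[OF g(1) l] \<sigma> by simp_all
  note T = iso_trans[of "A\<^sup>\<bottom> \<parallel> B"] and Y = iso_sym[of "A\<^sup>\<bottom> \<parallel> B"]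
  show ?thesis
    using T[OF p(1) p(3) p(4) Y[OF p(3) p(1) 3] T[OF p(3) p(2) p(4) Y[OF p(2) p(3) 2] 1]] .
qed

text \<open>Converse of the two unit laws, and the criterion by which the strategies below are
  recognised.\<close>

lemma stratI:
  assumes \<sigma>: "pre A B \<sigma>" and l: "strat_comp A B (\<gamma> B) \<sigma> \<cong> \<sigma>" and r: "strat_comp A B \<sigma> (\<gamma> A) \<cong> \<sigma>"
  shows "strat A B \<sigma>"
proof -
  have g: "pre A A (\<gamma> A)" "pre B B (\<gamma> B)" using pre_copycat \<sigma> by blast+
  have r': "pre A B (strat_comp A B \<sigma> (\<gamma> A))" using pre_comp[OF g(1) \<sigma>] .
  have "strat_comp A B (\<gamma> B) (strat_comp A B \<sigma> (\<gamma> A)) \<cong> strat_comp A B (\<gamma> B) \<sigma>"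
    by (rule comp_cong[OF r' \<sigma> g(2) g(2) r iso_refl[of "B\<^sup>\<bottom> \<parallel> B"]]) (use g in blast)
  then have "strat_comp A B (\<gamma> B) (strat_comp A B \<sigma> (\<gamma> A)) \<cong> \<sigma>"
    using iso_trans[of "A\<^sup>\<bottom> \<parallel> B"] pre_comp[OF r' g(2)] pre_comp[OF \<sigma> g(2)] \<sigma> l by blast
  then show ?thesis using strategy_iff[OF \<sigma>] \<sigma> by blast
qed

lemma strat_copycat: "game A \<Longrightarrow> strat A A (\<gamma> A)"
  by (rule stratI[OF pre_copycat copycat_idem copycat_idem])

text \<open>By associativity each copycat can be moved next to the factor that absorbs it.\<close>

lemma strat_comp_strat:
  assumes s: "strat A B \<sigma>" and t: "strat B C \<tau>" shows "strat A C (strat_comp A C \<tau> \<sigma>)"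
proof (rule stratI)
  note \<sigma> = strat_pre[OF s] and \<tau> = strat_pre[OF t]
  have g: "pre A A (\<gamma> A)" "pre C C (\<gamma> C)" using pre_copycat \<sigma> \<tau> by blast+
  show c: "pre A C (strat_comp A C \<tau> \<sigma>)" using pre_comp[OF \<sigma> \<tau>] .
  have "strat_comp A C (\<gamma> C) (strat_comp A C \<tau> \<sigma>) \<cong> strat_comp A C (strat_comp B C (\<gamma> C) \<tau>) \<sigma>"
    by (rule strat_assoc[OF \<sigma> \<tau> g(2)])
  moreover have "strat_comp A C (strat_comp B C (\<gamma> C) \<tau>) \<sigma> \<cong> strat_comp A C \<tau> \<sigma>"
    by (rule comp_cong[OF \<sigma> \<sigma> pre_comp[OF \<tau> g(2)] \<tau> iso_refl[of "A\<^sup>\<bottom> \<parallel> B"] strat_left[OF t]]) (use \<sigma> in blast)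
  ultimately show "strat_comp A C (\<gamma> C) (strat_comp A C \<tau> \<sigma>) \<cong> strat_comp A C \<tau> \<sigma>"
    using iso_trans[of "A\<^sup>\<bottom> \<parallel> C"] pre_comp[OF c g(2)] pre_comp[OF \<sigma> pre_comp[OF \<tau> g(2)]] c by blast
  have a: "strat_comp A C (strat_comp A C \<tau> \<sigma>) (\<gamma> A) \<cong> strat_comp A C \<tau> (strat_comp A B \<sigma> (\<gamma> A))"
    using iso_sym[of "A\<^sup>\<bottom> \<parallel> C"] strat_assoc[OF g(1) \<sigma> \<tau>] pre_comp[OF g(1) c] pre_comp[OF pre_comp[OF g(1) \<sigma>] \<tau>] by blast
  moreover have "strat_comp A C \<tau> (strat_comp A B \<sigma> (\<gamma> A)) \<cong> strat_comp A C \<tau> \<sigma>"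
    by (rule comp_cong[OF pre_comp[OF g(1) \<sigma>] \<sigma> \<tau> \<tau> strat_right[OF s] iso_refl[of "B\<^sup>\<bottom> \<parallel> C"]]) (use \<tau> in blast)
  ultimately show "strat_comp A C (strat_comp A C \<tau> \<sigma>) (\<gamma> A) \<cong> strat_comp A C \<tau> \<sigma>"
    using iso_trans[of "A\<^sup>\<bottom> \<parallel> C"] pre_comp[OF g(1) c] pre_comp[OF pre_comp[OF g(1) \<sigma>] \<tau>] c by blast
qed

text \<open>The unit law on labels: a copycat attached to a wire of a strategy renames that
  wire.\<close>

lemma unitR:
  assumes s: "strat A B \<sigma>" and sep: "sep p A q B" "sep p A r B" "sep q B r B"
  shows "hide (q ` Ev B) (LSp p q A B \<sigma> \<bowtie> cc q r B) \<approx> LSp p r A B \<sigma>"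
proof -
  note \<sigma> = strat_pre[OF s]
  have g: "pre B B (\<gamma> B)" using pre_copycat s by blast
  have "hide (q ` Ev B) (LSp p q A B \<sigma> \<bowtie> cc q r B) \<approx> hide (q ` Ev B) (LSp p q A B \<sigma> \<bowtie> LSp q r B B (\<gamma> B))"
    by (intro hide_cong join_cong ls_iso_refl ls_iso_sym[OF LSp_copycat]) (use s in blast)
  also have "\<dots> \<approx> LSp p r A B (strat_comp A B (\<gamma> B) \<sigma>)" by (rule ls_iso_sym[OF LSp_comp[OF \<sigma> g sep]])
  also have "\<dots> \<approx> LSp p r A B \<sigma>" by (rule LSp_iso[OF pre_comp[OF \<sigma> g] \<sigma> strat_left[OF s]])
  finally show ?thesis .
qed

lemma unitL:
  assumes s: "strat A B \<sigma>" and sep: "sep p A q A" "sep p A r B" "sep q A r B"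
  shows "hide (q ` Ev A) (cc p q A \<bowtie> LSp q r A B \<sigma>) \<approx> LSp p r A B \<sigma>"
proof -
  note \<sigma> = strat_pre[OF s]
  have g: "pre A A (\<gamma> A)" using pre_copycat s by blast
  have "hide (q ` Ev A) (cc p q A \<bowtie> LSp q r A B \<sigma>) \<approx> hide (q ` Ev A) (LSp p q A A (\<gamma> A) \<bowtie> LSp q r A B \<sigma>)"
    by (intro hide_cong join_cong ls_iso_refl ls_iso_sym[OF LSp_copycat]) (use s in blast)
  also have "\<dots> \<approx> LSp p r A B (strat_comp A B \<sigma> (\<gamma> A))" by (rule ls_iso_sym[OF LSp_comp[OF g \<sigma> sep]])
  also have "\<dots> \<approx> LSp p r A B \<sigma>" by (rule LSp_iso[OF pre_comp[OF g \<sigma>] \<sigma> strat_right[OF s]])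
  finally show ?thesis .
qed

lemma LSp_cong:
  assumes \<sigma>: "pre A B \<sigma>" and p: "\<And>a. a \<in> Ev A \<Longrightarrow> p a = p' a" and q: "\<And>a. a \<in> Ev B \<Longrightarrow> q a = q' a"
  shows "LSp p q A B \<sigma> \<approx> LSp p' q' A B \<sigma>"
proof -
  have pre: "prestrategy (A\<^sup>\<bottom> \<parallel> B) \<sigma>" using \<sigma> by blast
  have L: "p ` Ev A \<union> q ` Ev B = p' ` Ev A \<union> q' ` Ev B" using p q by (simp cong: image_cong)
  show ?thesis
    unfolding LSp_def L
  proof (rule LS_cong[OF prestrategyD(2)[OF pre]])
    fix s assume "s \<in> Ev (fst \<sigma>)"
    then have "snd \<sigma> s \<in> duo (Ev A) (Ev B)" using prestrategyD(3)[OF pre, of s] by simp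
    then show "tag p q (snd \<sigma> s) = tag p' q' (snd \<sigma> s)" using p q by auto
  qed
qed

lemma prestrategy_post:
  assumes \<sigma>: "prestrategy G \<sigma>" and i: "giso G G' h k"
  shows "prestrategy G' (fst \<sigma>, h \<circ> snd \<sigma>)"
proof (rule prestrategyI)
  note S = prestrategyD[OF \<sigma>] and D = gisoD[OF i]
  show "game (fst (fst \<sigma>, h \<circ> snd \<sigma>))" using S by simp
  show "snd (fst \<sigma>, h \<circ> snd \<sigma>) s \<in> Ev G'" if "s \<in> Ev (fst (fst \<sigma>, h \<circ> snd \<sigma>))" for s
    using that S(3) D(3) by simp
  show "pol G' (snd (fst \<sigma>, h \<circ> snd \<sigma>) s) = pol (fst (fst \<sigma>, h \<circ> snd \<sigma>)) s"
    if "s \<in> Ev (fst (fst \<sigma>, h \<circ> snd \<sigma>))" for s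
    using that S(3,6) D(5) by simp
  fix x assume "x \<in> configs (fst (fst \<sigma>, h \<circ> snd \<sigma>))"
  then have x: "x \<in> configs (fst \<sigma>)" by simp
  have "h ` snd \<sigma> ` x \<in> configs G'" by (rule giso_configs[OF i S(4)[OF x]])
  moreover have "inj_on (h \<circ> snd \<sigma>) x"
    using prestrategy_inj_comp[OF \<sigma> giso_inj[OF i] x] by (simp add: comp_def)
  ultimately show "snd (fst \<sigma>, h \<circ> snd \<sigma>) ` x \<in> configs G' \<and> inj_on (snd (fst \<sigma>, h \<circ> snd \<sigma>)) x"
    by (simp add: image_comp)
qed

section \<open>Liftings\<close>

lemma pre_lifting:
  assumes i: "giso A B f g" shows "pre A B (lifting A f)"
proof -
  note D = gisoD[OF i]
  have "prestrategy (A\<^sup>\<bottom> \<parallel> B) (fst (\<gamma> A), par_map id f \<circ> snd (\<gamma> A))"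
    by (rule prestrategy_post[OF prestrategy_copycat[OF D(1)] giso_par[OF giso_id i]]) (use D in simp)
  then show ?thesis using D by (simp add: lifting_def copycat_def)
qed

lemma LSp_lifting:
  assumes i: "giso A B f g" shows "LSp p q A B (lifting A f) \<approx> cc p (\<lambda>a. q (f a)) A"
proof -
  note D = gisoD[OF i]
  have "LSp p q A B (lifting A f) \<approx> LS (p ` Ev A \<union> (\<lambda>a. q (f a)) ` Ev A) (\<Gamma> A) (tag p (\<lambda>a. q (f a)))"
  proof -
    have "p ` Ev A \<union> q ` Ev B = p ` Ev A \<union> (\<lambda>a. q (f a)) ` Ev A"
      unfolding giso_image[OF i, symmetric] by (simp add: image_image)
    then show ?thesis
      unfolding LSp_def lifting_def copycat_def
      by (simp, intro LS_cong game_es game_copycat D(1)) (auto simp: copycat_simps)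
  qed
  also have "\<dots> \<approx> cc p (\<lambda>a. q (f a)) A" by (rule LS_copycat[OF D(1)])
  finally show ?thesis .
qed

lemma sep_giso:
  assumes i: "giso A B f g" shows "sep p C (\<lambda>a. q (f a)) A \<longleftrightarrow> sep p C q B"
proof -
  have "(\<lambda>a. q (f a)) ` Ev A = q ` Ev B" unfolding giso_image[OF i, symmetric] by (simp add: image_image)
  moreover have "inj_on (\<lambda>a. q (f a)) (Ev A) \<longleftrightarrow> inj_on q (Ev B)"
    using comp_inj_on_iff[OF giso_inj[OF i], of q] giso_image[OF i] by (simp add: comp_def)
  ultimately show ?thesis by simp
qed

text \<open>A copycat on \<open>B\<close> is carried back along \<open>f\<close> to one on
  \<open>A\<close>, after which both absorption laws are idempotence of copycat.\<close>

lemma strat_lifting: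
  assumes i: "giso A B f g" shows "strat A B (lifting A f)"
proof (rule stratI[OF pre_lifting[OF i]])
  note D = gisoD[OF i]
  note l = pre_lifting[OF i] and g = pre_copycat[OF D(1)] pre_copycat[OF D(2)]
  have fB: "P 2 ` Ev B = (\<lambda>a. P 2 (f a)) ` Ev A" unfolding giso_image[OF i, symmetric] by (simp add: image_image)
  have inj: "inj_on (\<lambda>a. P n (f a)) (Ev A)" for n using giso_inj[OF i] by (simp add: inj_on_def)
  show "strat_comp A B (\<gamma> B) (lifting A f) \<cong> lifting A f"
  proof (rule isoI_LSp[where p = "P 0" and q = "P 3", OF pre_comp[OF l g(2)] l])
    have "LSp (P 0) (P 3) A B (strat_comp A B (\<gamma> B) (lifting A f)) \<approx>
       hide (P 2 ` Ev B) (LSp (P 0) (P 2) A B (lifting A f) \<bowtie> LSp (P 2) (P 3) B B (\<gamma> B))"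
      by (rule LSp_comp[OF l g(2)]) simp_all
    also have "\<dots> \<approx> hide (P 2 ` Ev B) (cc (P 0) (\<lambda>a. P 2 (f a)) A \<bowtie> cc (P 2) (P 3) B)"
      by (intro hide_cong join_cong LSp_lifting[OF i] LSp_copycat[OF D(2)])
    also have "\<dots> \<approx> hide (P 2 ` Ev B) (cc (P 0) (\<lambda>a. P 2 (f a)) A \<bowtie> cc (\<lambda>a. P 2 (f a)) (\<lambda>a. P 3 (f a)) A)"
      by (intro hide_cong join_cong ls_iso_refl ls_iso_sym[OF cc_iso[OF i]])
    also have "\<dots> \<approx> cc (P 0) (\<lambda>a. P 3 (f a)) A"
      unfolding fB by (rule cc_idem[OF D(1)]) (use inj in auto)
    also have "\<dots> \<approx> LSp (P 0) (P 3) A B (lifting A f)" by (rule ls_iso_sym[OF LSp_lifting[OF i]])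
    finally show "LSp (P 0) (P 3) A B (strat_comp A B (\<gamma> B) (lifting A f)) \<approx> LSp (P 0) (P 3) A B (lifting A f)" .
  qed simp
  show "strat_comp A B (lifting A f) (\<gamma> A) \<cong> lifting A f"
  proof (rule isoI_LSp[where p = "P 0" and q = "P 3", OF pre_comp[OF g(1) l] l])
    have "LSp (P 0) (P 3) A B (strat_comp A B (lifting A f) (\<gamma> A)) \<approx>
       hide (P 2 ` Ev A) (LSp (P 0) (P 2) A A (\<gamma> A) \<bowtie> LSp (P 2) (P 3) A B (lifting A f))"
      by (rule LSp_comp[OF g(1) l]) simp_all
    also have "\<dots> \<approx> hide (P 2 ` Ev A) (cc (P 0) (P 2) A \<bowtie> cc (P 2) (\<lambda>a. P 3 (f a)) A)"
      by (intro hide_cong join_cong LSp_lifting[OF i] LSp_copycat[OF D(1)])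
    also have "\<dots> \<approx> cc (P 0) (\<lambda>a. P 3 (f a)) A"
      by (rule cc_idem[OF D(1)]) (use inj in auto)
    also have "\<dots> \<approx> LSp (P 0) (P 3) A B (lifting A f)" by (rule ls_iso_sym[OF LSp_lifting[OF i]])
    finally show "LSp (P 0) (P 3) A B (strat_comp A B (lifting A f) (\<gamma> A)) \<approx> LSp (P 0) (P 3) A B (lifting A f)" .
  qed simp
qed

text \<open>The lifting is a copycat on \<open>B\<close> whose outer side is named through
  \<open>f\<close>, so the unit law leaves only a renaming.\<close>

lemma lift_post:
  assumes s: "strat A B \<sigma>" and i: "giso B C f g" and sep: "sep p A q B" "sep p A r C" "sep q B r C"
  shows "LSp p r A C (strat_comp A C (lifting B f) \<sigma>) \<approx> LSp p (\<lambda>b. r (f b)) A B \<sigma>"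
proof -
  have "LSp p r A C (strat_comp A C (lifting B f) \<sigma>) \<approx> hide (q ` Ev B) (LSp p q A B \<sigma> \<bowtie> LSp q r B C (lifting B f))"
    by (rule LSp_comp[OF strat_pre[OF s] pre_lifting[OF i] sep])
  also have "\<dots> \<approx> hide (q ` Ev B) (LSp p q A B \<sigma> \<bowtie> cc q (\<lambda>b. r (f b)) B)"
    by (intro hide_cong join_cong ls_iso_refl LSp_lifting[OF i])
  also have "\<dots> \<approx> LSp p (\<lambda>b. r (f b)) A B \<sigma>"
    by (rule unitR[OF s sep(1)]) (use sep sep_giso[OF i, of p A r] sep_giso[OF i, of q B r] in blast)+
  finally show ?thesis .
qed

text \<open>\<open>p\<close> is tied to \<open>p'\<close> only on the moves of \<open>A\<close>. In
  the triangle identities \<open>p\<close> is a plain name, whereas \<open>p'\<close> is a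
  \<open>tag\<close> that also covers the empty game.\<close>

lemma lift_pre:
  assumes s: "strat B C \<sigma>" and i: "giso A B f g" and p: "\<And>a. a \<in> Ev A \<Longrightarrow> p a = p' (f a)"
    and sep: "sep p' B q B" "sep p' B r C" "sep q B r C"
  shows "LSp p r A C (strat_comp A C \<sigma> (lifting A f)) \<approx> LSp p' r B C \<sigma>"
proof -
  note D = gisoD[OF i]
  have "p ` Ev A = (\<lambda>a. p' (f a)) ` Ev A" using p by (simp cong: image_cong)
  then have im: "p ` Ev A = p' ` Ev B" unfolding giso_image[OF i, symmetric] by (simp add: image_image)
  have "inj_on (\<lambda>a. p' (f a)) (Ev A)"
    using comp_inj_on_iff[OF giso_inj[OF i], of p'] giso_image[OF i] sep by (simp add: comp_def)
  then have "inj_on p (Ev A)" using p by (simp cong: inj_on_cong)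
  then have sep': "sep p A q B" "sep p A r C" using sep im by simp_all
  have "LSp p r A C (strat_comp A C \<sigma> (lifting A f)) \<approx> hide (q ` Ev B) (LSp p q A B (lifting A f) \<bowtie> LSp q r B C \<sigma>)"
    by (rule LSp_comp[OF pre_lifting[OF i] strat_pre[OF s] sep' sep(3)])
  also have "\<dots> \<approx> hide (q ` Ev B) (cc p' q B \<bowtie> LSp q r B C \<sigma>)"
  proof (intro hide_cong join_cong ls_iso_refl)
    have "LSp p q A B (lifting A f) \<approx> cc p (\<lambda>b. q (f b)) A" by (rule LSp_lifting[OF i])
    also have "\<dots> \<approx> cc (\<lambda>a. p' (f a)) (\<lambda>b. q (f b)) A" by (rule cc_cong[OF D(1) p]) simp_all
    also have "\<dots> \<approx> cc p' q B" by (rule cc_iso[OF i])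
    finally show "LSp p q A B (lifting A f) \<approx> cc p' q B" .
  qed
  also have "\<dots> \<approx> LSp p' r B C \<sigma>" by (rule unitL[OF s sep])
  finally show ?thesis .
qed

text \<open>The structural maps are specified on suitably tagged events only, so coherence laws can
  be checked on events and nowhere else.\<close>

lemma lifting_cong:
  assumes "giso A B f g" "giso A B f' g'" "\<And>a. a \<in> Ev A \<Longrightarrow> f a = f' a"
  shows "lifting A f \<cong> lifting A f'"
proof (rule isoI_LSp[where p = "P 0" and q = "P 2", OF pre_lifting[OF assms(1)] pre_lifting[OF assms(2)]])
  have "LSp (P 0) (P 2) A B (lifting A f) \<approx> cc (P 0) (\<lambda>a. P 2 (f a)) A" by (rule LSp_lifting[OF assms(1)])
  also have "\<dots> \<approx> cc (P 0) (\<lambda>a. P 2 (f' a)) A"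
    by (rule cc_cong) (use assms gisoD(1) in auto)
  also have "\<dots> \<approx> LSp (P 0) (P 2) A B (lifting A f')" by (rule ls_iso_sym[OF LSp_lifting[OF assms(2)]])
  finally show "LSp (P 0) (P 2) A B (lifting A f) \<approx> LSp (P 0) (P 2) A B (lifting A f')" .
qed simp

lemma lifting_comp:
  assumes i: "giso A B f g" and j: "giso B C h k"
  shows "strat_comp A C (lifting B h) (lifting A f) \<cong> lifting A (h \<circ> f)"
proof (rule isoI_LSp[where p = "P 0" and q = "P 2", OF pre_comp[OF pre_lifting[OF i] pre_lifting[OF j]] pre_lifting[OF giso_comp[OF i j]]])
  have "LSp (P 0) (P 2) A C (strat_comp A C (lifting B h) (lifting A f)) \<approx> LSp (P 0) (\<lambda>b. P 2 (h b)) A B (lifting A f)"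
    by (rule lift_post[OF strat_lifting[OF i] j, of _ "P 3"]) simp_all
  also have "\<dots> \<approx> cc (P 0) (\<lambda>a. P 2 (h (f a))) A" by (rule LSp_lifting[OF i])
  also have "\<dots> \<approx> LSp (P 0) (P 2) A C (lifting A (h \<circ> f))"
    using ls_iso_sym[OF LSp_lifting[OF giso_comp[OF i j], of "P 0" "P 2"]] by simp
  finally show "LSp (P 0) (P 2) A C (strat_comp A C (lifting B h) (lifting A f)) \<approx> LSp (P 0) (P 2) A C (lifting A (h \<circ> f))" .
qed simp

lemma lifting_id:
  assumes A: "game A" shows "lifting A id \<cong> \<gamma> A"
proof (rule isoI_LSp[where p = "P 0" and q = "P 2", OF pre_lifting[OF giso_id[OF A]] pre_copycat[OF A]])
  have "LSp (P 0) (P 2) A A (lifting A id) \<approx> cc (P 0) (P 2) A"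
    using LSp_lifting[OF giso_id[OF A], of "P 0" "P 2"] by simp
  also have "\<dots> \<approx> LSp (P 0) (P 2) A A (\<gamma> A)" by (rule ls_iso_sym[OF LSp_copycat[OF A]])
  finally show "LSp (P 0) (P 2) A A (lifting A id) \<approx> LSp (P 0) (P 2) A A (\<gamma> A)" .
qed simp

section \<open>Structural isomorphisms\<close>

fun assoc_inv :: "'a ev \<Rightarrow> 'a ev" where
  "assoc_inv (Tag False a) = Tag False (Tag False a)"
| "assoc_inv (Tag True (Tag False b)) = Tag False (Tag True b)"
| "assoc_inv (Tag True (Tag True c)) = Tag True c"

lemma Con_duo [simp]: "duo X Y \<in> Con (A \<parallel> B) \<longleftrightarrow> X \<in> Con A \<and> Y \<in> Con B"
  by auto

lemma subset_duoE:
  assumes "X \<subseteq> duo Y Z" obtains y z where "X = duo y z" "y \<subseteq> Y" "z \<subseteq> Z"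
proof
  show "X = duo (inl X) (inr X)" by (rule duo_split[OF assms])
qed (use assms in \<open>auto simp: inl_def inr_def\<close>)

lemma giso_assoc:
  assumes "game A" "game B" "game C"
  shows "giso ((A \<parallel> B) \<parallel> C) (A \<parallel> (B \<parallel> C)) assoc_map assoc_inv"
proof -
  have Con: "assoc_map ` X \<in> Con (A \<parallel> (B \<parallel> C)) \<longleftrightarrow> X \<in> Con ((A \<parallel> B) \<parallel> C)"
    if sub: "X \<subseteq> duo (duo (Ev A) (Ev B)) (Ev C)" for X
  proof -
    obtain y z where X: "X = duo y z" "y \<subseteq> duo (Ev A) (Ev B)" using sub by (rule subset_duoE)
    obtain u v where y: "y = duo u v" using X(2) by (rule subset_duoE)
    show ?thesis unfolding X(1) y assoc_image Con_duo by blast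
  qed
  show ?thesis
    unfolding giso_def
  proof (intro conjI allI impI)
    show "assoc_map ` X \<in> Con (A \<parallel> (B \<parallel> C)) \<longleftrightarrow> X \<in> Con ((A \<parallel> B) \<parallel> C)" if "X \<subseteq> Ev ((A \<parallel> B) \<parallel> C)" for X
      using Con that by simp
  qed (use assms in auto)
qed

lemma giso_symm:
  assumes "game A" "game B"
  shows "giso (A \<parallel> B) (B \<parallel> A) symm_map symm_map"
proof -
  have Con: "symm_map ` X \<in> Con (B \<parallel> A) \<longleftrightarrow> X \<in> Con (A \<parallel> B)" if sub: "X \<subseteq> duo (Ev A) (Ev B)" for X
  proof -
    obtain y z where X: "X = duo y z" using sub by (rule subset_duoE)
    have "symm_map ` X = duo z y" unfolding X by (simp add: image_Un image_image Un_commute)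
    then show ?thesis unfolding X by (simp only: Con_duo conj_commute)
  qed
  show ?thesis
    unfolding giso_def
  proof (intro conjI allI impI)
    show "symm_map ` X \<in> Con (B \<parallel> A) \<longleftrightarrow> X \<in> Con (A \<parallel> B)" if "X \<subseteq> Ev (A \<parallel> B)" for X
      using Con that by simp
  qed (use assms in auto)
qed

lemma giso_lunit:
  assumes "game A" shows "giso (\<one> \<parallel> A) A lunit_map (Tag True)"
proof -
  have Con: "lunit_map ` X \<in> Con A \<longleftrightarrow> X \<in> Con (\<one> \<parallel> A)" if sub: "X \<subseteq> duo {} (Ev A)" for X
  proof -
    obtain y z where X: "X = duo y z" "y \<subseteq> {}" using sub by (rule subset_duoE)
    have "lunit_map ` X = z" "y = {}" using X by (simp_all add: image_Un image_image)
    then show ?thesis unfolding X(1) by (simp only: Con_duo) simp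
  qed
  show ?thesis
    unfolding giso_def
  proof (intro conjI allI impI)
    show "lunit_map ` X \<in> Con A \<longleftrightarrow> X \<in> Con (\<one> \<parallel> A)" if "X \<subseteq> Ev (\<one> \<parallel> A)" for X
      using Con that by simp
  qed (use assms in auto)
qed

lemma giso_runit:
  assumes "game A" shows "giso (A \<parallel> \<one>) A runit_map (Tag False)"
proof -
  have Con: "runit_map ` X \<in> Con A \<longleftrightarrow> X \<in> Con (A \<parallel> \<one>)" if sub: "X \<subseteq> duo (Ev A) {}" for X
  proof -
    obtain y z where X: "X = duo y z" "z \<subseteq> {}" using sub by (rule subset_duoE)
    have "runit_map ` X = y" "z = {}" using X by (simp_all add: image_Un image_image)
    then show ?thesis unfolding X(1) by (simp only: Con_duo) simp
  qed
  show ?thesis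
    unfolding giso_def
  proof (intro conjI allI impI)
    show "runit_map ` X \<in> Con A \<longleftrightarrow> X \<in> Con (A \<parallel> \<one>)" if "X \<subseteq> Ev (A \<parallel> \<one>)" for X
      using Con that by simp
  qed (use assms in auto)
qed

lemma exchange_image: "exchange_map ` duo (duo x y) (duo z w) = duo (duo x z) (duo y w)"
  by (simp add: image_Un image_image Un_ac)

lemma giso_exchange:
  assumes "game A" "game B" "game C" "game D"
  shows "giso ((A \<parallel> B) \<parallel> (C \<parallel> D)) ((A \<parallel> C) \<parallel> (B \<parallel> D)) exchange_map exchange_map"
proof -
  have Con: "exchange_map ` X \<in> Con ((A \<parallel> C) \<parallel> (B \<parallel> D)) \<longleftrightarrow> X \<in> Con ((A \<parallel> B) \<parallel> (C \<parallel> D))"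
    if sub: "X \<subseteq> duo (duo (Ev A) (Ev B)) (duo (Ev C) (Ev D))" for X
  proof -
    obtain y z where X: "X = duo y z" "y \<subseteq> duo (Ev A) (Ev B)" "z \<subseteq> duo (Ev C) (Ev D)" using sub by (rule subset_duoE)
    obtain u v where y: "y = duo u v" using X(2) by (rule subset_duoE)
    obtain u' v' where z: "z = duo u' v'" using X(3) by (rule subset_duoE)
    show ?thesis unfolding X(1) y z exchange_image Con_duo by blast
  qed
  show ?thesis
    unfolding giso_def
  proof (intro conjI allI impI)
    show "exchange_map ` X \<in> Con ((A \<parallel> C) \<parallel> (B \<parallel> D)) \<longleftrightarrow> X \<in> Con ((A \<parallel> B) \<parallel> (C \<parallel> D))"
      if "X \<subseteq> Ev ((A \<parallel> B) \<parallel> (C \<parallel> D))" for X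
      using Con that by simp
  qed (use assms in auto)
qed

section \<open>Tensor\<close>

lemma prestrategy_par:
  assumes \<sigma>: "prestrategy G \<sigma>" and \<tau>: "prestrategy H \<tau>" and G: "game G" and H: "game H"
  shows "prestrategy (G \<parallel> H) (fst \<sigma> \<parallel> fst \<tau>, par_map (snd \<sigma>) (snd \<tau>))"
proof (rule prestrategyI)
  note S = prestrategyD[OF \<sigma>] and T = prestrategyD[OF \<tau>]
  let ?\<rho> = "(fst \<sigma> \<parallel> fst \<tau>, par_map (snd \<sigma>) (snd \<tau>))"
  show "game (fst ?\<rho>)" using S T by simp
  show "snd ?\<rho> s \<in> Ev (G \<parallel> H)" if "s \<in> Ev (fst ?\<rho>)" for s
    using that S(3) T(3) by auto
  show "pol (G \<parallel> H) (snd ?\<rho> s) = pol (fst ?\<rho>) s" if "s \<in> Ev (fst ?\<rho>)" for s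
    using that S(3,6) T(3,6) by auto
  fix x assume "x \<in> configs (fst ?\<rho>)"
  then obtain y z where x: "x = duo y z" "y \<in> configs (fst \<sigma>)" "z \<in> configs (fst \<tau>)"
    using configs_par[OF S(2) T(2)] by auto
  have "snd ?\<rho> ` x = duo (snd \<sigma> ` y) (snd \<tau> ` z)" unfolding x(1) by (simp add: image_Un image_image)
  moreover have "duo (snd \<sigma> ` y) (snd \<tau> ` z) \<in> configs (G \<parallel> H)"
    unfolding config_par_iff[OF G H] using S(4)[OF x(2)] T(4)[OF x(3)] by blast
  moreover have "inj_on (snd ?\<rho>) x"
    unfolding x(1) snd_conv by (rule inj_par_map[OF S(5)[OF x(2)] T(5)[OF x(3)]])
  ultimately show "snd ?\<rho> ` x \<in> configs (G \<parallel> H) \<and> inj_on (snd ?\<rho>) x" by simp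
qed

lemma pre_tensor:
  assumes \<sigma>: "pre A B \<sigma>" and \<tau>: "pre A' B' \<tau>"
  shows "pre (A \<parallel> A') (B \<parallel> B') (strat_tensor \<sigma> \<tau>)"
proof -
  have g: "game (A\<^sup>\<bottom>)" "game B" "game (A'\<^sup>\<bottom>)" "game B'" using assms by simp_all
  have "prestrategy ((A\<^sup>\<bottom> \<parallel> B) \<parallel> (A'\<^sup>\<bottom> \<parallel> B')) (fst \<sigma> \<parallel> fst \<tau>, par_map (snd \<sigma>) (snd \<tau>))"
    by (rule prestrategy_par) (use assms in simp_all)
  from prestrategy_post[OF this giso_exchange[OF g]]
  have "prestrategy ((A \<parallel> A')\<^sup>\<bottom> \<parallel> (B \<parallel> B')) (strat_tensor \<sigma> \<tau>)"
    by (simp add: dual_par strat_tensor_def split_def)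
  then show ?thesis using assms by simp
qed

text \<open>Separation makes the labels of the two factors disjoint, so nothing synchronises;
  \<open>exchange_map\<close> merely regroups the names by source and target.\<close>

lemma LSp_tensor:
  assumes \<sigma>: "pre A B \<sigma>" and \<tau>: "pre A' B' \<tau>" and sep: "sep (tag p p') (A \<parallel> A') (tag q q') (B \<parallel> B')"
  shows "LSp (tag p p') (tag q q') (A \<parallel> A') (B \<parallel> B') (strat_tensor \<sigma> \<tau>) \<approx> LSp p q A B \<sigma> \<bowtie> LSp p' q' A' B' \<tau>"
proof -
  let ?f = "\<lambda>s. tag (tag p p') (tag q q') (exchange_map (par_map (snd \<sigma>) (snd \<tau>) s))"
  have S: "prestrategy (A\<^sup>\<bottom> \<parallel> B) \<sigma>" and T: "prestrategy (A'\<^sup>\<bottom> \<parallel> B') \<tau>" using assms by blast+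
  note D = prestrategyD[OF S] and E = prestrategyD[OF T]
  have R: "prestrategy ((A \<parallel> A')\<^sup>\<bottom> \<parallel> (B \<parallel> B')) (strat_tensor \<sigma> \<tau>)" using pre_tensor[OF \<sigma> \<tau>] by blast
  have t: "fst (strat_tensor \<sigma> \<tau>) = fst \<sigma> \<parallel> fst \<tau>" "snd (strat_tensor \<sigma> \<tau>) = exchange_map \<circ> par_map (snd \<sigma>) (snd \<tau>)"
    by (simp_all add: strat_tensor_def split_def)
  have l1: "?f (Tag False s) = tag p q (snd \<sigma> s)" if "s \<in> Ev (fst \<sigma>)" for s
    using D(3)[OF that] by auto
  have l2: "?f (Tag True s) = tag p' q' (snd \<tau> s)" if "s \<in> Ev (fst \<tau>)" for s
    using E(3)[OF that] by auto
  have in1: "tag p q (snd \<sigma> s) \<in> p ` Ev A \<union> q ` Ev B" if "s \<in> Ev (fst \<sigma>)" for s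
    using D(3)[OF that] by auto
  have in2: "tag p' q' (snd \<tau> s) \<in> p' ` Ev A' \<union> q' ` Ev B'" if "s \<in> Ev (fst \<tau>)" for s
    using E(3)[OF that] by auto
  have "LSp (tag p p') (tag q q') (A \<parallel> A') (B \<parallel> B') (strat_tensor \<sigma> \<tau>) \<approx>
     LS (p ` Ev A \<union> q ` Ev B) (fst \<sigma>) (\<lambda>s. ?f (Tag False s)) \<bowtie> LS (p' ` Ev A' \<union> q' ` Ev B') (fst \<tau>) (\<lambda>s. ?f (Tag True s))"
    unfolding LSp_def t comp_def
  proof (rule LS_par[OF D(2) E(2)])
    show "tag p p' ` Ev (A \<parallel> A') \<union> tag q q' ` Ev (B \<parallel> B') = (p ` Ev A \<union> q ` Ev B) \<union> (p' ` Ev A' \<union> q' ` Ev B')" by auto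
    show "(p ` Ev A \<union> q ` Ev B) \<inter> (p' ` Ev A' \<union> q' ` Ev B') = {}" using sep by auto
    show "(\<lambda>a. ?f (Tag False a)) ` Ev (fst \<sigma>) \<subseteq> p ` Ev A \<union> q ` Ev B"
      by (rule image_subsetI) (simp only: l1 in1)
    show "(\<lambda>a. ?f (Tag True a)) ` Ev (fst \<tau>) \<subseteq> p' ` Ev A' \<union> q' ` Ev B'"
      by (rule image_subsetI) (simp only: l2 in2)
    show "inj_on ?f x" if x: "x \<in> configs (fst \<sigma> \<parallel> fst \<tau>)" for x
      using prestrategy_inj_comp[OF R _ x[folded t(1)], of "tag (tag p p') (tag q q')"] inj_tag[OF sep]
      unfolding t comp_def by simp
  qed
  also have "\<dots> \<approx> LSp p q A B \<sigma> \<bowtie> LSp p' q' A' B' \<tau>"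
    unfolding LSp_def by (intro join_cong LS_cong[OF D(2)] LS_cong[OF E(2)] l1 l2)
  finally show ?thesis .
qed

abbreviation T2 :: "nat \<Rightarrow> nat \<Rightarrow> 'a ev \<Rightarrow> nat \<times> 'a ev" where
  "T2 m n \<equiv> tag (P m) (P n)"

lemmas Int_Un = Int_Un_distrib Int_Un_distrib2

lemma tensor_cong:
  assumes "pre A B \<sigma>" "pre A B \<sigma>'" "pre A' B' \<tau>" "pre A' B' \<tau>'" "\<sigma> \<cong> \<sigma>'" "\<tau> \<cong> \<tau>'"
  shows "strat_tensor \<sigma> \<tau> \<cong> strat_tensor \<sigma>' \<tau>'"
proof (rule isoI_LSp[OF pre_tensor[OF assms(1,3)] pre_tensor[OF assms(2,4)], where p = "T2 0 2" and q = "T2 3 4"])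
  have "LSp (T2 0 2) (T2 3 4) (A \<parallel> A') (B \<parallel> B') (strat_tensor \<sigma> \<tau>) \<approx> LSp (P 0) (P 3) A B \<sigma> \<bowtie> LSp (P 2) (P 4) A' B' \<tau>"
    by (rule LSp_tensor[OF assms(1,3)]) (simp add: Int_Un)
  also have "\<dots> \<approx> LSp (P 0) (P 3) A B \<sigma>' \<bowtie> LSp (P 2) (P 4) A' B' \<tau>'"
    by (intro join_cong LSp_iso assms)
  also have "\<dots> \<approx> LSp (T2 0 2) (T2 3 4) (A \<parallel> A') (B \<parallel> B') (strat_tensor \<sigma>' \<tau>')"
    by (rule ls_iso_sym[OF LSp_tensor[OF assms(2,4)]]) (simp add: Int_Un)
  finally show "LSp (T2 0 2) (T2 3 4) (A \<parallel> A') (B \<parallel> B') (strat_tensor \<sigma> \<tau>) \<approx>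
    LSp (T2 0 2) (T2 3 4) (A \<parallel> A') (B \<parallel> B') (strat_tensor \<sigma>' \<tau>')" .
qed (simp add: Int_Un)

text \<open>The wires \<open>B\<close> and \<open>B'\<close> carry different names, so the hiding of
  each passes over the other composite and the two merge into one. The interchange itself is
  \<open>join_medial\<close>.\<close>

lemma tensor_comp:
  assumes \<sigma>: "pre A B \<sigma>" and \<tau>: "pre B C \<tau>" and \<sigma>': "pre A' B' \<sigma>'" and \<tau>': "pre B' C' \<tau>'"
  shows "strat_tensor (strat_comp A C \<tau> \<sigma>) (strat_comp A' C' \<tau>' \<sigma>') \<cong>
    strat_comp (A \<parallel> A') (C \<parallel> C') (strat_tensor \<tau> \<tau>') (strat_tensor \<sigma> \<sigma>')"
proof (rule isoI_LSp[where p = "T2 0 2" and q = "T2 3 4"])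
  note c = pre_comp[OF \<sigma> \<tau>] pre_comp[OF \<sigma>' \<tau>'] and t = pre_tensor[OF \<sigma> \<sigma>'] pre_tensor[OF \<tau> \<tau>']
  show "pre (A \<parallel> A') (C \<parallel> C') (strat_tensor (strat_comp A C \<tau> \<sigma>) (strat_comp A' C' \<tau>' \<sigma>'))" by (rule pre_tensor[OF c])
  show "pre (A \<parallel> A') (C \<parallel> C') (strat_comp (A \<parallel> A') (C \<parallel> C') (strat_tensor \<tau> \<tau>') (strat_tensor \<sigma> \<sigma>'))" by (rule pre_comp[OF t])
  let ?X = "LSp (P 0) (P 5) A B \<sigma>" and ?X' = "LSp (P 2) (P 6) A' B' \<sigma>'"
  let ?Y = "LSp (P 5) (P 3) B C \<tau>" and ?Y' = "LSp (P 6) (P 4) B' C' \<tau>'"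
  have v: "valid ?X" "valid ?X'" "valid ?Y" "valid ?Y'" by (rule valid_LSp', use assms in blast, simp)+
  note [intro] = v
  let ?H = "P 5 ` Ev B" and ?H' = "P 6 ` Ev B'"
  have "LSp (T2 0 2) (T2 3 4) (A \<parallel> A') (C \<parallel> C') (strat_tensor (strat_comp A C \<tau> \<sigma>) (strat_comp A' C' \<tau>' \<sigma>')) \<approx>
    LSp (P 0) (P 3) A C (strat_comp A C \<tau> \<sigma>) \<bowtie> LSp (P 2) (P 4) A' C' (strat_comp A' C' \<tau>' \<sigma>')"
    by (rule LSp_tensor[OF c]) (simp add: Int_Un)
  also have "\<dots> \<approx> hide ?H (?X \<bowtie> ?Y) \<bowtie> hide ?H' (?X' \<bowtie> ?Y')"
    by (intro join_cong LSp_comp assms) simp_all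
  also have "\<dots> \<approx> hide ?H' (hide ?H (?X \<bowtie> ?Y) \<bowtie> (?X' \<bowtie> ?Y'))"
    by (rule ls_iso_sym[OF hide_join_right]) auto
  also have "\<dots> \<approx> hide ?H' (hide ?H ((?X \<bowtie> ?Y) \<bowtie> (?X' \<bowtie> ?Y')))"
    by (intro hide_cong ls_iso_sym[OF hide_join]) auto
  also have "\<dots> \<approx> hide (?H' \<union> ?H) ((?X \<bowtie> ?Y) \<bowtie> (?X' \<bowtie> ?Y'))" by (rule hide_hide) auto
  also have "\<dots> \<approx> hide (?H' \<union> ?H) ((?X \<bowtie> ?X') \<bowtie> (?Y \<bowtie> ?Y'))" by (intro hide_cong join_medial v)
  also have "\<dots> \<approx> hide (?H' \<union> ?H) (LSp (T2 0 2) (T2 5 6) (A \<parallel> A') (B \<parallel> B') (strat_tensor \<sigma> \<sigma>') \<bowtie>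
      LSp (T2 5 6) (T2 3 4) (B \<parallel> B') (C \<parallel> C') (strat_tensor \<tau> \<tau>'))"
    by (intro hide_cong join_cong ls_iso_sym[OF LSp_tensor] assms) (simp_all add: Int_Un)
  also have "\<dots> = hide (T2 5 6 ` Ev (B \<parallel> B')) (LSp (T2 0 2) (T2 5 6) (A \<parallel> A') (B \<parallel> B') (strat_tensor \<sigma> \<sigma>') \<bowtie>
      LSp (T2 5 6) (T2 3 4) (B \<parallel> B') (C \<parallel> C') (strat_tensor \<tau> \<tau>'))"
    by (simp add: Un_commute)
  also have "\<dots> \<approx> LSp (T2 0 2) (T2 3 4) (A \<parallel> A') (C \<parallel> C') (strat_comp (A \<parallel> A') (C \<parallel> C') (strat_tensor \<tau> \<tau>') (strat_tensor \<sigma> \<sigma>'))"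
    by (rule ls_iso_sym[OF LSp_comp[OF t]]) (simp_all add: Int_Un)
  finally show "LSp (T2 0 2) (T2 3 4) (A \<parallel> A') (C \<parallel> C') (strat_tensor (strat_comp A C \<tau> \<sigma>) (strat_comp A' C' \<tau>' \<sigma>')) \<approx>
    LSp (T2 0 2) (T2 3 4) (A \<parallel> A') (C \<parallel> C') (strat_comp (A \<parallel> A') (C \<parallel> C') (strat_tensor \<tau> \<tau>') (strat_tensor \<sigma> \<sigma>'))" .
qed (simp add: Int_Un)

lemma tensor_lifting:
  assumes i: "giso A B f g" and i': "giso A' B' f' g'"
  shows "strat_tensor (lifting A f) (lifting A' f') \<cong> lifting (A \<parallel> A') (par_map f f')"
proof (rule isoI_LSp[OF pre_tensor[OF pre_lifting[OF i] pre_lifting[OF i']] pre_lifting[OF giso_par[OF i i']], where p = "T2 0 2" and q = "T2 3 4"])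
  note D = gisoD[OF i] and D' = gisoD[OF i']
  have inj: "inj_on (\<lambda>a. P n (f a)) (Ev A)" "inj_on (\<lambda>a. P n (f' a)) (Ev A')" for n
    using giso_inj[OF i] giso_inj[OF i'] by (simp_all add: inj_on_def)
  have "LSp (T2 0 2) (T2 3 4) (A \<parallel> A') (B \<parallel> B') (strat_tensor (lifting A f) (lifting A' f')) \<approx>
     LSp (P 0) (P 3) A B (lifting A f) \<bowtie> LSp (P 2) (P 4) A' B' (lifting A' f')"
    by (rule LSp_tensor[OF pre_lifting[OF i] pre_lifting[OF i']]) (simp add: Int_Un)
  also have "\<dots> \<approx> cc (P 0) (\<lambda>a. P 3 (f a)) A \<bowtie> cc (P 2) (\<lambda>a. P 4 (f' a)) A'"
    by (rule join_cong[OF LSp_lifting[OF i] LSp_lifting[OF i']])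
  also have "\<dots> \<approx> cc (T2 0 2) (tag (\<lambda>a. P 3 (f a)) (\<lambda>a. P 4 (f' a))) (A \<parallel> A')"
  proof (rule ls_iso_sym[OF cc_par[OF D(1) D'(1)]])
    show "valid (cc (P 0) (\<lambda>a. P 3 (f a)) A)" by (rule valid_cc[OF D(1)]) (use inj in auto)
    show "valid (cc (P 2) (\<lambda>a. P 4 (f' a)) A')" by (rule valid_cc[OF D'(1)]) (use inj in auto)
  qed auto
  also have "\<dots> \<approx> cc (T2 0 2) (\<lambda>a. T2 3 4 (par_map f f' a)) (A \<parallel> A')"
    by (rule cc_cong) (use D(1) D'(1) in auto)
  also have "\<dots> \<approx> LSp (T2 0 2) (T2 3 4) (A \<parallel> A') (B \<parallel> B') (lifting (A \<parallel> A') (par_map f f'))"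
    by (rule ls_iso_sym[OF LSp_lifting[OF giso_par[OF i i']]])
  finally show "LSp (T2 0 2) (T2 3 4) (A \<parallel> A') (B \<parallel> B') (strat_tensor (lifting A f) (lifting A' f')) \<approx>
    LSp (T2 0 2) (T2 3 4) (A \<parallel> A') (B \<parallel> B') (lifting (A \<parallel> A') (par_map f f'))" .
qed (simp add: Int_Un)

lemma tensor_copycat:
  assumes A: "game A" and B: "game B"
  shows "strat_tensor (\<gamma> A) (\<gamma> B) \<cong> \<gamma> (A \<parallel> B)"
proof (rule isoI_LSp[OF pre_tensor[OF pre_copycat[OF A] pre_copycat[OF B]] pre_copycat[OF game_par[OF A B]], where p = "T2 0 2" and q = "T2 3 4"])
  have "LSp (T2 0 2) (T2 3 4) (A \<parallel> B) (A \<parallel> B) (strat_tensor (\<gamma> A) (\<gamma> B)) \<approx>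
     LSp (P 0) (P 3) A A (\<gamma> A) \<bowtie> LSp (P 2) (P 4) B B (\<gamma> B)"
    by (rule LSp_tensor[OF pre_copycat[OF A] pre_copycat[OF B]]) (simp add: Int_Un)
  also have "\<dots> \<approx> cc (P 0) (P 3) A \<bowtie> cc (P 2) (P 4) B" by (intro join_cong LSp_copycat A B)
  also have "\<dots> \<approx> cc (T2 0 2) (T2 3 4) (A \<parallel> B)"
    by (rule ls_iso_sym[OF cc_par[OF A B]]) (use A B in auto)
  also have "\<dots> \<approx> LSp (T2 0 2) (T2 3 4) (A \<parallel> B) (A \<parallel> B) (\<gamma> (A \<parallel> B))"
    by (rule ls_iso_sym[OF LSp_copycat[OF game_par[OF A B]]])
  finally show "LSp (T2 0 2) (T2 3 4) (A \<parallel> B) (A \<parallel> B) (strat_tensor (\<gamma> A) (\<gamma> B)) \<approx>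
    LSp (T2 0 2) (T2 3 4) (A \<parallel> B) (A \<parallel> B) (\<gamma> (A \<parallel> B))" .
qed (simp add: Int_Un)

lemma iso_trans_pre:
  "pre A B \<sigma> \<Longrightarrow> pre A B \<tau> \<Longrightarrow> pre A B \<upsilon> \<Longrightarrow> \<sigma> \<cong> \<tau> \<Longrightarrow> \<tau> \<cong> \<upsilon> \<Longrightarrow> \<sigma> \<cong> \<upsilon>"
  using iso_trans[of "A\<^sup>\<bottom> \<parallel> B"] by blast

lemma iso_sym_pre: "pre A B \<sigma> \<Longrightarrow> pre A B \<tau> \<Longrightarrow> \<sigma> \<cong> \<tau> \<Longrightarrow> \<tau> \<cong> \<sigma>"
  using iso_sym[of "A\<^sup>\<bottom> \<parallel> B"] by blast

lemma iso_refl_pre: "pre A B \<sigma> \<Longrightarrow> \<sigma> \<cong> \<sigma>"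
  using iso_refl[of "A\<^sup>\<bottom> \<parallel> B"] by blast

text \<open>Copycat on a parallel composition is the tensor of the copycats, so interchange reduces
  absorption to absorption by each factor.\<close>

lemma strat_tensor_strat:
  assumes s: "strat A B \<sigma>" and s': "strat A' B' \<sigma>'"
  shows "strat (A \<parallel> A') (B \<parallel> B') (strat_tensor \<sigma> \<sigma>')"
proof (rule stratI)
  note \<sigma> = strat_pre[OF s] and \<sigma>' = strat_pre[OF s']
  show t: "pre (A \<parallel> A') (B \<parallel> B') (strat_tensor \<sigma> \<sigma>')" by (rule pre_tensor[OF \<sigma> \<sigma>'])
  have g: "pre A A (\<gamma> A)" "pre A' A' (\<gamma> A')" "pre B B (\<gamma> B)" "pre B' B' (\<gamma> B')"
    "pre (A \<parallel> A') (A \<parallel> A') (\<gamma> (A \<parallel> A'))" "pre (B \<parallel> B') (B \<parallel> B') (\<gamma> (B \<parallel> B'))"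
    by (rule pre_copycat, use \<sigma> \<sigma>' in simp)+
  have A: "game A" "game A'" and B: "game B" "game B'" using \<sigma> \<sigma>' by blast+
  note gg = pre_tensor[OF g(1,2)] pre_tensor[OF g(3,4)]
  note l = pre_comp[OF \<sigma> g(3)] pre_comp[OF \<sigma>' g(4)] and r = pre_comp[OF g(1) \<sigma>] pre_comp[OF g(2) \<sigma>']
  let ?t = "strat_tensor \<sigma> \<sigma>'"
  let ?L = "strat_comp (A \<parallel> A') (B \<parallel> B') (\<gamma> (B \<parallel> B')) ?t"
  have "strat_comp (A \<parallel> A') (B \<parallel> B') (strat_tensor (\<gamma> B) (\<gamma> B')) ?t \<cong> ?L"
    by (rule comp_cong[OF t t gg(2) g(6) iso_refl_pre[OF t] tensor_copycat[OF B]])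
  then have 1: "?L \<cong> strat_comp (A \<parallel> A') (B \<parallel> B') (strat_tensor (\<gamma> B) (\<gamma> B')) ?t"
    by (rule iso_sym_pre[OF pre_comp[OF t gg(2)] pre_comp[OF t g(6)]])
  have 2: "strat_comp (A \<parallel> A') (B \<parallel> B') (strat_tensor (\<gamma> B) (\<gamma> B')) ?t \<cong>
      strat_tensor (strat_comp A B (\<gamma> B) \<sigma>) (strat_comp A' B' (\<gamma> B') \<sigma>')"
    by (rule iso_sym_pre[OF pre_tensor[OF l] pre_comp[OF t gg(2)] tensor_comp[OF \<sigma> g(3) \<sigma>' g(4)]])
  have 3: "strat_tensor (strat_comp A B (\<gamma> B) \<sigma>) (strat_comp A' B' (\<gamma> B') \<sigma>') \<cong> ?t"
    by (rule tensor_cong[OF l(1) \<sigma> l(2) \<sigma>' strat_left[OF s] strat_left[OF s']])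
  show "?L \<cong> ?t"
    by (rule iso_trans_pre[OF pre_comp[OF t g(6)] pre_comp[OF t gg(2)] t 1
        iso_trans_pre[OF pre_comp[OF t gg(2)] pre_tensor[OF l] t 2 3]])
  let ?R = "strat_comp (A \<parallel> A') (B \<parallel> B') ?t (\<gamma> (A \<parallel> A'))"
  have "strat_comp (A \<parallel> A') (B \<parallel> B') ?t (strat_tensor (\<gamma> A) (\<gamma> A')) \<cong> ?R"
    by (rule comp_cong[OF gg(1) g(5) t t tensor_copycat[OF A] iso_refl_pre[OF t]])
  then have 1: "?R \<cong> strat_comp (A \<parallel> A') (B \<parallel> B') ?t (strat_tensor (\<gamma> A) (\<gamma> A'))"
    by (rule iso_sym_pre[OF pre_comp[OF gg(1) t] pre_comp[OF g(5) t]])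
  have 2: "strat_comp (A \<parallel> A') (B \<parallel> B') ?t (strat_tensor (\<gamma> A) (\<gamma> A')) \<cong>
      strat_tensor (strat_comp A B \<sigma> (\<gamma> A)) (strat_comp A' B' \<sigma>' (\<gamma> A'))"
    by (rule iso_sym_pre[OF pre_tensor[OF r] pre_comp[OF gg(1) t] tensor_comp[OF g(1) \<sigma> g(2) \<sigma>']])
  have 3: "strat_tensor (strat_comp A B \<sigma> (\<gamma> A)) (strat_comp A' B' \<sigma>' (\<gamma> A')) \<cong> ?t"
    by (rule tensor_cong[OF r(1) \<sigma> r(2) \<sigma>' strat_right[OF s] strat_right[OF s']])
  show "?R \<cong> ?t"
    by (rule iso_trans_pre[OF pre_comp[OF g(5) t] pre_comp[OF gg(1) t] t 1
        iso_trans_pre[OF pre_comp[OF gg(1) t] pre_tensor[OF r] t 2 3]])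
qed

section \<open>Duality\<close>

lemma hide_empty: "hide {} X \<approx> X"
  by (rule ls_isoI[where f = id and g = id]) auto

text \<open>On the side of \<open>A\<close>, absorption is the hypothesis itself. On the side of the
  unit, the copycat of the empty game is neutral for the join and there is nothing to hide.\<close>

lemma strat_from_unit:
  assumes A: "game A" and s: "strategy A \<sigma>"
  shows "strat \<one> A (from_unit \<sigma>)"
proof (rule stratI)
  have "prestrategy A \<sigma>" using s by (simp add: strategy_def)
  then show u: "pre \<one> A (from_unit \<sigma>)" by (rule pre_from_unit[OF A])
  show "strat_comp \<one> A (\<gamma> A) (from_unit \<sigma>) \<cong> from_unit \<sigma>" using s by (simp add: strategy_def)
  have g: "pre \<one> \<one> (\<gamma> \<one>)" by (rule pre_copycat) simp
  show "strat_comp \<one> A (from_unit \<sigma>) (\<gamma> \<one>) \<cong> from_unit \<sigma>"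
  proof (rule isoI_LSp[OF pre_comp[OF g u] u, where p = "P 0" and q = "P 2"])
    let ?X = "LSp (P 3) (P 2) \<one> A (from_unit \<sigma>)"
    have v: "valid ?X" by (rule valid_LSp'[OF u]) simp
    have "LSp (P 0) (P 2) \<one> A (strat_comp \<one> A (from_unit \<sigma>) (\<gamma> \<one>)) \<approx>
       hide (P 3 ` Ev \<one>) (LSp (P 0) (P 3) \<one> \<one> (\<gamma> \<one>) \<bowtie> ?X)"
      by (rule LSp_comp[OF g u]) simp_all
    also have "\<dots> \<approx> LSp (P 0) (P 3) \<one> \<one> (\<gamma> \<one>) \<bowtie> ?X" using hide_empty by simp
    also have "\<dots> \<approx> cc (P 0) (P 3) \<one> \<bowtie> ?X" by (intro join_cong LSp_copycat ls_iso_refl) simp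
    also have "\<dots> \<approx> ?X \<bowtie> cc (P 0) (P 3) \<one>" by (rule join_comm)
    also have "\<dots> \<approx> ?X" by (rule cc_empty[OF v])
    also have "\<dots> \<approx> LSp (P 0) (P 2) \<one> A (from_unit \<sigma>)" by (rule LSp_cong[OF u]) simp_all
    finally show "LSp (P 0) (P 2) \<one> A (strat_comp \<one> A (from_unit \<sigma>) (\<gamma> \<one>)) \<approx> LSp (P 0) (P 2) \<one> A (from_unit \<sigma>)" .
  qed simp
qed

lemma coev_from_unit: "(\<Gamma> A, Tag True) = from_unit (\<gamma> A)"
  by (simp add: from_unit_def copycat_def)

text \<open>Viewed on the single game \<open>A\<^sup>\<bottom> \<parallel> A\<close>, the defining
  condition for \<open>\<eta>\<close> is the one that copycat is already known to satisfy.\<close>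

lemma strat_coev: "game A \<Longrightarrow> strat \<one> (A\<^sup>\<bottom> \<parallel> A) (\<Gamma> A, Tag True)"
  unfolding coev_from_unit using strat_from_unit[of "A\<^sup>\<bottom> \<parallel> A" "\<gamma> A"] strat_copycat[of A] by simp

lemma LSp_coev: "game A \<Longrightarrow> LSp u (tag p q) \<one> (A\<^sup>\<bottom> \<parallel> A) (\<Gamma> A, Tag True) \<approx> cc p q A"
  unfolding coev_from_unit LSp_from_unit by (rule LSp_copycat)

lemma LSp_ev: 
  assumes A: "game A" shows "LSp (tag p q) u (A \<parallel> A\<^sup>\<bottom>) \<one> (\<Gamma> A, Tag False) \<approx> cc p q A"
  using LS_copycat[OF A, of p q] by (simp add: LSp_def)

lemma pre_ev: 
  assumes A: "game A" shows "pre (A \<parallel> A\<^sup>\<bottom>) \<one> (\<Gamma> A, Tag False)"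
proof -
  have G: "game (A\<^sup>\<bottom> \<parallel> A)" using A by simp
  \<comment> \<open>\<open>Tag False\<close> is the inverse of the right unitor, and by
    \<open>dual_dual\<close> the dual of \<open>A \<parallel> A\<^sup>\<bottom>\<close> is the
    codomain of copycat.\<close>
  have "prestrategy ((A\<^sup>\<bottom> \<parallel> A) \<parallel> \<one>) (fst (\<gamma> A), Tag False \<circ> snd (\<gamma> A))"
    by (rule prestrategy_post[OF prestrategy_copycat[OF A] giso_sym[OF giso_runit[OF G]]])
  then show ?thesis using A by (simp add: dual_par copycat_def)
qed

text \<open>Three links in a row, a-b, b-c and c-d. The middle one stands last because the outer two
  arise together, as one factor of a composite.\<close>

lemma cc_chain3:
  assumes A: "game A" and s: "sep a A b A" "sep a A c A" "sep a A d A" "sep b A c A" "sep b A d A" "sep c A d A"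
  shows "hide (b ` Ev A \<union> c ` Ev A) ((cc a b A \<bowtie> cc c d A) \<bowtie> cc b c A) \<approx> cc a d A"
proof -
  let ?X = "cc a b A" and ?Y = "cc b c A" and ?Z = "cc c d A"
  have v: "valid ?X" "valid ?Y" "valid ?Z" using A s by (simp_all only: valid_cc)
  note [intro] = v
  have "(?X \<bowtie> ?Z) \<bowtie> ?Y \<approx> ?X \<bowtie> (?Z \<bowtie> ?Y)" by (rule join_assoc) auto
  also have "\<dots> \<approx> ?X \<bowtie> (?Y \<bowtie> ?Z)" by (intro join_cong join_comm ls_iso_refl)
  also have "\<dots> \<approx> (?X \<bowtie> ?Y) \<bowtie> ?Z" by (rule ls_iso_sym[OF join_assoc]) auto
  finally have "hide (b ` Ev A \<union> c ` Ev A) ((?X \<bowtie> ?Z) \<bowtie> ?Y) \<approx> hide (b ` Ev A \<union> c ` Ev A) ((?X \<bowtie> ?Y) \<bowtie> ?Z)"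
    by (rule hide_cong)
  also have "\<dots> = hide (c ` Ev A \<union> b ` Ev A) ((?X \<bowtie> ?Y) \<bowtie> ?Z)" by (simp add: Un_commute)
  also have "\<dots> \<approx> hide (c ` Ev A) (hide (b ` Ev A) ((?X \<bowtie> ?Y) \<bowtie> ?Z))" by (rule ls_iso_sym[OF hide_hide]) auto
  also have "\<dots> \<approx> hide (c ` Ev A) (hide (b ` Ev A) (?X \<bowtie> ?Y) \<bowtie> ?Z)"
    by (intro hide_cong hide_join) (use s in auto)
  also have "\<dots> \<approx> hide (c ` Ev A) (cc a c A \<bowtie> ?Z)"
    by (intro hide_cong join_cong ls_iso_refl cc_idem A s)
  also have "\<dots> \<approx> cc a d A" by (intro cc_idem A s)
  finally show ?thesis .
qed

text \<open>Here the game stands in the source, so the route through \<open>from_unit\<close> does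
  not apply. Copycat on \<open>A \<parallel> A\<^sup>\<bottom>\<close> attaches a link to each end
  of the copycat \<open>\<epsilon>\<close>, the one at \<open>A\<^sup>\<bottom>\<close> turned
  around, and the composite is a chain of three links.\<close>

lemma strat_ev:
  assumes A: "game A" shows "strat (A \<parallel> A\<^sup>\<bottom>) \<one> (\<Gamma> A, Tag False)"
proof (rule stratI)
  let ?G = "A \<parallel> A\<^sup>\<bottom>" and ?e = "(\<Gamma> A, Tag False)"
  show e: "pre ?G \<one> ?e" by (rule pre_ev[OF A])
  have g: "pre \<one> \<one> (\<gamma> \<one>)" "pre ?G ?G (\<gamma> ?G)" by (rule pre_copycat, use A in simp)+
  show "strat_comp ?G \<one> (\<gamma> \<one>) ?e \<cong> ?e"
  proof (rule isoI_LSp[OF pre_comp[OF e g(1)] e, where p = "P 0" and q = "P 2"])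
    let ?X = "LSp (P 0) (P 3) ?G \<one> ?e"
    have v: "valid ?X" by (rule valid_LSp'[OF e]) simp
    have "LSp (P 0) (P 2) ?G \<one> (strat_comp ?G \<one> (\<gamma> \<one>) ?e) \<approx>
       hide (P 3 ` Ev \<one>) (?X \<bowtie> LSp (P 3) (P 2) \<one> \<one> (\<gamma> \<one>))"
      by (rule LSp_comp[OF e g(1)]) simp_all
    also have "\<dots> \<approx> ?X \<bowtie> LSp (P 3) (P 2) \<one> \<one> (\<gamma> \<one>)" using hide_empty by simp
    also have "\<dots> \<approx> ?X \<bowtie> cc (P 3) (P 2) \<one>" by (intro join_cong LSp_copycat ls_iso_refl) simp
    also have "\<dots> \<approx> ?X" by (rule cc_empty[OF v])
    also have "\<dots> \<approx> LSp (P 0) (P 2) ?G \<one> ?e" by (rule LSp_cong[OF e]) simp_all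
    finally show "LSp (P 0) (P 2) ?G \<one> (strat_comp ?G \<one> (\<gamma> \<one>) ?e) \<approx> LSp (P 0) (P 2) ?G \<one> ?e" .
  qed simp
  show "strat_comp ?G \<one> ?e (\<gamma> ?G) \<cong> ?e"
  proof (rule isoI_LSp[OF pre_comp[OF g(2) e] e, where p = "T2 0 2" and q = "P 9"])
    let ?X = "cc (P 3) (P 0) A" 
    have G: "game ?G" using A by simp
    have "LSp (T2 0 2) (P 9) ?G \<one> (strat_comp ?G \<one> ?e (\<gamma> ?G)) \<approx>
       hide (T2 3 4 ` Ev ?G) (LSp (T2 0 2) (T2 3 4) ?G ?G (\<gamma> ?G) \<bowtie> LSp (T2 3 4) (P 9) ?G \<one> ?e)"
      by (rule LSp_comp[OF g(2) e]) (simp_all add: Int_Un)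
    also have "\<dots> \<approx> hide (P 3 ` Ev A \<union> P 4 ` Ev A) ((cc (P 0) (P 3) A \<bowtie> cc (P 4) (P 2) A) \<bowtie> cc (P 3) (P 4) A)"
    proof -
      have "LSp (T2 0 2) (T2 3 4) ?G ?G (\<gamma> ?G) \<approx> cc (T2 0 2) (T2 3 4) ?G" by (rule LSp_copycat[OF G])
      also have "\<dots> \<approx> cc (P 0) (P 3) A \<bowtie> cc (P 2) (P 4) (A\<^sup>\<bottom>)"
        by (rule cc_par) (use A in auto)
      also have "\<dots> \<approx> cc (P 0) (P 3) A \<bowtie> cc (P 4) (P 2) A" by (intro join_cong ls_iso_refl cc_dual A)
      finally have "LSp (T2 0 2) (T2 3 4) ?G ?G (\<gamma> ?G) \<approx> cc (P 0) (P 3) A \<bowtie> cc (P 4) (P 2) A" .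
      from hide_cong[OF join_cong[OF this LSp_ev[OF A]]] show ?thesis by simp
    qed
    also have "\<dots> \<approx> cc (P 0) (P 2) A" by (rule cc_chain3[OF A]) simp_all
    also have "\<dots> \<approx> LSp (T2 0 2) (P 9) ?G \<one> ?e" by (rule ls_iso_sym[OF LSp_ev[OF A]])
    finally show "LSp (T2 0 2) (P 9) ?G \<one> (strat_comp ?G \<one> ?e (\<gamma> ?G)) \<approx> LSp (T2 0 2) (P 9) ?G \<one> ?e" .
  qed (simp add: Int_Un)
qed

text \<open>The four links of a bent wire, grouped as in the triangle identities: the half with the
  unit contributes a-b and c-d, the half with the counit b-c and d-e.\<close>

lemma zigzag_chain:
  assumes A: "game A" and s: "sep a A b A" "sep a A c A" "sep a A d A" "sep a A e A" "sep b A c A" "sep b A d A"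
    "sep b A e A" "sep c A d A" "sep c A e A" "sep d A e A"
  shows "hide (b ` Ev A \<union> (c ` Ev A \<union> d ` Ev A)) ((cc a b A \<bowtie> cc c d A) \<bowtie> (cc b c A \<bowtie> cc d e A)) \<approx> cc a e A"
proof -
  let ?X = "cc a b A" and ?Y = "cc b c A" and ?Z = "cc c d A" and ?W = "cc d e A"
  have v: "valid ?X" "valid ?Y" "valid ?Z" "valid ?W" using A s by (simp_all only: valid_cc)
  note [intro] = v
  let ?H = "b ` Ev A \<union> c ` Ev A"
  have "hide (b ` Ev A \<union> (c ` Ev A \<union> d ` Ev A)) ((?X \<bowtie> ?Z) \<bowtie> (?Y \<bowtie> ?W)) \<approx>
      hide (b ` Ev A \<union> (c ` Ev A \<union> d ` Ev A)) (((?X \<bowtie> ?Z) \<bowtie> ?Y) \<bowtie> ?W)"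
    by (intro hide_cong ls_iso_sym[OF join_assoc]) auto
  also have "\<dots> = hide (d ` Ev A \<union> ?H) (((?X \<bowtie> ?Z) \<bowtie> ?Y) \<bowtie> ?W)" by (simp add: Un_ac)
  also have "\<dots> \<approx> hide (d ` Ev A) (hide ?H (((?X \<bowtie> ?Z) \<bowtie> ?Y) \<bowtie> ?W))" by (rule ls_iso_sym[OF hide_hide]) auto
  also have "\<dots> \<approx> hide (d ` Ev A) (hide ?H ((?X \<bowtie> ?Z) \<bowtie> ?Y) \<bowtie> ?W)"
    by (intro hide_cong hide_join) (use s in auto)
  also have "\<dots> \<approx> hide (d ` Ev A) (cc a d A \<bowtie> ?W)"
    by (intro hide_cong join_cong ls_iso_refl cc_chain3 A s)
  also have "\<dots> \<approx> cc a e A" by (intro cc_idem A s)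
  finally show ?thesis .
qed

section \<open>The category\<close>

lemma mk_arr_eqI:
  assumes \<sigma>: "pre A B \<sigma>" and \<tau>: "pre A B \<tau>" and iso: "\<sigma> \<cong> \<tau>"
  shows "mk_arr A B \<sigma> = mk_arr A B \<tau>"
proof -
  have "\<sigma> \<cong> \<upsilon> \<longleftrightarrow> \<tau> \<cong> \<upsilon>" if "prestrategy (A\<^sup>\<bottom> \<parallel> B) \<upsilon>" for \<upsilon>
  proof -
    have \<upsilon>: "pre A B \<upsilon>" using that \<sigma> by blast
    show ?thesis
      using iso_trans_pre[OF \<sigma> \<tau> \<upsilon> iso] iso_trans_pre[OF \<tau> \<sigma> \<upsilon> iso_sym_pre[OF \<sigma> \<tau> iso]] by blast
  qed
  then show ?thesis by (auto simp: mk_arr_def iso_class_def)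
qed

lemma mk_arr_simps [simp]: "src (mk_arr A B \<sigma>) = A" "trg (mk_arr A B \<sigma>) = B"
  "cls (mk_arr A B \<sigma>) = iso_class (A\<^sup>\<bottom> \<parallel> B) \<sigma>"
  by (simp_all add: mk_arr_def)

text \<open>Well-definedness of operations on classes: if \<open>F\<close> respects isomorphism,
  every choice of representatives contributes the same class, and by reflexivity there is at least
  one choice.\<close>

lemma iso_class_Union:
  assumes \<sigma>: "prestrategy G \<sigma>" and \<tau>: "prestrategy H \<tau>"
    and op: "\<And>\<sigma>' \<tau>'. prestrategy G \<sigma>' \<Longrightarrow> prestrategy H \<tau>' \<Longrightarrow> \<sigma> \<cong> \<sigma>' \<Longrightarrow> \<tau> \<cong> \<tau>' \<Longrightarrow> iso_class K (F \<tau>' \<sigma>') = iso_class K (F \<tau> \<sigma>)"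
  shows "(\<Union>\<tau>'\<in>iso_class H \<tau>. \<Union>\<sigma>'\<in>iso_class G \<sigma>. iso_class K (F \<tau>' \<sigma>')) = iso_class K (F \<tau> \<sigma>)"
proof (intro equalityI subsetI)
  fix x assume "x \<in> (\<Union>\<tau>'\<in>iso_class H \<tau>. \<Union>\<sigma>'\<in>iso_class G \<sigma>. iso_class K (F \<tau>' \<sigma>'))"
  then obtain \<tau>' \<sigma>' where "prestrategy H \<tau>'" "\<tau> \<cong> \<tau>'" "prestrategy G \<sigma>'" "\<sigma> \<cong> \<sigma>'" "x \<in> iso_class K (F \<tau>' \<sigma>')"
    unfolding iso_class_def[of H] iso_class_def[of G] by blast
  then show "x \<in> iso_class K (F \<tau> \<sigma>)" using op by simp
next
  fix x assume "x \<in> iso_class K (F \<tau> \<sigma>)"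
  moreover have "\<tau> \<in> iso_class H \<tau>" "\<sigma> \<in> iso_class G \<sigma>"
    using iso_refl[OF \<sigma>] iso_refl[OF \<tau>] \<sigma> \<tau> by (simp_all add: iso_class_def)
  ultimately show "x \<in> (\<Union>\<tau>'\<in>iso_class H \<tau>. \<Union>\<sigma>'\<in>iso_class G \<sigma>. iso_class K (F \<tau>' \<sigma>'))" by blast
qed

lemma CG_comp_mk:
  assumes \<sigma>: "pre A B \<sigma>" and \<tau>: "pre B C \<tau>"
  shows "CG_comp (mk_arr B C \<tau>) (mk_arr A B \<sigma>) = mk_arr A C (strat_comp A C \<tau> \<sigma>)"
proof -
  have "(\<Union>\<tau>'\<in>iso_class (B\<^sup>\<bottom> \<parallel> C) \<tau>. \<Union>\<sigma>'\<in>iso_class (A\<^sup>\<bottom> \<parallel> B) \<sigma>. iso_class (A\<^sup>\<bottom> \<parallel> C) (strat_comp A C \<tau>' \<sigma>')) =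
     iso_class (A\<^sup>\<bottom> \<parallel> C) (strat_comp A C \<tau> \<sigma>)"
  proof (rule iso_class_Union)
    fix \<sigma>' \<tau>' assume *: "prestrategy (A\<^sup>\<bottom> \<parallel> B) \<sigma>'" "prestrategy (B\<^sup>\<bottom> \<parallel> C) \<tau>'" "\<sigma> \<cong> \<sigma>'" "\<tau> \<cong> \<tau>'"
    then have p: "pre A B \<sigma>'" "pre B C \<tau>'" using \<sigma> \<tau> by blast+
    have "mk_arr A C (strat_comp A C \<tau> \<sigma>) = mk_arr A C (strat_comp A C \<tau>' \<sigma>')"
      by (rule mk_arr_eqI[OF pre_comp[OF \<sigma> \<tau>] pre_comp[OF p] comp_cong[OF \<sigma> p(1) \<tau> p(2) *(3,4)]])
    then show "iso_class (A\<^sup>\<bottom> \<parallel> C) (strat_comp A C \<tau>' \<sigma>') = iso_class (A\<^sup>\<bottom> \<parallel> C) (strat_comp A C \<tau> \<sigma>)"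
      by (simp add: mk_arr_def)
  qed (use \<sigma> \<tau> in blast)+
  then show ?thesis by (simp add: CG_comp_def mk_arr_def)
qed

lemma CG_tensor_mk:
  assumes \<sigma>: "pre A B \<sigma>" and \<tau>: "pre A' B' \<tau>"
  shows "CG_tensor (mk_arr A B \<sigma>) (mk_arr A' B' \<tau>) = mk_arr (A \<parallel> A') (B \<parallel> B') (strat_tensor \<sigma> \<tau>)"
proof -
  let ?K = "(A \<parallel> A')\<^sup>\<bottom> \<parallel> (B \<parallel> B')"
  have "(\<Union>\<sigma>'\<in>iso_class (A\<^sup>\<bottom> \<parallel> B) \<sigma>. \<Union>\<tau>'\<in>iso_class (A'\<^sup>\<bottom> \<parallel> B') \<tau>. iso_class ?K (strat_tensor \<sigma>' \<tau>')) =
     iso_class ?K (strat_tensor \<sigma> \<tau>)"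
  proof (rule iso_class_Union)
    fix \<tau>' \<sigma>' assume *: "prestrategy (A'\<^sup>\<bottom> \<parallel> B') \<tau>'" "prestrategy (A\<^sup>\<bottom> \<parallel> B) \<sigma>'" "\<tau> \<cong> \<tau>'" "\<sigma> \<cong> \<sigma>'"
    then have p: "pre A B \<sigma>'" "pre A' B' \<tau>'" using \<sigma> \<tau> by blast+
    have "mk_arr (A \<parallel> A') (B \<parallel> B') (strat_tensor \<sigma> \<tau>) = mk_arr (A \<parallel> A') (B \<parallel> B') (strat_tensor \<sigma>' \<tau>')"
      by (rule mk_arr_eqI[OF pre_tensor[OF \<sigma> \<tau>] pre_tensor[OF p] tensor_cong[OF \<sigma> p(1) \<tau> p(2) *(4,3)]])
    then show "iso_class ?K (strat_tensor \<sigma>' \<tau>') = iso_class ?K (strat_tensor \<sigma> \<tau>)"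
      by (simp add: mk_arr_def)
  qed (use \<sigma> \<tau> in blast)+
  then show ?thesis by (simp add: CG_tensor_def mk_arr_def)
qed

lemma CG_homE:
  assumes "f \<in> CG_hom A B" "A \<in> CG_ob" "B \<in> CG_ob"
  obtains \<sigma> where "strat A B \<sigma>" "f = mk_arr A B \<sigma>"
  using assms unfolding CG_hom_def CG_ob_def by blast

lemma mk_arr_in_hom: "strat A B \<sigma> \<Longrightarrow> mk_arr A B \<sigma> \<in> CG_hom A B"
  unfolding CG_hom_def by blast

lemma tag_Tag_image [simp]: "tag p q ` Tag False ` X = p ` X" "tag p q ` Tag True ` X = q ` X"
  by (simp_all add: image_image)

lemma inj_tag_Tag [simp]: "inj_on (tag p q) (Tag False ` X) \<longleftrightarrow> inj_on p X" "inj_on (tag p q) (Tag True ` X) \<longleftrightarrow> inj_on q X"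
  by (auto simp: inj_on_def)

interpretation CG: cat CG_ob CG_hom CG_comp CG_id
proof
  fix A B C D :: "'a ev esp" and f g h :: "'a arr"
  show "A = A' \<and> B = B'" if "f \<in> CG_hom A B" "f \<in> CG_hom A' B'" for A' B'
  proof -
    from that obtain \<sigma> \<tau> where f: "f = mk_arr A B \<sigma>" "f = mk_arr A' B' \<tau>" unfolding CG_hom_def by blast
    have "src f = A" "trg f = B" unfolding f(1) by simp_all
    moreover have "src f = A'" "trg f = B'" unfolding f(2) by simp_all
    ultimately show ?thesis by simp
  qed
  show "CG_id A \<in> CG_hom A A" if "A \<in> CG_ob"
    unfolding CG_id_def by (rule mk_arr_in_hom[OF strat_copycat]) (use that in \<open>simp add: CG_ob_def\<close>)
  assume A: "A \<in> CG_ob" and B: "B \<in> CG_ob"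
  {
    assume f: "f \<in> CG_hom A B"
    from CG_homE[OF f A B] obtain \<sigma> where s: "strat A B \<sigma>" and fs: "f = mk_arr A B \<sigma>" .
    have g: "pre A A (\<gamma> A)" "pre B B (\<gamma> B)" using pre_copycat s by blast+
    note \<sigma> = strat_pre[OF s]
    show "CG_comp f (CG_id A) = f"
      unfolding fs CG_id_def CG_comp_mk[OF g(1) \<sigma>] by (rule mk_arr_eqI[OF pre_comp[OF g(1) \<sigma>] \<sigma> strat_right[OF s]])
    show "CG_comp (CG_id B) f = f"
      unfolding fs CG_id_def CG_comp_mk[OF \<sigma> g(2)] by (rule mk_arr_eqI[OF pre_comp[OF \<sigma> g(2)] \<sigma> strat_left[OF s]])
  }
  assume C: "C \<in> CG_ob" 
  {
    assume f: "f \<in> CG_hom A B" and g: "g \<in> CG_hom B C"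
    from CG_homE[OF f A B] obtain \<sigma> where s: "strat A B \<sigma>" and fs: "f = mk_arr A B \<sigma>" .
    from CG_homE[OF g B C] obtain \<tau> where t: "strat B C \<tau>" and gt: "g = mk_arr B C \<tau>" .
    show "CG_comp g f \<in> CG_hom A C"
      unfolding fs gt CG_comp_mk[OF strat_pre[OF s] strat_pre[OF t]] by (rule mk_arr_in_hom[OF strat_comp_strat[OF s t]])
  }
  assume D: "D \<in> CG_ob" and f: "f \<in> CG_hom A B" and g: "g \<in> CG_hom B C" and h: "h \<in> CG_hom C D"
  from CG_homE[OF f A B] obtain \<sigma> where s: "strat A B \<sigma>" and fs: "f = mk_arr A B \<sigma>" .
  from CG_homE[OF g B C] obtain \<tau> where t: "strat B C \<tau>" and gt: "g = mk_arr B C \<tau>" .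
  from CG_homE[OF h C D] obtain \<upsilon> where u: "strat C D \<upsilon>" and hu: "h = mk_arr C D \<upsilon>" .
  note p = strat_pre[OF s] strat_pre[OF t] strat_pre[OF u]
  show "CG_comp h (CG_comp g f) = CG_comp (CG_comp h g) f"
    unfolding fs gt hu CG_comp_mk[OF p(1,2)] CG_comp_mk[OF p(2,3)] CG_comp_mk[OF pre_comp[OF p(1,2)] p(3)]
      CG_comp_mk[OF p(1) pre_comp[OF p(2,3)]]
    by (rule mk_arr_eqI[OF pre_comp[OF pre_comp[OF p(1,2)] p(3)] pre_comp[OF p(1) pre_comp[OF p(2,3)]] strat_assoc[OF p]])
qed

section \<open>Arrows lifted from isomorphisms of games\<close>

text \<open>On these arrows identities, composition and tensor are computed on the underlying
  functions. Coherence laws thereby become equations between functions on tagged events.\<close>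

definition lift_arr :: "'a ev esp \<Rightarrow> 'a ev esp \<Rightarrow> ('a ev \<Rightarrow> 'a ev) \<Rightarrow> 'a arr" where
  "lift_arr A B f = mk_arr A B (lifting A f)"

lemma lift_arr_in_hom: "giso A B f g \<Longrightarrow> lift_arr A B f \<in> CG_hom A B"
  unfolding lift_arr_def by (rule mk_arr_in_hom[OF strat_lifting])

lemma lift_arr_cong:
  assumes "giso A B f g" "giso A B f' g'" "\<And>a. a \<in> Ev A \<Longrightarrow> f a = f' a"
  shows "lift_arr A B f = lift_arr A B f'"
  unfolding lift_arr_def by (rule mk_arr_eqI[OF pre_lifting[OF assms(1)] pre_lifting[OF assms(2)] lifting_cong[OF assms]])

lemma lift_arr_comp:
  assumes i: "giso A B f g" and j: "giso B C h k"
  shows "CG_comp (lift_arr B C h) (lift_arr A B f) = lift_arr A C (h \<circ> f)"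
  unfolding lift_arr_def CG_comp_mk[OF pre_lifting[OF i] pre_lifting[OF j]]
  by (rule mk_arr_eqI[OF pre_comp[OF pre_lifting[OF i] pre_lifting[OF j]] pre_lifting[OF giso_comp[OF i j]] lifting_comp[OF i j]])

lemma lift_arr_id: "game A \<Longrightarrow> CG_id A = lift_arr A A id"
  unfolding lift_arr_def CG_id_def
  by (rule mk_arr_eqI[symmetric, OF pre_lifting[OF giso_id] pre_copycat lifting_id])

lemma lift_arr_tensor:
  assumes i: "giso A B f g" and j: "giso A' B' f' g'"
  shows "CG_tensor (lift_arr A B f) (lift_arr A' B' f') = lift_arr (A \<parallel> A') (B \<parallel> B') (par_map f f')"
  unfolding lift_arr_def CG_tensor_mk[OF pre_lifting[OF i] pre_lifting[OF j]]
  by (rule mk_arr_eqI[OF pre_tensor[OF pre_lifting[OF i] pre_lifting[OF j]] pre_lifting[OF giso_par[OF i j]] tensor_lifting[OF i j]])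

lemma lift_arr_inverse:
  assumes i: "giso A B f g" shows "CG.is_inverse A B (lift_arr A B f) (lift_arr B A g)"
proof -
  note D = gisoD[OF i] and j = giso_sym[OF i]
  have "lift_arr A A (g \<circ> f) = lift_arr A A id"
    by (rule lift_arr_cong[OF giso_comp[OF i j] giso_id[OF D(1)]]) (use D in simp)
  moreover have "lift_arr B B (f \<circ> g) = lift_arr B B id"
    by (rule lift_arr_cong[OF giso_comp[OF j i] giso_id[OF D(2)]]) (use D in simp)
  ultimately show ?thesis
    unfolding CG.is_inverse_def lift_arr_comp[OF i j] lift_arr_comp[OF j i] lift_arr_id[OF D(1)] lift_arr_id[OF D(2)]
    using lift_arr_in_hom[OF i] lift_arr_in_hom[OF j] by blast
qed

lemma lift_arr_iso: "giso A B f g \<Longrightarrow> CG.iso_arr A B (lift_arr A B f)"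
  using lift_arr_inverse CG.iso_arr_def by blast

text \<open>\<open>inv_arr\<close> is a definite description, so exhibiting an inverse is not
  enough; its uniqueness follows from the category laws.\<close>

lemma lift_arr_inv:
  assumes i: "giso A B f g" shows "CG.inv_arr A B (lift_arr A B f) = lift_arr B A g"
  unfolding CG.inv_arr_def
proof (rule the_equality)
  note D = gisoD[OF i]
  have ob: "A \<in> CG_ob" "B \<in> CG_ob" using D by (simp_all add: CG_ob_def)
  show I: "CG.is_inverse A B (lift_arr A B f) (lift_arr B A g)" by (rule lift_arr_inverse[OF i])
  fix h assume h: "CG.is_inverse A B (lift_arr A B f) h"
  have "h = CG_comp h (CG_comp (lift_arr A B f) (lift_arr B A g))"
    using h I CG.cmp_ide_right[OF ob(2,1)] unfolding CG.is_inverse_def by simp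
  also have "\<dots> = CG_comp (CG_comp h (lift_arr A B f)) (lift_arr B A g)"
    using h I CG.cmp_assoc[OF ob(2,1,2,1)] unfolding CG.is_inverse_def by blast
  also have "\<dots> = lift_arr B A g"
    using h I CG.cmp_ide_left[OF ob(2,1)] unfolding CG.is_inverse_def by simp
  finally show "h = lift_arr B A g" .
qed

text \<open>Post-composition renames the target through \<open>h\<close> and pre-composition the
  source through \<open>f\<close>, so the square commutes once the two strategies agree under these
  names. \<open>q\<close> and \<open>q'\<close> are spare names for the wires inside the
  composites.\<close>

lemma lift_arr_natural:
  assumes s: "strat A B \<sigma>" and t: "strat A' B' \<tau>" and f: "giso A A' f f'" and h: "giso B B' h h'"
    and sep: "sep p A' r B'" "sep p A' q B" "sep q B r B'" "sep p A' q' A'" "sep q' A' r B'"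
    and eq: "LSp (\<lambda>a. p (f a)) (\<lambda>b. r (h b)) A B \<sigma> \<approx> LSp p r A' B' \<tau>"
  shows "CG_comp (lift_arr B B' h) (mk_arr A B \<sigma>) = CG_comp (mk_arr A' B' \<tau>) (lift_arr A A' f)"
proof -
  note \<sigma> = strat_pre[OF s] and \<tau> = strat_pre[OF t] and lf = pre_lifting[OF f] and lh = pre_lifting[OF h]
  have sep': "sep (\<lambda>a. p (f a)) A r B'" "sep (\<lambda>a. p (f a)) A q B"
    using sep sep_giso[OF f, of r B' p] sep_giso[OF f, of q B p] sep_sym by blast+
  have "LSp (\<lambda>a. p (f a)) r A B' (strat_comp A B' (lifting B h) \<sigma>) \<approx> LSp (\<lambda>a. p (f a)) (\<lambda>b. r (h b)) A B \<sigma>"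
    by (rule lift_post[OF s h sep'(2,1) sep(3)])
  also have "\<dots> \<approx> LSp p r A' B' \<tau>" by (rule eq)
  also have "\<dots> \<approx> LSp (\<lambda>a. p (f a)) r A B' (strat_comp A B' \<tau> (lifting A f))"
    by (rule ls_iso_sym[OF lift_pre[OF t f refl sep(4,1,5)]])
  finally have "strat_comp A B' (lifting B h) \<sigma> \<cong> strat_comp A B' \<tau> (lifting A f)"
    by (rule isoI_LSp[OF pre_comp[OF \<sigma> lh] pre_comp[OF lf \<tau>] _ sep'(1)])
  then show ?thesis
    unfolding lift_arr_def CG_comp_mk[OF \<sigma> lh] CG_comp_mk[OF lf \<tau>]
    by (rule mk_arr_eqI[OF pre_comp[OF \<sigma> lh] pre_comp[OF lf \<tau>]])
qed

section \<open>Compact closure\<close>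

lemma CG_structure:
  "CG_assoc A B C = lift_arr ((A \<parallel> B) \<parallel> C) (A \<parallel> (B \<parallel> C)) assoc_map"
  "CG_lunit A = lift_arr (\<one> \<parallel> A) A lunit_map"
  "CG_runit A = lift_arr (A \<parallel> \<one>) A runit_map"
  "CG_symm A B = lift_arr (A \<parallel> B) (B \<parallel> A) symm_map"
  by (simp_all add: CG_assoc_def CG_lunit_def CG_runit_def CG_symm_def lift_arr_def)

text \<open>The empty game has no moves, so \<open>p'\<close> and \<open>q'\<close> are constrained
  on \<open>Tag True\<close> only. This admits names composed with \<open>lunit_map\<close>, as they
  occur in naturality.\<close>

lemma LSp_unit_tensor:
  assumes s: "pre A B \<sigma>" and g: "sep p A q B"
    and p: "\<And>a. a \<in> Ev A \<Longrightarrow> p' (Tag True a) = p a" and q: "\<And>b. b \<in> Ev B \<Longrightarrow> q' (Tag True b) = q b"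
  shows "LSp p' q' (\<one> \<parallel> A) (\<one> \<parallel> B) (strat_tensor (\<gamma> \<one>) \<sigma>) \<approx> LSp p q A B \<sigma>"
proof -
  have u: "pre \<one> \<one> (\<gamma> \<one>)" by (rule pre_copycat) simp
  have "LSp p' q' (\<one> \<parallel> A) (\<one> \<parallel> B) (strat_tensor (\<gamma> \<one>) \<sigma>) \<approx>
    LSp (tag p p) (tag q q) (\<one> \<parallel> A) (\<one> \<parallel> B) (strat_tensor (\<gamma> \<one>) \<sigma>)"
    by (rule LSp_cong[OF pre_tensor[OF u s]]) (use p q in auto)
  also have "\<dots> \<approx> LSp p q \<one> \<one> (\<gamma> \<one>) \<bowtie> LSp p q A B \<sigma>" by (rule LSp_tensor[OF u s]) (use g in simp)
  also have "\<dots> \<approx> LSp p q A B \<sigma> \<bowtie> LSp p q \<one> \<one> (\<gamma> \<one>)" by (rule join_comm)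
  also have "\<dots> \<approx> LSp p q A B \<sigma> \<bowtie> cc p q \<one>" by (intro join_cong ls_iso_refl LSp_copycat) simp
  also have "\<dots> \<approx> LSp p q A B \<sigma>" by (rule cc_empty[OF valid_LSp'[OF s g]])
  finally show ?thesis .
qed

lemma LSp_tensor_unit:
  assumes s: "pre A B \<sigma>" and g: "sep p A q B"
    and p: "\<And>a. a \<in> Ev A \<Longrightarrow> p' (Tag False a) = p a" and q: "\<And>b. b \<in> Ev B \<Longrightarrow> q' (Tag False b) = q b"
  shows "LSp p' q' (A \<parallel> \<one>) (B \<parallel> \<one>) (strat_tensor \<sigma> (\<gamma> \<one>)) \<approx> LSp p q A B \<sigma>"
proof -
  have u: "pre \<one> \<one> (\<gamma> \<one>)" by (rule pre_copycat) simp
  have "LSp p' q' (A \<parallel> \<one>) (B \<parallel> \<one>) (strat_tensor \<sigma> (\<gamma> \<one>)) \<approx>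
    LSp (tag p p) (tag q q) (A \<parallel> \<one>) (B \<parallel> \<one>) (strat_tensor \<sigma> (\<gamma> \<one>))"
    by (rule LSp_cong[OF pre_tensor[OF s u]]) (use p q in auto)
  also have "\<dots> \<approx> LSp p q A B \<sigma> \<bowtie> LSp p q \<one> \<one> (\<gamma> \<one>)" by (rule LSp_tensor[OF s u]) (use g in simp)
  also have "\<dots> \<approx> LSp p q A B \<sigma> \<bowtie> cc p q \<one>" by (intro join_cong ls_iso_refl LSp_copycat) simp
  also have "\<dots> \<approx> LSp p q A B \<sigma>" by (rule cc_empty[OF valid_LSp'[OF s g]])
  finally show ?thesis .
qed

lemma assoc_natural:
  assumes s: "strat A A' \<sigma>" and t: "strat B B' \<tau>" and u: "strat C C' \<upsilon>"
  shows "CG_comp (CG_assoc A' B' C') (mk_arr ((A \<parallel> B) \<parallel> C) ((A' \<parallel> B') \<parallel> C') (strat_tensor (strat_tensor \<sigma> \<tau>) \<upsilon>)) =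
    CG_comp (mk_arr (A \<parallel> (B \<parallel> C)) (A' \<parallel> (B' \<parallel> C')) (strat_tensor \<sigma> (strat_tensor \<tau> \<upsilon>))) (CG_assoc A B C)"
  unfolding CG_structure
\<comment> \<open>One name for each of the six games, tagged as in the right-nested bracketing;
  composing with \<open>assoc_map\<close> gives the left-nested tags over the same names.
  \<open>P 8\<close> is a spare wire.\<close>
proof (rule lift_arr_natural[where p = "tag (P 0) (T2 2 3)" and r = "tag (P 4) (T2 5 6)" and q = "P 8" and q' = "P 8"])
  note \<sigma> = strat_pre[OF s] and \<tau> = strat_pre[OF t] and \<upsilon> = strat_pre[OF u]
  show "strat ((A \<parallel> B) \<parallel> C) ((A' \<parallel> B') \<parallel> C') (strat_tensor (strat_tensor \<sigma> \<tau>) \<upsilon>)"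
    by (intro strat_tensor_strat s t u)
  show "strat (A \<parallel> (B \<parallel> C)) (A' \<parallel> (B' \<parallel> C')) (strat_tensor \<sigma> (strat_tensor \<tau> \<upsilon>))"
    by (intro strat_tensor_strat s t u)
  show "giso ((A \<parallel> B) \<parallel> C) (A \<parallel> (B \<parallel> C)) assoc_map assoc_inv" "giso ((A' \<parallel> B') \<parallel> C') (A' \<parallel> (B' \<parallel> C')) assoc_map assoc_inv"
    by (rule giso_assoc, use s t u in blast, use s t u in blast, use s t u in blast)+
  let ?p = "tag (P 0) (T2 2 3)" and ?r = "tag (P 4) (T2 5 6)"
  let ?X = "LSp (P 0) (P 4) A A' \<sigma>" and ?Y = "LSp (P 2) (P 5) B B' \<tau>" and ?Z = "LSp (P 3) (P 6) C C' \<upsilon>"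
  have v: "valid ?X" "valid ?Y" "valid ?Z" by (rule valid_LSp'[OF \<sigma>] valid_LSp'[OF \<tau>] valid_LSp'[OF \<upsilon>], simp)+
  have "LSp (\<lambda>a. ?p (assoc_map a)) (\<lambda>a. ?r (assoc_map a)) ((A \<parallel> B) \<parallel> C) ((A' \<parallel> B') \<parallel> C') (strat_tensor (strat_tensor \<sigma> \<tau>) \<upsilon>)
    \<approx> LSp (tag (T2 0 2) (P 3)) (tag (T2 4 5) (P 6)) ((A \<parallel> B) \<parallel> C) ((A' \<parallel> B') \<parallel> C') (strat_tensor (strat_tensor \<sigma> \<tau>) \<upsilon>)"
    by (rule LSp_cong[OF pre_tensor[OF pre_tensor[OF \<sigma> \<tau>] \<upsilon>]]) auto
  also have "\<dots> \<approx> LSp (T2 0 2) (T2 4 5) (A \<parallel> B) (A' \<parallel> B') (strat_tensor \<sigma> \<tau>) \<bowtie> ?Z"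
    by (rule LSp_tensor[OF pre_tensor[OF \<sigma> \<tau>] \<upsilon>]) (simp add: Int_Un)
  also have "\<dots> \<approx> (?X \<bowtie> ?Y) \<bowtie> ?Z"
    by (intro join_cong ls_iso_refl LSp_tensor[OF \<sigma> \<tau>]) (simp add: Int_Un)
  also have "\<dots> \<approx> ?X \<bowtie> (?Y \<bowtie> ?Z)" by (rule join_assoc[OF v])
  also have "\<dots> \<approx> ?X \<bowtie> LSp (T2 2 3) (T2 5 6) (B \<parallel> C) (B' \<parallel> C') (strat_tensor \<tau> \<upsilon>)"
    by (intro join_cong ls_iso_refl ls_iso_sym[OF LSp_tensor[OF \<tau> \<upsilon>]]) (simp add: Int_Un)
  also have "\<dots> \<approx> LSp ?p ?r (A \<parallel> (B \<parallel> C)) (A' \<parallel> (B' \<parallel> C')) (strat_tensor \<sigma> (strat_tensor \<tau> \<upsilon>))"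
    by (rule ls_iso_sym[OF LSp_tensor[OF \<sigma> pre_tensor[OF \<tau> \<upsilon>]]]) (simp add: Int_Un)
  finally show "LSp (\<lambda>a. ?p (assoc_map a)) (\<lambda>a. ?r (assoc_map a)) ((A \<parallel> B) \<parallel> C) ((A' \<parallel> B') \<parallel> C') (strat_tensor (strat_tensor \<sigma> \<tau>) \<upsilon>)
    \<approx> LSp ?p ?r (A \<parallel> (B \<parallel> C)) (A' \<parallel> (B' \<parallel> C')) (strat_tensor \<sigma> (strat_tensor \<tau> \<upsilon>))" .
qed (simp_all add: Int_Un)

lemma lunit_natural:
  assumes s: "strat A B \<sigma>"
  shows "CG_comp (CG_lunit B) (mk_arr (\<one> \<parallel> A) (\<one> \<parallel> B) (strat_tensor (\<gamma> \<one>) \<sigma>)) = CG_comp (mk_arr A B \<sigma>) (CG_lunit A)"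
  unfolding CG_structure
  by (rule lift_arr_natural[where p = "P 0" and r = "P 2" and q = "P 3" and q' = "P 3",
        OF strat_tensor_strat[OF strat_copycat s] s giso_lunit giso_lunit _ _ _ _ _ LSp_unit_tensor[OF strat_pre[OF s]]])
    (use s in simp_all)

lemma runit_natural:
  assumes s: "strat A B \<sigma>"
  shows "CG_comp (CG_runit B) (mk_arr (A \<parallel> \<one>) (B \<parallel> \<one>) (strat_tensor \<sigma> (\<gamma> \<one>))) = CG_comp (mk_arr A B \<sigma>) (CG_runit A)"
  unfolding CG_structure
  by (rule lift_arr_natural[where p = "P 0" and r = "P 2" and q = "P 3" and q' = "P 3",
        OF strat_tensor_strat[OF s strat_copycat] s giso_runit giso_runit _ _ _ _ _ LSp_tensor_unit[OF strat_pre[OF s]]])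
    (use s in simp_all)

lemma symm_natural:
  assumes s: "strat A A' \<sigma>" and t: "strat B B' \<tau>"
  shows "CG_comp (CG_symm A' B') (mk_arr (A \<parallel> B) (A' \<parallel> B') (strat_tensor \<sigma> \<tau>)) =
    CG_comp (mk_arr (B \<parallel> A) (B' \<parallel> A') (strat_tensor \<tau> \<sigma>)) (CG_symm A B)"
  unfolding CG_structure
proof (rule lift_arr_natural[where p = "T2 2 0" and r = "T2 4 3" and q = "P 8" and q' = "P 8"])
  note \<sigma> = strat_pre[OF s] and \<tau> = strat_pre[OF t]
  show "strat (A \<parallel> B) (A' \<parallel> B') (strat_tensor \<sigma> \<tau>)" "strat (B \<parallel> A) (B' \<parallel> A') (strat_tensor \<tau> \<sigma>)"
    by (rule strat_tensor_strat[OF s t] strat_tensor_strat[OF t s])+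
  show "giso (A \<parallel> B) (B \<parallel> A) symm_map symm_map" "giso (A' \<parallel> B') (B' \<parallel> A') symm_map symm_map"
    by (rule giso_symm, use s t in blast, use s t in blast)+
  have "LSp (\<lambda>a. T2 2 0 (symm_map a)) (\<lambda>a. T2 4 3 (symm_map a)) (A \<parallel> B) (A' \<parallel> B') (strat_tensor \<sigma> \<tau>)
    \<approx> LSp (T2 0 2) (T2 3 4) (A \<parallel> B) (A' \<parallel> B') (strat_tensor \<sigma> \<tau>)"
    by (rule LSp_cong[OF pre_tensor[OF \<sigma> \<tau>]]) auto
  also have "\<dots> \<approx> LSp (P 0) (P 3) A A' \<sigma> \<bowtie> LSp (P 2) (P 4) B B' \<tau>"
    by (rule LSp_tensor[OF \<sigma> \<tau>]) (simp add: Int_Un)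
  also have "\<dots> \<approx> LSp (P 2) (P 4) B B' \<tau> \<bowtie> LSp (P 0) (P 3) A A' \<sigma>" by (rule join_comm)
  also have "\<dots> \<approx> LSp (T2 2 0) (T2 4 3) (B \<parallel> A) (B' \<parallel> A') (strat_tensor \<tau> \<sigma>)"
    by (rule ls_iso_sym[OF LSp_tensor[OF \<tau> \<sigma>]]) (simp add: Int_Un)
  finally show "LSp (\<lambda>a. T2 2 0 (symm_map a)) (\<lambda>a. T2 4 3 (symm_map a)) (A \<parallel> B) (A' \<parallel> B') (strat_tensor \<sigma> \<tau>)
    \<approx> LSp (T2 2 0) (T2 4 3) (B \<parallel> A) (B' \<parallel> A') (strat_tensor \<tau> \<sigma>)" .
qed (simp_all add: Int_Un)

section \<open>The triangle identities\<close>

lemma CG_ob_iff [simp]: "A \<in> CG_ob \<longleftrightarrow> game A"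
  by (simp add: CG_ob_def)

text \<open>With 0 and 9 for the outer ends and 3, 4, 5 for the three copies in the middle, the half
  with \<open>\<eta>\<close> contributes the links 0-3 and 4-5, and the half with
  \<open>\<epsilon>\<close> the links 3-4 and 5-9. Straightened, this is a chain from 0 to 9. The
  structural isomorphisms only rename; 6 stands for the empty game and 8 is a spare wire.\<close>

lemma zigzag:
  assumes A: "game A"
  shows "CG_id A = CG_comp (CG_comp (CG_comp (CG_comp (CG_lunit A) (CG_tensor (CG_ev A) (CG_id A)))
      (CG.inv_arr ((A \<parallel> A\<^sup>\<bottom>) \<parallel> A) (A \<parallel> (A\<^sup>\<bottom> \<parallel> A)) (CG_assoc A (A\<^sup>\<bottom>) A)))
      (CG_tensor (CG_id A) (CG_coev A))) (CG.inv_arr (A \<parallel> \<one>) A (CG_runit A))"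
proof -
  let ?X = "(A \<parallel> A\<^sup>\<bottom>) \<parallel> A" and ?Y = "A \<parallel> (A\<^sup>\<bottom> \<parallel> A)"
  define E where "E = strat_tensor (\<Gamma> A, Tag False) (\<gamma> A)"
  define N where "N = strat_tensor (\<gamma> A) (\<Gamma> A, Tag True)"
  \<comment> \<open>\<open>s1\<close> to \<open>s4\<close> follow the left-nested bracketing of the
    statement, so each represents one of its partial composites.\<close>
  define s1 where "s1 = strat_comp ?X A (lifting (\<one> \<parallel> A) lunit_map) E"
  define s2 where "s2 = strat_comp ?Y A s1 (lifting ?Y assoc_inv)"
  define s3 where "s3 = strat_comp (A \<parallel> \<one>) A s2 N"
  define s4 where "s4 = strat_comp A A s3 (lifting A (Tag False))"
  have g: "strat A A (\<gamma> A)" by (rule strat_copycat[OF A])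
  have E: "strat ?X (\<one> \<parallel> A) E" unfolding E_def by (rule strat_tensor_strat[OF strat_ev[OF A] g])
  have N: "strat (A \<parallel> \<one>) ?Y N" unfolding N_def by (rule strat_tensor_strat[OF g strat_coev[OF A]])
  note il = giso_lunit[OF A] and ia = giso_assoc[OF A game_dual[OF A] A] and ir = giso_runit[OF A]
  note ia' = giso_sym[OF ia] and ir' = giso_sym[OF ir]
  have 1: "strat ?X A s1" unfolding s1_def by (rule strat_comp_strat[OF E strat_lifting[OF il]])
  have 2: "strat ?Y A s2" unfolding s2_def by (rule strat_comp_strat[OF strat_lifting[OF ia'] 1])
  have 3: "strat (A \<parallel> \<one>) A s3" unfolding s3_def by (rule strat_comp_strat[OF N 2])
  have 4: "strat A A s4" unfolding s4_def by (rule strat_comp_strat[OF strat_lifting[OF ir'] 3])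
  let ?q = "tag (P 3) (T2 4 5)" and ?q' = "tag (T2 3 4) (P 5)"
  have "LSp (P 0) (P 9) A A s4 \<approx> LSp (T2 0 6) (P 9) (A \<parallel> \<one>) A s3"
    unfolding s4_def by (rule lift_pre[OF 3 ir', where q = "P 8"]) (simp_all add: Int_Un)
  also have "\<dots> \<approx> hide (?q ` Ev ?Y) (LSp (T2 0 6) ?q (A \<parallel> \<one>) ?Y N \<bowtie> LSp ?q (P 9) ?Y A s2)"
    unfolding s3_def by (rule LSp_comp[OF strat_pre[OF N] strat_pre[OF 2]]) (simp_all add: Int_Un)
  also have "\<dots> \<approx> hide (?q ` Ev ?Y) ((cc (P 0) (P 3) A \<bowtie> cc (P 4) (P 5) A) \<bowtie> (cc (P 3) (P 4) A \<bowtie> cc (P 5) (P 9) A))"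
  proof (intro hide_cong join_cong)
    have "LSp (T2 0 6) ?q (A \<parallel> \<one>) ?Y N \<approx> LSp (P 0) (P 3) A A (\<gamma> A) \<bowtie> LSp (P 6) (T2 4 5) \<one> (A\<^sup>\<bottom> \<parallel> A) (\<Gamma> A, Tag True)"
      unfolding N_def by (rule LSp_tensor[OF strat_pre[OF g] strat_pre[OF strat_coev[OF A]]]) (simp add: Int_Un)
    also have "\<dots> \<approx> cc (P 0) (P 3) A \<bowtie> cc (P 4) (P 5) A" by (intro join_cong LSp_copycat LSp_coev A)
    finally show "LSp (T2 0 6) ?q (A \<parallel> \<one>) ?Y N \<approx> cc (P 0) (P 3) A \<bowtie> cc (P 4) (P 5) A" .
    have "LSp ?q (P 9) ?Y A s2 \<approx> LSp ?q' (P 9) ?X A s1"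
      unfolding s2_def by (rule lift_pre[OF 1 ia', where q = "P 8"]) (auto simp: Int_Un)
    also have "\<dots> \<approx> LSp ?q' (\<lambda>a. P 9 (lunit_map a)) ?X (\<one> \<parallel> A) E"
      unfolding s1_def by (rule lift_post[OF E il, where q = "P 8"]) (simp_all add: Int_Un)
    also have "\<dots> \<approx> LSp ?q' (T2 6 9) ?X (\<one> \<parallel> A) E" by (rule LSp_cong[OF strat_pre[OF E]]) auto
    also have "\<dots> \<approx> LSp (T2 3 4) (P 6) (A \<parallel> A\<^sup>\<bottom>) \<one> (\<Gamma> A, Tag False) \<bowtie> LSp (P 5) (P 9) A A (\<gamma> A)"
      unfolding E_def by (rule LSp_tensor[OF strat_pre[OF strat_ev[OF A]] strat_pre[OF g]]) (simp add: Int_Un)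
    also have "\<dots> \<approx> cc (P 3) (P 4) A \<bowtie> cc (P 5) (P 9) A" by (intro join_cong LSp_copycat LSp_ev A)
    finally show "LSp ?q (P 9) ?Y A s2 \<approx> cc (P 3) (P 4) A \<bowtie> cc (P 5) (P 9) A" .
  qed
  also have "\<dots> = hide (P 3 ` Ev A \<union> (P 4 ` Ev A \<union> P 5 ` Ev A)) ((cc (P 0) (P 3) A \<bowtie> cc (P 4) (P 5) A) \<bowtie> (cc (P 3) (P 4) A \<bowtie> cc (P 5) (P 9) A))"
    by simp
  also have "\<dots> \<approx> cc (P 0) (P 9) A" by (rule zigzag_chain[OF A]) simp_all
  also have "\<dots> \<approx> LSp (P 0) (P 9) A A (\<gamma> A)" by (rule ls_iso_sym[OF LSp_copycat[OF A]])
  finally have "s4 \<cong> \<gamma> A" by (rule isoI_LSp[OF strat_pre[OF 4] strat_pre[OF g]]) simp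
  then have "mk_arr A A s4 = CG_id A" unfolding CG_id_def by (rule mk_arr_eqI[OF strat_pre[OF 4] strat_pre[OF g]])
  moreover have "CG_tensor (CG_ev A) (CG_id A) = mk_arr ?X (\<one> \<parallel> A) E"
    unfolding CG_ev_def CG_id_def E_def by (rule CG_tensor_mk[OF strat_pre[OF strat_ev[OF A]] strat_pre[OF g]])
  moreover have "CG_tensor (CG_id A) (CG_coev A) = mk_arr (A \<parallel> \<one>) ?Y N"
    unfolding CG_coev_def CG_id_def N_def by (rule CG_tensor_mk[OF strat_pre[OF g] strat_pre[OF strat_coev[OF A]]])
  ultimately show ?thesis
    unfolding CG_structure lift_arr_inv[OF ia] lift_arr_inv[OF ir]
    by (simp add: lift_arr_def s1_def s2_def s3_def s4_def CG_comp_mk[OF strat_pre[OF E] pre_lifting[OF il]]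
        CG_comp_mk[OF pre_lifting[OF ia'] strat_pre[OF 1[unfolded s1_def]]]
        CG_comp_mk[OF strat_pre[OF N] strat_pre[OF 2[unfolded s2_def s1_def]]]
        CG_comp_mk[OF pre_lifting[OF ir'] strat_pre[OF 3[unfolded s3_def s2_def s1_def]]])
qed

text \<open>The outer identities are copycats on \<open>A\<^sup>\<bottom>\<close>, and
  \<open>cc_dual\<close> turns them into links of \<open>A\<close> with their ends exchanged. The
  chain of \<open>A\<close> therefore runs from 9 to 0, and one more use of \<open>cc_dual\<close>
  makes it the identity of the dual.\<close>

lemma zigzag_dual:
  assumes A: "game A"
  shows "CG_id (A\<^sup>\<bottom>) = CG_comp (CG_comp (CG_comp (CG_comp (CG_runit (A\<^sup>\<bottom>)) (CG_tensor (CG_id (A\<^sup>\<bottom>)) (CG_ev A)))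
      (CG_assoc (A\<^sup>\<bottom>) A (A\<^sup>\<bottom>))) (CG_tensor (CG_coev A) (CG_id (A\<^sup>\<bottom>))))
      (CG.inv_arr (\<one> \<parallel> A\<^sup>\<bottom>) (A\<^sup>\<bottom>) (CG_lunit (A\<^sup>\<bottom>)))"
proof -
  let ?D = "A\<^sup>\<bottom>"
  have D: "game ?D" using A by simp
  let ?X = "?D \<parallel> (A \<parallel> ?D)" and ?Y = "(?D \<parallel> A) \<parallel> ?D"
  define E where "E = strat_tensor (\<gamma> ?D) (\<Gamma> A, Tag False)"
  define N where "N = strat_tensor (\<Gamma> A, Tag True) (\<gamma> ?D)"
  define s1 where "s1 = strat_comp ?X ?D (lifting (?D \<parallel> \<one>) runit_map) E"
  define s2 where "s2 = strat_comp ?Y ?D s1 (lifting ?Y assoc_map)"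
  define s3 where "s3 = strat_comp (\<one> \<parallel> ?D) ?D s2 N"
  define s4 where "s4 = strat_comp ?D ?D s3 (lifting ?D (Tag True))"
  have g: "strat ?D ?D (\<gamma> ?D)" by (rule strat_copycat[OF D])
  have E: "strat ?X (?D \<parallel> \<one>) E" unfolding E_def by (rule strat_tensor_strat[OF g strat_ev[OF A]])
  have N: "strat (\<one> \<parallel> ?D) ?Y N" unfolding N_def by (rule strat_tensor_strat[OF strat_coev[OF A] g])
  note il = giso_lunit[OF D] and ia = giso_assoc[OF D A D] and ir = giso_runit[OF D]
  note il' = giso_sym[OF il]
  have 1: "strat ?X ?D s1" unfolding s1_def by (rule strat_comp_strat[OF E strat_lifting[OF ir]])
  have 2: "strat ?Y ?D s2" unfolding s2_def by (rule strat_comp_strat[OF strat_lifting[OF ia] 1])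
  have 3: "strat (\<one> \<parallel> ?D) ?D s3" unfolding s3_def by (rule strat_comp_strat[OF N 2])
  have 4: "strat ?D ?D s4" unfolding s4_def by (rule strat_comp_strat[OF strat_lifting[OF il'] 3])
  let ?q = "tag (T2 3 4) (P 5)" and ?q' = "tag (P 3) (T2 4 5)"
  have "LSp (P 0) (P 9) ?D ?D s4 \<approx> LSp (T2 6 0) (P 9) (\<one> \<parallel> ?D) ?D s3"
    unfolding s4_def by (rule lift_pre[OF 3 il', where q = "P 8"]) (simp_all add: Int_Un)
  also have "\<dots> \<approx> hide (?q ` Ev ?Y) (LSp (T2 6 0) ?q (\<one> \<parallel> ?D) ?Y N \<bowtie> LSp ?q (P 9) ?Y ?D s2)"
    unfolding s3_def by (rule LSp_comp[OF strat_pre[OF N] strat_pre[OF 2]]) (simp_all add: Int_Un)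
  also have "\<dots> \<approx> hide (?q ` Ev ?Y) ((cc (P 3) (P 4) A \<bowtie> cc (P 5) (P 0) A) \<bowtie> (cc (P 9) (P 3) A \<bowtie> cc (P 4) (P 5) A))"
  proof (intro hide_cong join_cong)
    have "LSp (T2 6 0) ?q (\<one> \<parallel> ?D) ?Y N \<approx> LSp (P 6) (T2 3 4) \<one> (?D \<parallel> A) (\<Gamma> A, Tag True) \<bowtie> LSp (P 0) (P 5) ?D ?D (\<gamma> ?D)"
      unfolding N_def by (rule LSp_tensor[OF strat_pre[OF strat_coev[OF A]] strat_pre[OF g]]) (simp add: Int_Un)
    also have "\<dots> \<approx> cc (P 3) (P 4) A \<bowtie> cc (P 0) (P 5) ?D" by (intro join_cong LSp_copycat LSp_coev A D)
    also have "\<dots> \<approx> cc (P 3) (P 4) A \<bowtie> cc (P 5) (P 0) A" by (intro join_cong cc_dual ls_iso_refl A)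
    finally show "LSp (T2 6 0) ?q (\<one> \<parallel> ?D) ?Y N \<approx> cc (P 3) (P 4) A \<bowtie> cc (P 5) (P 0) A" .
    have "LSp ?q (P 9) ?Y ?D s2 \<approx> LSp ?q' (P 9) ?X ?D s1"
      unfolding s2_def by (rule lift_pre[OF 1 ia, where q = "P 8"]) (auto simp: Int_Un)
    also have "\<dots> \<approx> LSp ?q' (\<lambda>a. P 9 (runit_map a)) ?X (?D \<parallel> \<one>) E"
      unfolding s1_def by (rule lift_post[OF E ir, where q = "P 8"]) (simp_all add: Int_Un)
    also have "\<dots> \<approx> LSp ?q' (T2 9 6) ?X (?D \<parallel> \<one>) E" by (rule LSp_cong[OF strat_pre[OF E]]) auto
    also have "\<dots> \<approx> LSp (P 3) (P 9) ?D ?D (\<gamma> ?D) \<bowtie> LSp (T2 4 5) (P 6) (A \<parallel> ?D) \<one> (\<Gamma> A, Tag False)"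
      unfolding E_def by (rule LSp_tensor[OF strat_pre[OF g] strat_pre[OF strat_ev[OF A]]]) (simp add: Int_Un)
    also have "\<dots> \<approx> cc (P 3) (P 9) ?D \<bowtie> cc (P 4) (P 5) A" by (intro join_cong LSp_copycat LSp_ev A D)
    also have "\<dots> \<approx> cc (P 9) (P 3) A \<bowtie> cc (P 4) (P 5) A" by (intro join_cong cc_dual ls_iso_refl A)
    finally show "LSp ?q (P 9) ?Y ?D s2 \<approx> cc (P 9) (P 3) A \<bowtie> cc (P 4) (P 5) A" .
  qed
  also have "\<dots> \<approx> hide (?q ` Ev ?Y) ((cc (P 9) (P 3) A \<bowtie> cc (P 4) (P 5) A) \<bowtie> (cc (P 3) (P 4) A \<bowtie> cc (P 5) (P 0) A))"
    by (rule hide_cong[OF join_comm])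
  also have "\<dots> = hide (P 3 ` Ev A \<union> (P 4 ` Ev A \<union> P 5 ` Ev A)) ((cc (P 9) (P 3) A \<bowtie> cc (P 4) (P 5) A) \<bowtie> (cc (P 3) (P 4) A \<bowtie> cc (P 5) (P 0) A))"
    by (simp add: Un_assoc)
  also have "\<dots> \<approx> cc (P 9) (P 0) A" by (rule zigzag_chain[OF A]) simp_all
  also have "\<dots> \<approx> cc (P 0) (P 9) ?D" by (rule ls_iso_sym[OF cc_dual[OF A]])
  also have "\<dots> \<approx> LSp (P 0) (P 9) ?D ?D (\<gamma> ?D)" by (rule ls_iso_sym[OF LSp_copycat[OF D]])
  finally have "s4 \<cong> \<gamma> ?D" by (rule isoI_LSp[OF strat_pre[OF 4] strat_pre[OF g]]) simp
  then have "mk_arr ?D ?D s4 = CG_id ?D" unfolding CG_id_def by (rule mk_arr_eqI[OF strat_pre[OF 4] strat_pre[OF g]])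
  moreover have "CG_tensor (CG_id ?D) (CG_ev A) = mk_arr ?X (?D \<parallel> \<one>) E"
    unfolding CG_ev_def CG_id_def E_def by (rule CG_tensor_mk[OF strat_pre[OF g] strat_pre[OF strat_ev[OF A]]])
  moreover have "CG_tensor (CG_coev A) (CG_id ?D) = mk_arr (\<one> \<parallel> ?D) ?Y N"
    unfolding CG_coev_def CG_id_def N_def by (rule CG_tensor_mk[OF strat_pre[OF strat_coev[OF A]] strat_pre[OF g]])
  ultimately show ?thesis
    unfolding CG_structure lift_arr_inv[OF il]
    by (simp add: lift_arr_def s1_def s2_def s3_def s4_def CG_comp_mk[OF strat_pre[OF E] pre_lifting[OF ir]]
        CG_comp_mk[OF pre_lifting[OF ia] strat_pre[OF 1[unfolded s1_def]]]
        CG_comp_mk[OF strat_pre[OF N] strat_pre[OF 2[unfolded s2_def s1_def]]]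
        CG_comp_mk[OF pre_lifting[OF il'] strat_pre[OF 3[unfolded s3_def s2_def s1_def]]])
qed

section \<open>Coherence of the structural isomorphisms\<close>

lemma CG_pentagon:
  assumes g: "game A" "game B" "game C" "game D"
  shows "CG_comp (CG_assoc A B (C \<parallel> D)) (CG_assoc (A \<parallel> B) C D) =
    CG_comp (CG_comp (CG_tensor (CG_id A) (CG_assoc B C D)) (CG_assoc A (B \<parallel> C) D)) (CG_tensor (CG_assoc A B C) (CG_id D))"
proof -
  note ids = giso_id[OF g(1)] giso_id[OF g(4)]
  note a1 = giso_assoc[OF game_par[OF g(1,2)] g(3,4)] and a2 = giso_assoc[OF g(1,2) game_par[OF g(3,4)]]
  note b1 = giso_par[OF giso_assoc[OF g(1-3)] ids(2)] and b2 = giso_assoc[OF g(1) game_par[OF g(2,3)] g(4)]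
    and b3 = giso_par[OF ids(1) giso_assoc[OF g(2-4)]]
  show ?thesis
    unfolding CG_structure lift_arr_id[OF g(1)] lift_arr_id[OF g(4)] lift_arr_tensor[OF ids(1) giso_assoc[OF g(2-4)]]
      lift_arr_tensor[OF giso_assoc[OF g(1-3)] ids(2)] lift_arr_comp[OF a1 a2] lift_arr_comp[OF b2 b3]
      lift_arr_comp[OF b1 giso_comp[OF b2 b3]]
    by (rule lift_arr_cong[OF giso_comp[OF a1 a2] giso_comp[OF b1 giso_comp[OF b2 b3]]]) auto
qed

lemma CG_triangle:
  assumes g: "game A" "game B"
  shows "CG_comp (CG_tensor (CG_id A) (CG_lunit B)) (CG_assoc A \<one> B) = CG_tensor (CG_runit A) (CG_id B)"
proof -
  note i = giso_id[OF g(1)] giso_id[OF g(2)] and a = giso_assoc[OF g(1) game_empty g(2)]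
  note l = giso_par[OF i(1) giso_lunit[OF g(2)]] and r = giso_par[OF giso_runit[OF g(1)] i(2)]
  show ?thesis
    unfolding CG_structure lift_arr_id[OF g(1)] lift_arr_id[OF g(2)] lift_arr_tensor[OF i(1) giso_lunit[OF g(2)]]
      lift_arr_tensor[OF giso_runit[OF g(1)] i(2)] lift_arr_comp[OF a l]
    by (rule lift_arr_cong[OF giso_comp[OF a l] r]) auto
qed

lemma CG_symm_symm:
  assumes g: "game A" "game B"
  shows "CG_comp (CG_symm B A) (CG_symm A B) = CG_id (A \<parallel> B)"
proof -
  note s = giso_symm[OF g] giso_symm[OF g(2,1)]
  show ?thesis
    unfolding CG_structure lift_arr_id[OF game_par[OF g]] lift_arr_comp[OF s]
    by (rule lift_arr_cong[OF giso_comp[OF s] giso_id[OF game_par[OF g]]]) auto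
qed

lemma CG_symm_unit:
  assumes g: "game A" shows "CG_comp (CG_lunit A) (CG_symm A \<one>) = CG_runit A"
proof -
  note s = giso_symm[OF g game_empty] giso_lunit[OF g]
  show ?thesis
    unfolding CG_structure lift_arr_comp[OF s]
    by (rule lift_arr_cong[OF giso_comp[OF s] giso_runit[OF g]]) auto
qed

lemma CG_hexagon:
  assumes g: "game A" "game B" "game C"
  shows "CG_comp (CG_comp (CG_assoc B C A) (CG_symm A (B \<parallel> C))) (CG_assoc A B C) =
    CG_comp (CG_comp (CG_tensor (CG_id B) (CG_symm A C)) (CG_assoc B A C)) (CG_tensor (CG_symm A B) (CG_id C))"
proof -
  note i = giso_id[OF g(2)] giso_id[OF g(3)]
  note a1 = giso_assoc[OF g] and a2 = giso_symm[OF g(1) game_par[OF g(2,3)]] and a3 = giso_assoc[OF g(2,3,1)]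
  note s1 = giso_symm[OF g(1,3)] and s2 = giso_symm[OF g(1,2)]
  note b1 = giso_par[OF s2 i(2)] and b2 = giso_assoc[OF g(2,1,3)] and b3 = giso_par[OF i(1) s1]
  show ?thesis
    unfolding CG_structure lift_arr_id[OF g(2)] lift_arr_id[OF g(3)] lift_arr_tensor[OF i(1) s1] lift_arr_tensor[OF s2 i(2)]
      lift_arr_comp[OF a2 a3] lift_arr_comp[OF a1 giso_comp[OF a2 a3]] lift_arr_comp[OF b2 b3]
      lift_arr_comp[OF b1 giso_comp[OF b2 b3]]
    by (rule lift_arr_cong[OF giso_comp[OF a1 giso_comp[OF a2 a3]] giso_comp[OF b1 giso_comp[OF b2 b3]]]) auto
qed

lemma CG_symmetric_monoidal:
  "symmetric_monoidal_cat (CG_ob :: 'a ev esp set) CG_hom CG_comp CG_id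
     par CG_tensor empty_game CG_assoc CG_lunit CG_runit CG_symm"
proof (unfold_locales, unfold CG_ob_iff)
  fix A A' A'' B B' B'' C C' D :: "'a ev esp" and f f' g g' h :: "'a arr"
  show "game (\<one> :: 'a ev esp)" by simp
  assume A: "game A"
  show "CG.iso_arr (\<one> \<parallel> A) A (CG_lunit A)" "CG.iso_arr (A \<parallel> \<one>) A (CG_runit A)"
    unfolding CG_structure by (rule lift_arr_iso[OF giso_lunit[OF A]] lift_arr_iso[OF giso_runit[OF A]])+
  show "CG_comp (CG_lunit A) (CG_symm A \<one>) = CG_runit A" by (rule CG_symm_unit[OF A])
  {
    assume B: "game B" and f: "f \<in> CG_hom A B"
    obtain \<sigma> where s: "strat A B \<sigma>" and fs: "f = mk_arr A B \<sigma>"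
      by (rule CG_homE[OF f]) (use A B in simp_all)
    have u: "pre \<one> \<one> (\<gamma> \<one>)" by (rule pre_copycat) simp
    have i: "CG_id \<one> = mk_arr \<one> \<one> (\<gamma> \<one>)" by (simp add: CG_id_def)
    show "CG_comp (CG_lunit B) (CG_tensor (CG_id \<one>) f) = CG_comp f (CG_lunit A)"
      unfolding fs i CG_tensor_mk[OF u strat_pre[OF s]] by (rule lunit_natural[OF s])
    show "CG_comp (CG_runit B) (CG_tensor f (CG_id \<one>)) = CG_comp f (CG_runit A)"
      unfolding fs i CG_tensor_mk[OF strat_pre[OF s] u] by (rule runit_natural[OF s])
  }
  assume B: "game B"
  show "game (A \<parallel> B)" using A B by simp
  show "CG_tensor (CG_id A) (CG_id B) = CG_id (A \<parallel> B)"
    unfolding CG_id_def CG_tensor_mk[OF pre_copycat[OF A] pre_copycat[OF B]]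
    by (rule mk_arr_eqI[OF pre_tensor[OF pre_copycat[OF A] pre_copycat[OF B]] pre_copycat[OF game_par[OF A B]] tensor_copycat[OF A B]])
  show "CG.iso_arr (A \<parallel> B) (B \<parallel> A) (CG_symm A B)"
    unfolding CG_structure by (rule lift_arr_iso[OF giso_symm[OF A B]])
  show "CG_comp (CG_tensor (CG_id A) (CG_lunit B)) (CG_assoc A \<one> B) = CG_tensor (CG_runit A) (CG_id B)"
    by (rule CG_triangle[OF A B])
  show "CG_comp (CG_symm B A) (CG_symm A B) = CG_id (A \<parallel> B)" by (rule CG_symm_symm[OF A B])
  {
    assume C: "game C"
    show "CG.iso_arr ((A \<parallel> B) \<parallel> C) (A \<parallel> B \<parallel> C) (CG_assoc A B C)"
      unfolding CG_structure by (rule lift_arr_iso[OF giso_assoc[OF A B C]])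
    show "CG_comp (CG_comp (CG_assoc B C A) (CG_symm A (B \<parallel> C))) (CG_assoc A B C) =
      CG_comp (CG_comp (CG_tensor (CG_id B) (CG_symm A C)) (CG_assoc B A C)) (CG_tensor (CG_symm A B) (CG_id C))"
      by (rule CG_hexagon[OF A B C])
    assume D: "game D"
    show "CG_comp (CG_assoc A B (C \<parallel> D)) (CG_assoc (A \<parallel> B) C D) =
      CG_comp (CG_comp (CG_tensor (CG_id A) (CG_assoc B C D)) (CG_assoc A (B \<parallel> C) D)) (CG_tensor (CG_assoc A B C) (CG_id D))"
      by (rule CG_pentagon[OF A B C D])
  }
next
  fix A B A' B' :: "'a ev esp" and f g :: "'a arr"
  assume G: "game A" "game B" "game A'" "game B'" and f: "f \<in> CG_hom A A'" and g: "g \<in> CG_hom B B'"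
  obtain \<sigma> where s: "strat A A' \<sigma>" and fs: "f = mk_arr A A' \<sigma>" by (rule CG_homE[OF f]) (use G in simp_all)
  obtain \<tau> where t: "strat B B' \<tau>" and gt: "g = mk_arr B B' \<tau>" by (rule CG_homE[OF g]) (use G in simp_all)
  show "CG_tensor f g \<in> CG_hom (A \<parallel> B) (A' \<parallel> B')"
    unfolding fs gt CG_tensor_mk[OF strat_pre[OF s] strat_pre[OF t]] by (rule mk_arr_in_hom[OF strat_tensor_strat[OF s t]])
next
  fix A A' A'' B B' B'' :: "'a ev esp" and f f' g g' :: "'a arr"
  assume G: "game A" "game A'" "game A''" "game B" "game B'" "game B''"
    and f: "f \<in> CG_hom A A'" and f': "f' \<in> CG_hom A' A''" and g: "g \<in> CG_hom B B'" and g': "g' \<in> CG_hom B' B''"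
  obtain \<sigma> where s: "strat A A' \<sigma>" and fs: "f = mk_arr A A' \<sigma>" by (rule CG_homE[OF f]) (use G in simp_all)
  obtain \<sigma>' where s': "strat A' A'' \<sigma>'" and fs': "f' = mk_arr A' A'' \<sigma>'" by (rule CG_homE[OF f']) (use G in simp_all)
  obtain \<tau> where t: "strat B B' \<tau>" and gt: "g = mk_arr B B' \<tau>" by (rule CG_homE[OF g]) (use G in simp_all)
  obtain \<tau>' where t': "strat B' B'' \<tau>'" and gt': "g' = mk_arr B' B'' \<tau>'" by (rule CG_homE[OF g']) (use G in simp_all)
  note p = strat_pre[OF s] strat_pre[OF s'] strat_pre[OF t] strat_pre[OF t']
  note q = pre_tensor[OF p(1,3)] pre_tensor[OF p(2,4)]
  show "CG_tensor (CG_comp f' f) (CG_comp g' g) = CG_comp (CG_tensor f' g') (CG_tensor f g)"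
    unfolding fs fs' gt gt' CG_comp_mk[OF p(1,2)] CG_comp_mk[OF p(3,4)] CG_tensor_mk[OF p(1,3)] CG_tensor_mk[OF p(2,4)]
      CG_comp_mk[OF q] CG_tensor_mk[OF pre_comp[OF p(1,2)] pre_comp[OF p(3,4)]]
    by (rule mk_arr_eqI[OF pre_tensor[OF pre_comp[OF p(1,2)] pre_comp[OF p(3,4)]] pre_comp[OF q] tensor_comp[OF p]])
next
  fix A A' B B' C C' :: "'a ev esp" and f g h :: "'a arr"
  assume G: "game A" "game A'" "game B" "game B'" "game C" "game C'"
    and f: "f \<in> CG_hom A A'" and g: "g \<in> CG_hom B B'" and h: "h \<in> CG_hom C C'"
  obtain \<sigma> where s: "strat A A' \<sigma>" and fs: "f = mk_arr A A' \<sigma>" by (rule CG_homE[OF f]) (use G in simp_all)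
  obtain \<tau> where t: "strat B B' \<tau>" and gt: "g = mk_arr B B' \<tau>" by (rule CG_homE[OF g]) (use G in simp_all)
  obtain \<upsilon> where u: "strat C C' \<upsilon>" and hu: "h = mk_arr C C' \<upsilon>" by (rule CG_homE[OF h]) (use G in simp_all)
  note p = strat_pre[OF s] strat_pre[OF t] strat_pre[OF u]
  show "CG_comp (CG_assoc A' B' C') (CG_tensor (CG_tensor f g) h) = CG_comp (CG_tensor f (CG_tensor g h)) (CG_assoc A B C)"
    unfolding fs gt hu CG_tensor_mk[OF p(1,2)] CG_tensor_mk[OF p(2,3)] CG_tensor_mk[OF pre_tensor[OF p(1,2)] p(3)]
      CG_tensor_mk[OF p(1) pre_tensor[OF p(2,3)]]
    by (rule assoc_natural[OF s t u])
next
  fix A A' B B' :: "'a ev esp" and f g :: "'a arr"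
  assume G: "game A" "game A'" "game B" "game B'" and f: "f \<in> CG_hom A A'" and g: "g \<in> CG_hom B B'"
  obtain \<sigma> where s: "strat A A' \<sigma>" and fs: "f = mk_arr A A' \<sigma>" by (rule CG_homE[OF f]) (use G in simp_all)
  obtain \<tau> where t: "strat B B' \<tau>" and gt: "g = mk_arr B B' \<tau>" by (rule CG_homE[OF g]) (use G in simp_all)
  note p = strat_pre[OF s] strat_pre[OF t]
  show "CG_comp (CG_symm A' B') (CG_tensor f g) = CG_comp (CG_tensor g f) (CG_symm A B)"
    unfolding fs gt CG_tensor_mk[OF p] CG_tensor_mk[OF p(2,1)] by (rule symm_natural[OF s t])
qed

theorem mainTheorem3:
  shows "compact_closed_cat (CG_ob :: 'a ev esp set) CG_hom CG_comp CG_id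
           par CG_tensor empty_game CG_assoc CG_lunit CG_runit CG_symm
           dual CG_coev CG_ev"
proof (rule compact_closed_cat.intro[OF CG_symmetric_monoidal], unfold_locales, unfold CG_ob_iff)
  fix A :: "'a ev esp" assume A: "game A"
  show "game (A\<^sup>\<bottom>)" using A by simp
  show "CG_coev A \<in> CG_hom \<one> (A\<^sup>\<bottom> \<parallel> A)" unfolding CG_coev_def by (rule mk_arr_in_hom[OF strat_coev[OF A]])
  show "CG_ev A \<in> CG_hom (A \<parallel> A\<^sup>\<bottom>) \<one>" unfolding CG_ev_def by (rule mk_arr_in_hom[OF strat_ev[OF A]])
qed (rule zigzag zigzag_dual; assumption)+

end
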